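(* Let $\Omega'$ be the monoid of monic polynomials in $\mathbb{C}[z]$ all of whose roots lie in $\mathbb{Z}+\frac12$, and $\mathcal{O}=\{(z-\lambda)\mid\lambda\in\mathbb{Z}\}$. As $\Omega'$-graded vector spaces, $$\mathscr{A}(\Omega',\mathcal{O})\simeq\mathbb{C}[M^1]\oplus\bigoplus_{t\in\Omega',\,t\ne1}\ \bigoplus_{i=0}^{\ell(t)}\mathbb{C}[M^t_{s_i,s_{i+1}}],$$ where, for $t\neq 1$, $s_1<\dots<s_{\ell(t)}$ are the distinct roots of $t$, $s_0=-\infty$ and $s_{\ell(t)+1}=\infty$. The multiplication of $\mathscr{A}(\Omega',\mathcal{O})$ is determined by the fact that $[M^1]$ is the identity and, for $t,u\in\Omega'\setminus\{1\}$, with $s_i<s_{i+1}$ consecutive elements of the extended root set of $t$ and $w_j<w_{j+1}$ consecutive elements of the extended root set of $u$, $$[M^t_{s_i,s_{i+1}}]\cdot[M^u_{w_j,w_{j+1}}]=\begin{cases}[M^{tu}_{\max\{s_i,w_j\},\min\{s_{i+1},w_{j+1}\}}]&\text{if }\max\{s_i,w_j\}<\min\{s_{i+1},w_{j+1}\},\\0&\text{otherwise.}\end{cases}$$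
   Context: Let $R=\mathbb{C}[z]$, $\sigma^{1/2}(z)=z-\frac12$, $\sigma(z)=z-1$. For nonzero $t\in\mathbb{C}[z]$, $A(t)$ is the $\mathbb{C}$-algebra generated by $\mathbb{C}[z]$ and $X^+,X^-$ with relations $X^{\pm}r=\sigma^{\pm1}(r)X^{\pm}$ ($r\in\mathbb{C}[z]$) and $X^{\pm}X^{\mp}=\sigma^{\pm1/2}(t)$ (a rank one generalized Weyl algebra). A weight module is an $A(t)$-module $M=\bigoplus_{\mathfrak{m}}M_{\mathfrak{m}}$, $M_{\mathfrak{m}}=\{v\mid\mathfrak{m}v=0\}$, over maximal ideals $\mathfrak{m}$ of $\mathbb{C}[z]$; $\mathrm{Supp}(M)=\{\mathfrak{m}\mid M_{\mathfrak{m}}\ne0\}$. $A(t)\text{-wmod}_{\mathcal{O}}$ is the category of weight modules with finite-dimensional weight spaces and support contained in $\mathcal{O}$; $K_0$ denotes its Grothendieck group (generated by classes $[M]$, with $[M'']=[M]+[M']$ for short exact sequences $0\to M\to M''\to M'\to0$). If $M$ is a weight $A(t)$-module and $M'$ a weight $A(t')$-module, then $M\otimes_{\mathbb{C}[z]}M'$ is an $A(tt')$-module via $r(v\otimes v')=rv\otimes v'$ and $X^{\pm}(v\otimes v')=X^{\pm}v\otimes X^{\pm}v'$. This makes $$\mathscr{A}(\Omega',\mathcal{O})=\bigoplus_{t\in\Omega'}\mathbb{C}\otimes_{\mathbb{Z}}K_0(A(t)\text{-wmod}_{\mathcal{O}})$$ into a commutative associative $\Omega'$-graded $\mathbb{C}$-algebra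 with $[M][M']=[M\otimes_{\mathbb{C}[z]}M']$. $M^1$ is the unique (up to isomorphism) simple object of $A(1)\text{-wmod}_{\mathcal{O}}$. For $t\in\Omega'\setminus\{1\}$ with distinct roots $s_1<\dots<s_\ell$ ($\ell=\ell(t)$), the extended root set is $\{s_0=-\infty<s_1<\dots<s_\ell<s_{\ell+1}=\infty\}$, and $M^t_{s_i,s_{i+1}}$ ($0\le i\le\ell$) is the simple object of $A(t)\text{-wmod}_{\mathcal{O}}$ with support $\{(z-k)\mid k\in\mathbb{Z},\ s_i<k<s_{i+1}\}$ (unique up to isomorphism, with one-dimensional weight spaces; by a theorem of Bavula these are all the simple objects up to isomorphism). *)

theory Defs
  imports
    "HOL-Computational_Algebra.Polynomial"
    "HOL-Library.Poly_Mapping"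
    "HOL-Library.Extended_Real"
    "HOL-Algebra.Module"
    "HOL-Algebra.QuotRing"
    "HOL-Algebra.Free_Abelian_Groups"
begin

hide_const (open) Polynomial.smult

section \<open>Algebraic preliminaries\<close>

definition class_ring :: "'a::ring_1 ring" where
  "class_ring = \<lparr>carrier = UNIV, monoid.mult = (*), monoid.one = 1, ring.zero = 0, ring.add = (+)\<rparr>"

abbreviation CC :: "complex ring" where "CC \<equiv> class_ring"

abbreviation CZ :: "complex poly ring" where "CZ \<equiv> class_ring"

text \<open>The library's \<^locale>\<open>module\<close> is restricted to commutative rings; this is the same
  notion over an arbitrary ring.\<close>

locale left_module = R?: ring R + M?: abelian_group M
  for R (structure) and M :: "('r, 'm) module" (structure) +
  assumes smult_closed:
      "\<lbrakk>a \<in> carrier R; x \<in> carrier M\<rbrakk> \<Longrightarrow> a \<odot>\<^bsub>M\<^esub> x \<in> carrier M"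
    and smult_l_distr:
      "\<lbrakk>a \<in> carrier R; b \<in> carrier R; x \<in> carrier M\<rbrakk> \<Longrightarrow>
       (a \<oplus> b) \<odot>\<^bsub>M\<^esub> x = a \<odot>\<^bsub>M\<^esub> x \<oplus>\<^bsub>M\<^esub> b \<odot>\<^bsub>M\<^esub> x"
    and smult_r_distr:
      "\<lbrakk>a \<in> carrier R; x \<in> carrier M; y \<in> carrier M\<rbrakk> \<Longrightarrow>
       a \<odot>\<^bsub>M\<^esub> (x \<oplus>\<^bsub>M\<^esub> y) = a \<odot>\<^bsub>M\<^esub> x \<oplus>\<^bsub>M\<^esub> a \<odot>\<^bsub>M\<^esub> y"
    and smult_assoc1:
      "\<lbrakk>a \<in> carrier R; b \<in> carrier R; x \<in> carrier M\<rbrakk> \<Longrightarrow>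
       (a \<otimes> b) \<odot>\<^bsub>M\<^esub> x = a \<odot>\<^bsub>M\<^esub> (b \<odot>\<^bsub>M\<^esub> x)"
    and smult_one:
      "x \<in> carrier M \<Longrightarrow> \<one> \<odot>\<^bsub>M\<^esub> x = x"

definition lmod_hom :: "'r ring \<Rightarrow> ('r, 'm) module \<Rightarrow> ('r, 'n) module \<Rightarrow> ('m \<Rightarrow> 'n) set" where
  "lmod_hom R M N =
     {f \<in> hom (add_monoid M) (add_monoid N).
        \<forall>a\<in>carrier R. \<forall>x\<in>carrier M. f (a \<odot>\<^bsub>M\<^esub> x) = a \<odot>\<^bsub>N\<^esub> f x}"

definition short_exact ::
  "'r ring \<Rightarrow> ('r, 'm) module \<Rightarrow> ('r, 'm) module \<Rightarrow> ('r, 'm) module \<Rightarrow> bool" where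
  "short_exact R M M'' M' \<longleftrightarrow>
     (\<exists>f g. f \<in> lmod_hom R M M'' \<and> g \<in> lmod_hom R M'' M' \<and>
        inj_on f (carrier M) \<and> g ` carrier M'' = carrier M' \<and>
        f ` carrier M = {x \<in> carrier M''. g x = \<zero>\<^bsub>M'\<^esub>})"

definition simple_lmod :: "'r ring \<Rightarrow> ('r, 'm) module \<Rightarrow> bool" where
  "simple_lmod R M \<longleftrightarrow> carrier M \<noteq> {\<zero>\<^bsub>M\<^esub>} \<and>
     (\<forall>W. submodule W R M \<longrightarrow> W = {\<zero>\<^bsub>M\<^esub>} \<or> W = carrier M)"

text \<open>Tensor product \<open>G \<otimes>\<^sub>S H\<close> of two commutative groups (written multiplicatively) on
  which a set \<open>S\<close> of scalars acts by \<open>a\<close> and \<open>b\<close>: the free Abelian group on pairs modulo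
  biadditivity and \<open>(s g) \<otimes> h = g \<otimes> (s h)\<close>.\<close>

definition tensor_relators ::
  "'s set \<Rightarrow> ('s \<Rightarrow> 'g \<Rightarrow> 'g) \<Rightarrow> ('s \<Rightarrow> 'h \<Rightarrow> 'h) \<Rightarrow> ('g, 'x) monoid_scheme \<Rightarrow> ('h, 'y) monoid_scheme
     \<Rightarrow> (('g \<times> 'h) \<Rightarrow>\<^sub>0 int) set"
  where
  "tensor_relators S a b G H =
     {frag_of (g \<otimes>\<^bsub>G\<^esub> g', h) - frag_of (g, h) - frag_of (g', h) | g g' h.
        g \<in> carrier G \<and> g' \<in> carrier G \<and> h \<in> carrier H} \<union>
     {frag_of (g, h \<otimes>\<^bsub>H\<^esub> h') - frag_of (g, h) - frag_of (g, h') | g h h'.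
        g \<in> carrier G \<and> h \<in> carrier H \<and> h' \<in> carrier H} \<union>
     {frag_of (a s g, h) - frag_of (g, b s h) | s g h.
        s \<in> S \<and> g \<in> carrier G \<and> h \<in> carrier H}"

definition tensor_null ::
  "'s set \<Rightarrow> ('s \<Rightarrow> 'g \<Rightarrow> 'g) \<Rightarrow> ('s \<Rightarrow> 'h \<Rightarrow> 'h) \<Rightarrow> ('g, 'x) monoid_scheme \<Rightarrow> ('h, 'y) monoid_scheme
     \<Rightarrow> (('g \<times> 'h) \<Rightarrow>\<^sub>0 int) set"
  where
  "tensor_null S a b G H =
     generate (free_Abelian_group (carrier G \<times> carrier H)) (tensor_relators S a b G H)"

definition tensor_group ::
  "'s set \<Rightarrow> ('s \<Rightarrow> 'g \<Rightarrow> 'g) \<Rightarrow> ('s \<Rightarrow> 'h \<Rightarrow> 'h) \<Rightarrow> ('g, 'x) monoid_scheme \<Rightarrow> ('h, 'y) monoid_scheme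
     \<Rightarrow> (('g \<times> 'h) \<Rightarrow>\<^sub>0 int) set monoid" where
  "tensor_group S a b G H =
     free_Abelian_group (carrier G \<times> carrier H) Mod tensor_null S a b G H"

definition tensor_coset ::
  "'s set \<Rightarrow> ('s \<Rightarrow> 'g \<Rightarrow> 'g) \<Rightarrow> ('s \<Rightarrow> 'h \<Rightarrow> 'h) \<Rightarrow> ('g, 'x) monoid_scheme \<Rightarrow> ('h, 'y) monoid_scheme
     \<Rightarrow> (('g \<times> 'h) \<Rightarrow>\<^sub>0 int) \<Rightarrow> (('g \<times> 'h) \<Rightarrow>\<^sub>0 int) set" where
  "tensor_coset S a b G H x =
     tensor_null S a b G H #>\<^bsub>free_Abelian_group (carrier G \<times> carrier H)\<^esub> x"

abbreviation pure_tensor ::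
  "'s set \<Rightarrow> ('s \<Rightarrow> 'g \<Rightarrow> 'g) \<Rightarrow> ('s \<Rightarrow> 'h \<Rightarrow> 'h) \<Rightarrow> ('g, 'x) monoid_scheme \<Rightarrow> ('h, 'y) monoid_scheme
     \<Rightarrow> 'g \<Rightarrow> 'h \<Rightarrow> (('g \<times> 'h) \<Rightarrow>\<^sub>0 int) set" where
  "pure_tensor S a b G H g h \<equiv> tensor_coset S a b G H (frag_of (g, h))"

text \<open>The complex vector space \<open>\<complex> \<otimes>\<^sub>\<int> G\<close> of a commutative group \<open>G\<close>. Its scalar
  multiplication \<open>c (d \<otimes> g) = (c d) \<otimes> g\<close> is computed on representatives; the union
  runs over copies of one and the same coset.\<close>

abbreviation cplx_coset ::
  "'g monoid \<Rightarrow> ((complex \<times> 'g) \<Rightarrow>\<^sub>0 int) \<Rightarrow> ((complex \<times> 'g) \<Rightarrow>\<^sub>0 int) set" where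
  "cplx_coset G \<equiv> tensor_coset (UNIV :: int set)
     (\<lambda>n c. c [^]\<^bsub>add_monoid CC\<^esub> n) (\<lambda>n g. g [^]\<^bsub>G\<^esub> n) (add_monoid CC) G"

abbreviation cplx_group :: "'g monoid \<Rightarrow> ((complex \<times> 'g) \<Rightarrow>\<^sub>0 int) set monoid" where
  "cplx_group G \<equiv> tensor_group (UNIV :: int set)
     (\<lambda>n c. c [^]\<^bsub>add_monoid CC\<^esub> n) (\<lambda>n g. g [^]\<^bsub>G\<^esub> n) (add_monoid CC) G"

definition complexification ::
  "'g monoid \<Rightarrow> (complex, ((complex \<times> 'g) \<Rightarrow>\<^sub>0 int) set) module" where
  "complexification G =
     \<lparr>carrier = carrier (cplx_group G),
      monoid.mult = undefined, monoid.one = undefined,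
      ring.zero = \<one>\<^bsub>cplx_group G\<^esub>,
      ring.add = monoid.mult (cplx_group G),
      module.smult = (\<lambda>c X. \<Union>x\<in>X. cplx_coset G (frag_extend (\<lambda>(d, g). frag_of (c * d, g)) x))\<rparr>"

text \<open>External direct sum of complex vector spaces. The ring-multiplication fields of the
  record carry no meaning.\<close>

definition dsum :: "'i set \<Rightarrow> ('i \<Rightarrow> (complex, 'v) module) \<Rightarrow> (complex, 'i \<Rightarrow> 'v) module" where
  "dsum I V =
     \<lparr>carrier = carrier (sum_group I (\<lambda>i. add_monoid (V i))),
      monoid.mult = undefined, monoid.one = undefined,
      ring.zero = \<one>\<^bsub>sum_group I (\<lambda>i. add_monoid (V i))\<^esub>,
      ring.add = monoid.mult (sum_group I (\<lambda>i. add_monoid (V i))),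
      module.smult = (\<lambda>c f. \<lambda>i\<in>I. c \<odot>\<^bsub>V i\<^esub> f i)\<rparr>"

definition homogeneous :: "'i set \<Rightarrow> ('i \<Rightarrow> (complex, 'v) module) \<Rightarrow> 'i \<Rightarrow> ('i \<Rightarrow> 'v) set" where
  "homogeneous I V t = {f \<in> carrier (dsum I V). \<forall>s\<in>I. s \<noteq> t \<longrightarrow> f s = \<zero>\<^bsub>V s\<^esub>}"

definition graded_linear_iso ::
  "'i set \<Rightarrow> ('i \<Rightarrow> (complex, 'v) module) \<Rightarrow> ('i \<Rightarrow> (complex, 'w) module)
     \<Rightarrow> (('i \<Rightarrow> 'v) \<Rightarrow> ('i \<Rightarrow> 'w)) \<Rightarrow> bool" where
  "graded_linear_iso I V W \<Phi> \<longleftrightarrow>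
     \<Phi> \<in> lmod_hom CC (dsum I V) (dsum I W) \<and>
     bij_betw \<Phi> (carrier (dsum I V)) (carrier (dsum I W)) \<and>
     (\<forall>t\<in>I. \<Phi> ` homogeneous I V t = homogeneous I W t)"

definition bilinear_on :: "(complex, 'v) module \<Rightarrow> ('v \<Rightarrow> 'v \<Rightarrow> 'v) \<Rightarrow> bool" where
  "bilinear_on V \<mu> \<longleftrightarrow>
     (\<forall>x\<in>carrier V. \<mu> x \<in> lmod_hom CC V V \<and> (\<lambda>y. \<mu> y x) \<in> lmod_hom CC V V)"

definition complex_line :: "(complex, complex) module" where
  "complex_line =
     \<lparr>carrier = UNIV, monoid.mult = (*), monoid.one = 1, ring.zero = 0, ring.add = (+), module.smult = (*)\<rparr>"

section \<open>The generalized Weyl algebra\<close>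

datatype gwa_gen = GenZ | GenXp | GenXm

text \<open>The free monoid on the generators, written additively because \<open>\<Rightarrow>\<^sub>0\<close> forms monoid
  algebras over additive monoids:
  \<open>gwa_word \<Rightarrow>\<^sub>0 complex\<close> is the free algebra
  \<open>\<complex>\<langle>z, X\<^sup>+, X\<^sup>-\<rangle>\<close>.\<close>

datatype gwa_word = Word "gwa_gen list"

instantiation gwa_word :: monoid_add
begin

definition zero_gwa_word :: gwa_word where "0 = Word []"

fun plus_gwa_word :: "gwa_word \<Rightarrow> gwa_word \<Rightarrow> gwa_word" where
  "Word u + Word v = Word (u @ v)"

instance
proof
  fix a b c :: gwa_word
  show "a + b + c = a + (b + c)" by (cases a; cases b; cases c) simp
  show "0 + a = a" by (cases a) (simp add: zero_gwa_word_def)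
  show "a + 0 = a" by (cases a) (simp add: zero_gwa_word_def)
qed

end

type_synonym free_alg = "gwa_word \<Rightarrow>\<^sub>0 complex"

definition free_gen :: "gwa_gen \<Rightarrow> free_alg" where
  "free_gen g = Poly_Mapping.single (Word [g]) 1"

definition free_poly :: "complex poly \<Rightarrow> free_alg" where
  "free_poly r = (\<Sum>i\<le>degree r. Poly_Mapping.single (Word (replicate i GenZ)) (coeff r i))"

text \<open>\<open>shift a r = r(z - a)\<close>, so that \<open>\<sigma> = shift 1\<close> and \<open>\<sigma>\<^sup>1\<^sup>/\<^sup>2 = shift (1/2)\<close>.\<close>

definition shift :: "complex \<Rightarrow> complex poly \<Rightarrow> complex poly" where
  "shift a r = pcompose r [:-a, 1:]"

definition gwa_relators :: "complex poly \<Rightarrow> free_alg set" where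
  "gwa_relators t =
     {free_gen GenXp * free_poly r - free_poly (shift 1 r) * free_gen GenXp | r. True} \<union>
     {free_gen GenXm * free_poly r - free_poly (shift (-1) r) * free_gen GenXm | r. True} \<union>
     {free_gen GenXp * free_gen GenXm - free_poly (shift (1/2) t),
      free_gen GenXm * free_gen GenXp - free_poly (shift (-1/2) t)}"

abbreviation gwa_ideal :: "complex poly \<Rightarrow> free_alg set" where
  "gwa_ideal t \<equiv> Idl\<^bsub>class_ring\<^esub> (gwa_relators t)"

definition GWA :: "complex poly \<Rightarrow> free_alg set ring" where
  "GWA t = class_ring Quot gwa_ideal t"

definition gwa_gen :: "complex poly \<Rightarrow> gwa_gen \<Rightarrow> free_alg set" where
  "gwa_gen t g = gwa_ideal t +>\<^bsub>class_ring\<^esub> free_gen g"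

definition gwa_poly :: "complex poly \<Rightarrow> complex poly \<Rightarrow> free_alg set" where
  "gwa_poly t r = gwa_ideal t +>\<^bsub>class_ring\<^esub> free_poly r"

section \<open>Weight modules\<close>

text \<open>To form a Grothendieck group one needs a set of objects. A weight module with
  finite-dimensional weight spaces and support in a countable set has countable dimension,
  so up to isomorphism its carrier is a subset of the type below, a complex vector
  space of countably infinite dimension (its vector space structure is not used).\<close>

type_synonym univ = "nat \<Rightarrow>\<^sub>0 complex"

type_synonym gmod = "(free_alg set, univ) module"

definition max_ideals :: "complex poly set set" where
  "max_ideals = {m. maximalideal m CZ}"

definition weight_space ::
  "complex poly \<Rightarrow> (free_alg set, 'v) module \<Rightarrow> complex poly set \<Rightarrow> 'v set" where
  "weight_space t M m = {v \<in> carrier M. \<forall>r\<in>m. gwa_poly t r \<odot>\<^bsub>M\<^esub> v = \<zero>\<^bsub>M\<^esub>}"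

definition Supp :: "complex poly \<Rightarrow> (free_alg set, 'v) module \<Rightarrow> complex poly set set" where
  "Supp t M = {m \<in> max_ideals. weight_space t M m \<noteq> {\<zero>\<^bsub>M\<^esub>}}"

definition weight_module :: "complex poly \<Rightarrow> (free_alg set, 'v) module \<Rightarrow> bool" where
  "weight_module t M \<longleftrightarrow> left_module (GWA t) M \<and>
     (\<forall>v\<in>carrier M. \<exists>!f. f \<in> (\<Pi>\<^sub>E m\<in>max_ideals. weight_space t M m) \<and>
        finite {m \<in> max_ideals. f m \<noteq> \<zero>\<^bsub>M\<^esub>} \<and>
        v = finsum M f {m \<in> max_ideals. f m \<noteq> \<zero>\<^bsub>M\<^esub>})"

definition fin_dim_weights :: "complex poly \<Rightarrow> (free_alg set, 'v) module \<Rightarrow> bool" where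
  "fin_dim_weights t M \<longleftrightarrow>
     (\<forall>m\<in>max_ideals. \<exists>B. finite B \<and> B \<subseteq> weight_space t M m \<and>
        (\<forall>v\<in>weight_space t M m. \<exists>c :: 'v \<Rightarrow> complex.
           v = finsum M (\<lambda>b. gwa_poly t [:c b:] \<odot>\<^bsub>M\<^esub> b) B))"

definition pt_ideal :: "int \<Rightarrow> complex poly set" where
  "pt_ideal k = PIdl\<^bsub>CZ\<^esub> [:- of_int k, 1:]"

definition orbit :: "complex poly set set" where
  "orbit = range pt_ideal"

definition wmod :: "complex poly \<Rightarrow> gmod set" where
  "wmod t = {M. weight_module t M \<and> fin_dim_weights t M \<and> Supp t M \<subseteq> orbit}"

definition K0_relators :: "complex poly \<Rightarrow> (gmod \<Rightarrow>\<^sub>0 int) set" where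
  "K0_relators t = {frag_of M'' - frag_of M - frag_of M' | M M' M''.
     M \<in> wmod t \<and> M' \<in> wmod t \<and> M'' \<in> wmod t \<and> short_exact (GWA t) M M'' M'}"

definition K0_null :: "complex poly \<Rightarrow> (gmod \<Rightarrow>\<^sub>0 int) set" where
  "K0_null t = generate (free_Abelian_group (wmod t)) (K0_relators t)"

definition K0 :: "complex poly \<Rightarrow> (gmod \<Rightarrow>\<^sub>0 int) set monoid" where
  "K0 t = free_Abelian_group (wmod t) Mod K0_null t"

definition K0_class :: "complex poly \<Rightarrow> gmod \<Rightarrow> (gmod \<Rightarrow>\<^sub>0 int) set" where
  "K0_class t M = K0_null t #>\<^bsub>free_Abelian_group (wmod t)\<^esub> frag_of M"

text \<open>\<open>N\<close>, identified by \<open>\<phi>\<close>, is a copy of \<open>M \<otimes>\<^bsub>\<complex>[z]\<^esub> M'\<close> with its \<open>A(t u)\<close>-module structure.\<close>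

definition is_tensor ::
  "complex poly \<Rightarrow> gmod \<Rightarrow> complex poly \<Rightarrow> gmod \<Rightarrow> gmod \<Rightarrow> bool" where
  "is_tensor t M u M' N \<longleftrightarrow> left_module (GWA (t * u)) N \<and>
     (let G = add_monoid M; H = add_monoid M';
          a = (\<lambda>r v. gwa_poly t r \<odot>\<^bsub>M\<^esub> v); b = (\<lambda>r w. gwa_poly u r \<odot>\<^bsub>M'\<^esub> w);
          T = tensor_group (UNIV :: complex poly set) a b G H;
          pure = pure_tensor (UNIV :: complex poly set) a b G H
      in \<exists>\<phi> \<in> iso T (add_monoid N). \<forall>v\<in>carrier M. \<forall>w\<in>carrier M'.
           (\<forall>r. gwa_poly (t * u) r \<odot>\<^bsub>N\<^esub> \<phi> (pure v w) = \<phi> (pure (a r v) w)) \<and>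
           (\<forall>g\<in>{GenXp, GenXm}. gwa_gen (t * u) g \<odot>\<^bsub>N\<^esub> \<phi> (pure v w) =
              \<phi> (pure (gwa_gen t g \<odot>\<^bsub>M\<^esub> v) (gwa_gen u g \<odot>\<^bsub>M'\<^esub> w))))"

definition tensor_mod :: "complex poly \<Rightarrow> gmod \<Rightarrow> complex poly \<Rightarrow> gmod \<Rightarrow> gmod" where
  "tensor_mod t M u M' = (SOME N. is_tensor t M u M' N)"

section \<open>The graded algebra\<close>

definition Omega :: "complex poly set" where
  "Omega = {t. lead_coeff t = 1 \<and> (\<forall>x. poly t x = 0 \<longrightarrow> (\<exists>k::int. x = of_int k + 1/2))}"

abbreviation graded_part ::
  "complex poly \<Rightarrow> (complex, ((complex \<times> (gmod \<Rightarrow>\<^sub>0 int) set) \<Rightarrow>\<^sub>0 int) set) module" where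
  "graded_part t \<equiv> complexification (K0 t)"

type_synonym alg_elt = "complex poly \<Rightarrow> ((complex \<times> (gmod \<Rightarrow>\<^sub>0 int) set) \<Rightarrow>\<^sub>0 int) set"

definition alg_space :: "(complex, alg_elt) module" where
  "alg_space = dsum Omega graded_part"

definition cls :: "complex poly \<Rightarrow> gmod \<Rightarrow> alg_elt" where
  "cls t M = (\<lambda>s\<in>Omega. if s = t then cplx_coset (K0 t) (frag_of (1, K0_class t M))
                        else \<zero>\<^bsub>graded_part s\<^esub>)"

definition is_tensor_mult :: "(alg_elt \<Rightarrow> alg_elt \<Rightarrow> alg_elt) \<Rightarrow> bool" where
  "is_tensor_mult \<mu> \<longleftrightarrow> bilinear_on alg_space \<mu> \<and>
     (\<forall>t\<in>Omega. \<forall>u\<in>Omega. \<forall>M\<in>wmod t. \<forall>M'\<in>wmod u.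
        \<mu> (cls t M) (cls u M') = cls (t * u) (tensor_mod t M u M'))"

text \<open>\<open>\<A>(\<Omega>', \<O>)\<close>. The conditions in \<open>is_tensor_mult\<close> determine the multiplication on
  the carrier, because the classes of modules span \<open>alg_space\<close>.\<close>

definition alg_mult :: "alg_elt \<Rightarrow> alg_elt \<Rightarrow> alg_elt" where
  "alg_mult = (SOME \<mu>. is_tensor_mult \<mu>)"

definition Alg :: "(complex, alg_elt) module" where
  "Alg =
     \<lparr>carrier = carrier alg_space,
      monoid.mult = alg_mult,
      monoid.one = (THE e. e \<in> carrier alg_space \<and>
              (\<forall>x\<in>carrier alg_space. alg_mult e x = x \<and> alg_mult x e = x)),
      ring.zero = \<zero>\<^bsub>alg_space\<^esub>,
      ring.add = ring.add alg_space,
      module.smult = module.smult alg_space\<rparr>"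

section \<open>The simple modules\<close>

definition simple_obj :: "complex poly \<Rightarrow> gmod \<Rightarrow> bool" where
  "simple_obj t M \<longleftrightarrow> M \<in> wmod t \<and> simple_lmod (GWA t) M"

definition M1 :: gmod where
  "M1 = (SOME M. simple_obj 1 M)"

definition M_interval :: "complex poly \<Rightarrow> ereal \<Rightarrow> ereal \<Rightarrow> gmod" where
  "M_interval t a b = (SOME M. simple_obj t M \<and>
     Supp t M = {pt_ideal k | k. a < ereal (of_int k) \<and> ereal (of_int k) < b})"

text \<open>For \<open>t \<in> \<Omega>'\<close> all roots are real, and \<open>ext_root t\<close> enumerates
  \<open>s\<^sub>0 = -\<infinity> < s\<^sub>1 < \<dots> < s\<^sub>\<ell> < s\<^bsub>\<ell>+1\<^esub> = \<infinity>\<close>.\<close>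

definition root_set :: "complex poly \<Rightarrow> real set" where
  "root_set t = {x. poly t (of_real x) = 0}"

definition num_roots :: "complex poly \<Rightarrow> nat" where
  "num_roots t = card (root_set t)"

definition ext_root :: "complex poly \<Rightarrow> nat \<Rightarrow> ereal" where
  "ext_root t i =
     (if i = 0 then -\<infinity>
      else if i \<le> num_roots t then ereal (sorted_list_of_set (root_set t) ! (i - 1))
      else \<infinity>)"

definition simple_rep :: "complex poly \<Rightarrow> nat \<Rightarrow> gmod" where
  "simple_rep t i =
     (if t = 1 then M1 else M_interval t (ext_root t i) (ext_root t (Suc i)))"

text \<open>The graded vector space with one line for each of the simple modules
  \<open>simple_rep t i\<close>, \<open>0 \<le> i \<le> \<ell>(t)\<close>, placed in degree \<open>t\<close> (a single line for
  \<open>t = 1\<close>, where \<open>\<ell>(1) = 0\<close>), and the generators of these lines.\<close>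

abbreviation simple_lines :: "complex poly \<Rightarrow> (complex, nat \<Rightarrow> complex) module" where
  "simple_lines t \<equiv> dsum {0..num_roots t} (\<lambda>i. complex_line)"

definition line_gen :: "complex poly \<Rightarrow> nat \<Rightarrow> complex poly \<Rightarrow> nat \<Rightarrow> complex" where
  "line_gen t i = (\<lambda>s\<in>Omega. \<lambda>j\<in>{0..num_roots s}. if s = t \<and> j = i then 1 else 0)"

end

theory Submission
  imports Defs
begin

text \<open>A weight module \<open>M\<close> over \<open>A(t)\<close> has a dimension function \<open>k \<mapsto> dim M\<^sub>k\<close> on the
  integers. Between two consecutive roots of \<open>t\<close> the operators \<open>X\<^sup>\<plusminus>\<close> are invertible up to
  scalars, so the simple modules have as dimension functions the indicators of the intervals
  cut out by the roots, and every nonzero module has a simple submodule. Hence the class of \<open>M\<close> in the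
  complexified Grothendieck group is determined by its dimension function, and the degree \<open>t\<close>
  part is identified with the functions that are constant on these intervals. The tensor
  product over \<open>\<complex>[z]\<close> is the tensor product of weight spaces, so it multiplies dimension
  functions pointwise, and the product of two indicators is the indicator of the intersection.\<close>

text \<open>\<open>alg_mult\<close> is an unspecified choice among the bilinear maps with prescribed
  values on classes, so the real issue is that one exists. Instead of showing that the tensor
  product is exact in each argument and descends to Grothendieck groups, the proof uses that
  dimension functions separate elements (\<open>\<Theta>_inj\<close>). A product is then the element
  whose dimension function is a prescribed convolution, and its algebraic laws become identities
  between dimension functions. That such an element exists has to be checked only for products of
  simple classes. A second obstacle is that carriers must lie in the fixed type \<open>univ\<close>.
  Quotients and tensor products enter it by transport along an encoding
  (\<open>wmod_realize\<close>), with chosen representatives in place of cosets. Dimensions are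
  computed with coordinate forms and tr(AB) = tr(BA), which yields both their invariance and their
  additivity on exact sequences. Modules may be infinite-dimensional, but t has finitely many roots,
  so one weight from each interval suffices to detect a nonzero module. The total dimension at these
  weights is the induction measure.\<close>

declare mult_FactGroup [simp del] one_FactGroup [simp del]

subsection \<open>Commutative groups given by generators and relations\<close>

context
  fixes S :: "'a set" and R :: "('a \<Rightarrow>\<^sub>0 int) set"
  assumes R: "R \<subseteq> carrier (free_Abelian_group S)"
begin

private abbreviation "F \<equiv> free_Abelian_group S"
private abbreviation "N \<equiv> generate F R"

lemma pres_normal: "N \<lhd> F"
  by (rule comm_group.subgroup_imp_normal[OF abelian_free_Abelian_group])
    (rule group.generate_is_subgroup[OF group_free_Abelian_group R])

lemma pres_comm_group: "comm_group (F Mod N)"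
  by (rule comm_group.abelian_FactGroup[OF abelian_free_Abelian_group])
    (rule group.generate_is_subgroup[OF group_free_Abelian_group R])

lemma pres_class_hom: "(\<lambda>x. N #>\<^bsub>F\<^esub> x) \<in> hom F (F Mod N)"
  by (rule normal.r_coset_hom_Mod[OF pres_normal])

lemma pres_class_closed: "Poly_Mapping.keys x \<subseteq> S \<Longrightarrow> N #>\<^bsub>F\<^esub> x \<in> carrier (F Mod N)"
  using hom_in_carrier[OF pres_class_hom] by simp

lemma pres_class_add:
  "Poly_Mapping.keys x \<subseteq> S \<Longrightarrow> Poly_Mapping.keys y \<subseteq> S \<Longrightarrow> N #>\<^bsub>F\<^esub> (x + y) = (N #>\<^bsub>F\<^esub> x) \<otimes>\<^bsub>F Mod N\<^esub> (N #>\<^bsub>F\<^esub> y)"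
  using hom_mult[OF pres_class_hom, of x y] by simp

lemma pres_class_relator: "r \<in> R \<Longrightarrow> N #>\<^bsub>F\<^esub> r = \<one>\<^bsub>F Mod N\<^esub>"
  using group.coset_join2[OF group_free_Abelian_group, of r S N] R
    group.generate_is_subgroup[OF group_free_Abelian_group R] generate.incl[of r R F]
  by (auto simp: FactGroup_def)

lemma pres_class_eq:
  assumes "x - y \<in> R" "Poly_Mapping.keys x \<subseteq> S" "Poly_Mapping.keys y \<subseteq> S"
  shows "N #>\<^bsub>F\<^esub> x = N #>\<^bsub>F\<^esub> y"
proof -
  interpret A: comm_group "F Mod N" by (rule pres_comm_group)
  have "Poly_Mapping.keys (x - y) \<subseteq> S" using subsetD[OF R assms(1)] by simp
  then have "N #>\<^bsub>F\<^esub> ((x - y) + y) = (N #>\<^bsub>F\<^esub> (x - y)) \<otimes>\<^bsub>F Mod N\<^esub> (N #>\<^bsub>F\<^esub> y)"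
    using pres_class_add assms by blast
  then show ?thesis
    using pres_class_relator[OF assms(1)] pres_class_closed[OF assms(3)] by simp
qed

text \<open>The case \<open>mult_inv\<close> mirrors the difference x - y in the induction principle
  of free Abelian groups.\<close>

lemma pres_induct [consumes 1, case_names one gen mult_inv]:
  assumes X: "X \<in> carrier (F Mod N)"
    and one: "P \<one>\<^bsub>F Mod N\<^esub>"
    and gen: "\<And>x. x \<in> S \<Longrightarrow> P (N #>\<^bsub>F\<^esub> frag_of x)"
    and minv: "\<And>X Y. X \<in> carrier (F Mod N) \<Longrightarrow> Y \<in> carrier (F Mod N) \<Longrightarrow> P X \<Longrightarrow> P Y
      \<Longrightarrow> P (X \<otimes>\<^bsub>F Mod N\<^esub> inv\<^bsub>F Mod N\<^esub> Y)"
  shows "P X"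
proof -
  interpret A: comm_group "F Mod N" by (rule pres_comm_group)
  interpret h: group_hom F "F Mod N" "\<lambda>x. N #>\<^bsub>F\<^esub> x"
    by (simp add: group_hom_def group_hom_axioms_def pres_class_hom A.is_group)
  obtain x where x: "Poly_Mapping.keys x \<subseteq> S" and Xx: "X = N #>\<^bsub>F\<^esub> x"
    using X by (auto simp: FactGroup_def RCOSETS_def)
  have "P (N #>\<^bsub>F\<^esub> x)"
  proof (rule free_Abelian_group_induct[OF x])
    show "P (N #>\<^bsub>F\<^esub> 0)" using one h.hom_one by simp
  next
    fix x y assume 2: "Poly_Mapping.keys x \<subseteq> S" "Poly_Mapping.keys y \<subseteq> S"
      "P (N #>\<^bsub>F\<^esub> x)" "P (N #>\<^bsub>F\<^esub> y)"
    have "N #>\<^bsub>F\<^esub> (x - y) = N #>\<^bsub>F\<^esub> (x \<otimes>\<^bsub>F\<^esub> inv\<^bsub>F\<^esub> y)" using 2 by simp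
    also have "\<dots> = (N #>\<^bsub>F\<^esub> x) \<otimes>\<^bsub>F Mod N\<^esub> inv\<^bsub>F Mod N\<^esub> (N #>\<^bsub>F\<^esub> y)"
      using 2 h.hom_mult[of x "inv\<^bsub>F\<^esub> y"] h.hom_inv[of y] by simp
    finally show "P (N #>\<^bsub>F\<^esub> (x - y))" using minv 2 pres_class_closed by metis
  qed (rule gen)
  then show ?thesis by (simp add: Xx)
qed

text \<open>The extension of f to the free group exists only inside the proof. Hence
  \<open>rel\<close> asks that every homomorphism extending f kill the relators. The same
  presentation facts serve the Grothendieck groups and, through \<open>balanced\<close>, both kinds
  of tensor product.\<close>

lemma pres_universal:
  assumes H: "comm_group H" and f: "f ` S \<subseteq> carrier H"
    and rel: "\<And>h r. h \<in> hom F H \<Longrightarrow> (\<And>x. x \<in> S \<Longrightarrow> h (frag_of x) = f x) \<Longrightarrow> r \<in> R \<Longrightarrow> h r = \<one>\<^bsub>H\<^esub>"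
  obtains g where "g \<in> hom (F Mod N) H" "\<And>x. x \<in> S \<Longrightarrow> g (N #>\<^bsub>F\<^esub> frag_of x) = f x"
proof -
  interpret H: comm_group H by (rule H)
  obtain h where h: "h \<in> hom F H" "\<And>x. x \<in> S \<Longrightarrow> h (frag_of x) = f x"
    using H.free_Abelian_group_universal[OF f] by blast
  interpret h: group_hom F H h
    by (simp add: group_hom_def group_hom_axioms_def h H.is_group)
  have "R \<subseteq> kernel F H h" unfolding kernel_def using subsetD[OF R] rel[OF h] by blast
  then have "N \<subseteq> kernel F H h"
    using group.generate_subgroup_incl[OF group_free_Abelian_group _ h.subgroup_kernel] by blast
  then obtain g where "g \<in> hom (F Mod N) H" "\<And>x. x \<in> carrier F \<Longrightarrow> g (N #>\<^bsub>F\<^esub> x) = h x"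
    using h.FactGroup_universal_kernel[OF pres_normal] by metis
  then show thesis using that[of g] h(2) by auto
qed

end

text \<open>These are the two shapes of relators that occur: differences x - y for balancing, and z
  - x - y for biadditivity and for short exact sequences.\<close>

lemma hom_frag_relators:
  assumes "h \<in> hom (free_Abelian_group S) H" "comm_group H" "x \<in> S" "y \<in> S"
  shows "h (frag_of x - frag_of y) = h (frag_of x) \<otimes>\<^bsub>H\<^esub> inv\<^bsub>H\<^esub> h (frag_of y)"
    and "z \<in> S \<Longrightarrow> h (frag_of z - frag_of x - frag_of y)
        = h (frag_of z) \<otimes>\<^bsub>H\<^esub> inv\<^bsub>H\<^esub> h (frag_of x) \<otimes>\<^bsub>H\<^esub> inv\<^bsub>H\<^esub> h (frag_of y)"
proof -
  interpret H: comm_group H by fact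
  interpret h: group_hom "free_Abelian_group S" H h
    by (simp add: group_hom_def group_hom_axioms_def assms H.is_group)
  have d: "h (u - v) = h u \<otimes>\<^bsub>H\<^esub> inv\<^bsub>H\<^esub> h v" if "Poly_Mapping.keys u \<subseteq> S" "Poly_Mapping.keys v \<subseteq> S" for u v
    using h.hom_mult[of u "inv\<^bsub>free_Abelian_group S\<^esub> v"] h.hom_inv[of v] that by simp
  show "h (frag_of x - frag_of y) = h (frag_of x) \<otimes>\<^bsub>H\<^esub> inv\<^bsub>H\<^esub> h (frag_of y)"
    using assms by (simp add: d)
  show "h (frag_of z - frag_of x - frag_of y)
        = h (frag_of z) \<otimes>\<^bsub>H\<^esub> inv\<^bsub>H\<^esub> h (frag_of x) \<otimes>\<^bsub>H\<^esub> inv\<^bsub>H\<^esub> h (frag_of y)" if "z \<in> S"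
  proof -
    have "Poly_Mapping.keys (frag_of z - frag_of x) \<subseteq> S"
      using that assms keys_diff[of "frag_of z" "frag_of x"] by (auto split: if_splits)
    then show ?thesis using assms that by (simp add: d)
  qed
qed

subsection \<open>Balanced tensor products\<close>

text \<open>Two instances are used: polynomials acting on two modules, and integers acting by
  powers, the latter for extending scalars from the integers to the complex numbers.\<close>

locale balanced =
  G: comm_group G + H: comm_group H
  for S :: "'s set" and a :: "'s \<Rightarrow> 'g \<Rightarrow> 'g" and b :: "'s \<Rightarrow> 'h \<Rightarrow> 'h"
    and G :: "('g, 'x) monoid_scheme" and H :: "('h, 'y) monoid_scheme" +
  assumes a_closed: "s \<in> S \<Longrightarrow> g \<in> carrier G \<Longrightarrow> a s g \<in> carrier G"
    and b_closed: "s \<in> S \<Longrightarrow> h \<in> carrier H \<Longrightarrow> b s h \<in> carrier H"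
begin

abbreviation "T \<equiv> tensor_group S a b G H"
abbreviation pure :: "'g \<Rightarrow> 'h \<Rightarrow> (('g \<times> 'h) \<Rightarrow>\<^sub>0 int) set" where "pure \<equiv> pure_tensor S a b G H"

lemma relators_carrier:
  "tensor_relators S a b G H \<subseteq> carrier (free_Abelian_group (carrier G \<times> carrier H))"
proof -
  have 1: "Poly_Mapping.keys (frag_of x - frag_of y) \<subseteq> {x, y}" for x y :: "'g \<times> 'h"
    using keys_diff[of "frag_of x" "frag_of y"] by auto
  have 2: "Poly_Mapping.keys (frag_of x - frag_of y - frag_of z) \<subseteq> {x, y, z}" for x y z :: "'g \<times> 'h"
    using keys_diff[of "frag_of x - frag_of y" "frag_of z"] 1[of x y] by auto
  show ?thesis
    unfolding tensor_relators_def carrier_free_Abelian_group_iff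
    by (auto simp: a_closed b_closed dest!: subsetD[OF 1] subsetD[OF 2])
qed

lemmas T_def = tensor_group_def[of S a b G H, unfolded tensor_null_def]

lemmas pure_def' = tensor_coset_def[of S a b G H, unfolded tensor_null_def]

sublocale T: comm_group T
  unfolding T_def by (rule pres_comm_group[OF relators_carrier])

lemma pure_closed: "g \<in> carrier G \<Longrightarrow> h \<in> carrier H \<Longrightarrow> pure g h \<in> carrier T"
  unfolding T_def pure_def' by (rule pres_class_closed[OF relators_carrier]) simp

lemma pure_mult_left:
  assumes "g \<in> carrier G" "g' \<in> carrier G" "h \<in> carrier H"
  shows "pure (g \<otimes>\<^bsub>G\<^esub> g') h = pure g h \<otimes>\<^bsub>T\<^esub> pure g' h"
proof -
  have "pure (g \<otimes>\<^bsub>G\<^esub> g') h = tensor_coset S a b G H (frag_of (g, h) + frag_of (g', h))"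
    unfolding pure_def'
    by (rule pres_class_eq[OF relators_carrier])
      (use assms in \<open>auto simp: tensor_relators_def algebra_simps dest!: subsetD[OF keys_add]\<close>)
  also have "\<dots> = pure g h \<otimes>\<^bsub>T\<^esub> pure g' h"
    unfolding T_def pure_def' by (rule pres_class_add[OF relators_carrier]) (use assms in auto)
  finally show ?thesis .
qed

lemma pure_mult_right:
  assumes "g \<in> carrier G" "h \<in> carrier H" "h' \<in> carrier H"
  shows "pure g (h \<otimes>\<^bsub>H\<^esub> h') = pure g h \<otimes>\<^bsub>T\<^esub> pure g h'"
proof -
  have "pure g (h \<otimes>\<^bsub>H\<^esub> h') = tensor_coset S a b G H (frag_of (g, h) + frag_of (g, h'))"
    unfolding pure_def'
    by (rule pres_class_eq[OF relators_carrier])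
      (use assms in \<open>auto simp: tensor_relators_def algebra_simps dest!: subsetD[OF keys_add]\<close>)
  also have "\<dots> = pure g h \<otimes>\<^bsub>T\<^esub> pure g h'"
    unfolding T_def pure_def' by (rule pres_class_add[OF relators_carrier]) (use assms in auto)
  finally show ?thesis .
qed

lemma pure_balanced:
  assumes "s \<in> S" "g \<in> carrier G" "h \<in> carrier H"
  shows "pure (a s g) h = pure g (b s h)"
  unfolding pure_def'
  by (rule pres_class_eq[OF relators_carrier])
    (use assms in \<open>auto simp: tensor_relators_def a_closed b_closed\<close>)

lemma pure_hom_left: "h \<in> carrier H \<Longrightarrow> (\<lambda>g. pure g h) \<in> hom G T"
  by (rule homI) (auto simp: pure_closed pure_mult_left)

lemma pure_hom_right: "g \<in> carrier G \<Longrightarrow> pure g \<in> hom H T"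
  by (rule homI) (auto simp: pure_closed pure_mult_right)

lemma pure_one_left: "h \<in> carrier H \<Longrightarrow> pure \<one>\<^bsub>G\<^esub> h = \<one>\<^bsub>T\<^esub>"
  by (rule hom_one[OF pure_hom_left]) (auto simp: G.is_group T.is_group)

lemma pure_one_right: "g \<in> carrier G \<Longrightarrow> pure g \<one>\<^bsub>H\<^esub> = \<one>\<^bsub>T\<^esub>"
  by (rule hom_one[OF pure_hom_right]) (auto simp: H.is_group T.is_group)

lemma pure_inv_left:
  assumes "g \<in> carrier G" "h \<in> carrier H"
  shows "pure (inv\<^bsub>G\<^esub> g) h = inv\<^bsub>T\<^esub> pure g h"
proof -
  interpret group_hom G T "\<lambda>g. pure g h"
    by (simp add: group_hom_def group_hom_axioms_def pure_hom_left assms G.is_group T.is_group)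
  show ?thesis by (rule hom_inv[OF assms(1)])
qed

lemma pure_inv_right:
  assumes "g \<in> carrier G" "h \<in> carrier H"
  shows "pure g (inv\<^bsub>H\<^esub> h) = inv\<^bsub>T\<^esub> pure g h"
proof -
  interpret group_hom H T "pure g"
    by (simp add: group_hom_def group_hom_axioms_def pure_hom_right assms H.is_group T.is_group)
  show ?thesis by (rule hom_inv[OF assms(2)])
qed

text \<open>Inverses need no case of their own because the inverse of g \<otimes> h is the pure
  tensor of the inverse of g with h. The proof runs the presentation induction for P at X and at its
  inverse simultaneously.\<close>

lemma tensor_induct [consumes 1, case_names pure mult]:
  assumes X: "X \<in> carrier T"
    and pure: "\<And>g h. g \<in> carrier G \<Longrightarrow> h \<in> carrier H \<Longrightarrow> P (pure g h)"
    and mult: "\<And>X Y. X \<in> carrier T \<Longrightarrow> Y \<in> carrier T \<Longrightarrow> P X \<Longrightarrow> P Y \<Longrightarrow> P (X \<otimes>\<^bsub>T\<^esub> Y)"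
  shows "P X"
proof -
  have one: "P \<one>\<^bsub>T\<^esub>"
    using pure[of "\<one>\<^bsub>G\<^esub>" "\<one>\<^bsub>H\<^esub>"] pure_one_left by simp
  have "P X \<and> P (inv\<^bsub>T\<^esub> X)"
  proof (rule pres_induct[OF relators_carrier X[unfolded T_def], folded T_def pure_def'])
    show "P \<one>\<^bsub>T\<^esub> \<and> P (inv\<^bsub>T\<^esub> \<one>\<^bsub>T\<^esub>)" using one by simp
  next
    fix x assume "x \<in> carrier G \<times> carrier H"
    then show "P (tensor_coset S a b G H (frag_of x)) \<and> P (inv\<^bsub>T\<^esub> tensor_coset S a b G H (frag_of x))"
      using pure pure_inv_left[symmetric] by auto
  next
    fix X Y assume "X \<in> carrier T" "Y \<in> carrier T" "P X \<and> P (inv\<^bsub>T\<^esub> X)" "P Y \<and> P (inv\<^bsub>T\<^esub> Y)"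
    then show "P (X \<otimes>\<^bsub>T\<^esub> inv\<^bsub>T\<^esub> Y) \<and> P (inv\<^bsub>T\<^esub> (X \<otimes>\<^bsub>T\<^esub> inv\<^bsub>T\<^esub> Y))"
      using mult by (auto simp: T.inv_mult)
  qed
  then show ?thesis ..
qed

lemma tensor_universal:
  assumes K: "comm_group K"
    and closed: "\<And>g h. g \<in> carrier G \<Longrightarrow> h \<in> carrier H \<Longrightarrow> f g h \<in> carrier K"
    and left: "\<And>g g' h. g \<in> carrier G \<Longrightarrow> g' \<in> carrier G \<Longrightarrow> h \<in> carrier H \<Longrightarrow>
       f (g \<otimes>\<^bsub>G\<^esub> g') h = f g h \<otimes>\<^bsub>K\<^esub> f g' h"
    and right: "\<And>g h h'. g \<in> carrier G \<Longrightarrow> h \<in> carrier H \<Longrightarrow> h' \<in> carrier H \<Longrightarrow>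
       f g (h \<otimes>\<^bsub>H\<^esub> h') = f g h \<otimes>\<^bsub>K\<^esub> f g h'"
    and bal: "\<And>s g h. s \<in> S \<Longrightarrow> g \<in> carrier G \<Longrightarrow> h \<in> carrier H \<Longrightarrow> f (a s g) h = f g (b s h)"
  obtains \<phi> where "\<phi> \<in> hom T K" "\<And>g h. g \<in> carrier G \<Longrightarrow> h \<in> carrier H \<Longrightarrow> \<phi> (pure g h) = f g h"
proof -
  interpret K: comm_group K by (rule K)
  have rel: "h r = \<one>\<^bsub>K\<^esub>"
    if h: "h \<in> hom (free_Abelian_group (carrier G \<times> carrier H)) K"
      "\<And>x. x \<in> carrier G \<times> carrier H \<Longrightarrow> h (frag_of x) = (\<lambda>(g, h). f g h) x"
      and r: "r \<in> tensor_relators S a b G H" for h r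
  proof -
    have cancel: "x \<otimes>\<^bsub>K\<^esub> y \<otimes>\<^bsub>K\<^esub> inv\<^bsub>K\<^esub> x \<otimes>\<^bsub>K\<^esub> inv\<^bsub>K\<^esub> y = \<one>\<^bsub>K\<^esub>"
      if "x \<in> carrier K" "y \<in> carrier K" for x y
      using that by (metis K.inv_closed K.inv_solve_right' K.l_one K.m_closed K.m_comm K.one_closed K.r_inv)
    show ?thesis
      using r unfolding tensor_relators_def
      by (auto simp: hom_frag_relators[OF h(1) K] h(2) a_closed b_closed left right bal closed cancel)
  qed
  obtain \<phi> where "\<phi> \<in> hom T K" "\<And>x. x \<in> carrier G \<times> carrier H \<Longrightarrow> \<phi> (tensor_coset S a b G H (frag_of x)) = (\<lambda>(g, h). f g h) x"
    using pres_universal[OF relators_carrier K, of "\<lambda>(g, h). f g h", folded T_def pure_def'] rel closed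
    by (smt (verit, best) SigmaE case_prod_conv image_subsetI)
  then show thesis using that[of \<phi>] by auto
qed

end

subsection \<open>Finite-dimensional complex vector spaces\<close>

lemma class_ring_simps [simp]:
  "carrier class_ring = UNIV" "x \<otimes>\<^bsub>class_ring\<^esub> y = x * y" "\<one>\<^bsub>class_ring\<^esub> = 1"
  "x \<oplus>\<^bsub>class_ring\<^esub> y = x + y" "\<zero>\<^bsub>class_ring\<^esub> = 0"
  by (simp_all add: class_ring_def)

lemma class_ring_ring: "ring (class_ring :: 'a::ring_1 ring)"
proof (rule ringI)
  show "abelian_group (class_ring :: 'a ring)"
    by (rule abelian_groupI) (auto simp: algebra_simps intro: exI[of _ "- _"] add.left_inverse)
  show "Group.monoid (class_ring :: 'a ring)"
    by (rule monoidI) (auto simp: algebra_simps)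
qed (auto simp: algebra_simps)

lemma class_ring_cring: "cring (class_ring :: 'a::comm_ring_1 ring)"
  by (rule cring.intro[OF class_ring_ring])
    (rule comm_monoidI, auto simp: algebra_simps)

lemma class_ring_a_inv [simp]: "\<ominus>\<^bsub>class_ring\<^esub> x = - (x :: 'a::ring_1)"
  using abelian_group.minus_equality[OF ring.is_abelian_group[OF class_ring_ring], of "- x" x] by simp

lemma class_ring_a_minus [simp]: "x \<ominus>\<^bsub>class_ring\<^esub> y = x - (y :: 'a::ring_1)"
  by (simp add: a_minus_def)

definition lin_form :: "(complex, 'v) module \<Rightarrow> ('v \<Rightarrow> complex) \<Rightarrow> bool" where
  "lin_form V f \<longleftrightarrow> (\<forall>x\<in>carrier V. \<forall>y\<in>carrier V. f (x \<oplus>\<^bsub>V\<^esub> y) = f x + f y) \<and>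
     (\<forall>c. \<forall>x\<in>carrier V. f (c \<odot>\<^bsub>V\<^esub> x) = c * f x)"

text \<open>A basis is carried together with its coordinate forms. Biorthogonality replaces linear
  independence, and the trace of an operator A becomes the sum of the numbers
  \<open>l i (A (e i))\<close>.\<close>

definition dual_basis ::
  "(complex, 'v) module \<Rightarrow> 'i set \<Rightarrow> ('i \<Rightarrow> 'v) \<Rightarrow> ('i \<Rightarrow> 'v \<Rightarrow> complex) \<Rightarrow> bool" where
  "dual_basis V I e l \<longleftrightarrow> finite I \<and> (\<forall>i\<in>I. e i \<in> carrier V) \<and> (\<forall>i\<in>I. lin_form V (l i)) \<and>
     (\<forall>i\<in>I. \<forall>j\<in>I. l i (e j) = (if i = j then 1 else 0)) \<and>
     (\<forall>x\<in>carrier V. x = (\<Oplus>\<^bsub>V\<^esub>i\<in>I. l i x \<odot>\<^bsub>V\<^esub> e i))"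

definition has_dim :: "(complex, 'v) module \<Rightarrow> nat \<Rightarrow> bool" where
  "has_dim V n \<longleftrightarrow> (\<exists>e l. dual_basis V {..<n} e l)"

lemma dual_basisD:
  assumes "dual_basis V I e l"
  shows "finite I" "\<And>i. i \<in> I \<Longrightarrow> e i \<in> carrier V" "\<And>i. i \<in> I \<Longrightarrow> lin_form V (l i)"
    "\<And>i j. i \<in> I \<Longrightarrow> j \<in> I \<Longrightarrow> l i (e j) = (if i = j then 1 else 0)"
    "\<And>x. x \<in> carrier V \<Longrightarrow> x = (\<Oplus>\<^bsub>V\<^esub>i\<in>I. l i x \<odot>\<^bsub>V\<^esub> e i)"
  using assms unfolding dual_basis_def by blast+

locale cspace = module CC V for V :: "(complex, 'v) module" (structure)
begin

lemma comb_closed: "(\<And>i. i \<in> I \<Longrightarrow> e i \<in> carrier V) \<Longrightarrow> (\<Oplus>i\<in>I. c i \<odot> e i) \<in> carrier V"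
  by (rule M.finsum_closed) auto

lemma comb_add:
  "(\<And>i. i \<in> I \<Longrightarrow> e i \<in> carrier V) \<Longrightarrow>
    (\<Oplus>i\<in>I. c i \<odot> e i) \<oplus> (\<Oplus>i\<in>I. d i \<odot> e i) = (\<Oplus>i\<in>I. (c i + d i) \<odot> e i)"
  by (rule trans[OF M.finsum_addf[symmetric] M.finsum_cong'])
    (simp_all add: smult_l_distr[simplified] smult_closed[simplified])

lemma comb_smult:
  "finite I \<Longrightarrow> (\<And>i. i \<in> I \<Longrightarrow> e i \<in> carrier V) \<Longrightarrow>
    a \<odot> (\<Oplus>i\<in>I. c i \<odot> e i) = (\<Oplus>i\<in>I. (a * c i) \<odot> e i)"
  by (rule trans[OF finsum_smult_ldistr M.finsum_cong'])
    (simp_all add: smult_assoc1[simplified] smult_closed[simplified])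

lemma comb_add_smult:
  "finite I \<Longrightarrow> (\<And>i. i \<in> I \<Longrightarrow> e i \<in> carrier V) \<Longrightarrow>
    (\<Oplus>i\<in>I. c i \<odot> e i) \<oplus> k \<odot> (\<Oplus>i\<in>I. d i \<odot> e i) = (\<Oplus>i\<in>I. (c i + k * d i) \<odot> e i)"
  by (simp only: comb_smult comb_add)

lemma comb_delta:
  assumes "finite I" "\<And>i. i \<in> I \<Longrightarrow> e i \<in> carrier V" "j \<in> I"
  shows "(\<Oplus>i\<in>I. (if i = j then 1 else 0) \<odot> e i) = e j"
proof -
  have "(\<Oplus>i\<in>I. (if i = j then 1 else 0) \<odot> e i) = (\<Oplus>i\<in>I. if j = i then e i else \<zero>)"
    using assms by (intro M.finsum_cong') (simp_all add: smult_l_null[simplified] smult_one[simplified])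
  also have "\<dots> = e j" using assms by (intro M.finsum_singleton) auto
  finally show ?thesis .
qed

lemma lin_form_zero: "lin_form V f \<Longrightarrow> f \<zero> = 0"
  by (metis M.zero_closed lin_form_def M.l_zero add_cancel_left_left)

lemma lin_form_comb:
  assumes "lin_form V f" "finite I" "\<And>i. i \<in> I \<Longrightarrow> e i \<in> carrier V"
  shows "f (\<Oplus>i\<in>I. c i \<odot> e i) = (\<Sum>i\<in>I. c i * f (e i))"
  using assms(2,3)
proof (induction I rule: finite_induct)
  case empty
  then show ?case by (simp add: lin_form_zero[OF assms(1)])
next
  case (insert i I)
  then have "f (\<Oplus>i\<in>insert i I. c i \<odot> e i) = f (c i \<odot> e i \<oplus> (\<Oplus>i\<in>I. c i \<odot> e i))"
    by (subst M.finsum_insert) auto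
  also have "\<dots> = f (c i \<odot> e i) + f (\<Oplus>i\<in>I. c i \<odot> e i)"
    using assms(1) insert by (auto simp: lin_form_def comb_closed)
  finally show ?case using insert assms(1) by (auto simp: lin_form_def)
qed

lemma dual_basis_reindex:
  assumes "dual_basis V I e l" "bij_betw h J I"
  shows "dual_basis V J (e \<circ> h) (l \<circ> h)"
proof -
  have *: "(\<Oplus>i\<in>I. l i x \<odot> e i) = (\<Oplus>j\<in>J. l (h j) x \<odot> e (h j))" if "x \<in> carrier V" for x
    using M.finsum_reindex[of "\<lambda>i. l i x \<odot> e i" h J] assms
    by (auto simp: dual_basis_def bij_betw_def Pi_def)
  have inj: "h i = h j \<longleftrightarrow> i = j" if "i \<in> J" "j \<in> J" for i j
    using assms(2) that by (auto simp: bij_betw_def inj_on_def)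
  show ?thesis
    unfolding dual_basis_def
  proof (intro conjI ballI)
    show "x = (\<Oplus>i\<in>J. (l \<circ> h) i x \<odot> (e \<circ> h) i)" if "x \<in> carrier V" for x
      using *[OF that] dual_basisD(5)[OF assms(1) that] by simp
  qed (use assms inj in \<open>auto simp: dual_basis_def bij_betw_finite bij_betwE\<close>)
qed

lemma dual_basis_imp_has_dim:
  assumes "dual_basis V I e l"
  shows "has_dim V (card I)"
proof -
  obtain h where "bij_betw h {..<card I} I"
    using ex_bij_betw_nat_finite[of I] assms by (auto simp: dual_basis_def atLeast0LessThan)
  then show ?thesis using dual_basis_reindex[OF assms] has_dim_def by blast
qed

text \<open>Coefficients are first picked arbitrarily for each vector. Uniqueness then forces the
  choice to be additive and homogeneous, so the picked coefficients are linear forms.\<close>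

lemma dual_basis_if_unique_coeffs:
  assumes fin: "finite B" and B: "\<And>i. i \<in> B \<Longrightarrow> e i \<in> carrier V"
    and span: "\<And>v. v \<in> carrier V \<Longrightarrow> \<exists>c. v = (\<Oplus>b\<in>B. c b \<odot> e b)"
    and indep: "\<And>c b. (\<Oplus>b\<in>B. c b \<odot> e b) = \<zero> \<Longrightarrow> b \<in> B \<Longrightarrow> c b = 0"
  shows "\<exists>l. dual_basis V B e l"
proof -
  obtain c where c: "\<And>v. v \<in> carrier V \<Longrightarrow> v = (\<Oplus>b\<in>B. c v b \<odot> e b)"
    using span by metis
  have uniq: "d b = d' b" if "(\<Oplus>b\<in>B. d b \<odot> e b) = (\<Oplus>b\<in>B. d' b \<odot> e b)" "b \<in> B" for d d' b
  proof -
    have Bc: "\<And>i. i \<in> B \<Longrightarrow> e i \<in> carrier V" using B by auto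
    have "(\<Oplus>b\<in>B. (d b + (-1) * d' b) \<odot> e b) = (\<Oplus>b\<in>B. d b \<odot> e b) \<oplus> (-1) \<odot> (\<Oplus>b\<in>B. d' b \<odot> e b)"
      by (rule comb_add_smult[OF fin Bc, symmetric])
    also have "\<dots> = (\<Oplus>b\<in>B. d' b \<odot> e b) \<oplus> (-1) \<odot> (\<Oplus>b\<in>B. d' b \<odot> e b)" by (simp only: that(1))
    also have "\<dots> = (\<Oplus>b\<in>B. (d' b + (-1) * d' b) \<odot> e b)"
      by (rule comb_add_smult[OF fin Bc])
    also have "\<dots> = \<zero>" using Bc smult_l_null[simplified] by (intro M.add.finprod_one_eqI) auto
    finally show ?thesis using indep[OF _ that(2)] by fastforce
  qed
  have Bc: "\<And>i. i \<in> B \<Longrightarrow> e i \<in> carrier V" using B by auto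
  have "dual_basis V B e (\<lambda>b v. c v b)"
    unfolding dual_basis_def
  proof (intro conjI ballI)
    fix i assume i: "i \<in> B"
    show "lin_form V (\<lambda>v. c v i)"
      unfolding lin_form_def
    proof (intro conjI ballI allI)
      fix x y assume xy: "x \<in> carrier V" "y \<in> carrier V"
      have "(\<Oplus>b\<in>B. c (x \<oplus> y) b \<odot> e b) = (\<Oplus>b\<in>B. (c x b + c y b) \<odot> e b)"
        using comb_add[of B e "c x" "c y", OF Bc] c[OF xy(1)] c[OF xy(2)] c[OF M.a_closed[OF xy]]
        by simp
      then show "c (x \<oplus> y) i = c x i + c y i" by (rule uniq[OF _ i])
    next
      fix a x assume x: "x \<in> carrier V"
      have "(\<Oplus>b\<in>B. c (a \<odot> x) b \<odot> e b) = (\<Oplus>b\<in>B. (a * c x b) \<odot> e b)"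
        using comb_smult[OF fin, where e = e and a = a and c = "c x"] Bc c[OF x] c[OF smult_closed[simplified, OF x, of a]]
        by simp
      then show "c (a \<odot> x) i = a * c x i" by (rule uniq[OF _ i])
    qed
  next
    fix i j assume ij: "i \<in> B" "j \<in> B"
    have "(\<Oplus>b\<in>B. c (e j) b \<odot> e b) = (\<Oplus>b\<in>B. (if b = j then 1 else 0) \<odot> e b)"
      using comb_delta[OF fin _ ij(2), of e] Bc c[OF Bc[OF ij(2)]] by simp
    then show "c (e j) i = (if i = j then 1 else 0)"
      using uniq[of "c (e j)" "\<lambda>b. if b = j then 1 else 0" i] ij by simp
  qed (use fin Bc c in auto)
  then show ?thesis by blast
qed

text \<open>Strong induction on the size of the spanning family: either the coefficients are unique,
  or a nontrivial relation allows one vector to be discarded.\<close>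

lemma has_dim_if_finite_span:
  assumes "finite B" "\<And>i. i \<in> B \<Longrightarrow> e i \<in> carrier V" "\<And>v. v \<in> carrier V \<Longrightarrow> \<exists>c. v = (\<Oplus>b\<in>B. c b \<odot> e b)"
  shows "\<exists>n. has_dim V n"
  using assms
proof (induction "card B" arbitrary: B rule: less_induct)
  case less
  note fin = less.prems(1) and B = less.prems(2) and span = less.prems(3)
  show ?case
  proof (cases "\<forall>c. (\<Oplus>b\<in>B. c b \<odot> e b) = \<zero> \<longrightarrow> (\<forall>b\<in>B. c b = 0)")
    case True
    then show ?thesis
      using dual_basis_if_unique_coeffs[OF fin B span] dual_basis_imp_has_dim by blast
  next
    case False
    then obtain d b0 where d: "(\<Oplus>b\<in>B. d b \<odot> e b) = \<zero>" "b0 \<in> B" "d b0 \<noteq> 0" by blast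
    let ?B = "B - {b0}"
    have Bc: "\<And>i. i \<in> B \<Longrightarrow> e i \<in> carrier V" using B by auto
    have "\<exists>c. v = (\<Oplus>b\<in>?B. c b \<odot> e b)" if v: "v \<in> carrier V" for v
    proof -
      obtain c where c: "v = (\<Oplus>b\<in>B. c b \<odot> e b)" using span[OF v] by blast
      \<comment> \<open>With this multiple of the relation added, the coefficient at
        \<open>b0\<close> becomes \<open>c b0 + ?k * d b0 = 0\<close>.\<close>
      let ?k = "- (c b0 / d b0)"
      have "v = (\<Oplus>b\<in>B. c b \<odot> e b) \<oplus> ?k \<odot> (\<Oplus>b\<in>B. d b \<odot> e b)"
        using c d v by (simp add: smult_r_null[simplified])
      also have "\<dots> = (\<Oplus>b\<in>B. (c b + ?k * d b) \<odot> e b)"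
        by (rule comb_add_smult[OF fin Bc])
      also have "B = insert b0 ?B" using d by auto
      also have "(\<Oplus>b\<in>insert b0 ?B. (c b + ?k * d b) \<odot> e b) =
          (c b0 + ?k * d b0) \<odot> e b0 \<oplus> (\<Oplus>b\<in>?B. (c b + ?k * d b) \<odot> e b)"
        by (rule M.finsum_insert) (use fin Bc d in auto)
      also have "\<dots> = (\<Oplus>b\<in>?B. (c b + ?k * d b) \<odot> e b)"
        using d Bc by (simp add: smult_l_null[simplified] comb_closed)
      finally show ?thesis by (rule exI[of _ "\<lambda>b. c b + ?k * d b"])
    qed
    moreover have "card ?B < card B" using d fin by (simp add: card_gt_0_iff card_Diff1_less del: card_Diff_insert)
    ultimately show ?thesis using less.hyps[of ?B] fin B by auto
  qed
qed

end

text \<open>This is tr(AB) = tr(BA) in coordinates: both sides expand to the same double sum of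
  matrix entries.\<close>

lemma linear_trace:
  assumes U: "cspace U" and V: "cspace V" and a: "dual_basis U I u a" and b: "dual_basis V J v b"
    and A: "A \<in> lmod_hom CC U V" and B: "B \<in> lmod_hom CC V U"
  shows "(\<Sum>j\<in>J. b j (A (B (v j)))) = (\<Sum>i\<in>I. a i (B (A (u i))))"
proof -
  interpret U: cspace U by (rule U)
  interpret V: cspace V by (rule V)
  have Ac: "A x \<in> carrier V" if "x \<in> carrier U" for x
    using A that by (auto simp: lmod_hom_def hom_def)
  have Bc: "B x \<in> carrier U" if "x \<in> carrier V" for x
    using B that by (auto simp: lmod_hom_def hom_def)
  have form: "lin_form U (\<lambda>x. b j (A x))" if "j \<in> J" for j
    using b A that Ac by (auto simp: dual_basis_def lin_form_def lmod_hom_def hom_def)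
  have form': "lin_form V (\<lambda>x. a i (B x))" if "i \<in> I" for i
    using a B that Bc by (auto simp: dual_basis_def lin_form_def lmod_hom_def hom_def)
  have I: "finite I" "\<And>i. i \<in> I \<Longrightarrow> u i \<in> carrier U" "\<And>x. x \<in> carrier U \<Longrightarrow> x = (\<Oplus>\<^bsub>U\<^esub>i\<in>I. a i x \<odot>\<^bsub>U\<^esub> u i)"
    using a unfolding dual_basis_def by simp_all
  have J: "finite J" "\<And>j. j \<in> J \<Longrightarrow> v j \<in> carrier V" "\<And>x. x \<in> carrier V \<Longrightarrow> x = (\<Oplus>\<^bsub>V\<^esub>i\<in>J. b i x \<odot>\<^bsub>V\<^esub> v i)"
    using b unfolding dual_basis_def by simp_all
  have 1: "b j (A (B (v j))) = (\<Sum>i\<in>I. a i (B (v j)) * b j (A (u i)))" if "j \<in> J" for j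
    using U.lin_form_comb[OF form[OF that] I(1), where e = u and c = "\<lambda>i. a i (B (v j))"] I(2) I(3)[OF Bc[OF J(2)[OF that]]] by simp
  have 2: "a i (B (A (u i))) = (\<Sum>j\<in>J. b j (A (u i)) * a i (B (v j)))" if "i \<in> I" for i
    using V.lin_form_comb[OF form'[OF that] J(1), where e = v and c = "\<lambda>j. b j (A (u i))"] J(2) J(3)[OF Ac[OF I(2)[OF that]]] by simp
  show ?thesis
    by (simp add: 1 2 cong: sum.cong) (subst sum.swap, simp add: mult.commute)
qed

text \<open>For mutually inverse maps the two traces of \<open>linear_trace\<close> are traces of
  identities, hence n and m as complex numbers.\<close>

lemma has_dim_transfer:
  assumes U: "cspace U" and V: "cspace V"
    and A: "A \<in> lmod_hom CC U V" and B: "B \<in> lmod_hom CC V U"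
    and AB: "\<And>x. x \<in> carrier V \<Longrightarrow> A (B x) = x" and BA: "\<And>x. x \<in> carrier U \<Longrightarrow> B (A x) = x"
    and "has_dim U n" "has_dim V m"
  shows "n = m"
proof -
  obtain u a v b where *: "dual_basis U {..<n} u a" "dual_basis V {..<m} v b"
    using assms unfolding has_dim_def by blast
  have "(\<Sum>j<m. b j (A (B (v j)))) = (\<Sum>j<m. 1)"
    using dual_basisD(2,4)[OF *(2)] AB by (intro sum.cong) auto
  moreover have "(\<Sum>j<n. a j (B (A (u j)))) = (\<Sum>j<n. 1)"
    using dual_basisD(2,4)[OF *(1)] BA by (intro sum.cong) auto
  ultimately show ?thesis
    using linear_trace[OF U V * A B] by simp
qed

lemma has_dim_unique:
  assumes "cspace V" "has_dim V n" "has_dim V m"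
  shows "n = m"
  by (rule has_dim_transfer[OF assms(1,1) _ _ _ _ assms(2,3), of "\<lambda>x. x" "\<lambda>x. x"])
    (auto simp: lmod_hom_def hom_def)

text \<open>The sequence is split linearly by a section s of g and a retraction p of f, so that the
  identity of the middle space is fp + sg. Its trace is m, while tr(fp) = tr(pf) = n and tr(sg) =
  tr(gs) = k.\<close>

lemma has_dim_exact:
  assumes U: "cspace U" and V: "cspace V" and W: "cspace W"
    and f: "f \<in> lmod_hom CC U V" and g: "g \<in> lmod_hom CC V W"
    and inj: "inj_on f (carrier U)" and surj: "g ` carrier V = carrier W"
    and ex: "f ` carrier U = {x \<in> carrier V. g x = \<zero>\<^bsub>W\<^esub>}"
    and dims: "has_dim U n" "has_dim V m" "has_dim W k"
  shows "m = n + k"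
proof -
  interpret U: cspace U by (rule U)
  interpret V: cspace V by (rule V)
  interpret W: cspace W by (rule W)
  obtain u a v b w c where d: "dual_basis U {..<n} u a" "dual_basis V {..<m} v b" "dual_basis W {..<k} w c"
    using dims unfolding has_dim_def by blast
  have c_add: "c i (x \<oplus>\<^bsub>W\<^esub> y) = c i x + c i y" if "x \<in> carrier W" "y \<in> carrier W" "i < k" for i x y
    using d(3) that by (auto simp: dual_basis_def lin_form_def)
  have c_smult: "c i (\<alpha> \<odot>\<^bsub>W\<^esub> x) = \<alpha> * c i x" if "x \<in> carrier W" "i < k" for i x \<alpha>
    using d(3) that by (auto simp: dual_basis_def lin_form_def)
  have fh: "f (x \<oplus>\<^bsub>U\<^esub> y) = f x \<oplus>\<^bsub>V\<^esub> f y" "f (\<alpha> \<odot>\<^bsub>U\<^esub> x) = \<alpha> \<odot>\<^bsub>V\<^esub> f x" "f x \<in> carrier V"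
    if "x \<in> carrier U" "y \<in> carrier U" for x y \<alpha>
    using f that by (auto simp: lmod_hom_def hom_def)
  have gh: "g (x \<oplus>\<^bsub>V\<^esub> y) = g x \<oplus>\<^bsub>W\<^esub> g y" "g (\<alpha> \<odot>\<^bsub>V\<^esub> x) = \<alpha> \<odot>\<^bsub>W\<^esub> g x" "g x \<in> carrier W"
    if "x \<in> carrier V" "y \<in> carrier V" for x y \<alpha>
    using g that by (auto simp: lmod_hom_def hom_def)
  have fc: "f x \<in> carrier V" and f_smult: "f (\<alpha> \<odot>\<^bsub>U\<^esub> x) = \<alpha> \<odot>\<^bsub>V\<^esub> f x" if "x \<in> carrier U" for x \<alpha>
    using fh(2,3)[OF that that] by auto
  have gc: "g x \<in> carrier W" and g_smult: "g (\<alpha> \<odot>\<^bsub>V\<^esub> x) = \<alpha> \<odot>\<^bsub>W\<^esub> g x" if "x \<in> carrier V" for x \<alpha>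
    using gh(2,3)[OF that that] by auto
  have wc: "w i \<in> carrier W" if "i < k" for i using d(3) that by (auto simp: dual_basis_def)
  have "\<exists>x\<in>carrier V. g x = w i" if "i < k" for i using wc[OF that] surj by (metis imageE)
  then obtain x where x: "\<And>i. i < k \<Longrightarrow> x i \<in> carrier V \<and> g (x i) = w i" by metis
  \<comment> \<open>The section sends each basis vector \<open>w i\<close> of W to a chosen preimage
    \<open>x i\<close>.\<close>
  define s where "s y = (\<Oplus>\<^bsub>V\<^esub>i\<in>{..<k}. c i y \<odot>\<^bsub>V\<^esub> x i)" for y
  have s_closed: "s y \<in> carrier V" for y unfolding s_def using x by (intro V.comb_closed) auto
  have s_add: "s (y \<oplus>\<^bsub>W\<^esub> z) = s y \<oplus>\<^bsub>V\<^esub> s z" if "y \<in> carrier W" "z \<in> carrier W" for y z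
    unfolding s_def using x that
    by (intro trans[OF V.M.finsum_cong' V.comb_add[symmetric]]) (simp_all add: c_add V.smult_closed[simplified])
  have s_smult: "s (\<alpha> \<odot>\<^bsub>W\<^esub> y) = \<alpha> \<odot>\<^bsub>V\<^esub> s y" if "y \<in> carrier W" for y \<alpha>
    unfolding s_def using x that
    by (intro trans[OF V.M.finsum_cong' V.comb_smult[symmetric]]) (simp_all add: c_smult V.smult_closed[simplified])
  have s_hom: "s \<in> lmod_hom CC W V"
    using s_closed s_add s_smult by (auto simp: lmod_hom_def hom_def)
  have g_comb: "g (\<Oplus>\<^bsub>V\<^esub>i\<in>I. d i \<odot>\<^bsub>V\<^esub> x i) = (\<Oplus>\<^bsub>W\<^esub>i\<in>I. d i \<odot>\<^bsub>W\<^esub> w i)" if "finite I" "I \<subseteq> {..<k}" for I d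
    using that
  proof (induction I rule: finite_induct)
    case empty
    have "\<zero>\<^bsub>V\<^esub> \<in> {x \<in> carrier V. g x = \<zero>\<^bsub>W\<^esub>}"
      using gh(1)[of "\<zero>\<^bsub>V\<^esub>" "\<zero>\<^bsub>V\<^esub>"] gh(3)[of "\<zero>\<^bsub>V\<^esub>" "\<zero>\<^bsub>V\<^esub>"]
        W.M.add.l_cancel_one'[of "g \<zero>\<^bsub>V\<^esub>" "g \<zero>\<^bsub>V\<^esub>"] by simp
    then show ?case by simp
  next
    case (insert i I)
    have "g (\<Oplus>\<^bsub>V\<^esub>i\<in>insert i I. d i \<odot>\<^bsub>V\<^esub> x i) = g (d i \<odot>\<^bsub>V\<^esub> x i \<oplus>\<^bsub>V\<^esub> (\<Oplus>\<^bsub>V\<^esub>i\<in>I. d i \<odot>\<^bsub>V\<^esub> x i))"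
      using insert x by (subst V.M.finsum_insert) (auto simp: subset_eq)
    also have "\<dots> = d i \<odot>\<^bsub>W\<^esub> w i \<oplus>\<^bsub>W\<^esub> g (\<Oplus>\<^bsub>V\<^esub>i\<in>I. d i \<odot>\<^bsub>V\<^esub> x i)"
      using insert x V.comb_closed[of I x d] by (subst gh(1)) (auto simp: gh(2)[of "x i" "x i"] subset_eq)
    finally show ?case
      using insert wc by (subst W.M.finsum_insert) (auto simp: subset_eq)
  qed
  have gs: "g (s y) = y" if "y \<in> carrier W" for y
    using g_comb[of "{..<k}" "\<lambda>i. c i y"] dual_basisD(5)[OF d(3) that] unfolding s_def by simp
  \<comment> \<open>The vector y - s(g(y)) lies in the kernel of g, which is the image of f, so f
    can be inverted on it.\<close>
  define p where "p y = the_inv_into (carrier U) f (y \<ominus>\<^bsub>V\<^esub> s (g y))" for y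
  have g_diff: "g (y \<ominus>\<^bsub>V\<^esub> s (g y)) = \<zero>\<^bsub>W\<^esub>" if "y \<in> carrier V" for y
  proof -
    have "g (y \<ominus>\<^bsub>V\<^esub> s (g y)) \<oplus>\<^bsub>W\<^esub> g (s (g y)) = g y"
      using that s_closed by (subst gh(1)[symmetric]) (auto simp: a_minus_def V.M.a_assoc V.M.l_neg)
    then have "g (y \<ominus>\<^bsub>V\<^esub> s (g y)) \<oplus>\<^bsub>W\<^esub> g y = g y"
      using gs[OF gh(3)[OF that that]] by simp
    then show ?thesis
      using gh(3)[OF that that] gh(3)[of "y \<ominus>\<^bsub>V\<^esub> s (g y)" y] that s_closed W.M.add.r_cancel_one by auto
  qed
  have p_closed: "p y \<in> carrier U" and fp: "f (p y) = y \<ominus>\<^bsub>V\<^esub> s (g y)" if "y \<in> carrier V" for y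
  proof -
    have "y \<ominus>\<^bsub>V\<^esub> s (g y) \<in> f ` carrier U" using ex g_diff that s_closed by auto
    then show "p y \<in> carrier U" "f (p y) = y \<ominus>\<^bsub>V\<^esub> s (g y)"
      unfolding p_def using the_inv_into_into[OF inj _ subset_refl] f_the_inv_into_f[OF inj] by blast+
  qed
  have split: "f (p y) \<oplus>\<^bsub>V\<^esub> s (g y) = y" if "y \<in> carrier V" for y
    using fp that s_closed by (simp add: a_minus_def V.M.a_assoc V.M.l_neg)
  have p_hom: "p \<in> lmod_hom CC V U"
  proof -
    have "p (y \<oplus>\<^bsub>V\<^esub> z) = p y \<oplus>\<^bsub>U\<^esub> p z" if yz: "y \<in> carrier V" "z \<in> carrier V" for y z
    proof (rule inj_onD[OF inj])
      have "f (p y \<oplus>\<^bsub>U\<^esub> p z) \<oplus>\<^bsub>V\<^esub> s (g (y \<oplus>\<^bsub>V\<^esub> z)) = (f (p y) \<oplus>\<^bsub>V\<^esub> s (g y)) \<oplus>\<^bsub>V\<^esub> (f (p z) \<oplus>\<^bsub>V\<^esub> s (g z))"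
        using yz p_closed s_closed by (simp add: fh(1) fc gc gh(1) s_add V.M.a_ac)
      also have "\<dots> = f (p (y \<oplus>\<^bsub>V\<^esub> z)) \<oplus>\<^bsub>V\<^esub> s (g (y \<oplus>\<^bsub>V\<^esub> z))"
        using split yz by simp
      finally show "f (p (y \<oplus>\<^bsub>V\<^esub> z)) = f (p y \<oplus>\<^bsub>U\<^esub> p z)"
        using yz p_closed fc s_closed by simp
    qed (use yz p_closed in auto)
    moreover have "p (\<alpha> \<odot>\<^bsub>V\<^esub> y) = \<alpha> \<odot>\<^bsub>U\<^esub> p y" if y: "y \<in> carrier V" for y \<alpha>
    proof (rule inj_onD[OF inj])
      have "f (\<alpha> \<odot>\<^bsub>U\<^esub> p y) \<oplus>\<^bsub>V\<^esub> s (g (\<alpha> \<odot>\<^bsub>V\<^esub> y)) = \<alpha> \<odot>\<^bsub>V\<^esub> (f (p y) \<oplus>\<^bsub>V\<^esub> s (g y))"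
        using y p_closed s_closed by (simp add: f_smult fc gc g_smult s_smult V.smult_r_distr)
      also have "\<dots> = f (p (\<alpha> \<odot>\<^bsub>V\<^esub> y)) \<oplus>\<^bsub>V\<^esub> s (g (\<alpha> \<odot>\<^bsub>V\<^esub> y))"
        using split y by simp
      finally show "f (p (\<alpha> \<odot>\<^bsub>V\<^esub> y)) = f (\<alpha> \<odot>\<^bsub>U\<^esub> p y)"
        using y p_closed fc s_closed by simp
    qed (use y p_closed in auto)
    ultimately show ?thesis using p_closed by (auto simp: lmod_hom_def hom_def)
  qed
  have pf: "p (f y) = y" if y: "y \<in> carrier U" for y
  proof (rule inj_onD[OF inj])
    have "g (f y) = \<zero>\<^bsub>W\<^esub>" using ex y by blast
    moreover have "s \<zero>\<^bsub>W\<^esub> = \<zero>\<^bsub>V\<^esub>"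
      using s_add[of "\<zero>\<^bsub>W\<^esub>" "\<zero>\<^bsub>W\<^esub>"] s_closed[of "\<zero>\<^bsub>W\<^esub>"] V.M.add.r_cancel_one' by auto
    ultimately show "f (p (f y)) = f y" using split[of "f y"] y fc p_closed by simp
  qed (use y p_closed fc in auto)
  have vc: "v j \<in> carrier V" if "j < m" for j using d(2) that by (auto simp: dual_basis_def)
  have bform: "lin_form V (b j)" if "j < m" for j using d(2) that by (auto simp: dual_basis_def)
  have "of_nat m = (\<Sum>j<m. b j (v j))"
    using dual_basisD(4)[OF d(2)] by simp
  also have "\<dots> = (\<Sum>j<m. b j (f (p (v j)) \<oplus>\<^bsub>V\<^esub> s (g (v j))))"
    by (rule sum.cong) (simp_all add: split vc)
  also have "\<dots> = (\<Sum>j<m. b j (f (p (v j)))) + (\<Sum>j<m. b j (s (g (v j))))"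
    unfolding sum.distrib[symmetric]
    by (rule sum.cong) (use bform vc p_closed s_closed fc in \<open>auto simp: lin_form_def\<close>)
  also have "(\<Sum>j<m. b j (f (p (v j)))) = (\<Sum>i<n. a i (p (f (u i))))"
    by (rule linear_trace[OF U V d(1,2) f p_hom])
  also have "\<dots> = of_nat n"
    using dual_basisD(2,4)[OF d(1)] pf by simp
  also have "(\<Sum>j<m. b j (s (g (v j)))) = (\<Sum>i<k. c i (g (s (w i))))"
    by (rule linear_trace[OF W V d(3,2) s_hom g])
  also have "\<dots> = of_nat k"
    using dual_basisD(4)[OF d(3)] gs wc by simp
  finally show ?thesis by (metis of_nat_add of_nat_eq_iff)
qed

subsection \<open>Modules over the generalized Weyl algebra as triples of operators\<close>

lemma free_alg_single_induct [case_names zero single add]: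
  fixes x :: free_alg
  assumes "P 0" "\<And>w c. P (Poly_Mapping.single w c)" "\<And>x y. P x \<Longrightarrow> P y \<Longrightarrow> P (x + y)"
  shows "P x"
proof (induction x rule: Poly_Mapping.update_induct)
  case const
  show ?case by fact
next
  case (update f k v)
  have "Poly_Mapping.update k v f = f + Poly_Mapping.single k v"
    using update(1)
    by (intro poly_mapping_eqI) (auto simp: lookup_update lookup_add lookup_single when_def in_keys_iff)
  then show ?case using assms update by metis
qed

lemma free_poly_sum:
  assumes "degree r \<le> n"
  shows "free_poly r = (\<Sum>i\<le>n. Poly_Mapping.single (Word (replicate i GenZ)) (coeff r i))"
  unfolding free_poly_def
  by (rule sum.mono_neutral_left) (use assms in \<open>auto simp: coeff_eq_0\<close>)

lemma free_poly_add: "free_poly (r + s) = free_poly r + free_poly s"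
proof -
  let ?n = "max (degree r) (degree s)"
  have "degree (r + s) \<le> ?n" by (rule degree_add_le_max)
  then show ?thesis
    by (simp add: free_poly_sum[of _ ?n] single_add sum.distrib)
qed

lemma free_poly_0 [simp]: "free_poly 0 = 0"
  by (simp add: free_poly_def)

lemma free_poly_const: "free_poly [:c:] = Poly_Mapping.single 0 c"
  by (simp add: free_poly_def zero_gwa_word_def)

lemma free_poly_1 [simp]: "free_poly 1 = 1"
  using free_poly_const[of 1] by (simp add: one_pCons)

lemma free_poly_pCons_0: "free_poly (pCons 0 r) = free_gen GenZ * free_poly r"
proof -
  have "free_poly (pCons 0 r) = (\<Sum>i\<le>Suc (degree r). Poly_Mapping.single (Word (replicate i GenZ)) (coeff (pCons 0 r) i))"
    by (rule free_poly_sum) (simp add: degree_pCons_le)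
  also have "\<dots> = (\<Sum>i\<le>degree r. Poly_Mapping.single (Word (replicate (Suc i) GenZ)) (coeff r i))"
    by (subst sum.atMost_Suc_shift) simp
  also have "\<dots> = free_gen GenZ * free_poly r"
    unfolding free_poly_def free_gen_def sum_distrib_left by (simp add: mult_single)
  finally show ?thesis .
qed

lemma free_poly_GenZ: "free_poly [:0, 1:] = free_gen GenZ"
  using free_poly_pCons_0[of 1] by (simp add: one_pCons[symmetric])

lemma free_poly_smult: "free_poly (Polynomial.smult c r) = Poly_Mapping.single 0 c * free_poly r"
  unfolding free_poly_sum[OF degree_smult_le[of c r]] free_poly_def[of r] sum_distrib_left
  by (simp add: mult_single)

lemma free_poly_pCons: "free_poly (pCons c r) = Poly_Mapping.single 0 c + free_gen GenZ * free_poly r"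
proof -
  have "pCons c r = [:c:] + pCons 0 r" by simp
  then show ?thesis using free_poly_add free_poly_const free_poly_pCons_0 by metis
qed

lemma free_poly_mult: "free_poly (r * s) = free_poly r * free_poly s"
proof (induction r)
  case 0
  then show ?case by simp
next
  case (pCons c r)
  then show ?case
    by (simp add: mult_pCons_left free_poly_add free_poly_smult free_poly_pCons_0 free_poly_pCons
      algebra_simps)
qed

text \<open>An A(t)-module without the algebra: a \<complex>[z]-action \<open>sc\<close> and
  operators P, Q for X+ and X- satisfying the defining relations. The underlying structure is any
  additive group, so that function spaces and tensor groups qualify before a module record has been
  built on them.\<close>

locale gwa_rep = abelian_group M for M :: "('v, 'm) ring_scheme" (structure) +
  fixes t :: "complex poly" and sc :: "complex poly \<Rightarrow> 'v \<Rightarrow> 'v" and P Q :: "'v \<Rightarrow> 'v"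
  assumes sc_closed [simp, intro]: "v \<in> carrier M \<Longrightarrow> sc r v \<in> carrier M"
    and sc_radd: "v \<in> carrier M \<Longrightarrow> w \<in> carrier M \<Longrightarrow> sc r (v \<oplus> w) = sc r v \<oplus> sc r w"
    and sc_ladd: "v \<in> carrier M \<Longrightarrow> sc (r + s) v = sc r v \<oplus> sc s v"
    and sc_mult: "v \<in> carrier M \<Longrightarrow> sc (r * s) v = sc r (sc s v)"
    and sc_one [simp]: "v \<in> carrier M \<Longrightarrow> sc 1 v = v"
    and P_closed [simp, intro]: "v \<in> carrier M \<Longrightarrow> P v \<in> carrier M"
    and P_add: "v \<in> carrier M \<Longrightarrow> w \<in> carrier M \<Longrightarrow> P (v \<oplus> w) = P v \<oplus> P w"
    and P_sc: "v \<in> carrier M \<Longrightarrow> P (sc r v) = sc (shift 1 r) (P v)"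
    and Q_closed [simp, intro]: "v \<in> carrier M \<Longrightarrow> Q v \<in> carrier M"
    and Q_add: "v \<in> carrier M \<Longrightarrow> w \<in> carrier M \<Longrightarrow> Q (v \<oplus> w) = Q v \<oplus> Q w"
    and Q_sc: "v \<in> carrier M \<Longrightarrow> Q (sc r v) = sc (shift (-1) r) (Q v)"
    and PQ: "v \<in> carrier M \<Longrightarrow> P (Q v) = sc (shift (1/2) t) v"
    and QP: "v \<in> carrier M \<Longrightarrow> Q (P v) = sc (shift (-1/2) t) v"

section \<open>The quotient algebra A(t) and homomorphisms of its modules\<close>

lemma gwa_ideal: "ideal (gwa_ideal t) class_ring"
  by (rule ring.genideal_ideal[OF class_ring_ring]) simp

lemma gwa_ring: "ring (GWA t)"
  unfolding GWA_def by (rule ideal.quotient_is_ring[OF gwa_ideal])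

definition gwa_proj :: "complex poly \<Rightarrow> free_alg \<Rightarrow> free_alg set" where
  "gwa_proj t x = gwa_ideal t +>\<^bsub>class_ring\<^esub> x"

lemma gwa_proj_hom: "gwa_proj t \<in> ring_hom class_ring (GWA t)"
  using ideal.rcos_ring_hom[OF gwa_ideal, of t] unfolding GWA_def gwa_proj_def by simp

lemma gwa_proj_simps:
  "gwa_proj t x \<in> carrier (GWA t)"
  "gwa_proj t (x + y) = gwa_proj t x \<oplus>\<^bsub>GWA t\<^esub> gwa_proj t y"
  "gwa_proj t (x * y) = gwa_proj t x \<otimes>\<^bsub>GWA t\<^esub> gwa_proj t y"
  "gwa_proj t 1 = \<one>\<^bsub>GWA t\<^esub>"
  using ring_hom_closed[OF gwa_proj_hom] ring_hom_add[OF gwa_proj_hom] ring_hom_mult[OF gwa_proj_hom]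
    ring_hom_one[OF gwa_proj_hom] by fastforce+

lemma gwa_carrier: "carrier (GWA t) = range (gwa_proj t)"
  by (auto simp: GWA_def FactRing_def A_RCOSETS_def' gwa_proj_def)

lemma gwa_proj_eq_iff: "gwa_proj t x = gwa_proj t y \<longleftrightarrow> x - y \<in> gwa_ideal t"
  using ring.quotient_eq_iff_same_a_r_cos[OF class_ring_ring gwa_ideal, of x y t]
  by (simp add: gwa_proj_def)

lemma gwa_proj_alt: "gwa_proj t x = {y. y - x \<in> gwa_ideal t}"
  by (force simp: gwa_proj_def a_r_coset_def')

lemma gwa_proj_mem: "x \<in> gwa_proj t x"
  using ideal.axioms(1)[OF gwa_ideal[of t]] additive_subgroup.zero_closed
  by (force simp: gwa_proj_alt)

lemma gwa_proj_memD: "y \<in> gwa_proj t x \<Longrightarrow> gwa_proj t y = gwa_proj t x"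
  unfolding gwa_proj_eq_iff by (simp add: gwa_proj_alt)

lemma gwa_poly_proj: "gwa_poly t r = gwa_proj t (free_poly r)"
  by (simp add: gwa_poly_def gwa_proj_def)

lemma gwa_gen_proj: "gwa_gen t g = gwa_proj t (free_gen g)"
  by (simp add: gwa_gen_def gwa_proj_def)

lemma gwa_poly_simps:
  "gwa_poly t r \<in> carrier (GWA t)" "gwa_gen t g \<in> carrier (GWA t)"
  "gwa_poly t (r + s) = gwa_poly t r \<oplus>\<^bsub>GWA t\<^esub> gwa_poly t s"
  "gwa_poly t (r * s) = gwa_poly t r \<otimes>\<^bsub>GWA t\<^esub> gwa_poly t s"
  "gwa_poly t 1 = \<one>\<^bsub>GWA t\<^esub>"
  by (simp_all add: gwa_poly_proj gwa_gen_proj gwa_proj_simps free_poly_add free_poly_mult)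

lemma gwa_relator_eq: "x - y \<in> gwa_relators t \<Longrightarrow> gwa_proj t x = gwa_proj t y"
  unfolding gwa_proj_eq_iff
  using ring.genideal_self[OF class_ring_ring, of "gwa_relators t"] by auto

lemma gwa_relations:
  "gwa_gen t GenXp \<otimes>\<^bsub>GWA t\<^esub> gwa_poly t r = gwa_poly t (shift 1 r) \<otimes>\<^bsub>GWA t\<^esub> gwa_gen t GenXp"
  "gwa_gen t GenXm \<otimes>\<^bsub>GWA t\<^esub> gwa_poly t r = gwa_poly t (shift (-1) r) \<otimes>\<^bsub>GWA t\<^esub> gwa_gen t GenXm"
  "gwa_gen t GenXp \<otimes>\<^bsub>GWA t\<^esub> gwa_gen t GenXm = gwa_poly t (shift (1/2) t)"
  "gwa_gen t GenXm \<otimes>\<^bsub>GWA t\<^esub> gwa_gen t GenXp = gwa_poly t (shift (-1/2) t)"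
  unfolding gwa_poly_proj gwa_gen_proj gwa_proj_simps(3)[symmetric]
  by (rule gwa_relator_eq, force simp: gwa_relators_def)+

abbreviation mod_sc :: "complex poly \<Rightarrow> (free_alg set, 'v) module \<Rightarrow> complex poly \<Rightarrow> 'v \<Rightarrow> 'v" where
  "mod_sc t M r v \<equiv> gwa_poly t r \<odot>\<^bsub>M\<^esub> v"

abbreviation mod_gen :: "complex poly \<Rightarrow> (free_alg set, 'v) module \<Rightarrow> gwa_gen \<Rightarrow> 'v \<Rightarrow> 'v" where
  "mod_gen t M g v \<equiv> gwa_gen t g \<odot>\<^bsub>M\<^esub> v"

lemma gwa_rep_of_module:
  assumes "left_module (GWA t) M"
  shows "gwa_rep M t (mod_sc t M) (mod_gen t M GenXp) (mod_gen t M GenXm)"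
proof -
  interpret left_module "GWA t" M by fact
  note s = gwa_poly_simps smult_closed smult_l_distr smult_r_distr smult_assoc1 smult_one
  note a = smult_assoc1[OF gwa_poly_simps(2,1), symmetric] smult_assoc1[OF gwa_poly_simps(2,2), symmetric]
  show ?thesis
    by unfold_locales (simp_all add: s, simp_all add: a gwa_relations, simp_all add: s)
qed

text \<open>Every element of A(t) is the class of a linear combination of words in the generators,
  so compatibility with polynomials and with X+, X- spreads to the whole algebra by induction on
  words.\<close>

lemma gwa_hom_iff:
  assumes M: "left_module (GWA t) M" and N: "left_module (GWA t) N"
    and f: "f \<in> hom (add_monoid M) (add_monoid N)"
    and sc: "\<And>r v. v \<in> carrier M \<Longrightarrow> f (mod_sc t M r v) = mod_sc t N r (f v)"
    and gen: "\<And>g v. v \<in> carrier M \<Longrightarrow> g \<in> {GenXp, GenXm} \<Longrightarrow> f (mod_gen t M g v) = mod_gen t N g (f v)"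
  shows "f \<in> lmod_hom (GWA t) M N"
proof -
  interpret M: left_module "GWA t" M by (rule M)
  interpret N: left_module "GWA t" N by (rule N)
  have fc: "f v \<in> carrier N" if "v \<in> carrier M" for v using f that by (auto simp: hom_def)
  have fa: "f (v \<oplus>\<^bsub>M\<^esub> w) = f v \<oplus>\<^bsub>N\<^esub> f w" if "v \<in> carrier M" "w \<in> carrier M" for v w
    using f that by (auto simp: hom_def)
  \<comment> \<open>The third generator z is covered by the polynomial hypothesis, as the class of
    \<open>free_gen GenZ\<close> is that of the polynomial z.\<close>
  have gen': "f (mod_gen t M g v) = mod_gen t N g (f v)" if "v \<in> carrier M" for g v
    using gen[of v g] sc[of v "[:0, 1:]"] that
    by (cases g) (auto simp: gwa_poly_proj gwa_gen_proj free_poly_GenZ)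
  have word: "\<forall>v\<in>carrier M. f (gwa_proj t (Poly_Mapping.single (Word l) c) \<odot>\<^bsub>M\<^esub> v) =
      gwa_proj t (Poly_Mapping.single (Word l) c) \<odot>\<^bsub>N\<^esub> f v" for l c
  proof (induction l)
    case Nil
    then show ?case
      using sc[of _ "[:c:]"] by (simp add: gwa_poly_proj free_poly_const zero_gwa_word_def)
  next
    case (Cons g l)
    have "Poly_Mapping.single (Word (g # l)) c = free_gen g * Poly_Mapping.single (Word l) c"
      by (simp add: free_gen_def mult_single)
    then have "gwa_proj t (Poly_Mapping.single (Word (g # l)) c) =
        gwa_gen t g \<otimes>\<^bsub>GWA t\<^esub> gwa_proj t (Poly_Mapping.single (Word l) c)"
      by (simp add: gwa_proj_simps gwa_gen_proj)
    then show ?case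
      using Cons.IH
      by (simp add: M.smult_assoc1 N.smult_assoc1 gwa_poly_simps gwa_proj_simps M.smult_closed gen' fc)
  qed
  have all: "\<forall>v\<in>carrier M. f (gwa_proj t x \<odot>\<^bsub>M\<^esub> v) = gwa_proj t x \<odot>\<^bsub>N\<^esub> f v" for x
  proof (induction x rule: free_alg_single_induct)
    case zero
    then show ?case using word[of "[]" 0] by simp
  next
    case (single w c)
    then show ?case using word by (cases w) simp
  next
    case (add x y)
    then show ?case
      by (simp add: gwa_proj_simps M.smult_l_distr N.smult_l_distr M.smult_closed fa fc)
  qed
  then show ?thesis using f by (auto simp: lmod_hom_def gwa_carrier)
qed

section \<open>From operators back to a module over the quotient algebra\<close>

context gwa_rep
begin

lemma sc_zero [simp]: "sc r \<zero> = \<zero>"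
  using sc_radd[of \<zero> \<zero> r] add.r_cancel_one'[of "sc r \<zero>" "sc r \<zero>"] by simp

lemma P_zero [simp]: "P \<zero> = \<zero>"
  using P_add[of \<zero> \<zero>] add.r_cancel_one'[of "P \<zero>" "P \<zero>"] by simp

lemma Q_zero [simp]: "Q \<zero> = \<zero>"
  using Q_add[of \<zero> \<zero>] add.r_cancel_one'[of "Q \<zero>" "Q \<zero>"] by simp

lemma sc_0 [simp]: "v \<in> carrier M \<Longrightarrow> sc 0 v = \<zero>"
  using sc_ladd[of v 0 0] add.r_cancel_one'[of "sc 0 v" "sc 0 v"] by simp

lemma sc_commute: "v \<in> carrier M \<Longrightarrow> sc r (sc s v) = sc s (sc r v)"
  by (simp add: sc_mult[symmetric] mult.commute)

fun gen_act :: "gwa_gen \<Rightarrow> 'v \<Rightarrow> 'v" where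
  "gen_act GenZ = sc [:0, 1:]"
| "gen_act GenXp = P"
| "gen_act GenXm = Q"

fun word_act :: "gwa_word \<Rightarrow> 'v \<Rightarrow> 'v" where
  "word_act (Word l) = foldr gen_act l"

lemma gen_act_closed [simp]: "v \<in> carrier M \<Longrightarrow> gen_act g v \<in> carrier M"
  by (cases g) auto

lemma foldr_gen_act_closed: "v \<in> carrier M \<Longrightarrow> foldr gen_act l v \<in> carrier M"
  by (induction l) auto

lemma word_act_closed [simp]: "v \<in> carrier M \<Longrightarrow> word_act w v \<in> carrier M"
  by (cases w) (simp add: foldr_gen_act_closed)

lemma gen_act_add: "v \<in> carrier M \<Longrightarrow> w \<in> carrier M \<Longrightarrow> gen_act g (v \<oplus> w) = gen_act g v \<oplus> gen_act g w"
  by (cases g) (auto simp: sc_radd P_add Q_add)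

lemma word_act_add:
  assumes "v \<in> carrier M" "w \<in> carrier M" shows "word_act u (v \<oplus> w) = word_act u v \<oplus> word_act u w"
proof (cases u)
  case (Word l)
  have "foldr gen_act l (v \<oplus> w) = foldr gen_act l v \<oplus> foldr gen_act l w"
    using assms by (induction l) (auto simp: gen_act_add foldr_gen_act_closed)
  then show ?thesis using Word by simp
qed

lemma word_act_mult: "word_act (u + w) v = word_act u (word_act w v)"
  by (cases u; cases w) simp

lemma gen_act_const: "v \<in> carrier M \<Longrightarrow> gen_act g (sc [:c:] v) = sc [:c:] (gen_act g v)"
  by (cases g) (auto simp: sc_commute[of _ "[:c:]"] P_sc Q_sc shift_def pcompose_const)

lemma word_act_const:
  assumes "v \<in> carrier M" shows "word_act u (sc [:c:] v) = sc [:c:] (word_act u v)"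
proof (cases u)
  case (Word l)
  have "foldr gen_act l (sc [:c:] v) = sc [:c:] (foldr gen_act l v)"
    using assms by (induction l) (auto simp: gen_act_const foldr_gen_act_closed)
  then show ?thesis using Word by simp
qed

definition act :: "free_alg \<Rightarrow> 'v \<Rightarrow> 'v" where
  "act x v = (\<Oplus>w\<in>Poly_Mapping.keys x. sc [:poly_mapping.lookup x w:] (word_act w v))"

lemma act_closed [simp]: "v \<in> carrier M \<Longrightarrow> act x v \<in> carrier M"
  unfolding act_def by (rule finsum_closed) auto

lemma act_superset:
  assumes "finite A" "Poly_Mapping.keys x \<subseteq> A" "v \<in> carrier M"
  shows "act x v = (\<Oplus>w\<in>A. sc [:poly_mapping.lookup x w:] (word_act w v))"
  unfolding act_def
  by (rule add.finprod_mono_neutral_cong_left) (use assms in \<open>auto simp: in_keys_iff\<close>)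

lemma act_add:
  assumes "v \<in> carrier M" shows "act (x + y) v = act x v \<oplus> act y v"
proof -
  let ?A = "Poly_Mapping.keys x \<union> Poly_Mapping.keys y"
  have sub: "Poly_Mapping.keys (x + y) \<subseteq> ?A" by (rule keys_add)
  have "act (x + y) v = (\<Oplus>w\<in>?A. sc [:poly_mapping.lookup x w:] (word_act w v) \<oplus> sc [:poly_mapping.lookup y w:] (word_act w v))"
    using assms
    by (subst act_superset[OF _ sub]) (auto simp: lookup_add sc_ladd[symmetric] intro!: finsum_cong')
  also have "\<dots> = act x v \<oplus> act y v"
    using assms act_superset[of ?A x v] act_superset[of ?A y v]
    by (subst finsum_addf) auto
  finally show ?thesis .
qed

lemma act_single: "v \<in> carrier M \<Longrightarrow> act (Poly_Mapping.single w c) v = sc [:c:] (word_act w v)"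
  by (subst act_superset[of "{w}"]) auto

lemma act_zero [simp]: "act 0 v = \<zero>"
  by (simp add: act_def)

lemma act_radd:
  assumes "v \<in> carrier M" "w \<in> carrier M" shows "act x (v \<oplus> w) = act x v \<oplus> act x w"
  by (induction x rule: free_alg_single_induct)
    (use assms in \<open>auto simp: act_single act_add word_act_add sc_radd a_ac\<close>)

lemma act_right_zero: "act x \<zero> = \<zero>"
  using act_radd[of \<zero> \<zero> x] add.r_cancel_one'[of "act x \<zero>" "act x \<zero>"] by simp

lemma act_mult:
  assumes "v \<in> carrier M" shows "act (x * y) v = act x (act y v)"
proof (induction x rule: free_alg_single_induct)
  case zero
  then show ?case by simp
next
  case (single w c)
  show ?case
  proof (induction y rule: free_alg_single_induct)
    case zero
    show ?case by (simp add: act_right_zero)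
  next
    case (single u d)
    show ?case
      using assms by (simp add: mult_single act_single word_act_mult word_act_const sc_mult[symmetric] mult.commute)
  next
    case (add y z)
    then show ?case using assms by (simp add: act_add act_radd ring_distribs)
  qed
next
  case (add x z)
  then show ?case using assms by (simp add: act_add ring_distribs)
qed

lemma act_gen: "v \<in> carrier M \<Longrightarrow> act (free_gen g) v = gen_act g v"
  using sc_one[of "gen_act g v"] by (simp add: free_gen_def act_single one_pCons[symmetric])

lemma act_poly:
  assumes "v \<in> carrier M" shows "act (free_poly r) v = sc r v"
proof (induction r)
  case 0
  then show ?case using assms by simp
next
  case (pCons c r)
  have "act (free_poly (pCons c r)) v = sc [:c:] v \<oplus> sc [:0, 1:] (sc r v)"
    using assms pCons
    by (simp add: free_poly_pCons act_add act_mult act_gen act_single zero_gwa_word_def)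
  also have "\<dots> = sc ([:c:] + [:0, 1:] * r) v" using assms by (simp only: sc_ladd sc_mult sc_closed)
  finally show ?case by simp
qed

lemma act_minus: "v \<in> carrier M \<Longrightarrow> act (x - y) v = act x v \<ominus> act y v"
  using act_add[of v "x - y" y] by (simp add: add.inv_solve_right a_minus_def)

text \<open>The elements of the free algebra acting by zero form a two-sided ideal. It contains the
  relators, hence the ideal generated by them.\<close>

lemma act_ideal:
  assumes "x \<in> gwa_ideal t" "v \<in> carrier M"
  shows "act x v = \<zero>"
proof -
  let ?K = "{x. \<forall>v\<in>carrier M. act x v = \<zero>}"
  have "ideal ?K class_ring"
  proof (rule idealI[OF class_ring_ring])
    show "subgroup ?K (add_monoid class_ring)"
    proof (rule group.subgroupI)
      show "group (add_monoid (class_ring :: free_alg ring))"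
        using abelian_group.a_group[OF ring.is_abelian_group[OF class_ring_ring]] .
      show "inv\<^bsub>add_monoid class_ring\<^esub> x \<in> ?K" if "x \<in> ?K" for x :: free_alg
        using that act_minus[of _ 0 x] class_ring_a_inv[of x] by (auto simp: a_inv_def a_minus_def)
    qed (auto simp: act_add intro: exI[of _ 0])
    show "a \<otimes>\<^bsub>class_ring\<^esub> x \<in> ?K" if "a \<in> ?K" "x \<in> carrier class_ring" for a x
      using that by (auto simp: act_mult)
    show "x \<otimes>\<^bsub>class_ring\<^esub> a \<in> ?K" if "a \<in> ?K" "x \<in> carrier class_ring" for a x
      using that by (auto simp: act_mult act_right_zero)
  qed
  moreover have "gwa_relators t \<subseteq> ?K"
    by (auto simp: gwa_relators_def act_minus act_mult act_gen act_poly P_sc Q_sc PQ QP a_minus_def r_neg)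
  ultimately have "gwa_ideal t \<subseteq> ?K" by (rule ring.genideal_minimal[OF class_ring_ring])
  then show ?thesis using assms by blast
qed

text \<open>A coset acts through an arbitrary representative; \<open>act_ideal\<close> makes the
  choice irrelevant. This is the inverse construction to \<open>gwa_rep_of_module\<close>.\<close>

definition to_module :: "(free_alg set, 'v) module" where
  "to_module = \<lparr>carrier = carrier M, monoid.mult = undefined, monoid.one = undefined,
     ring.zero = \<zero>, ring.add = (\<oplus>), module.smult = (\<lambda>X v. act (SOME x. x \<in> X) v)\<rparr>"

lemma to_module_simps [simp]:
  "carrier to_module = carrier M" "\<zero>\<^bsub>to_module\<^esub> = \<zero>" "v \<oplus>\<^bsub>to_module\<^esub> w = v \<oplus> w"
  by (simp_all add: to_module_def)

lemma to_module_proj: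
  assumes "v \<in> carrier M" shows "gwa_proj t x \<odot>\<^bsub>to_module\<^esub> v = act x v"
proof -
  let ?y = "SOME y. y \<in> gwa_proj t x"
  have "?y \<in> gwa_proj t x" using gwa_proj_mem by (rule someI)
  then have "?y - x \<in> gwa_ideal t" using gwa_proj_eq_iff gwa_proj_memD by blast
  then have "act (?y - x) v = \<zero>" using assms by (rule act_ideal)
  then have "act ((?y - x) + x) v = act x v" using assms by (subst act_add) auto
  then show ?thesis by (simp add: to_module_def)
qed

lemma to_module_sc [simp]: "v \<in> carrier M \<Longrightarrow> gwa_poly t r \<odot>\<^bsub>to_module\<^esub> v = sc r v"
  by (simp add: gwa_poly_proj to_module_proj act_poly)

lemma to_module_gen [simp]:
  "v \<in> carrier M \<Longrightarrow> gwa_gen t GenXp \<odot>\<^bsub>to_module\<^esub> v = P v"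
  "v \<in> carrier M \<Longrightarrow> gwa_gen t GenXm \<odot>\<^bsub>to_module\<^esub> v = Q v"
  by (simp_all add: gwa_gen_proj to_module_proj act_gen)

lemma to_module: "left_module (GWA t) to_module"
proof -
  interpret R: ring "GWA t" by (rule gwa_ring)
  have "abelian_group to_module"
    by (rule abelian_groupI) (auto simp: a_ac intro: exI[of _ "\<ominus> _"] l_neg)
  then interpret A: abelian_group to_module .
  show ?thesis
  proof (unfold_locales, goal_cases)
    case (4 a b x)
    then show ?case
      by (auto simp: gwa_carrier gwa_proj_simps(3)[symmetric] to_module_proj act_mult)
  next
    case (5 x)
    then show ?case using to_module_proj[of x 1] act_poly[of x 1] by (simp add: gwa_proj_simps(4))
  qed (auto simp: gwa_carrier gwa_proj_simps(2)[symmetric] to_module_proj act_add act_radd)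
qed

end

subsection \<open>Weight decompositions\<close>

definition pann :: "int set \<Rightarrow> complex poly" where
  "pann F = (\<Prod>j\<in>F. [:- of_int j, 1:])"

text \<open>The Lagrange interpolation polynomial of the node k. For k in F it is 1 at k and 0 at
  the other points of F. For k outside F it vanishes on all of F, so the same formula yields the
  zero component at weights that do not occur.\<close>

definition lagrange :: "int set \<Rightarrow> int \<Rightarrow> complex poly" where
  "lagrange F k = Polynomial.smult (inverse (poly (pann (F - {k})) (of_int k))) (pann (F - {k}))"

lemma poly_pann: "poly (pann F) x = (\<Prod>j\<in>F. x - of_int j)"
  by (simp add: pann_def poly_prod)

lemma pann_dvd:
  assumes "finite F" "\<And>j. j \<in> F \<Longrightarrow> poly r (of_int j) = 0"
  shows "pann F dvd r"
  using assms
proof (induction F arbitrary: r rule: finite_induct)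
  case empty
  then show ?case by (simp add: pann_def)
next
  case (insert j F)
  then obtain s where s: "r = [:- of_int j, 1:] * s"
    by (metis dvdE insertCI poly_eq_0_iff_dvd)
  have "poly s (of_int i) = 0" if "i \<in> F" for i
  proof -
    have "(of_int i - of_int j) * poly s (of_int i) = (0 :: complex)"
      using insert.prems[of i] that by (simp add: s algebra_simps)
    moreover have "i \<noteq> j" using that insert.hyps by auto
    ultimately show ?thesis by simp
  qed
  then have "pann F dvd s" by (rule insert.IH)
  then show ?case
    unfolding pann_def s by (subst prod.insert[OF insert.hyps]) (rule mult_dvd_mono, simp_all)
qed

lemma poly_lagrange:
  assumes "finite F" "j \<in> F \<or> j = k"
  shows "poly (lagrange F k) (of_int j) = (if j = k then 1 else 0)"
proof -
  have "poly (pann (F - {k})) (of_int k) \<noteq> 0" using assms by (auto simp: poly_pann)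
  moreover have "poly (pann (F - {k})) (of_int j) = 0" if "j \<noteq> k"
    using assms that by (auto simp: poly_pann intro!: prod_zero bexI[of _ j])
  ultimately show ?thesis by (auto simp: lagrange_def)
qed

text \<open>The weight space at (z - k) as a complex vector space, with scalars acting as constant
  polynomials.\<close>

definition wspace :: "('v, 'm) ring_scheme \<Rightarrow> (complex poly \<Rightarrow> 'v \<Rightarrow> 'v) \<Rightarrow> int \<Rightarrow> (complex, 'v) module" where
  "wspace M sc k = \<lparr>carrier = {v \<in> carrier M. sc [:- of_int k, 1:] v = \<zero>\<^bsub>M\<^esub>},
     monoid.mult = undefined, monoid.one = undefined, ring.zero = \<zero>\<^bsub>M\<^esub>, ring.add = (\<oplus>\<^bsub>M\<^esub>),
     module.smult = (\<lambda>c v. sc [:c:] v)\<rparr>"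

lemma wspace_simps [simp]:
  "\<zero>\<^bsub>wspace M sc k\<^esub> = \<zero>\<^bsub>M\<^esub>" "v \<oplus>\<^bsub>wspace M sc k\<^esub> w = v \<oplus>\<^bsub>M\<^esub> w" "c \<odot>\<^bsub>wspace M sc k\<^esub> v = sc [:c:] v"
  by (simp_all add: wspace_def)

context gwa_rep
begin

abbreviation W :: "int \<Rightarrow> 'v set" where "W k \<equiv> carrier (wspace M sc k)"

lemma W_iff: "v \<in> W k \<longleftrightarrow> v \<in> carrier M \<and> sc [:- of_int k, 1:] v = \<zero>"
  by (simp add: wspace_def)

lemma W_carrier [simp, dest]: "v \<in> W k \<Longrightarrow> v \<in> carrier M"
  by (simp add: W_iff)

lemma sc_uminus: "v \<in> carrier M \<Longrightarrow> sc r (\<ominus> v) = \<ominus> sc r v"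
  using sc_radd[of "\<ominus> v" v r] minus_equality[of "sc r (\<ominus> v)" "sc r v"] by (simp add: l_neg)

text \<open>The difference r - s vanishes on F, so it is divisible by \<open>pann F\<close>, which
  kills v. On such a vector a polynomial thus acts through its values on F only; all statements
  about components rest on this.\<close>

lemma sc_agree:
  assumes v: "v \<in> carrier M" and F: "finite F" "sc (pann F) v = \<zero>"
    and eq: "\<And>j. j \<in> F \<Longrightarrow> poly r (of_int j) = poly s (of_int j)"
  shows "sc r v = sc s v"
proof -
  obtain q where q: "r - s = pann F * q"
    using pann_dvd[OF F(1), of "r - s"] eq by (auto elim: dvdE)
  have "sc (r - s) v = \<zero>" unfolding q by (simp add: mult.commute[of _ q] sc_mult v F)
  then have "sc ((r - s) + s) v = sc s v" using v by (subst sc_ladd) auto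
  then show ?thesis by simp
qed

lemma pann_W: "v \<in> W k \<Longrightarrow> sc (pann {k}) v = \<zero>"
  by (simp add: W_iff pann_def)

lemma sc_W: "v \<in> W k \<Longrightarrow> sc r v = sc [:poly r (of_int k):] v"
  by (rule sc_agree[of v "{k}"]) (auto simp: pann_W)

lemma pann_mono:
  assumes "v \<in> carrier M" "finite G" "F \<subseteq> G" "sc (pann F) v = \<zero>"
  shows "sc (pann G) v = \<zero>"
proof -
  have "pann G = pann (G - F) * pann F"
    using assms by (simp add: pann_def prod.subset_diff)
  then show ?thesis using assms by (simp add: sc_mult)
qed

lemma cspace_wspace: "cspace (wspace M sc k)"
proof -
  have cl: "sc [:c:] v \<in> W k" if "v \<in> W k" for c v
    using that by (auto simp: W_iff sc_commute[of _ _ "[:c:]"])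
  have ab: "abelian_group (wspace M sc k)"
  proof (rule abelian_groupI)
    show "\<exists>y\<in>W k. y \<oplus>\<^bsub>wspace M sc k\<^esub> x = \<zero>\<^bsub>wspace M sc k\<^esub>" if "x \<in> W k" for x
      using that by (intro bexI[of _ "\<ominus> x"]) (auto simp: W_iff sc_uminus l_neg)
  qed (auto simp: W_iff sc_radd a_ac)
  have "module CC (wspace M sc k)"
  proof (rule moduleI[OF class_ring_cring ab], goal_cases)
    case (2 a b x)
    have "[:a + b:] = [:a:] + [:b:]" by simp
    then show ?case using 2 by (simp only: class_ring_simps wspace_simps sc_ladd W_carrier)
  next
    case (4 a b x)
    have "[:a * b:] = [:a:] * [:b:]" by simp
    then show ?case using 4 by (simp only: class_ring_simps wspace_simps sc_mult W_carrier)
  qed (auto simp: cl sc_radd one_pCons[symmetric])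
  then show ?thesis by (rule cspace.intro)
qed

lemma W_closed [simp, intro]:
  "\<zero> \<in> W k" "v \<in> W k \<Longrightarrow> w \<in> W k \<Longrightarrow> v \<oplus> w \<in> W k" "v \<in> W k \<Longrightarrow> sc r v \<in> W k"
  by (auto simp: W_iff sc_radd sc_commute[of _ _ r])

lemma finsum_wspace:
  assumes "f \<in> A \<rightarrow> W k"
  shows "finsum (wspace M sc k) f A = finsum M f A"
proof -
  interpret V: cspace "wspace M sc k" by (rule cspace_wspace)
  show ?thesis
    using assms
  proof (induction A rule: infinite_finite_induct)
    case (insert a A)
    then have "f \<in> A \<rightarrow> carrier M" "f a \<in> carrier M" by (auto simp: Pi_iff)
    with insert show ?case by (simp add: V.M.finsum_insert)
  qed simp_all
qed

lemma sc_sum: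
  assumes "v \<in> carrier M" shows "sc (\<Sum>i\<in>A. r i) v = (\<Oplus>i\<in>A. sc (r i) v)"
proof (induction A rule: infinite_finite_induct)
  case (insert a A)
  with assms show ?case by (simp add: sc_ladd)
qed (use assms in simp_all)

text \<open>\<open>shift 1\<close> turns z - k into z - (k + 1), so X+ raises weights by
  one.\<close>

lemma P_W: "v \<in> W k \<Longrightarrow> P v \<in> W (k + 1)"
  using P_sc[of v "[:- of_int k, 1:]"]
  by (auto simp: W_iff shift_def pcompose_pCons algebra_simps)

lemma Q_W: "v \<in> W k \<Longrightarrow> Q v \<in> W (k - 1)"
  using Q_sc[of v "[:- of_int k, 1:]"]
  by (auto simp: W_iff shift_def pcompose_pCons algebra_simps)

text \<open>The half shift evaluates t at the midpoint of the edge from k to k + 1. Going there and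
  back is multiplication by t(k + 1/2), so the roots of t are the edges along which the operators
  fail to be invertible.\<close>

lemma QP_W: "v \<in> W k \<Longrightarrow> Q (P v) = sc [:poly t (of_int k + 1/2):] v"
  using sc_W[of v k "shift (-1/2) t"] by (simp add: QP shift_def poly_pcompose add.commute)

lemma PQ_W: "v \<in> W k \<Longrightarrow> P (Q v) = sc [:poly t (of_int k - 1/2):] v"
  using sc_W[of v k "shift (1/2) t"] by (simp add: PQ shift_def poly_pcompose)

lemma P_const: "v \<in> carrier M \<Longrightarrow> P (sc [:c:] v) = sc [:c:] (P v)"
  by (simp add: P_sc shift_def pcompose_const)

lemma Q_const: "v \<in> carrier M \<Longrightarrow> Q (sc [:c:] v) = sc [:c:] (Q v)"
  by (simp add: Q_sc shift_def pcompose_const)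

lemma sc_const_eq_zero:
  assumes "v \<in> carrier M" "sc [:c:] v = \<zero>" "c \<noteq> 0" shows "v = \<zero>"
proof -
  have "v = sc ([:inverse c:] * [:c:]) v" using assms by (simp add: one_pCons[symmetric])
  also have "\<dots> = \<zero>" using assms by (simp only: sc_mult sc_zero)
  finally show ?thesis .
qed

end

text \<open>Being killed by a product of distinct factors z - j is, by interpolation, the same as
  being a finite sum of weight vectors with integral weights. In this elementwise form the property
  passes easily to images and tensor products.\<close>

locale gwa_local_rep = gwa_rep M t sc P Q
  for M :: "('v, 'm) ring_scheme" (structure) and t :: "complex poly"
    and sc :: "complex poly \<Rightarrow> 'v \<Rightarrow> 'v" and P Q :: "'v \<Rightarrow> 'v" +
  assumes annihilated: "v \<in> carrier M \<Longrightarrow> \<exists>F. finite F \<and> sc (pann F) v = \<zero>"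
begin

text \<open>The projection to weight k, given by an interpolation polynomial. It is therefore the
  action of an algebra element, which keeps every submodule stable.\<close>

definition comp :: "int \<Rightarrow> 'v \<Rightarrow> 'v" where
  "comp k v = sc (lagrange (SOME F. finite F \<and> sc (pann F) v = \<zero>) k) v"

text \<open>Two annihilating sets F and G are compared through their union: on each of the two sets
  its own interpolation polynomial agrees with that of the union.\<close>

lemma comp_eq:
  assumes v: "v \<in> carrier M" and F: "finite F" "sc (pann F) v = \<zero>"
  shows "comp k v = sc (lagrange F k) v"
proof -
  define G where "G = (SOME F. finite F \<and> sc (pann F) v = \<zero>)"
  have G: "finite G" "sc (pann G) v = \<zero>"
    using someI_ex[OF annihilated[OF v]] by (auto simp: G_def)
  have "sc (lagrange H k) v = sc (lagrange (F \<union> G) k) v"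
    if "finite H" "sc (pann H) v = \<zero>" "H \<subseteq> F \<union> G" for H
    by (rule sc_agree[OF v that(1,2)]) (use that F G in \<open>auto simp: poly_lagrange\<close>)
  from this[OF F] this[OF G] show ?thesis
    by (simp add: comp_def G_def)
qed

lemma comp_W [simp, intro]:
  assumes v: "v \<in> carrier M" shows "comp k v \<in> W k"
proof -
  obtain F where F: "finite F" "sc (pann F) v = \<zero>" using annihilated[OF v] by blast
  have "sc [:- of_int k, 1:] (sc (lagrange F k) v) = sc ([:- of_int k, 1:] * lagrange F k) v"
    by (simp only: sc_mult v)
  also have "\<dots> = sc 0 v"
    by (rule sc_agree[OF v F]) (use F in \<open>auto simp: poly_lagrange\<close>)
  finally show ?thesis using v by (simp add: W_iff comp_eq[OF v F])
qed

lemma comp_carrier [simp, intro]: "v \<in> carrier M \<Longrightarrow> comp k v \<in> carrier M"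
  using comp_W W_carrier by blast

lemma common_annihilator:
  assumes "v \<in> carrier M" "w \<in> carrier M"
  obtains F where "finite F" "sc (pann F) v = \<zero>" "sc (pann F) w = \<zero>"
proof -
  obtain F G where F: "finite F" "sc (pann F) v = \<zero>" and G: "finite G" "sc (pann G) w = \<zero>"
    using annihilated assms by meson
  show thesis
    by (rule that[of "F \<union> G"]) (use F G pann_mono[of v "F \<union> G" F] pann_mono[of w "F \<union> G" G] assms in auto)
qed

lemma comp_add:
  assumes "v \<in> carrier M" "w \<in> carrier M" shows "comp k (v \<oplus> w) = comp k v \<oplus> comp k w"
proof -
  obtain F where F: "finite F" "sc (pann F) v = \<zero>" "sc (pann F) w = \<zero>"
    using common_annihilator[OF assms] .
  then have "sc (pann F) (v \<oplus> w) = \<zero>" using assms by (simp add: sc_radd)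
  then show ?thesis using F assms comp_eq[of _ F] by (simp add: sc_radd)
qed

lemma comp_of_W:
  assumes "v \<in> W j" shows "comp k v = (if j = k then v else \<zero>)"
proof -
  have "comp k v = sc (lagrange {j} k) v"
    by (rule comp_eq) (use assms pann_W in auto)
  also have "\<dots> = sc [:if j = k then 1 else 0:] v"
    by (subst sc_W[OF assms]) (simp add: poly_lagrange)
  finally show ?thesis using assms by (auto simp: one_pCons[symmetric])
qed

text \<open>The interpolation polynomials for the nodes in F sum to 1 on F, so they act as a
  partition of unity.\<close>

lemma decomposition:
  assumes v: "v \<in> carrier M" and F: "finite F" "sc (pann F) v = \<zero>"
  shows "v = (\<Oplus>k\<in>F. comp k v)"
proof -
  have "sc (\<Sum>k\<in>F. lagrange F k) v = sc 1 v"
    by (rule sc_agree[OF v F]) (use F in \<open>auto simp: poly_sum poly_lagrange\<close>)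
  then show ?thesis using v by (simp add: sc_sum comp_eq[OF v F])
qed

lemma comp_notin:
  assumes v: "v \<in> carrier M" and F: "finite F" "sc (pann F) v = \<zero>" and "k \<notin> F"
  shows "comp k v = \<zero>"
proof -
  have "sc (lagrange F k) v = sc 0 v"
    by (rule sc_agree[OF v F]) (use assms in \<open>auto simp: poly_lagrange\<close>)
  then show ?thesis using v by (simp add: comp_eq[OF v F])
qed

lemma finite_comp_support:
  assumes "v \<in> carrier M" shows "finite {k. comp k v \<noteq> \<zero>}"
proof -
  obtain F where "finite F" "sc (pann F) v = \<zero>" using annihilated[OF assms] by blast
  then show ?thesis using comp_notin[OF assms] by (metis (mono_tags, lifting) finite_subset mem_Collect_eq subsetI)
qed

lemma comp_eqI:
  assumes "v \<in> carrier M" "w \<in> carrier M" "\<And>k. comp k v = comp k w"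
  shows "v = w"
proof -
  obtain F where F: "finite F" "sc (pann F) v = \<zero>" "sc (pann F) w = \<zero>"
    using common_annihilator[OF assms(1,2)] .
  show ?thesis
    using decomposition[OF assms(1) F(1,2)] decomposition[OF assms(2) F(1,3)] assms(3) by simp
qed

lemma comp_zero [simp]: "comp k \<zero> = \<zero>"
  using comp_of_W[of \<zero> k k] by simp

lemma weight_induct [consumes 1, case_names weight add]:
  assumes v: "v \<in> carrier M"
    and wt: "\<And>k v. v \<in> W k \<Longrightarrow> R v"
    and add: "\<And>v w. v \<in> carrier M \<Longrightarrow> w \<in> carrier M \<Longrightarrow> R v \<Longrightarrow> R w \<Longrightarrow> R (v \<oplus> w)"
  shows "R v"
proof -
  obtain F where F: "finite F" "sc (pann F) v = \<zero>" using annihilated[OF v] by blast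
  have "(\<Oplus>k\<in>F. comp k v) \<in> carrier M \<and> R (\<Oplus>k\<in>F. comp k v)"
    using F(1)
  proof (induction F rule: finite_induct)
    case empty
    show ?case using wt[of \<zero> 0] by simp
  next
    case (insert k F)
    then have "(\<Oplus>k\<in>insert k F. comp k v) = comp k v \<oplus> (\<Oplus>k\<in>F. comp k v)"
      using v by (intro finsum_insert) auto
    then show ?case using insert add[of "comp k v" "\<Oplus>k\<in>F. comp k v"] wt[OF comp_W[OF v]] v by auto
  qed
  then show ?thesis using decomposition[OF v F] by simp
qed

lemma comp_sc:
  assumes "v \<in> carrier M" shows "comp k (sc r v) = sc r (comp k v)"
  using assms
proof (induction rule: weight_induct)
  case (weight j v)
  then show ?case using comp_of_W[of "sc r v" j k] comp_of_W[of v j k] by auto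
qed (simp add: comp_add sc_radd)

lemma comp_P:
  assumes "v \<in> carrier M" shows "comp (k + 1) (P v) = P (comp k v)"
  using assms
proof (induction rule: weight_induct)
  case (weight j v)
  then show ?case using comp_of_W[OF P_W, of v j "k + 1"] comp_of_W[of v j k] by auto
qed (simp add: comp_add P_add)

lemma comp_Q:
  assumes "v \<in> carrier M" shows "comp (k - 1) (Q v) = Q (comp k v)"
  using assms
proof (induction rule: weight_induct)
  case (weight j v)
  then show ?case using comp_of_W[OF Q_W, of v j "k - 1"] comp_of_W[of v j k] by auto
qed (simp add: comp_add Q_add)

lemma comp_finsum:
  assumes "finite F" "\<And>j. j \<in> F \<Longrightarrow> w j \<in> W j"
  shows "comp k (\<Oplus>j\<in>F. w j) = (if k \<in> F then w k else \<zero>)"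
  using assms
proof (induction F rule: finite_induct)
  case (insert j F)
  have "(\<Oplus>j\<in>insert j F. w j) = w j \<oplus> (\<Oplus>j\<in>F. w j)"
    by (rule finsum_insert) (use insert in auto)
  moreover have "(\<Oplus>j\<in>F. w j) \<in> carrier M" by (rule finsum_closed) (use insert in auto)
  ultimately show ?case
    using insert comp_of_W[of "w j" j k] W_carrier[OF insert.prems(1)]
    by (auto simp: comp_add)
qed simp

lemma nonzero_weight_vector:
  assumes "v \<in> carrier M" "v \<noteq> \<zero>"
  obtains k where "comp k v \<noteq> \<zero>"
  using comp_eqI[of v \<zero>] assms by auto

end

locale gwa_wrep = gwa_local_rep M t sc P Q
  for M :: "('v, 'm) ring_scheme" (structure) and t :: "complex poly"
    and sc :: "complex poly \<Rightarrow> 'v \<Rightarrow> 'v" and P Q :: "'v \<Rightarrow> 'v" +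
  assumes findim: "\<exists>n. has_dim (wspace M sc k) n"

text \<open>All axioms are equations or closure conditions, so they pass to the image of a
  structure-preserving map. That N is an abelian group belongs to the conclusion.\<close>

lemma gwa_rep_image:
  assumes M: "gwa_rep M t sc P Q"
    and f: "f ` carrier M = carrier N" "f \<zero>\<^bsub>M\<^esub> = \<zero>\<^bsub>N\<^esub>"
      "\<And>v w. v \<in> carrier M \<Longrightarrow> w \<in> carrier M \<Longrightarrow> f (v \<oplus>\<^bsub>M\<^esub> w) = f v \<oplus>\<^bsub>N\<^esub> f w"
      "\<And>r v. v \<in> carrier M \<Longrightarrow> f (sc r v) = sc' r (f v)"
      "\<And>v. v \<in> carrier M \<Longrightarrow> f (P v) = P' (f v)"
      "\<And>v. v \<in> carrier M \<Longrightarrow> f (Q v) = Q' (f v)"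
  shows "gwa_rep N t sc' P' Q'"
proof -
  interpret gwa_rep M t sc P Q by fact
  note s = f(3-6)[symmetric]
  have ex: "\<exists>v\<in>carrier M. x = f v" if "x \<in> carrier N" for x using that f(1) by auto
  have cl: "f v \<in> carrier N" if "v \<in> carrier M" for v using that f(1) by auto
  have "abelian_group N"
  proof (rule abelian_groupI)
    show "\<exists>y\<in>carrier N. y \<oplus>\<^bsub>N\<^esub> x = \<zero>\<^bsub>N\<^esub>" if x: "x \<in> carrier N" for x
    proof -
      obtain v where v: "v \<in> carrier M" "x = f v" using ex[OF x] by blast
      then have "f (\<ominus>\<^bsub>M\<^esub> v) \<oplus>\<^bsub>N\<^esub> x = \<zero>\<^bsub>N\<^esub>" by (simp add: s f(2) l_neg)
      then show ?thesis using cl v by blast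
    qed
    show "\<zero>\<^bsub>N\<^esub> \<in> carrier N" using cl[of "\<zero>\<^bsub>M\<^esub>"] f(2) by simp
  qed (auto dest!: ex simp: s cl f(2)[symmetric] a_ac)
  then interpret N: abelian_group N .
  show ?thesis
    by unfold_locales
      (auto dest!: ex simp: s cl sc_radd sc_ladd sc_mult P_add P_sc Q_add Q_sc PQ QP)
qed

text \<open>A weight vector of the image lifts to a weight vector: project any preimage with
  \<open>comp k\<close>. So a basis of each weight space maps to a finite spanning family, from
  which a basis is extracted.\<close>

lemma gwa_wrep_image:
  assumes M: "gwa_wrep M t sc P Q"
    and f: "f ` carrier M = carrier N" "f \<zero>\<^bsub>M\<^esub> = \<zero>\<^bsub>N\<^esub>"
      "\<And>v w. v \<in> carrier M \<Longrightarrow> w \<in> carrier M \<Longrightarrow> f (v \<oplus>\<^bsub>M\<^esub> w) = f v \<oplus>\<^bsub>N\<^esub> f w"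
      "\<And>r v. v \<in> carrier M \<Longrightarrow> f (sc r v) = sc' r (f v)"
      "\<And>v. v \<in> carrier M \<Longrightarrow> f (P v) = P' (f v)"
      "\<And>v. v \<in> carrier M \<Longrightarrow> f (Q v) = Q' (f v)"
  shows "gwa_wrep N t sc' P' Q'"
proof -
  interpret gwa_wrep M t sc P Q by fact
  interpret N: gwa_rep N t sc' P' Q'
    by (rule gwa_rep_image[OF gwa_rep_axioms f])
  have ex: "\<exists>v\<in>carrier M. x = f v" if "x \<in> carrier N" for x using that f(1) by auto
  have cl: "f v \<in> carrier N" if "v \<in> carrier M" for v using that f(1) by auto
  have fW: "f v \<in> N.W k" if "v \<in> W k" for v k
    using that f(2,4)[symmetric] cl by (auto simp: W_iff N.W_iff)
  have W_ex: "\<exists>v\<in>W k. x = f v" if x: "x \<in> N.W k" for x k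
  proof -
    obtain v where v: "v \<in> carrier M" "x = f v" using ex[of x] x by auto
    obtain F where F: "finite F" "sc (pann F) v = \<zero>\<^bsub>M\<^esub>" using annihilated[OF v(1)] by blast
    have "f (comp k v) = sc' (lagrange F k) x" using v F by (simp add: comp_eq f)
    also have "\<dots> = x" using N.sc_W[OF x, of "lagrange F k"] x F by (simp add: poly_lagrange one_pCons[symmetric])
    finally show ?thesis using comp_W v by metis
  qed
  show ?thesis
  proof
    show "\<exists>F. finite F \<and> sc' (pann F) x = \<zero>\<^bsub>N\<^esub>" if "x \<in> carrier N" for x
      using ex[OF that] annihilated f(2,4) by metis
    show "\<exists>n. has_dim (wspace N sc' k) n" for k
    proof -
      interpret V: cspace "wspace M sc k" by (rule cspace_wspace)
      interpret V': cspace "wspace N sc' k" by (rule N.cspace_wspace)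
      obtain n e l where d: "dual_basis (wspace M sc k) {..<(n::nat)} e l"
        using findim[of k] unfolding has_dim_def by blast
      have fsum: "f (\<Oplus>\<^bsub>wspace M sc k\<^esub>i\<in>I. c i \<odot>\<^bsub>wspace M sc k\<^esub> e i) =
          (\<Oplus>\<^bsub>wspace N sc' k\<^esub>i\<in>I. c i \<odot>\<^bsub>wspace N sc' k\<^esub> f (e i))"
        if "finite I" "I \<subseteq> {..<n}" for I c
        using that
      proof (induction I rule: finite_induct)
        case (insert i I)
        have e: "e j \<in> W k" if "j \<in> insert i I" for j
          using insert dual_basisD(2)[OF d] that by auto
        then have "(\<Oplus>\<^bsub>wspace M sc k\<^esub>i\<in>I. c i \<odot>\<^bsub>wspace M sc k\<^esub> e i) \<in> carrier M"
          by (intro W_carrier[of _ k] V.comb_closed) auto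
        with insert e fW[OF e] W_carrier[OF e[of i]] show ?case
          by (simp add: V.M.finsum_insert V'.M.finsum_insert f Pi_iff)
      qed (simp add: f(2))
      have "\<exists>m. has_dim (wspace N sc' k) m"
      proof (rule V'.has_dim_if_finite_span[of "{..<n}" "\<lambda>i. f (e i)"])
        show "f (e i) \<in> N.W k" if "i \<in> {..<n}" for i using fW dual_basisD(2)[OF d that] by blast
        show "\<exists>c. x = (\<Oplus>\<^bsub>wspace N sc' k\<^esub>i\<in>{..<n}. c i \<odot>\<^bsub>wspace N sc' k\<^esub> f (e i))"
          if x: "x \<in> N.W k" for x
        proof -
          obtain v where v: "v \<in> W k" "x = f v" using W_ex[OF x] by blast
          show ?thesis
            using fsum[of "{..<n}" "\<lambda>i. l i v"] dual_basisD(5)[OF d v(1)] v(2) by auto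
        qed
      qed simp
      then show ?thesis .
    qed
  qed
qed

subsection \<open>The category of weight modules\<close>

lemma pt_ideal_eq: "pt_ideal k = {r. poly r (of_int k) = 0}"
  by (auto simp: pt_ideal_def cgenideal_def poly_eq_0_iff_dvd dvd_def mult.commute)

lemma inj_pt_ideal: "inj pt_ideal"
proof (rule injI)
  fix j k assume "pt_ideal j = pt_ideal k"
  moreover have "[:- of_int j, 1:] \<in> pt_ideal j" by (simp add: pt_ideal_eq)
  ultimately have "[:- of_int j, 1:] \<in> pt_ideal k" by (simp only:)
  then show "j = k" by (simp add: pt_ideal_eq)
qed

lemma pt_ideal_ideal: "ideal (pt_ideal k) CZ"
  unfolding pt_ideal_def by (rule cring.cgenideal_ideal[OF class_ring_cring]) simp

lemma pt_ideal_max: "pt_ideal k \<in> max_ideals"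
  unfolding max_ideals_def mem_Collect_eq
proof (rule maximalidealI[OF pt_ideal_ideal])
  have "1 \<notin> pt_ideal k" by (simp add: pt_ideal_eq)
  then show "carrier CZ \<noteq> pt_ideal k" by auto
  show "J = pt_ideal k \<or> J = carrier CZ" if J: "ideal J CZ" "pt_ideal k \<subseteq> J" for J
  proof (cases "J \<subseteq> pt_ideal k")
    case False
    then obtain r where r: "r \<in> J" "poly r (of_int k) \<noteq> 0" by (auto simp: pt_ideal_eq)
    interpret J: ideal J CZ by (rule J)
    let ?c = "poly r (of_int k)"
    \<comment> \<open>Modulo the ideal, r equals its value at k. This is a nonzero constant, hence
      invertible, so J contains 1.\<close>
    have "[:?c:] - r \<in> pt_ideal k" by (simp add: pt_ideal_eq)
    then have "[:?c:] - r \<oplus>\<^bsub>CZ\<^esub> r \<in> J" using J(2) r(1) by (intro additive_subgroup.a_closed[OF J.additive_subgroup_axioms]) auto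
    then have "[:?c:] \<in> J" by simp
    then have "[:inverse ?c:] \<otimes>\<^bsub>CZ\<^esub> [:?c:] \<in> J" by (intro J.I_l_closed) auto
    then have "\<one>\<^bsub>CZ\<^esub> \<in> J" using r(2) by (simp add: one_pCons[symmetric])
    then show ?thesis using J.one_imp_carrier by blast
  qed (use that in blast)
qed

text \<open>This serves to exclude weights outside the orbit: the polynomial r acts invertibly on
  the weight space at k but kills every weight vector for m.\<close>

lemma max_ideal_separating:
  assumes "m \<in> max_ideals" "m \<noteq> pt_ideal k"
  obtains r where "r \<in> m" "poly r (of_int k) \<noteq> 0"
proof -
  interpret m: maximalideal m CZ using assms(1) by (simp add: max_ideals_def)
  have "\<not> m \<subseteq> pt_ideal k"
  proof
    assume "m \<subseteq> pt_ideal k"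
    then have "pt_ideal k = m \<or> pt_ideal k = carrier CZ"
      by (intro m.I_maximal[OF pt_ideal_ideal]) auto
    moreover have "1 \<notin> pt_ideal k" by (simp add: pt_ideal_eq)
    ultimately show False using assms(2) by auto
  qed
  then show thesis using that by (auto simp: pt_ideal_eq)
qed

lemma (in gwa_rep) annihilated_add:
  assumes "v \<in> carrier M" "w \<in> carrier M" "\<exists>F. finite F \<and> sc (pann F) v = \<zero>" "\<exists>F. finite F \<and> sc (pann F) w = \<zero>"
  shows "\<exists>F. finite F \<and> sc (pann F) (v \<oplus> w) = \<zero>"
proof -
  obtain F G where F: "finite F" "sc (pann F) v = \<zero>" and G: "finite G" "sc (pann G) w = \<zero>"
    using assms by auto
  have "sc (pann (F \<union> G)) (v \<oplus> w) = \<zero>"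
    using F G assms(1,2) pann_mono[of v "F \<union> G" F] pann_mono[of w "F \<union> G" G] by (simp add: sc_radd)
  then show ?thesis using F(1) G(1) by (intro exI[of _ "F \<union> G"]) simp
qed

lemma (in gwa_wrep) decomposition_support:
  assumes "v \<in> carrier M" shows "v = (\<Oplus>k\<in>{k. comp k v \<noteq> \<zero>}. comp k v)"
proof (rule comp_eqI[OF assms])
  show "(\<Oplus>k\<in>{k. comp k v \<noteq> \<zero>}. comp k v) \<in> carrier M"
    by (rule finsum_closed) (use assms in auto)
  show "comp j v = comp j (\<Oplus>k\<in>{k. comp k v \<noteq> \<zero>}. comp k v)" for j
    using assms by (subst comp_finsum[OF finite_comp_support]) auto
qed

abbreviation wrep :: "complex poly \<Rightarrow> (free_alg set, 'v) module \<Rightarrow> bool" where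
  "wrep t M \<equiv> gwa_wrep M t (mod_sc t M) (mod_gen t M GenXp) (mod_gen t M GenXm)"

lemma weight_space_pt:
  assumes "gwa_rep M t (mod_sc t M) P Q"
  shows "weight_space t M (pt_ideal k) = carrier (wspace M (mod_sc t M) k)"
proof -
  interpret gwa_rep M t "mod_sc t M" P Q by fact
  show ?thesis
  proof (intro subset_antisym subsetI)
    fix v assume v: "v \<in> weight_space t M (pt_ideal k)"
    moreover have "[:- of_int k, 1:] \<in> pt_ideal k" by (simp add: pt_ideal_eq)
    ultimately show "v \<in> W k" unfolding weight_space_def W_iff by blast
  next
    fix v assume v: "v \<in> W k"
    have "mod_sc t M r v = \<zero>\<^bsub>M\<^esub>" if "r \<in> pt_ideal k" for r
    proof -
      have "mod_sc t M r v = mod_sc t M [:poly r (of_int k):] v" by (rule sc_W[OF v])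
      also have "poly r (of_int k) = 0" using that by (simp add: pt_ideal_eq)
      finally show ?thesis using v by simp
    qed
    then show "v \<in> weight_space t M (pt_ideal k)"
      using v unfolding weight_space_def by (blast dest: W_carrier)
  qed
qed

text \<open>The decomposition in \<open>weight_module\<close> runs over all maximal ideals. The
  support condition places each nonzero summand at a point ideal, and a finite sum of such vectors
  is annihilated by some \<open>pann F\<close>.\<close>

lemma wrep_if_wmod:
  assumes "weight_module t M" "fin_dim_weights t M" "Supp t M \<subseteq> orbit"
  shows "wrep t M"
proof -
  have M: "left_module (GWA t) M" using assms by (simp add: weight_module_def)
  interpret gwa_rep M t "mod_sc t M" "mod_gen t M GenXp" "mod_gen t M GenXm"
    by (rule gwa_rep_of_module[OF M])
  show ?thesis
  proof
    fix v assume "v \<in> carrier M"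
    then obtain f where f: "f \<in> (\<Pi>\<^sub>E m\<in>max_ideals. weight_space t M m)"
      "finite {m \<in> max_ideals. f m \<noteq> \<zero>\<^bsub>M\<^esub>}" "v = finsum M f {m \<in> max_ideals. f m \<noteq> \<zero>\<^bsub>M\<^esub>}"
      using assms(1) unfolding weight_module_def by blast
    have fW: "\<exists>k. f m \<in> W k" if "m \<in> max_ideals" "f m \<noteq> \<zero>\<^bsub>M\<^esub>" for m
    proof -
      have "f m \<in> weight_space t M m" using f(1) that by auto
      then have "m \<in> Supp t M" using that by (auto simp: Supp_def)
      then obtain k where "m = pt_ideal k" using assms(3) by (auto simp: orbit_def)
      then show ?thesis using \<open>f m \<in> weight_space t M m\<close> weight_space_pt[OF gwa_rep_axioms] by auto
    qed
    have "\<exists>F. finite F \<and> mod_sc t M (pann F) (finsum M f A) = \<zero>\<^bsub>M\<^esub>"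
      if "finite A" "A \<subseteq> {m \<in> max_ideals. f m \<noteq> \<zero>\<^bsub>M\<^esub>}" for A
      using that
    proof (induction A rule: finite_induct)
      case empty
      show ?case by (rule exI[of _ "{}"]) simp
    next
      case (insert m A)
      obtain k where k: "f m \<in> W k" using fW insert.prems by blast
      have fc: "f n \<in> carrier M" if "n \<in> A" for n
        using fW[of n] insert.prems that by auto
      have "finsum M f A \<in> carrier M" by (rule finsum_closed) (use fc in auto)
      moreover have "finsum M f (insert m A) = f m \<oplus>\<^bsub>M\<^esub> finsum M f A"
        by (rule finsum_insert) (use insert fc k in auto)
      ultimately show ?case
        using insert annihilated_add[of "f m" "finsum M f A"] k pann_W[OF k] W_carrier[OF k] by auto
    qed
    from this[OF f(2)] show "\<exists>F. finite F \<and> mod_sc t M (pann F) v = \<zero>\<^bsub>M\<^esub>" using f(3) by simp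
  next
    fix k
    interpret V: cspace "wspace M (mod_sc t M) k" by (rule cspace_wspace)
    obtain B where B: "finite B" "B \<subseteq> W k"
      "\<And>v. v \<in> W k \<Longrightarrow> \<exists>c :: _ \<Rightarrow> complex. v = finsum M (\<lambda>b. mod_sc t M [:c b:] b) B"
      using assms(2) pt_ideal_max unfolding fin_dim_weights_def weight_space_pt[OF gwa_rep_axioms, symmetric]
      by meson
    have "\<exists>c. v = finsum (wspace M (mod_sc t M) k) (\<lambda>b. c b \<odot>\<^bsub>wspace M (mod_sc t M) k\<^esub> b) B" if v: "v \<in> W k" for v
    proof -
      obtain c :: "_ \<Rightarrow> complex" where "v = finsum M (\<lambda>b. mod_sc t M [:c b:] b) B" using B(3)[OF v] by blast
      also have "\<dots> = finsum (wspace M (mod_sc t M) k) (\<lambda>b. mod_sc t M [:c b:] b) B"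
        by (rule finsum_wspace[symmetric]) (use B(2) in auto)
      finally show ?thesis by auto
    qed
    with V.has_dim_if_finite_span[where B = B and e = "\<lambda>b. b"] B(1,2)
    show "\<exists>n. has_dim (wspace M (mod_sc t M) k) n" by (meson subsetD)
  qed
qed

text \<open>The decomposition over integers has to be extended to all maximal ideals, uniquely; this
  works because the weight spaces off the orbit vanish (\<open>outside\<close>).\<close>

lemma wmod_if_wrep:
  assumes M: "left_module (GWA t) M" and wrep: "wrep t M"
  shows "weight_module t M" "fin_dim_weights t M" "Supp t M \<subseteq> orbit"
proof -
  interpret gwa_wrep M t "mod_sc t M" "mod_gen t M GenXp" "mod_gen t M GenXm" by (rule wrep)
  note W_pt = weight_space_pt[OF gwa_rep_axioms]
  have outside: "v = \<zero>\<^bsub>M\<^esub>" if m: "m \<in> max_ideals" "m \<notin> orbit" and v: "v \<in> weight_space t M m" for m v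
  proof (rule comp_eqI)
    show vc: "v \<in> carrier M" using v by (simp add: weight_space_def)
    fix k
    obtain r where r: "r \<in> m" "poly r (of_int k) \<noteq> 0"
      using max_ideal_separating[OF m(1), of k] m(2) by (auto simp: orbit_def)
    have "mod_sc t M r v = \<zero>\<^bsub>M\<^esub>" using v r by (simp add: weight_space_def)
    then have "mod_sc t M r (comp k v) = \<zero>\<^bsub>M\<^esub>" using comp_sc[OF vc, of k r] by simp
    then have "mod_sc t M [:poly r (of_int k):] (comp k v) = \<zero>\<^bsub>M\<^esub>" using sc_W[OF comp_W[OF vc], of r k] by simp
    then show "comp k v = comp k \<zero>\<^bsub>M\<^esub>" using sc_const_eq_zero[of "comp k v" "poly r (of_int k)"] r vc by simp
  qed simp
  have zero_ws: "\<zero>\<^bsub>M\<^esub> \<in> weight_space t M m" for m by (simp add: weight_space_def)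
  show "Supp t M \<subseteq> orbit"
  proof
    fix m assume m: "m \<in> Supp t M"
    show "m \<in> orbit"
    proof (rule ccontr)
      assume "m \<notin> orbit"
      then have "weight_space t M m = {\<zero>\<^bsub>M\<^esub>}" using outside[of m] m zero_ws by (auto simp: Supp_def)
      then show False using m by (simp add: Supp_def)
    qed
  qed
  show "fin_dim_weights t M"
    unfolding fin_dim_weights_def
  proof
    fix m assume m: "m \<in> max_ideals"
    show "\<exists>B. finite B \<and> B \<subseteq> weight_space t M m \<and>
        (\<forall>v\<in>weight_space t M m. \<exists>c :: _ \<Rightarrow> complex. v = finsum M (\<lambda>b. mod_sc t M [:c b:] b) B)"
    proof (cases "m \<in> orbit")
      case False
      then show ?thesis using outside[OF m] by (intro exI[of _ "{}"]) auto
    next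
      case True
      then obtain k where k: "m = pt_ideal k" by (auto simp: orbit_def)
      obtain n e l where d: "dual_basis (wspace M (mod_sc t M) k) {..<(n::nat)} e l"
        using findim[of k] unfolding has_dim_def by blast
      \<comment> \<open>\<open>fin_dim_weights\<close> asks for a finite set with coefficients
        indexed by its elements. Distinctness of the \<open>e i\<close> allows the coefficients to
        be read off from vectors instead of indices.\<close>
      have inj: "inj_on e {..<n}"
        by (rule inj_onI) (metis dual_basisD(4)[OF d] zero_neq_one)
      have "\<exists>c :: _ \<Rightarrow> complex. v = finsum M (\<lambda>b. mod_sc t M [:c b:] b) (e ` {..<n})" if v: "v \<in> W k" for v
      proof -
        let ?c = "\<lambda>b. l (the_inv_into {..<n} e b) v"
        have "v = finsum (wspace M (mod_sc t M) k) (\<lambda>i. mod_sc t M [:l i v:] (e i)) {..<n}"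
          using dual_basisD(5)[OF d v] by simp
        also have "\<dots> = finsum M (\<lambda>i. mod_sc t M [:l i v:] (e i)) {..<n}"
          by (rule finsum_wspace) (use dual_basisD(2)[OF d] in auto)
        also have "\<dots> = finsum M (\<lambda>i. mod_sc t M [:?c (e i):] (e i)) {..<n}"
          by (rule finsum_cong') (use dual_basisD(2)[OF d] in \<open>auto simp: the_inv_into_f_f[OF inj]\<close>)
        also have "\<dots> = finsum M (\<lambda>b. mod_sc t M [:?c b:] b) (e ` {..<n})"
          by (rule finsum_reindex[symmetric, OF _ inj]) (use dual_basisD(2)[OF d] in auto)
        finally show ?thesis by (rule exI[of _ ?c])
      qed
      then show ?thesis
        using dual_basisD(2)[OF d] by (intro exI[of _ "e ` {..<n}"]) (auto simp: k W_pt)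
    qed
  qed
  show "weight_module t M"
    unfolding weight_module_def
  proof (intro conjI M ballI)
    fix v assume v: "v \<in> carrier M"
    \<comment> \<open>The only candidate: the components of v on the orbit, extended by zero to the
      remaining maximal ideals.\<close>
    define f where "f = (\<lambda>m\<in>max_ideals. if m \<in> orbit then comp (the_inv pt_ideal m) v else \<zero>\<^bsub>M\<^esub>)"
    have f_pt: "f (pt_ideal k) = comp k v" for k
      using pt_ideal_max by (simp add: f_def orbit_def the_inv_f_f[OF inj_pt_ideal])
    have fPi: "f \<in> (\<Pi>\<^sub>E m\<in>max_ideals. weight_space t M m)"
    proof (rule PiE_I)
      fix m assume "m \<in> max_ideals"
      show "f m \<in> weight_space t M m"
      proof (cases "m \<in> orbit")
        case True
        then show ?thesis using f_pt v by (auto simp: orbit_def W_pt)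
      next
        case False
        then show ?thesis using \<open>m \<in> max_ideals\<close> zero_ws by (simp add: f_def)
      qed
    qed (simp add: f_def)
    have supp: "{m \<in> max_ideals. g m \<noteq> \<zero>\<^bsub>M\<^esub>} = pt_ideal ` {k. g (pt_ideal k) \<noteq> \<zero>\<^bsub>M\<^esub>}"
      if "g \<in> (\<Pi>\<^sub>E m\<in>max_ideals. weight_space t M m)" for g
    proof -
      have "m \<in> orbit" if "m \<in> max_ideals" "g m \<noteq> \<zero>\<^bsub>M\<^esub>" for m
        using outside[OF that(1)] \<open>g \<in> _\<close> that by (metis PiE_mem)
      then show ?thesis using pt_ideal_max by (auto simp: orbit_def)
    qed
    have gW: "g (pt_ideal k) \<in> W k" if "g \<in> (\<Pi>\<^sub>E m\<in>max_ideals. weight_space t M m)" for g k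
      using PiE_mem[OF that pt_ideal_max[of k]] by (simp add: W_pt)
    have fs: "finsum M g {m \<in> max_ideals. g m \<noteq> \<zero>\<^bsub>M\<^esub>} = finsum M (\<lambda>k. g (pt_ideal k)) {k. g (pt_ideal k) \<noteq> \<zero>\<^bsub>M\<^esub>}"
      if g: "g \<in> (\<Pi>\<^sub>E m\<in>max_ideals. weight_space t M m)" for g
      unfolding supp[OF g]
      by (rule finsum_reindex) (use gW[OF g] in \<open>auto intro: inj_on_subset[OF inj_pt_ideal]\<close>)
    show "\<exists>!f. f \<in> (\<Pi>\<^sub>E m\<in>max_ideals. weight_space t M m) \<and>
        finite {m \<in> max_ideals. f m \<noteq> \<zero>\<^bsub>M\<^esub>} \<and> v = finsum M f {m \<in> max_ideals. f m \<noteq> \<zero>\<^bsub>M\<^esub>}"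
    proof (rule ex1I[of _ f])
      show "f \<in> (\<Pi>\<^sub>E m\<in>max_ideals. weight_space t M m) \<and>
        finite {m \<in> max_ideals. f m \<noteq> \<zero>\<^bsub>M\<^esub>} \<and> v = finsum M f {m \<in> max_ideals. f m \<noteq> \<zero>\<^bsub>M\<^esub>}"
        using fPi decomposition_support[OF v] finite_comp_support[OF v] fs[OF fPi]
        by (auto simp: supp[OF fPi] f_pt)
    next
      fix g assume g: "g \<in> (\<Pi>\<^sub>E m\<in>max_ideals. weight_space t M m) \<and>
        finite {m \<in> max_ideals. g m \<noteq> \<zero>\<^bsub>M\<^esub>} \<and> v = finsum M g {m \<in> max_ideals. g m \<noteq> \<zero>\<^bsub>M\<^esub>}"
      then have gPi: "g \<in> (\<Pi>\<^sub>E m\<in>max_ideals. weight_space t M m)" by blast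
      have fin: "finite {k. g (pt_ideal k) \<noteq> \<zero>\<^bsub>M\<^esub>}"
        using g supp[OF gPi] by (metis (no_types, lifting) finite_imageD inj_on_subset[OF inj_pt_ideal] subset_UNIV)
      have "g (pt_ideal k) = comp k v" for k
        using comp_finsum[OF fin, of "\<lambda>k. g (pt_ideal k)" k] gW[OF gPi] g fs[OF gPi] by auto
      then have pt: "g (pt_ideal k) = f (pt_ideal k)" for k by (simp add: f_pt)
      show "g = f"
      proof (rule PiE_ext[OF gPi fPi])
        fix m assume m: "m \<in> max_ideals"
        show "g m = f m"
        proof (cases "m \<in> orbit")
          case True
          then show ?thesis using pt by (auto simp: orbit_def)
        next
          case False
          then show ?thesis using outside[OF m False PiE_mem[OF gPi m]] outside[OF m False PiE_mem[OF fPi m]] by simp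
        qed
      qed
    qed
  qed
qed

lemma wmod_iff: "M \<in> wmod t \<longleftrightarrow> left_module (GWA t) M \<and> wrep t M"
proof
  assume "M \<in> wmod t"
  then have M: "weight_module t M" "fin_dim_weights t M" "Supp t M \<subseteq> orbit"
    by (simp_all only: wmod_def mem_Collect_eq)
  from M(1) have "left_module (GWA t) M" unfolding weight_module_def by (rule conjunct1)
  with wrep_if_wmod[OF M] show "left_module (GWA t) M \<and> wrep t M" by (rule conjI[rotated])
next
  assume *: "left_module (GWA t) M \<and> wrep t M"
  show "M \<in> wmod t"
    unfolding wmod_def mem_Collect_eq
    by (intro conjI wmod_if_wrep conjunct1[OF *] conjunct2[OF *])
qed

subsection \<open>Realization on the universe of carriers\<close>

text \<open>The hypotheses say that the fibres of f form a congruence, so the operations can be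
  pushed forward along f by means of a chosen section. An injective f yields a copy of M inside
  \<open>univ\<close>; an f that picks coset representatives yields a quotient of M.\<close>

lemma wmod_realize:
  fixes M :: "('v, 'm) ring_scheme" (structure) and f :: "'v \<Rightarrow> univ"
  assumes M: "gwa_wrep M t sc P Q"
    and add: "\<And>a a' b b'. a \<in> carrier M \<Longrightarrow> a' \<in> carrier M \<Longrightarrow> b \<in> carrier M \<Longrightarrow> b' \<in> carrier M \<Longrightarrow>
      f a = f a' \<Longrightarrow> f b = f b' \<Longrightarrow> f (a \<oplus> b) = f (a' \<oplus> b')"
    and sc: "\<And>r a a'. a \<in> carrier M \<Longrightarrow> a' \<in> carrier M \<Longrightarrow> f a = f a' \<Longrightarrow> f (sc r a) = f (sc r a')"
    and P: "\<And>a a'. a \<in> carrier M \<Longrightarrow> a' \<in> carrier M \<Longrightarrow> f a = f a' \<Longrightarrow> f (P a) = f (P a')"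
    and Q: "\<And>a a'. a \<in> carrier M \<Longrightarrow> a' \<in> carrier M \<Longrightarrow> f a = f a' \<Longrightarrow> f (Q a) = f (Q a')"
  obtains N where "N \<in> wmod t" "f ` carrier M = carrier N" "f \<zero> = \<zero>\<^bsub>N\<^esub>"
    "\<And>v w. v \<in> carrier M \<Longrightarrow> w \<in> carrier M \<Longrightarrow> f (v \<oplus> w) = f v \<oplus>\<^bsub>N\<^esub> f w"
    "\<And>r v. v \<in> carrier M \<Longrightarrow> f (sc r v) = mod_sc t N r (f v)"
    "\<And>v. v \<in> carrier M \<Longrightarrow> f (P v) = mod_gen t N GenXp (f v)"
    "\<And>v. v \<in> carrier M \<Longrightarrow> f (Q v) = mod_gen t N GenXm (f v)"
proof -
  interpret gwa_wrep M t sc P Q by fact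
  define g where "g = inv_into (carrier M) f"
  have g: "g (f v) \<in> carrier M" "f (g (f v)) = f v" if "v \<in> carrier M" for v
    using that by (auto simp: g_def inv_into_into f_inv_into_f)
  define N0 :: "univ ring" where "N0 = \<lparr>carrier = f ` carrier M, monoid.mult = undefined, monoid.one = undefined,
     ring.zero = f \<zero>, ring.add = (\<lambda>x y. f (g x \<oplus> g y))\<rparr>"
  define sc' P' Q' where "sc' = (\<lambda>r x. f (sc r (g x)))" and "P' = (\<lambda>x. f (P (g x)))" and "Q' = (\<lambda>x. f (Q (g x)))"
  have hom: "f ` carrier M = carrier N0" "f \<zero> = \<zero>\<^bsub>N0\<^esub>"
    "\<And>v w. v \<in> carrier M \<Longrightarrow> w \<in> carrier M \<Longrightarrow> f (v \<oplus> w) = f v \<oplus>\<^bsub>N0\<^esub> f w"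
    "\<And>r v. v \<in> carrier M \<Longrightarrow> f (sc r v) = sc' r (f v)"
    "\<And>v. v \<in> carrier M \<Longrightarrow> f (P v) = P' (f v)"
    "\<And>v. v \<in> carrier M \<Longrightarrow> f (Q v) = Q' (f v)"
    using g by (simp_all add: N0_def sc'_def P'_def Q'_def) (metis add sc P Q)+
  interpret N: gwa_wrep N0 t sc' P' Q'
    by (rule gwa_wrep_image[OF gwa_wrep_axioms hom])
  have cl: "f v \<in> carrier N0" if "v \<in> carrier M" for v using hom(1) that by auto
  have hom': "f ` carrier M = carrier N.to_module" "f \<zero> = \<zero>\<^bsub>N.to_module\<^esub>"
    "\<And>v w. v \<in> carrier M \<Longrightarrow> w \<in> carrier M \<Longrightarrow> f (v \<oplus> w) = f v \<oplus>\<^bsub>N.to_module\<^esub> f w"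
    "\<And>r v. v \<in> carrier M \<Longrightarrow> f (sc r v) = mod_sc t N.to_module r (f v)"
    "\<And>v. v \<in> carrier M \<Longrightarrow> f (P v) = mod_gen t N.to_module GenXp (f v)"
    "\<And>v. v \<in> carrier M \<Longrightarrow> f (Q v) = mod_gen t N.to_module GenXm (f v)"
    by (simp add: hom(1), simp add: hom(2), simp add: hom(3), simp add: hom(4) cl,
      simp add: hom(5) cl, simp add: hom(6) cl)
  have "wrep t N.to_module"
    by (rule gwa_wrep_image[OF gwa_wrep_axioms hom'])
  then have "N.to_module \<in> wmod t" using N.to_module by (simp add: wmod_iff)
  then show thesis by (rule that[OF _ hom'])
qed

text \<open>The quotient by the image of i is realized on a system of coset representatives. These
  already lie in the carrier of M, hence in \<open>univ\<close>.\<close>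

lemma quotient_exists:
  assumes S: "S \<in> wmod t" and M: "M \<in> wmod t" and i: "i \<in> lmod_hom (GWA t) S M" and inj: "inj_on i (carrier S)"
  obtains N where "N \<in> wmod t" "short_exact (GWA t) S M N"
proof -
  interpret S: gwa_wrep S t "mod_sc t S" "mod_gen t S GenXp" "mod_gen t S GenXm" using S by (simp add: wmod_iff)
  interpret gwa_wrep M t "mod_sc t M" "mod_gen t M GenXp" "mod_gen t M GenXm" using M by (simp add: wmod_iff)
  have iadd: "i (v \<oplus>\<^bsub>S\<^esub> w) = i v \<oplus>\<^bsub>M\<^esub> i w" if "v \<in> carrier S" "w \<in> carrier S" for v w
    using i that by (auto simp: lmod_hom_def hom_def)
  have ic: "i v \<in> carrier M" if "v \<in> carrier S" for v
    using i that by (auto simp: lmod_hom_def hom_def)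
  have ism: "i (a \<odot>\<^bsub>S\<^esub> v) = a \<odot>\<^bsub>M\<^esub> i v" if "v \<in> carrier S" "a \<in> carrier (GWA t)" for a v
    using i that by (auto simp: lmod_hom_def)
  have i0: "i \<zero>\<^bsub>S\<^esub> = \<zero>\<^bsub>M\<^esub>"
    using iadd[of "\<zero>\<^bsub>S\<^esub>" "\<zero>\<^bsub>S\<^esub>"] ic[of "\<zero>\<^bsub>S\<^esub>"] add.r_cancel_one'[of "i \<zero>\<^bsub>S\<^esub>" "i \<zero>\<^bsub>S\<^esub>"] by simp
  let ?U = "i ` carrier S"
  have iinv: "i (\<ominus>\<^bsub>S\<^esub> v) = \<ominus>\<^bsub>M\<^esub> i v" if "v \<in> carrier S" for v
    using iadd[of "\<ominus>\<^bsub>S\<^esub> v" v] that ic i0 minus_equality[of "i (\<ominus>\<^bsub>S\<^esub> v)" "i v"] by (simp add: S.l_neg)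
  have U: "\<zero>\<^bsub>M\<^esub> \<in> ?U" "\<And>x y. x \<in> ?U \<Longrightarrow> y \<in> ?U \<Longrightarrow> x \<oplus>\<^bsub>M\<^esub> y \<in> ?U" "\<And>x. x \<in> ?U \<Longrightarrow> \<ominus>\<^bsub>M\<^esub> x \<in> ?U"
    using i0 iadd[symmetric] iinv[symmetric] by (force simp: image_iff)+
  have Uc: "x \<in> carrier M" if "x \<in> ?U" for x using that ic by auto
  have Sc: "a \<odot>\<^bsub>S\<^esub> v \<in> carrier S" if "v \<in> carrier S" "a \<in> carrier (GWA t)" for a v
    using S that by (auto simp: wmod_iff left_module_def left_module_axioms_def)
  have Usm: "a \<odot>\<^bsub>M\<^esub> x \<in> ?U" if "x \<in> ?U" "a \<in> carrier (GWA t)" for a x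
    using that ism[symmetric] Sc by auto
  have Mm: "left_module (GWA t) M" using M by (simp add: wmod_iff)
  have sm_diff: "a \<odot>\<^bsub>M\<^esub> x \<ominus>\<^bsub>M\<^esub> a \<odot>\<^bsub>M\<^esub> y = a \<odot>\<^bsub>M\<^esub> (x \<ominus>\<^bsub>M\<^esub> y)" and sm_closed: "a \<odot>\<^bsub>M\<^esub> x \<in> carrier M"
    if "x \<in> carrier M" "y \<in> carrier M" "a \<in> carrier (GWA t)" for a x y
  proof -
    interpret L: left_module "GWA t" M by (rule Mm)
    have c: "a \<odot>\<^bsub>M\<^esub> x \<in> carrier M" "a \<odot>\<^bsub>M\<^esub> y \<in> carrier M" "a \<odot>\<^bsub>M\<^esub> (x \<ominus>\<^bsub>M\<^esub> y) \<in> carrier M"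
      using L.smult_closed that by auto
    show "a \<odot>\<^bsub>M\<^esub> x \<in> carrier M" by (rule c)
    have "a \<odot>\<^bsub>M\<^esub> (x \<ominus>\<^bsub>M\<^esub> y) \<oplus>\<^bsub>M\<^esub> a \<odot>\<^bsub>M\<^esub> y = a \<odot>\<^bsub>M\<^esub> ((x \<ominus>\<^bsub>M\<^esub> y) \<oplus>\<^bsub>M\<^esub> y)"
      using L.smult_r_distr that by auto
    also have "(x \<ominus>\<^bsub>M\<^esub> y) \<oplus>\<^bsub>M\<^esub> y = x" using that by (simp add: a_minus_def a_assoc l_neg)
    finally have "a \<odot>\<^bsub>M\<^esub> x = a \<odot>\<^bsub>M\<^esub> (x \<ominus>\<^bsub>M\<^esub> y) \<oplus>\<^bsub>M\<^esub> a \<odot>\<^bsub>M\<^esub> y" ..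
    then show "a \<odot>\<^bsub>M\<^esub> x \<ominus>\<^bsub>M\<^esub> a \<odot>\<^bsub>M\<^esub> y = a \<odot>\<^bsub>M\<^esub> (x \<ominus>\<^bsub>M\<^esub> y)"
      using c by (simp add: a_minus_def a_assoc r_neg)
  qed
  \<comment> \<open>The predicate under the choice depends only on the coset of x, so f is constant
    on cosets and separates them; this is \<open>f_eq\<close>.\<close>
  define f where "f x = (SOME y. y \<in> carrier M \<and> x \<ominus>\<^bsub>M\<^esub> y \<in> ?U)" for x
  have f_ex: "f x \<in> carrier M \<and> x \<ominus>\<^bsub>M\<^esub> f x \<in> ?U" if "x \<in> carrier M" for x
    unfolding f_def by (rule someI[of _ x]) (use that U(1) in \<open>simp add: a_minus_def r_neg\<close>)
  have f_eq: "f x = f y \<longleftrightarrow> x \<ominus>\<^bsub>M\<^esub> y \<in> ?U" if x: "x \<in> carrier M" and y: "y \<in> carrier M" for x y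
  proof
    assume "f x = f y"
    then have "(x \<ominus>\<^bsub>M\<^esub> f x) \<oplus>\<^bsub>M\<^esub> \<ominus>\<^bsub>M\<^esub> (y \<ominus>\<^bsub>M\<^esub> f x) \<in> ?U" using f_ex x y U by metis
    also have "\<ominus>\<^bsub>M\<^esub> (y \<ominus>\<^bsub>M\<^esub> f x) = f x \<oplus>\<^bsub>M\<^esub> \<ominus>\<^bsub>M\<^esub> y"
      using y f_ex[OF x] by (simp add: a_minus_def minus_add a_comm)
    also have "(x \<ominus>\<^bsub>M\<^esub> f x) \<oplus>\<^bsub>M\<^esub> (f x \<oplus>\<^bsub>M\<^esub> \<ominus>\<^bsub>M\<^esub> y) = x \<ominus>\<^bsub>M\<^esub> y"
      using x y f_ex[OF x] by (simp add: a_minus_def a_assoc r_neg1)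
    finally show "x \<ominus>\<^bsub>M\<^esub> y \<in> ?U" .
  next
    assume d: "x \<ominus>\<^bsub>M\<^esub> y \<in> ?U"
    have "x \<ominus>\<^bsub>M\<^esub> z \<in> ?U \<longleftrightarrow> y \<ominus>\<^bsub>M\<^esub> z \<in> ?U" if z: "z \<in> carrier M" for z
    proof -
      have "x \<ominus>\<^bsub>M\<^esub> z = (x \<ominus>\<^bsub>M\<^esub> y) \<oplus>\<^bsub>M\<^esub> (y \<ominus>\<^bsub>M\<^esub> z)"
        using x y z by (simp add: a_minus_def a_assoc r_neg1 r_neg2)
      moreover have "\<ominus>\<^bsub>M\<^esub> (x \<ominus>\<^bsub>M\<^esub> y) = y \<oplus>\<^bsub>M\<^esub> \<ominus>\<^bsub>M\<^esub> x"
        using x y by (simp add: a_minus_def minus_add a_comm)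
      then have "y \<ominus>\<^bsub>M\<^esub> z = \<ominus>\<^bsub>M\<^esub> (x \<ominus>\<^bsub>M\<^esub> y) \<oplus>\<^bsub>M\<^esub> (x \<ominus>\<^bsub>M\<^esub> z)"
        using x y z by (simp add: a_minus_def a_assoc r_neg1)
      ultimately show ?thesis using U d by metis
    qed
    then have "(\<lambda>z. z \<in> carrier M \<and> x \<ominus>\<^bsub>M\<^esub> z \<in> ?U) = (\<lambda>z. z \<in> carrier M \<and> y \<ominus>\<^bsub>M\<^esub> z \<in> ?U)"
      by (intro ext conj_cong refl) blast
    then show "f x = f y" unfolding f_def by (rule arg_cong)
  qed
  have sm_cong: "f (a \<odot>\<^bsub>M\<^esub> x) = f (a \<odot>\<^bsub>M\<^esub> y)" if "x \<in> carrier M" "y \<in> carrier M" "f x = f y" "a \<in> carrier (GWA t)" for a x y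
    using f_eq[OF sm_closed[OF that(1,1,4)] sm_closed[OF that(2,2,4)]] f_eq[OF that(1,2)] that(3)
      sm_diff[OF that(1,2,4)] Usm[OF _ that(4), of "x \<ominus>\<^bsub>M\<^esub> y"] by simp
  have add_cong: "f (a \<oplus>\<^bsub>M\<^esub> b) = f (a' \<oplus>\<^bsub>M\<^esub> b')"
    if "a \<in> carrier M" "a' \<in> carrier M" "b \<in> carrier M" "b' \<in> carrier M" "f a = f a'" "f b = f b'" for a a' b b'
  proof -
    have "(a \<oplus>\<^bsub>M\<^esub> b) \<ominus>\<^bsub>M\<^esub> (a' \<oplus>\<^bsub>M\<^esub> b') = (a \<ominus>\<^bsub>M\<^esub> a') \<oplus>\<^bsub>M\<^esub> (b \<ominus>\<^bsub>M\<^esub> b')"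
      using that by (simp add: a_minus_def minus_add a_ac)
    then show ?thesis using that f_eq[of a a'] f_eq[of b b'] f_eq[of "a \<oplus>\<^bsub>M\<^esub> b" "a' \<oplus>\<^bsub>M\<^esub> b'"] U(2) by auto
  qed
  obtain N where N: "N \<in> wmod t" "f ` carrier M = carrier N" "f \<zero>\<^bsub>M\<^esub> = \<zero>\<^bsub>N\<^esub>"
    "\<And>v w. v \<in> carrier M \<Longrightarrow> w \<in> carrier M \<Longrightarrow> f (v \<oplus>\<^bsub>M\<^esub> w) = f v \<oplus>\<^bsub>N\<^esub> f w"
    "\<And>r v. v \<in> carrier M \<Longrightarrow> f (mod_sc t M r v) = mod_sc t N r (f v)"
    "\<And>v. v \<in> carrier M \<Longrightarrow> f (mod_gen t M GenXp v) = mod_gen t N GenXp (f v)"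
    "\<And>v. v \<in> carrier M \<Longrightarrow> f (mod_gen t M GenXm v) = mod_gen t N GenXm (f v)"
  proof (rule wmod_realize[OF gwa_wrep_axioms, of f], goal_cases)
    case 1 show ?case by (rule add_cong[OF 1(2-7)])
  next
    case 2 show ?case by (rule sm_cong[OF 2(2-4) gwa_poly_simps(1)])
  next
    case 3 show ?case by (rule sm_cong[OF 3(2-4) gwa_poly_simps(2)])
  next
    case 4 show ?case by (rule sm_cong[OF 4(2-4) gwa_poly_simps(2)])
  next
    case (5 N) show ?case by (rule 5(1)[OF 5(2-8)])
  qed
  have "f \<in> lmod_hom (GWA t) M N"
    by (rule gwa_hom_iff) (use N Mm in \<open>auto simp: wmod_iff hom_def\<close>)
  moreover have "?U = {x \<in> carrier M. f x = \<zero>\<^bsub>N\<^esub>}"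
  proof -
    have "\<ominus>\<^bsub>M\<^esub> \<zero>\<^bsub>M\<^esub> = \<zero>\<^bsub>M\<^esub>" by (rule minus_equality) auto
    then have "x \<ominus>\<^bsub>M\<^esub> \<zero>\<^bsub>M\<^esub> = x" if "x \<in> carrier M" for x
      using that by (simp only: a_minus_def r_zero)
    then have "f x = \<zero>\<^bsub>N\<^esub> \<longleftrightarrow> x \<in> ?U" if "x \<in> carrier M" for x
      using f_eq[OF that zero_closed] that by (simp only: N(3)[symmetric])
    then show ?thesis using Uc by blast
  qed
  ultimately have "short_exact (GWA t) S M N"
    unfolding short_exact_def using i inj N(2) by blast
  then show thesis using that N(1) by blast
qed

subsection \<open>Dimensions of weight spaces\<close>

definition wdim :: "complex poly \<Rightarrow> (free_alg set, 'v) module \<Rightarrow> int \<Rightarrow> nat" where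
  "wdim t M k = (THE n. has_dim (wspace M (mod_sc t M) k) n)"

lemma wdim_eqI:
  assumes "M \<in> wmod t" "has_dim (wspace M (mod_sc t M) k) n"
  shows "wdim t M k = n"
proof -
  interpret gwa_wrep M t "mod_sc t M" "mod_gen t M GenXp" "mod_gen t M GenXm" using assms by (simp add: wmod_iff)
  show ?thesis unfolding wdim_def using has_dim_unique[OF cspace_wspace _ assms(2)] assms(2) by blast
qed

lemma has_dim_wdim:
  assumes "M \<in> wmod t" shows "has_dim (wspace M (mod_sc t M) k) (wdim t M k)"
proof -
  interpret gwa_wrep M t "mod_sc t M" "mod_gen t M GenXp" "mod_gen t M GenXm" using assms by (simp add: wmod_iff)
  show ?thesis using findim[of k] wdim_eqI[OF assms] by auto
qed

lemma (in cspace) has_dim_0_iff: "has_dim V 0 \<longleftrightarrow> carrier V = {\<zero>}"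
proof
  assume "has_dim V 0"
  then obtain e l where "dual_basis V {..<0::nat} e l" unfolding has_dim_def by blast
  then have "x = \<zero>" if "x \<in> carrier V" for x using dual_basisD(5) that by fastforce
  then show "carrier V = {\<zero>}" using M.zero_closed by blast
next
  assume "carrier V = {\<zero>}"
  then have "dual_basis V {..<0::nat} e l" for e :: "nat \<Rightarrow> 'v" and l by (simp add: dual_basis_def)
  then show "has_dim V 0" unfolding has_dim_def by blast
qed

lemma wdim_0_iff:
  assumes "M \<in> wmod t" shows "wdim t M k = 0 \<longleftrightarrow> carrier (wspace M (mod_sc t M) k) = {\<zero>\<^bsub>M\<^esub>}"
proof -
  interpret gwa_wrep M t "mod_sc t M" "mod_gen t M GenXp" "mod_gen t M GenXm" using assms by (simp add: wmod_iff)
  interpret V: cspace "wspace M (mod_sc t M) k" by (rule cspace_wspace)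
  show ?thesis using V.has_dim_0_iff has_dim_wdim[OF assms, of k] wdim_eqI[OF assms, of k 0] by auto
qed

lemma Supp_wdim:
  assumes "M \<in> wmod t" shows "Supp t M = pt_ideal ` {k. wdim t M k \<noteq> 0}"
proof -
  interpret gwa_wrep M t "mod_sc t M" "mod_gen t M GenXp" "mod_gen t M GenXm" using assms by (simp add: wmod_iff)
  have "Supp t M \<subseteq> orbit" using assms by (simp add: wmod_def)
  moreover have "pt_ideal k \<in> Supp t M \<longleftrightarrow> wdim t M k \<noteq> 0" for k
    using pt_ideal_max wdim_0_iff[OF assms] weight_space_pt[OF gwa_rep_axioms] by (simp add: Supp_def)
  ultimately show ?thesis by (auto simp: orbit_def)
qed

lemma lmod_homD:
  assumes "f \<in> lmod_hom R M N"
  shows "v \<in> carrier M \<Longrightarrow> f v \<in> carrier N"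
    "v \<in> carrier M \<Longrightarrow> w \<in> carrier M \<Longrightarrow> f (v \<oplus>\<^bsub>M\<^esub> w) = f v \<oplus>\<^bsub>N\<^esub> f w"
    "v \<in> carrier M \<Longrightarrow> a \<in> carrier R \<Longrightarrow> f (a \<odot>\<^bsub>M\<^esub> v) = a \<odot>\<^bsub>N\<^esub> f v"
  using assms by (auto simp: lmod_hom_def hom_def)

lemma lmod_hom_zero:
  assumes "f \<in> lmod_hom R M N" "abelian_group M" "abelian_group N"
  shows "f \<zero>\<^bsub>M\<^esub> = \<zero>\<^bsub>N\<^esub>"
proof -
  interpret M: abelian_group M by fact
  interpret N: abelian_group N by fact
  show ?thesis
    using lmod_homD(2)[OF assms(1), of "\<zero>\<^bsub>M\<^esub>" "\<zero>\<^bsub>M\<^esub>"] lmod_homD(1)[OF assms(1), of "\<zero>\<^bsub>M\<^esub>"]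
      N.add.r_cancel_one'[of "f \<zero>\<^bsub>M\<^esub>" "f \<zero>\<^bsub>M\<^esub>"] by simp
qed

text \<open>Taking weight spaces preserves exactness. For surjectivity, a preimage of a weight
  vector is corrected by an interpolation polynomial; for exactness in the middle, injectivity of f
  shows that the preimage has the same weight.\<close>

lemma wdim_exact:
  assumes M: "M \<in> wmod t" and M'': "M'' \<in> wmod t" and M': "M' \<in> wmod t"
    and ex: "short_exact (GWA t) M M'' M'"
  shows "wdim t M'' k = wdim t M k + wdim t M' k"
proof -
  interpret M: gwa_wrep M t "mod_sc t M" "mod_gen t M GenXp" "mod_gen t M GenXm" using M by (simp add: wmod_iff)
  interpret M'': gwa_wrep M'' t "mod_sc t M''" "mod_gen t M'' GenXp" "mod_gen t M'' GenXm" using M'' by (simp add: wmod_iff)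
  interpret M': gwa_wrep M' t "mod_sc t M'" "mod_gen t M' GenXp" "mod_gen t M' GenXm" using M' by (simp add: wmod_iff)
  obtain f g where f: "f \<in> lmod_hom (GWA t) M M''" and g: "g \<in> lmod_hom (GWA t) M'' M'"
    and inj: "inj_on f (carrier M)" and surj: "g ` carrier M'' = carrier M'"
    and im: "f ` carrier M = {x \<in> carrier M''. g x = \<zero>\<^bsub>M'\<^esub>}"
    using ex unfolding short_exact_def by blast
  note fD = lmod_homD[OF f] and gD = lmod_homD[OF g]
  have f0: "f \<zero>\<^bsub>M\<^esub> = \<zero>\<^bsub>M''\<^esub>" and g0: "g \<zero>\<^bsub>M''\<^esub> = \<zero>\<^bsub>M'\<^esub>"
    using lmod_hom_zero f g M.abelian_group_axioms M''.abelian_group_axioms M'.abelian_group_axioms by blast+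
  have fW: "f v \<in> M''.W k" if "v \<in> M.W k" for v
    using that fD(1)[of v] fD(3)[of v "gwa_poly t [:- of_int k, 1:]", symmetric] f0
    by (simp add: M.W_iff M''.W_iff gwa_poly_simps)
  have gW: "g v \<in> M'.W k" if "v \<in> M''.W k" for v
    using that gD(1)[of v] gD(3)[of v "gwa_poly t [:- of_int k, 1:]", symmetric] g0
    by (simp add: M''.W_iff M'.W_iff gwa_poly_simps)
  show ?thesis
  proof (rule has_dim_exact[OF M.cspace_wspace M''.cspace_wspace M'.cspace_wspace _ _ _ _ _
        has_dim_wdim[OF M] has_dim_wdim[OF M''] has_dim_wdim[OF M']])
    show "f \<in> lmod_hom CC (wspace M (mod_sc t M) k) (wspace M'' (mod_sc t M'') k)"
      using fW fD by (auto simp: lmod_hom_def hom_def gwa_poly_simps)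
    show "g \<in> lmod_hom CC (wspace M'' (mod_sc t M'') k) (wspace M' (mod_sc t M') k)"
      using gW gD by (auto simp: lmod_hom_def hom_def gwa_poly_simps)
    show "inj_on f (M.W k)" by (rule inj_on_subset[OF inj]) auto
    show "g ` M''.W k = M'.W k"
    proof
      show "M'.W k \<subseteq> g ` M''.W k"
      proof
        fix y assume y: "y \<in> M'.W k"
        then obtain x where x: "x \<in> carrier M''" "y = g x" using surj by (auto dest: M'.W_carrier)
        obtain F where F: "finite F" "mod_sc t M'' (pann F) x = \<zero>\<^bsub>M''\<^esub>" using M''.annihilated[OF x(1)] by blast
        have "g (M''.comp k x) = mod_sc t M' (lagrange F k) y"
          using x F by (simp add: M''.comp_eq gD gwa_poly_simps)
        also have "\<dots> = mod_sc t M' [:1:] y"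
          using F by (subst M'.sc_W[OF y]) (simp add: poly_lagrange)
        also have "\<dots> = y" using y by (simp add: one_pCons[symmetric])
        finally show "y \<in> g ` M''.W k" using M''.comp_W[OF x(1), of k] by (metis imageI)
      qed
    qed (use gW in auto)
    show "f ` M.W k = {x \<in> M''.W k. g x = \<zero>\<^bsub>wspace M' (mod_sc t M') k\<^esub>}"
    proof (intro subset_antisym subsetI)
      fix x assume "x \<in> f ` M.W k"
      then obtain y where y: "y \<in> M.W k" "x = f y" by blast
      then have "x \<in> f ` carrier M" by auto
      then show "x \<in> {x \<in> M''.W k. g x = \<zero>\<^bsub>wspace M' (mod_sc t M') k\<^esub>}"
        using im fW y by auto
    next
      fix x assume x: "x \<in> {x \<in> M''.W k. g x = \<zero>\<^bsub>wspace M' (mod_sc t M') k\<^esub>}"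
      then have "x \<in> f ` carrier M" using im M''.W_carrier by auto
      then obtain y where y: "y \<in> carrier M" "x = f y" by blast
      have "f (mod_sc t M [:- of_int k, 1:] y) = f \<zero>\<^bsub>M\<^esub>"
        using x y fD(3)[of y "gwa_poly t [:- of_int k, 1:]"] by (simp add: f0 M''.W_iff gwa_poly_simps)
      then have "mod_sc t M [:- of_int k, 1:] y = \<zero>\<^bsub>M\<^esub>" by (rule inj_onD[OF inj]) (use y in auto)
      then show "x \<in> f ` M.W k" using y by (auto simp: M.W_iff)
    qed
  qed
qed

subsection \<open>Separation by the roots\<close>

text \<open>Membership in the same interval between consecutive roots. It is stated without
  numbering the roots, so that for a product of polynomials it becomes a conjunction
  (\<open>sim_mult\<close>).\<close>

definition sim :: "complex poly \<Rightarrow> int \<Rightarrow> int \<Rightarrow> bool" where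
  "sim t j k \<longleftrightarrow> (\<forall>x\<in>root_set t. x < real_of_int j \<longleftrightarrow> x < real_of_int k)"

lemma sim_refl [simp]: "sim t k k" by (simp add: sim_def)
lemma sim_sym: "sim t j k \<Longrightarrow> sim t k j" by (simp add: sim_def)
lemma sim_trans: "sim t i j \<Longrightarrow> sim t j k \<Longrightarrow> sim t i k" by (simp add: sim_def)

lemma Omega_nonzero: "t \<in> Omega \<Longrightarrow> t \<noteq> 0" by (auto simp: Omega_def)

lemma Omega_root:
  assumes "t \<in> Omega" "x \<in> root_set t"
  obtains k :: int where "x = of_int k + 1/2"
proof -
  obtain k :: int where "complex_of_real x = of_int k + 1/2"
    using assms by (auto simp: Omega_def root_set_def)
  then have "Re (complex_of_real x) = Re (of_int k + 1/2)" by simp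
  then show thesis using that by simp
qed

lemma finite_root_set: "t \<in> Omega \<Longrightarrow> finite (root_set t)"
proof -
  assume "t \<in> Omega"
  then have "finite {z. poly t z = 0}" by (intro poly_roots_finite Omega_nonzero)
  then have "finite (complex_of_real ` root_set t)"
    by (rule finite_subset[rotated]) (auto simp: root_set_def)
  then show ?thesis by (rule finite_imageD) (auto intro: inj_onI)
qed

lemma root_iff: "poly t (of_int k + 1/2) = 0 \<longleftrightarrow> real_of_int k + 1/2 \<in> root_set t"
  by (simp add: root_set_def)

text \<open>All roots are half-integers, so the only one that can separate k from k + 1 is k +
  1/2.\<close>

lemma sim_Suc_iff:
  assumes "t \<in> Omega" shows "sim t k (k + 1) \<longleftrightarrow> poly t (of_int k + 1/2) \<noteq> 0"
proof
  assume "sim t k (k + 1)"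
  then show "poly t (of_int k + 1/2) \<noteq> 0" unfolding root_iff sim_def by force
next
  assume nz: "poly t (of_int k + 1/2) \<noteq> 0"
  show "sim t k (k + 1)"
    unfolding sim_def
  proof
    fix x assume x: "x \<in> root_set t"
    obtain m :: int where m: "x = of_int m + 1/2" using Omega_root[OF assms x] .
    have "m \<noteq> k" using nz x m root_iff by auto
    then show "x < real_of_int k \<longleftrightarrow> x < real_of_int (k + 1)" unfolding m by linarith
  qed
qed

lemma sim_between:
  assumes "sim t j k" "j \<le> i" "i \<le> k" shows "sim t j i"
  unfolding sim_def
proof
  fix x assume "x \<in> root_set t"
  then have "x < real_of_int j \<longleftrightarrow> x < real_of_int k" using assms(1) by (simp add: sim_def)
  moreover have "real_of_int j \<le> real_of_int i" "real_of_int i \<le> real_of_int k" using assms(2,3) by simp_all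
  ultimately show "x < real_of_int j \<longleftrightarrow> x < real_of_int i" by linarith
qed

text \<open>Intervals have no gaps, so invariance along single steps that cross no root is
  enough.\<close>

lemma sim_induct:
  assumes "sim t j k" and step: "\<And>i. sim t i (i + 1) \<Longrightarrow> f i = f (i + 1)"
  shows "f j = f k"
proof -
  have "j \<le> k \<Longrightarrow> sim t j k \<Longrightarrow> f j = f k" for j k
  proof (induction k rule: int_ge_induct)
    case (step k)
    have jk: "sim t j k" by (rule sim_between[OF step.prems]) (use step.hyps in auto)
    have "sim t k (k + 1)" by (rule sim_trans[OF sim_sym[OF jk] step.prems])
    then show ?case using step.IH[OF jk] assms(2)[of k] by simp
  qed simp
  from this[OF _ assms(1)] this[OF _ sim_sym[OF assms(1)]] show ?thesis by (metis linear)
qed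

lemma root_set_mult: "root_set (t * u) = root_set t \<union> root_set u"
  by (auto simp: root_set_def)

lemma sim_mult: "sim (t * u) j k \<longleftrightarrow> sim t j k \<and> sim u j k"
  by (auto simp: sim_def root_set_mult)

lemma Omega_mult: "t \<in> Omega \<Longrightarrow> u \<in> Omega \<Longrightarrow> t * u \<in> Omega"
  by (auto simp: Omega_def lead_coeff_mult)

lemma one_Omega: "1 \<in> Omega"
  by (simp add: Omega_def)

subsection \<open>The standard simple modules\<close>

text \<open>Functions of finite support on the interval containing k. The delta functions are a
  basis of weight vectors, one for each weight in the interval.\<close>

definition model_group :: "complex poly \<Rightarrow> int \<Rightarrow> (int \<Rightarrow> complex) ring" where
  "model_group t k = \<lparr>carrier = {c. finite {j. c j \<noteq> 0} \<and> (\<forall>j. c j \<noteq> 0 \<longrightarrow> sim t j k)},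
     monoid.mult = undefined, monoid.one = undefined, ring.zero = (\<lambda>_. 0), ring.add = (\<lambda>c d j. c j + d j)\<rparr>"

definition model_sc :: "complex poly \<Rightarrow> (int \<Rightarrow> complex) \<Rightarrow> int \<Rightarrow> complex" where
  "model_sc r c = (\<lambda>j. poly r (of_int j) * c j)"

text \<open>On basis vectors, e_j goes to e_(j+1) with coefficient 1, cut off at the right end of
  the interval.\<close>

definition model_P :: "complex poly \<Rightarrow> int \<Rightarrow> (int \<Rightarrow> complex) \<Rightarrow> int \<Rightarrow> complex" where
  "model_P t k c = (\<lambda>j. if sim t j k then c (j - 1) else 0)"

text \<open>With P normalized to coefficient 1, Q carries the whole factor: e_(j+1) goes to t(j +
  1/2) e_j. A cut-off at the left end is built in, because this factor vanishes on an edge that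
  leaves the interval.\<close>

definition model_Q :: "complex poly \<Rightarrow> (int \<Rightarrow> complex) \<Rightarrow> int \<Rightarrow> complex" where
  "model_Q t c = (\<lambda>j. poly t (of_int j + 1/2) * c (j + 1))"

lemma model_group_simps [simp]:
  "c \<in> carrier (model_group t k) \<longleftrightarrow> finite {j. c j \<noteq> 0} \<and> (\<forall>j. c j \<noteq> 0 \<longrightarrow> sim t j k)"
  "\<zero>\<^bsub>model_group t k\<^esub> = (\<lambda>_. 0)" "c \<oplus>\<^bsub>model_group t k\<^esub> d = (\<lambda>j. c j + d j)"
  by (simp_all add: model_group_def)

lemma model_rep:
  assumes t: "t \<in> Omega"
  shows "gwa_rep (model_group t k) t model_sc (model_P t k) (model_Q t)"
proof -
  have fin: "finite {j. c j + d j \<noteq> 0}" if "finite {j. c j \<noteq> 0}" "finite {j. d j \<noteq> 0}" for c d :: "int \<Rightarrow> complex"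
    by (rule finite_subset[OF _ finite_UnI[OF that]]) auto
  have "abelian_group (model_group t k)"
  proof (rule abelian_groupI)
    show "\<exists>y\<in>carrier (model_group t k). y \<oplus>\<^bsub>model_group t k\<^esub> x = \<zero>\<^bsub>model_group t k\<^esub>"
      if "x \<in> carrier (model_group t k)" for x
      using that by (intro bexI[of _ "\<lambda>j. - x j"]) auto
    show "x \<oplus>\<^bsub>model_group t k\<^esub> y \<in> carrier (model_group t k)"
      if "x \<in> carrier (model_group t k)" "y \<in> carrier (model_group t k)" for x y
      using that by (auto simp: fin) (metis add.right_neutral)
  qed (auto simp: algebra_simps)
  then interpret abelian_group "model_group t k" .
  have P: "model_P t k c \<in> carrier (model_group t k)" if c: "c \<in> carrier (model_group t k)" for c
  proof -
    have "{j. model_P t k c j \<noteq> 0} \<subseteq> (\<lambda>j. j + 1) ` {j. c j \<noteq> 0}"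
      by (auto simp: model_P_def image_iff intro!: exI[of _ "_ - 1"])
    then show ?thesis using c finite_surj by (auto simp: model_P_def split: if_splits)
  qed
  have Q: "model_Q t c \<in> carrier (model_group t k)" if c: "c \<in> carrier (model_group t k)" for c
  proof -
    have "{j. model_Q t c j \<noteq> 0} \<subseteq> (\<lambda>j. j - 1) ` {j. c j \<noteq> 0}"
      by (auto simp: model_Q_def image_iff intro!: exI[of _ "_ + 1"])
    moreover have "sim t j k" if "model_Q t c j \<noteq> 0" for j
      using that c sim_Suc_iff[OF t, of j] sim_trans[of t j "j + 1" k] by (auto simp: model_Q_def)
    ultimately show ?thesis using c finite_surj by auto
  qed
  \<comment> \<open>If j is in the interval and j + 1 is not, then j + 1/2 is a root, so the
    truncation inside P is absorbed by the factor.\<close>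
  have qp: "poly t (of_int j + 1/2) * (if sim t (j + 1) k then c j else 0) = poly t (of_int j + 1/2) * c j"
    if "c \<in> carrier (model_group t k)" for c j
    using that sim_Suc_iff[OF t, of j] sim_trans[of t "j + 1" j k] sim_sym[of t j "j + 1"] by auto
  show ?thesis
  \<comment> \<open>The numbered cases are closure under \<open>sc\<close> (1), P (6) and Q (9), and
    the two product relations PQ (12) and QP (13).\<close>
  proof (unfold_locales, goal_cases)
    case (1 v r)
    have "{j. model_sc r v j \<noteq> 0} \<subseteq> {j. v j \<noteq> 0}" by (auto simp: model_sc_def)
    then show ?case using 1 finite_subset by (auto simp: model_sc_def)
  next
    case (6 v) then show ?case by (rule P)
  next
    case (9 v) then show ?case by (rule Q)
  next
    case (12 v)
    have "complex_of_int (j - 1) + 1/2 = of_int j - 1/2" for j by simp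
    then show ?case
      using 12 by (auto simp: fun_eq_iff model_sc_def model_P_def model_Q_def shift_def poly_pcompose)
  next
    case (13 v)
    have "model_Q t (model_P t k v) = (\<lambda>j. poly t (of_int j + 1/2) * (if sim t (j + 1) k then v j else 0))"
      by (simp add: fun_eq_iff model_P_def model_Q_def)
    also have "\<dots> = (\<lambda>j. poly t (of_int j + 1/2) * v j)" by (simp only: qp[OF 13])
    finally show ?case by (simp add: model_sc_def shift_def poly_pcompose add.commute)
  qed (auto simp: model_sc_def model_P_def model_Q_def shift_def poly_pcompose algebra_simps)
qed

lemma model_W:
  assumes "t \<in> Omega"
  shows "c \<in> carrier (wspace (model_group t k) model_sc j) \<longleftrightarrow>
    (\<forall>i. i \<noteq> j \<longrightarrow> c i = 0) \<and> (c j \<noteq> 0 \<longrightarrow> sim t j k)"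
proof -
  interpret gwa_rep "model_group t k" t model_sc "model_P t k" "model_Q t" by (rule model_rep[OF assms])
  have fin: "finite {i. c i \<noteq> 0}" if "\<forall>i. i \<noteq> j \<longrightarrow> c i = 0"
    by (rule finite_subset[of _ "{j}"]) (use that in auto)
  have "(\<lambda>i. poly [:- of_int j, 1:] (of_int i) * c i) = (\<lambda>_. 0) \<longleftrightarrow> (\<forall>i. i \<noteq> j \<longrightarrow> c i = 0)"
    by (auto simp: fun_eq_iff)
  then show ?thesis unfolding W_iff using fin by (auto simp: model_sc_def)
qed

lemma model_dim:
  assumes "t \<in> Omega"
  shows "has_dim (wspace (model_group t k) model_sc j) (if sim t j k then 1 else 0)"
proof -
  interpret gwa_rep "model_group t k" t model_sc "model_P t k" "model_Q t" by (rule model_rep[OF assms])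
  interpret V: cspace "wspace (model_group t k) model_sc j" by (rule cspace_wspace)
  \<comment> \<open>An index set with one element or none treats both values of the dimension at
    once.\<close>
  let ?I = "if sim t j k then {()} else {}"
  let ?e = "\<lambda>i. if i = j then 1 else 0 :: complex"
  have "dual_basis (wspace (model_group t k) model_sc j) ?I (\<lambda>_. ?e) (\<lambda>_ c. c j)"
    unfolding dual_basis_def
  proof (intro conjI ballI)
    fix c assume c: "c \<in> W j"
    then have "c = (\<lambda>i. c j * ?e i)" unfolding model_W[OF assms] by (intro ext) auto
    then have "sim t j k \<Longrightarrow> c = model_sc [:c j:] ?e" by (simp add: model_sc_def)
    moreover have "?e \<in> W j" if "sim t j k" using that by (simp add: model_W[OF assms])
    moreover have "c = (\<lambda>_. 0)" if "\<not> sim t j k"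
      using c that unfolding model_W[OF assms] by force
    ultimately show "c = (\<Oplus>\<^bsub>wspace (model_group t k) model_sc j\<^esub>i\<in>?I. c j \<odot>\<^bsub>wspace (model_group t k) model_sc j\<^esub> ?e)"
      using W_closed(3)[of ?e j] c by (cases "sim t j k") (simp_all add: V.M.finsum_insert Pi_iff)
  qed (auto simp: model_W[OF assms] lin_form_def model_sc_def split: if_splits)
  from V.dual_basis_imp_has_dim[OF this] show ?thesis by (simp split: if_splits)
qed

lemma model_wrep:
  assumes "t \<in> Omega"
  shows "gwa_wrep (model_group t k) t model_sc (model_P t k) (model_Q t)"
proof -
  interpret gwa_rep "model_group t k" t model_sc "model_P t k" "model_Q t" by (rule model_rep[OF assms])
  show ?thesis
  proof
    fix c assume c: "c \<in> carrier (model_group t k)"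
    have "poly (pann {j. c j \<noteq> 0}) (of_int j) * c j = 0" for j
      using c by (auto simp: poly_pann intro!: prod_zero)
    then show "\<exists>F. finite F \<and> model_sc (pann F) c = \<zero>\<^bsub>model_group t k\<^esub>"
      using c by (intro exI[of _ "{j. c j \<noteq> 0}"]) (auto simp: model_sc_def)
  qed (use model_dim[OF assms] in blast)
qed

definition is_model :: "complex poly \<Rightarrow> int \<Rightarrow> gmod \<Rightarrow> ((int \<Rightarrow> complex) \<Rightarrow> univ) \<Rightarrow> bool" where
  "is_model t k S h \<longleftrightarrow> S \<in> wmod t \<and> bij_betw h (carrier (model_group t k)) (carrier S) \<and>
     (\<forall>c\<in>carrier (model_group t k).
        (\<forall>d\<in>carrier (model_group t k). h (\<lambda>j. c j + d j) = h c \<oplus>\<^bsub>S\<^esub> h d) \<and>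
        (\<forall>r. h (model_sc r c) = mod_sc t S r (h c)) \<and>
        h (model_P t k c) = mod_gen t S GenXp (h c) \<and> h (model_Q t c) = mod_gen t S GenXm (h c))"

text \<open>A bijection between integers and naturals turns finitely supported functions on the
  integers into elements of \<open>univ\<close>, so the standard module has a copy among the
  objects.\<close>

lemma model_exists:
  assumes t: "t \<in> Omega" obtains S h where "is_model t k S h"
proof -
  define h :: "(int \<Rightarrow> complex) \<Rightarrow> univ" where "h c = Abs_poly_mapping (\<lambda>n. c (int_decode n))" for c
  have look: "poly_mapping.lookup (h c) n = c (int_decode n)" if "c \<in> carrier (model_group t k)" for c n
  proof -
    have "{n. c (int_decode n) \<noteq> 0} \<subseteq> int_encode ` {j. c j \<noteq> 0}"
      by (auto simp: image_iff) (metis int_decode_inverse)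
    then have "finite {n. c (int_decode n) \<noteq> 0}" using that finite_surj by auto
    then show ?thesis unfolding h_def by (simp add: Abs_poly_mapping_inverse)
  qed
  have inj: "inj_on h (carrier (model_group t k))"
  proof (rule inj_onI)
    fix c d assume cd: "c \<in> carrier (model_group t k)" "d \<in> carrier (model_group t k)" "h c = h d"
    have "c j = d j" for j
      using look[OF cd(1), of "int_encode j"] look[OF cd(2), of "int_encode j"] cd(3) by simp
    then show "c = d" by auto
  qed
  obtain S where S: "S \<in> wmod t" "h ` carrier (model_group t k) = carrier S" "h \<zero>\<^bsub>model_group t k\<^esub> = \<zero>\<^bsub>S\<^esub>"
    "\<And>v w. v \<in> carrier (model_group t k) \<Longrightarrow> w \<in> carrier (model_group t k) \<Longrightarrow> h (v \<oplus>\<^bsub>model_group t k\<^esub> w) = h v \<oplus>\<^bsub>S\<^esub> h w"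
    "\<And>r v. v \<in> carrier (model_group t k) \<Longrightarrow> h (model_sc r v) = mod_sc t S r (h v)"
    "\<And>v. v \<in> carrier (model_group t k) \<Longrightarrow> h (model_P t k v) = mod_gen t S GenXp (h v)"
    "\<And>v. v \<in> carrier (model_group t k) \<Longrightarrow> h (model_Q t v) = mod_gen t S GenXm (h v)"
    by (rule wmod_realize[where f = h, OF model_wrep[OF t, of k]]) (auto dest!: inj_onD[OF inj] simp del: model_group_simps)
  have "is_model t k S h"
    unfolding is_model_def bij_betw_def
    using S inj by (simp del: model_group_simps(1))
  then show thesis by (rule that)
qed

section \<open>Embedding a standard module into a nonzero weight module\<close>

context gwa_wrep
begin

lemma P_funpow_W: "v \<in> W k \<Longrightarrow> (P ^^ n) v \<in> W (k + int n)"
  by (induction n) (use P_W in \<open>force simp: algebra_simps\<close>)+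

lemma Q_funpow_W: "v \<in> W k \<Longrightarrow> (Q ^^ n) v \<in> W (k - int n)"
proof (induction n)
  case (Suc n)
  then show ?case using Q_W[of "(Q ^^ n) v" "k - int n"] by (simp add: algebra_simps)
qed simp

text \<open>Follow \<open>P\<close> across the roots as far to the right as possible, then \<open>Q\<close> as far to the left as
  possible; crossing a root by \<open>Q\<close> lands in the kernel of \<open>P\<close>, so the first property survives.\<close>

lemma extremal_weight_vector:
  assumes t: "t \<in> Omega" and nz: "carrier M \<noteq> {\<zero>}"
  obtains k v where "v \<in> W k" "v \<noteq> \<zero>"
    "\<And>n. poly t (of_int (k + int n) + 1/2) = 0 \<Longrightarrow> (P ^^ Suc n) v = \<zero>"
    "\<And>n. poly t (of_int (k - int n - 1) + 1/2) = 0 \<Longrightarrow> (Q ^^ Suc n) v = \<zero>"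
proof -
  have fin: "finite (root_set t)" by (rule finite_root_set[OF t])
  define A where "A = {(k, v). v \<in> W k \<and> v \<noteq> \<zero>}"
  obtain w where "w \<in> carrier M" "w \<noteq> \<zero>" using nz by blast
  then have ex: "\<exists>p. p \<in> A" using nonzero_weight_vector unfolding A_def by (metis (mono_tags, lifting) case_prodI comp_W mem_Collect_eq)
  \<comment> \<open>The number of roots to the right of the weight measures how far the vector has
    moved. At the minimum, a power of P that crosses a further root must give zero.\<close>
  obtain p where p: "p \<in> A" "\<And>q. q \<in> A \<Longrightarrow> card {x\<in>root_set t. x > of_int (fst p)} \<le> card {x\<in>root_set t. x > of_int (fst q)}"
    using ex_has_least_nat[of "\<lambda>p. p \<in> A" _ "\<lambda>p. card {x\<in>root_set t. x > of_int (fst p)}"] ex by blast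
  define B where "B = {(k, v). (k, v) \<in> A \<and> (\<forall>n. poly t (of_int (k + int n) + 1/2) = 0 \<longrightarrow> (P ^^ Suc n) v = \<zero>)}"
  have "p \<in> B"
  proof -
    obtain k v where kv: "p = (k, v)" by fastforce
    have "(P ^^ Suc n) v = \<zero>" if root: "poly t (of_int (k + int n) + 1/2) = 0" for n
    proof (rule ccontr)
      assume "(P ^^ Suc n) v \<noteq> \<zero>"
      moreover have "(P ^^ Suc n) v \<in> W (k + int (Suc n))" by (rule P_funpow_W) (use p kv A_def in auto)
      ultimately have "(k + int (Suc n), (P ^^ Suc n) v) \<in> A" unfolding A_def by blast
      from p(2)[OF this] have "card {x\<in>root_set t. x > of_int k} \<le> card {x\<in>root_set t. x > of_int (k + int (Suc n))}"
        by (simp add: kv)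
      moreover have "card {x\<in>root_set t. x > of_int (k + int (Suc n))} < card {x\<in>root_set t. x > of_int k}"
      proof (rule psubset_card_mono)
        have "real_of_int (k + int n) + 1/2 \<in> {x\<in>root_set t. x > of_int k}"
          using root root_iff[of t "k + int n"] by simp
        moreover have "real_of_int (k + int n) + 1/2 \<notin> {x\<in>root_set t. x > of_int (k + int (Suc n))}" by simp
        moreover have "{x\<in>root_set t. x > of_int (k + int (Suc n))} \<subseteq> {x\<in>root_set t. x > of_int k}" by auto
        ultimately show "{x\<in>root_set t. x > of_int (k + int (Suc n))} \<subset> {x\<in>root_set t. x > of_int k}" by blast
      qed (use fin in simp)
      ultimately show False by simp
    qed
    then show ?thesis using p(1) unfolding B_def kv by blast
  qed
  then obtain q where q: "q \<in> B" "\<And>r. r \<in> B \<Longrightarrow> card {x\<in>root_set t. x < of_int (fst q)} \<le> card {x\<in>root_set t. x < of_int (fst r)}"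
    using ex_has_least_nat[of "\<lambda>p. p \<in> B" p "\<lambda>p. card {x\<in>root_set t. x < of_int (fst p)}"] by blast
  obtain k v where kv: "q = (k, v)" by fastforce
  have v: "v \<in> W k" "v \<noteq> \<zero>" using q(1) by (auto simp: B_def A_def kv)
  have R: "(P ^^ Suc n) v = \<zero>" if "poly t (of_int (k + int n) + 1/2) = 0" for n
    using q(1) that unfolding B_def kv by blast
  have L: "(Q ^^ Suc n) v = \<zero>" if root: "poly t (of_int (k - int n - 1) + 1/2) = 0" for n
  proof (rule ccontr)
    let ?u = "(Q ^^ Suc n) v"
    assume "?u \<noteq> \<zero>"
    moreover have "?u \<in> W (k - int (Suc n))" by (rule Q_funpow_W[OF v(1)])
    ultimately have "(k - int (Suc n), ?u) \<in> A" unfolding A_def by blast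
    moreover have "P ?u = \<zero>"
    proof -
      have "P ?u = sc [:poly t (of_int (k - int n) - 1/2):] ((Q ^^ n) v)"
        using PQ_W[OF Q_funpow_W[OF v(1), of n]] by simp
      also have "complex_of_int (k - int n) - 1/2 = of_int (k - int n - 1) + 1/2" by simp
      finally show ?thesis using W_carrier[OF Q_funpow_W[OF v(1), of n]] root by simp
    qed
    then have "(P ^^ Suc m) ?u = \<zero>" for m
    proof -
      have "(P ^^ m) \<zero> = \<zero>" by (induction m) auto
      then show ?thesis using \<open>P ?u = \<zero>\<close> by (simp only: funpow_Suc_right comp_def o_apply)
    qed
    ultimately have "(k - int (Suc n), ?u) \<in> B" unfolding B_def by blast
    from q(2)[OF this] have "card {x\<in>root_set t. x < of_int k} \<le> card {x\<in>root_set t. x < of_int (k - int (Suc n))}"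
      by (simp add: kv)
    moreover have "card {x\<in>root_set t. x < of_int (k - int (Suc n))} < card {x\<in>root_set t. x < of_int k}"
    proof (rule psubset_card_mono)
      have "real_of_int (k - int n - 1) + 1/2 \<in> {x\<in>root_set t. x < of_int k}" using root root_iff[of t "k - int n - 1"] by simp
      moreover have "real_of_int (k - int n - 1) + 1/2 \<notin> {x\<in>root_set t. x < of_int (k - int (Suc n))}" by simp
      moreover have "{x\<in>root_set t. x < of_int (k - int (Suc n))} \<subseteq> {x\<in>root_set t. x < of_int k}" by auto
      ultimately show "{x\<in>root_set t. x < of_int (k - int (Suc n))} \<subset> {x\<in>root_set t. x < of_int k}" by blast
    qed (use fin in simp)
    ultimately show False by simp
  qed
  show thesis by (rule that[OF v R L])
qed

text \<open>The string follows P to the right of the extremal vector and rescaled Q to the left. The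
  scaling matches the standard module: coefficient 1 for P, the value of t for Q. The vanishing
  properties of the extremal vector are what make the relations hold at the roots.\<close>

lemma weight_string:
  assumes t: "t \<in> Omega" and nz: "carrier M \<noteq> {\<zero>}"
  obtains k u where "\<And>j. u j \<in> W j"
    "\<And>j. P (u j) = (if poly t (of_int j + 1/2) = 0 then \<zero> else u (j + 1))"
    "\<And>j. Q (u (j + 1)) = sc [:poly t (of_int j + 1/2):] (u j)"
    "\<And>j. sim t j k \<Longrightarrow> u j \<noteq> \<zero>"
proof -
  obtain k v where v: "v \<in> W k" "v \<noteq> \<zero>"
    and R: "\<And>n. poly t (of_int (k + int n) + 1/2) = 0 \<Longrightarrow> (P ^^ Suc n) v = \<zero>"
    and L: "\<And>n. poly t (of_int (k - int n - 1) + 1/2) = 0 \<Longrightarrow> (Q ^^ Suc n) v = \<zero>"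
    by (rule extremal_weight_vector[OF t nz]) (rule that)
  \<comment> \<open>At a root the inverse is \<open>inverse 0 = 0\<close>, so the string is zero
    from there on to the left, as required.\<close>
  define dn where "dn = rec_nat v (\<lambda>n w. sc [:inverse (poly t (of_int (k - int n - 1) + 1/2)):] (Q w))"
  have dn0: "dn 0 = v" and dnS: "dn (Suc n) = sc [:inverse (poly t (of_int (k - int n - 1) + 1/2)):] (Q (dn n))" for n
    by (simp_all add: dn_def)
  have dn_W: "dn n \<in> W (k - int n)" for n
  proof (induction n)
    case (Suc n)
    then show ?case using Q_W[OF Suc] by (simp add: dnS algebra_simps W_closed(3))
  qed (simp add: dn0 v)
  have dn_Q: "\<exists>c. dn n = sc [:c:] ((Q ^^ n) v)" for n
  proof (induction n)
    case 0
    show ?case using v by (intro exI[of _ 1]) (simp add: dn0 one_pCons[symmetric])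
  next
    case (Suc n)
    then obtain c where c: "dn n = sc [:c:] ((Q ^^ n) v)" by blast
    have qc: "(Q ^^ n) v \<in> carrier M" using Q_funpow_W[OF v(1)] by blast
    let ?d = "inverse (poly t (of_int (k - int n - 1) + 1/2))"
    have "dn (Suc n) = sc ([:?d:] * [:c:]) ((Q ^^ Suc n) v)"
      using qc by (simp only: dnS c Q_const sc_mult Q_closed funpow.simps o_apply)
    then show ?case by auto
  qed
  define u where "u j = (if k \<le> j then (P ^^ nat (j - k)) v else dn (nat (k - j)))" for j
  have up: "u (k + int n) = (P ^^ n) v" for n by (simp add: u_def)
  have down: "u (k - int n) = dn n" for n by (cases "n = 0") (simp_all add: u_def dn0)
  have uW: "u j \<in> W j" for j
  proof (cases "k \<le> j")
    case True
    then show ?thesis using P_funpow_W[OF v(1), of "nat (j - k)"] by (simp add: u_def)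
  next
    case False
    then show ?thesis using dn_W[of "nat (k - j)"] by (simp add: u_def)
  qed
  have right: "P (u j) = u (j + 1) \<and> (poly t (of_int j + 1/2) = 0 \<longrightarrow> u (j + 1) = \<zero>)" if "k \<le> j" for j
  proof -
    define n where "n = nat (j - k)"
    have n: "j = k + int n" using that by (simp add: n_def)
    have u1: "u (j + 1) = (P ^^ Suc n) v" using up[of "Suc n"] by (simp add: n ac_simps)
    then have "P (u j) = u (j + 1)" using up[of n] by (simp add: n)
    moreover have "u (j + 1) = \<zero>" if "poly t (of_int j + 1/2) = 0"
      unfolding u1 by (rule R) (use that in \<open>simp only: n\<close>)
    ultimately show ?thesis by blast
  qed
  have left: "u j = sc [:inverse (poly t (of_int j + 1/2)):] (Q (u (j + 1))) \<and>
      (poly t (of_int j + 1/2) = 0 \<longrightarrow> Q (u (j + 1)) = \<zero>)" if "j < k" for j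
  proof -
    define n where "n = nat (k - j - 1)"
    have n: "j = k - int n - 1" using that by (simp add: n_def)
    have "u j = dn (Suc n)" using down[of "Suc n"] by (simp add: n algebra_simps)
    moreover have u1: "u (j + 1) = dn n" using down[of n] by (simp add: n)
    moreover have "Q (dn n) = \<zero>" if root: "poly t (of_int j + 1/2) = 0"
    proof -
      obtain c where c: "dn n = sc [:c:] ((Q ^^ n) v)" using dn_Q by blast
      have "Q (dn n) = sc [:c:] ((Q ^^ Suc n) v)"
        using W_carrier[OF Q_funpow_W[OF v(1), of n]] by (simp add: c Q_const)
      also have "(Q ^^ Suc n) v = \<zero>" by (rule L) (use root in \<open>simp only: n\<close>)
      finally show ?thesis by simp
    qed
    ultimately show ?thesis using dnS[of n] unfolding n by metis
  qed
  have Pu: "P (u j) = (if poly t (of_int j + 1/2) = 0 then \<zero> else u (j + 1))" for j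
  proof (cases "k \<le> j")
    case True
    then show ?thesis using right by auto
  next
    case False
    let ?t = "poly t (of_int j + 1/2)"
    have c: "u (j + 1) \<in> carrier M" using uW by blast
    have "u j = sc [:inverse ?t:] (Q (u (j + 1)))" using left[of j] False by auto
    then have "P (u j) = sc [:inverse ?t:] (P (Q (u (j + 1))))" using c by (simp add: P_const)
    also have "P (Q (u (j + 1))) = sc [:?t:] (u (j + 1))" using PQ_W[OF uW[of "j + 1"]] by (simp add: add.commute)
    also have "sc [:inverse ?t:] (sc [:?t:] (u (j + 1))) = sc [:inverse ?t * ?t:] (u (j + 1))"
      using c by (simp add: sc_mult[symmetric] mult.commute)
    finally show ?thesis using c by (auto simp: one_pCons[symmetric])
  qed
  have Qu: "Q (u (j + 1)) = sc [:poly t (of_int j + 1/2):] (u j)" for j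
  proof (cases "k \<le> j")
    case True
    then have "P (u j) = u (j + 1)" using right by blast
    then show ?thesis using QP_W[OF uW[of j]] by simp
  next
    case False
    let ?t = "poly t (of_int j + 1/2)"
    have c: "Q (u (j + 1)) \<in> carrier M" "u j \<in> carrier M" using uW by blast+
    show ?thesis
    proof (cases "?t = 0")
      case True
      then show ?thesis using left[of j] False c by simp
    next
      case nz: False
      have "sc [:?t:] (u j) = sc [:?t:] (sc [:inverse ?t:] (Q (u (j + 1))))" using left[of j] False by simp
      also have "\<dots> = sc [:?t * inverse ?t:] (Q (u (j + 1)))"
        using c by (simp add: sc_mult[symmetric] mult.commute)
      finally show ?thesis using nz c by (simp add: one_pCons[symmetric])
    qed
  qed
  have u0: "u j \<noteq> \<zero>" if "sim t j k" for j
  proof -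
    \<comment> \<open>Inside the interval each step has a nonzero value of t, so u_i and u_(i+1)
      vanish together and nonvanishing spreads from v.\<close>
    have "(u j = \<zero>) = (u k = \<zero>)"
      using that
    proof (rule sim_induct)
      fix i assume "sim t i (i + 1)"
      then have nz: "poly t (of_int i + 1/2) \<noteq> 0" using sim_Suc_iff[OF t] by simp
      show "(u i = \<zero>) = (u (i + 1) = \<zero>)"
        using Pu[of i] Qu[of i] nz sc_const_eq_zero[of "u i" "poly t (of_int i + 1/2)"] W_carrier[OF uW[of i]]
        by auto
    qed
    then show ?thesis using v by (simp add: u_def)
  qed
  show thesis by (rule that[OF uW Pu Qu u0])
qed

text \<open>The map sends c to the sum of the c_j u_j. Every identity is checked weight by weight,
  where it reduces to one about the string; injectivity holds because u_j is nonzero throughout the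
  interval.\<close>

lemma model_embedding:
  assumes t: "t \<in> Omega" and nz: "carrier M \<noteq> {\<zero>}"
  obtains k f where "inj_on f (carrier (model_group t k))"
    "\<And>c. c \<in> carrier (model_group t k) \<Longrightarrow> f c \<in> carrier M"
    "\<And>c d. c \<in> carrier (model_group t k) \<Longrightarrow> d \<in> carrier (model_group t k) \<Longrightarrow> f (\<lambda>j. c j + d j) = f c \<oplus> f d"
    "\<And>r c. c \<in> carrier (model_group t k) \<Longrightarrow> f (model_sc r c) = sc r (f c)"
    "\<And>c. c \<in> carrier (model_group t k) \<Longrightarrow> f (model_P t k c) = P (f c)"
    "\<And>c. c \<in> carrier (model_group t k) \<Longrightarrow> f (model_Q t c) = Q (f c)"
proof -
  obtain k u where uW: "\<And>j. u j \<in> W j"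
    and Pu: "\<And>j. P (u j) = (if poly t (of_int j + 1/2) = 0 then \<zero> else u (j + 1))"
    and Qu: "\<And>j. Q (u (j + 1)) = sc [:poly t (of_int j + 1/2):] (u j)"
    and u0: "\<And>j. sim t j k \<Longrightarrow> u j \<noteq> \<zero>"
    by (rule weight_string[OF assms]) (rule that)
  have uc: "u j \<in> carrier M" for j using uW by blast
  interpret X: gwa_wrep "model_group t k" t model_sc "model_P t k" "model_Q t" by (rule model_wrep[OF t])
  define f where "f c = (\<Oplus>j\<in>{j. c j \<noteq> 0}. sc [:c j:] (u j))" for c :: "int \<Rightarrow> complex"
  have fc: "f c \<in> carrier M" for c unfolding f_def by (rule finsum_closed) (use uc in auto)
  have comp_f: "comp j (f c) = sc [:c j:] (u j)" if "finite {j. c j \<noteq> 0}" for c j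
    unfolding f_def using uc by (subst comp_finsum[OF that]) (auto simp: uW)
  have two: "sc [:a:] (sc [:b:] (u j)) = sc [:a * b:] (u j)" for a b j
    using uc by (simp add: sc_mult[symmetric] mult.commute)
  have "inj_on f (carrier (model_group t k))"
  proof (rule inj_onI)
    fix c d assume cd: "c \<in> carrier (model_group t k)" "d \<in> carrier (model_group t k)" "f c = f d"
    have "c j = d j" for j
    proof (rule ccontr)
      assume ne: "c j \<noteq> d j"
      have "sim t j k" using ne cd by (cases "c j = 0") auto
      have "sc [:c j:] (u j) = sc [:d j:] (u j)" using cd comp_f[of c j] comp_f[of d j] by simp
      moreover have "sc [:c j:] (u j) = sc [:c j - d j:] (u j) \<oplus> sc [:d j:] (u j)"
        using uc by (simp add: sc_ladd[symmetric])
      ultimately have "sc [:c j - d j:] (u j) = \<zero>" using uc by simp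
      then show False using sc_const_eq_zero[OF uc] ne u0[OF \<open>sim t j k\<close>] by auto
    qed
    then show "c = d" by auto
  qed
  moreover have "f (\<lambda>j. c j + d j) = f c \<oplus> f d" if "c \<in> carrier (model_group t k)" "d \<in> carrier (model_group t k)" for c d
  proof (rule comp_eqI)
    have fin: "finite {j. c j + d j \<noteq> 0}" using X.a_closed[OF that] by simp
    show "comp j (f (\<lambda>j. c j + d j)) = comp j (f c \<oplus> f d)" for j
      using that fc uc by (simp add: comp_f[OF fin] comp_f comp_add sc_ladd[symmetric])
  qed (use fc in auto)
  moreover have "f (model_sc r c) = sc r (f c)" if c: "c \<in> carrier (model_group t k)" for r c
  proof (rule comp_eqI)
    have fin: "finite {j. model_sc r c j \<noteq> 0}" using X.sc_closed[OF c] by simp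
    show "comp j (f (model_sc r c)) = comp j (sc r (f c))" for j
      using c fc sc_W[of "sc [:c j:] (u j)" j r] uW
      by (simp add: comp_f[OF fin] comp_f comp_sc W_closed(3) two) (simp add: model_sc_def)
  qed (use fc in auto)
  moreover have "f (model_P t k c) = P (f c)" if c: "c \<in> carrier (model_group t k)" for c
  proof (rule comp_eqI)
    have fin: "finite {j. model_P t k c j \<noteq> 0}" using X.P_closed[OF c] by simp
    fix j
    have "comp j (P (f c)) = P (sc [:c (j - 1):] (u (j - 1)))"
      using comp_P[OF fc, of "j - 1" c] comp_f[of c "j - 1"] c by simp
    also have "\<dots> = sc [:c (j - 1):] (P (u (j - 1)))" using uc by (simp add: P_const)
    also have "\<dots> = sc [:model_P t k c j:] (u j)"
    proof (cases "c (j - 1) = 0")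
      case True
      then show ?thesis using uc by (simp add: model_P_def)
    next
      case False
      then have "sim t (j - 1) k" using c by simp
      \<comment> \<open>As j - 1 lies in the interval, j lies there exactly if the edge between them
        is not a root. So the truncation in \<open>model_P\<close> matches the case distinction for
        P on the string.\<close>
      then have "sim t j k \<longleftrightarrow> sim t (j - 1) (j - 1 + 1)"
        using sim_trans[of t j k "j - 1"] sim_trans[of t j "j - 1" k] sim_sym by (metis diff_add_cancel)
      then show ?thesis
        using Pu[of "j - 1"] uc sim_Suc_iff[OF t, of "j - 1"] by (auto simp: model_P_def)
    qed
    finally show "comp j (f (model_P t k c)) = comp j (P (f c))" by (simp add: comp_f[OF fin])
  qed (use fc in auto)
  moreover have "f (model_Q t c) = Q (f c)" if c: "c \<in> carrier (model_group t k)" for c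
  proof (rule comp_eqI)
    have fin: "finite {j. model_Q t c j \<noteq> 0}" using X.Q_closed[OF c] by simp
    fix j
    have "comp j (Q (f c)) = Q (sc [:c (j + 1):] (u (j + 1)))"
      using comp_Q[OF fc, of "j + 1" c] comp_f[of c "j + 1"] c by simp
    also have "\<dots> = sc [:c (j + 1):] (sc [:poly t (of_int j + 1/2):] (u j))" using uc Qu[of j] by (simp add: Q_const)
    also have "\<dots> = sc [:model_Q t c j:] (u j)" by (simp add: two) (simp add: model_Q_def mult.commute)
    finally show "comp j (f (model_Q t c)) = comp j (Q (f c))" by (simp add: comp_f[OF fin])
  qed (use fc in auto)
  ultimately show thesis using that[of f k] fc by blast
qed

end

section \<open>Dimension functions of simple objects\<close>

lemma model_cong:
  assumes "sim t k k'" shows "model_group t k = model_group t k'" "model_P t k = model_P t k'"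
proof -
  have "sim t j k \<longleftrightarrow> sim t j k'" for j using assms sim_trans sim_sym by metis
  then show "model_group t k = model_group t k'" "model_P t k = model_P t k'"
    by (simp_all add: model_group_def model_P_def fun_eq_iff)
qed

lemma is_model_cong: "sim t k k' \<Longrightarrow> is_model t k S h \<longleftrightarrow> is_model t k' S h"
  by (simp only: is_model_def model_cong)

text \<open>X may live on any type, so dimensions computed for function models and for tensor groups
  transfer to their copies in \<open>univ\<close>.\<close>

lemma iso_wdim:
  fixes X :: "('v, 'm) ring_scheme"
  assumes X: "gwa_wrep X t sc P Q" and S: "S \<in> wmod t" and bij: "bij_betw h (carrier X) (carrier S)"
    and add: "\<And>c d. c \<in> carrier X \<Longrightarrow> d \<in> carrier X \<Longrightarrow> h (c \<oplus>\<^bsub>X\<^esub> d) = h c \<oplus>\<^bsub>S\<^esub> h d"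
    and sc: "\<And>r c. c \<in> carrier X \<Longrightarrow> h (sc r c) = mod_sc t S r (h c)"
    and dim: "has_dim (wspace X sc j) n"
  shows "wdim t S j = n"
proof -
  interpret X: gwa_wrep X t sc P Q by (rule X)
  interpret gwa_wrep S t "mod_sc t S" "mod_gen t S GenXp" "mod_gen t S GenXm" using S by (simp add: wmod_iff)
  let ?g = "the_inv_into (carrier X) h"
  have inj: "inj_on h (carrier X)" using bij by (simp add: bij_betw_def)
  have gh: "?g (h c) = c" if "c \<in> carrier X" for c using the_inv_into_f_f[OF inj that] .
  have hg: "h (?g v) = v" "?g v \<in> carrier X" if "v \<in> carrier S" for v
  proof -
    have "v \<in> h ` carrier X" using that bij by (simp only: bij_betw_def)
    then show "h (?g v) = v" "?g v \<in> carrier X"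
      by (rule f_the_inv_into_f[OF inj], rule the_inv_into_into[OF inj _ subset_refl])
  qed
  have hD: "h (c \<oplus>\<^bsub>X\<^esub> d) = h c \<oplus>\<^bsub>S\<^esub> h d" "h (sc r c) = mod_sc t S r (h c)" "h c \<in> carrier S"
    if "c \<in> carrier X" "d \<in> carrier X" for c d r
    using add[OF that] sc[OF that(1)] bij_betwE[OF bij] that by blast+
  have h0: "h \<zero>\<^bsub>X\<^esub> = \<zero>\<^bsub>S\<^esub>"
    using hD(1)[OF X.zero_closed X.zero_closed] hD(3)[OF X.zero_closed X.zero_closed]
      add.r_cancel_one'[of "h \<zero>\<^bsub>X\<^esub>" "h \<zero>\<^bsub>X\<^esub>"] by (simp only: X.l_zero X.zero_closed)
  have hW: "h c \<in> W j" if "c \<in> X.W j" for c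
    using that hD(2)[of c c "[:- of_int j, 1:]"] hD(3)[of c c] h0 by (simp only: W_iff X.W_iff)
  have gW: "?g v \<in> X.W j" if "v \<in> W j" for v
  proof -
    have v: "v \<in> carrier S" "mod_sc t S [:- of_int j, 1:] v = \<zero>\<^bsub>S\<^esub>" using that by (simp_all only: W_iff)
    then have "h (sc [:- of_int j, 1:] (?g v)) = h \<zero>\<^bsub>X\<^esub>"
      using hD(2)[OF hg(2) hg(2), of v v] hg(1) h0 by simp
    then have "sc [:- of_int j, 1:] (?g v) = \<zero>\<^bsub>X\<^esub>"
      by (rule inj_onD[OF inj]) (use hg(2)[OF v(1)] in blast)+
    then show ?thesis using hg(2)[OF v(1)] by (simp only: X.W_iff)
  qed
  have g_add: "?g (v \<oplus>\<^bsub>S\<^esub> w) = ?g v \<oplus>\<^bsub>X\<^esub> ?g w" if "v \<in> carrier S" "w \<in> carrier S" for v w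
    using gh[OF X.a_closed[OF hg(2)[OF that(1)] hg(2)[OF that(2)]]] hD(1)[OF hg(2)[OF that(1)] hg(2)[OF that(2)]]
    by (simp only: hg(1)[OF that(1)] hg(1)[OF that(2)])
  have g_sc: "?g (mod_sc t S r v) = sc r (?g v)" if "v \<in> carrier S" for r v
    using gh[OF X.sc_closed[OF hg(2)[OF that]], of r] hD(2)[OF hg(2)[OF that] hg(2)[OF that], of r]
    by (simp only: hg(1)[OF that])
  have "n = wdim t S j"
  proof (rule has_dim_transfer[OF X.cspace_wspace cspace_wspace _ _ _ _ dim has_dim_wdim[OF S]])
    show "h \<in> lmod_hom CC (wspace X sc j) (wspace S (mod_sc t S) j)"
      using hW hD X.W_carrier unfolding lmod_hom_def hom_def by auto
    show "?g \<in> lmod_hom CC (wspace S (mod_sc t S) j) (wspace X sc j)"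
      using gW g_add g_sc W_carrier unfolding lmod_hom_def hom_def by auto
  qed (use gh hg W_carrier X.W_carrier in \<open>blast+\<close>)
  then show ?thesis by simp
qed

lemma is_model_wdim:
  assumes t: "t \<in> Omega" and S: "is_model t k S h"
  shows "wdim t S j = (if sim t j k then 1 else 0)"
  by (rule iso_wdim[OF model_wrep[OF t] _ _ _ _ model_dim[OF t]])
    (use S in \<open>auto simp: is_model_def simp del: model_group_simps(1)\<close>)

text \<open>The interval is fixed before the copy S is chosen: one k works for all copies of its
  standard module, so later arguments may swap one copy for another.\<close>

lemma standard_submodule:
  assumes t: "t \<in> Omega" and M: "M \<in> wmod t" and nz: "carrier M \<noteq> {\<zero>\<^bsub>M\<^esub>}"
  obtains k where "\<And>S h. is_model t k S h \<Longrightarrow> \<exists>i\<in>lmod_hom (GWA t) S M. inj_on i (carrier S)"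
proof -
  interpret gwa_wrep M t "mod_sc t M" "mod_gen t M GenXp" "mod_gen t M GenXm" using M by (simp add: wmod_iff)
  obtain k f where f: "inj_on f (carrier (model_group t k))"
    "\<And>c. c \<in> carrier (model_group t k) \<Longrightarrow> f c \<in> carrier M"
    "\<And>c d. c \<in> carrier (model_group t k) \<Longrightarrow> d \<in> carrier (model_group t k) \<Longrightarrow> f (\<lambda>j. c j + d j) = f c \<oplus>\<^bsub>M\<^esub> f d"
    "\<And>r c. c \<in> carrier (model_group t k) \<Longrightarrow> f (model_sc r c) = mod_sc t M r (f c)"
    "\<And>c. c \<in> carrier (model_group t k) \<Longrightarrow> f (model_P t k c) = mod_gen t M GenXp (f c)"
    "\<And>c. c \<in> carrier (model_group t k) \<Longrightarrow> f (model_Q t c) = mod_gen t M GenXm (f c)"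
    by (rule model_embedding[OF t nz]) (rule that)
  interpret X: gwa_wrep "model_group t k" t model_sc "model_P t k" "model_Q t" by (rule model_wrep[OF t])
  show thesis
  proof (rule that[of k])
    fix S h assume S: "is_model t k S h"
    have SW: "S \<in> wmod t" and inj: "inj_on h (carrier (model_group t k))"
      and im: "h ` carrier (model_group t k) = carrier S"
      using S by (auto simp: is_model_def bij_betw_def)
    let ?g = "the_inv_into (carrier (model_group t k)) h"
    have gh: "?g (h c) = c" if "c \<in> carrier (model_group t k)" for c using the_inv_into_f_f[OF inj that] .
    have ex: "\<exists>c\<in>carrier (model_group t k). v = h c" if "v \<in> carrier S" for v using im that by auto
    have hs: "h (\<lambda>j. c j + d j) = h c \<oplus>\<^bsub>S\<^esub> h d" "h (model_sc r c) = mod_sc t S r (h c)"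
      "h (model_P t k c) = mod_gen t S GenXp (h c)" "h (model_Q t c) = mod_gen t S GenXm (h c)"
      if "c \<in> carrier (model_group t k)" "d \<in> carrier (model_group t k)" for c d r
      using S that unfolding is_model_def by blast+
    have ga: "?g (h c \<oplus>\<^bsub>S\<^esub> h d) = (\<lambda>j. c j + d j)" if "c \<in> carrier (model_group t k)" "d \<in> carrier (model_group t k)" for c d
      using gh[OF X.a_closed[OF that]] hs(1)[OF that] by simp
    have gs: "?g (mod_sc t S r (h c)) = model_sc r c" "?g (mod_gen t S GenXp (h c)) = model_P t k c"
      "?g (mod_gen t S GenXm (h c)) = model_Q t c" if "c \<in> carrier (model_group t k)" for c r
      using gh[OF X.sc_closed[OF that]] gh[OF X.P_closed[OF that]] gh[OF X.Q_closed[OF that]] hs(2-4)[OF that that] by simp_all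
    have "(\<lambda>v. f (?g v)) \<in> lmod_hom (GWA t) S M"
    proof (rule gwa_hom_iff)
      show "left_module (GWA t) S" "left_module (GWA t) M" using SW M by (simp_all add: wmod_iff)
      show "(\<lambda>v. f (?g v)) \<in> hom (add_monoid S) (add_monoid M)"
        by (rule homI) (auto dest!: ex simp: gh ga f(2,3) simp del: model_group_simps)
      show "f (?g (mod_sc t S r v)) = mod_sc t M r (f (?g v))" if "v \<in> carrier S" for r v
        using ex[OF that] gh gs(1) f(4) by auto
      show "f (?g (mod_gen t S g v)) = mod_gen t M g (f (?g v))" if "v \<in> carrier S" "g \<in> {GenXp, GenXm}" for g v
        using ex[OF that(1)] that(2) gh gs(2,3) f(5,6) by auto
    qed
    moreover have "inj_on (\<lambda>v. f (?g v)) (carrier S)"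
    proof (rule inj_onI)
      fix v w assume vw: "v \<in> carrier S" "w \<in> carrier S" "f (?g v) = f (?g w)"
      obtain c d where "c \<in> carrier (model_group t k)" "d \<in> carrier (model_group t k)" "v = h c" "w = h d"
        using ex vw by meson
      then show "v = w" using vw(3) gh inj_onD[OF f(1)] by metis
    qed
    ultimately show "\<exists>i\<in>lmod_hom (GWA t) S M. inj_on i (carrier S)" by blast
  qed
qed

lemma wdim_zero_module:
  assumes "M \<in> wmod t" shows "carrier M = {\<zero>\<^bsub>M\<^esub>} \<longleftrightarrow> (\<forall>k. wdim t M k = 0)"
proof -
  interpret gwa_wrep M t "mod_sc t M" "mod_gen t M GenXp" "mod_gen t M GenXm" using assms by (simp add: wmod_iff)
  have "carrier M = {\<zero>\<^bsub>M\<^esub>} \<longleftrightarrow> (\<forall>k. W k = {\<zero>\<^bsub>M\<^esub>})"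
  proof
    assume "carrier M = {\<zero>\<^bsub>M\<^esub>}"
    then show "\<forall>k. W k = {\<zero>\<^bsub>M\<^esub>}" using W_carrier W_closed(1) by blast
  next
    assume *: "\<forall>k. W k = {\<zero>\<^bsub>M\<^esub>}"
    have "v = \<zero>\<^bsub>M\<^esub>" if "v \<in> carrier M" for v
      by (rule comp_eqI[OF that]) (use * comp_W[OF that] in auto)
    then show "carrier M = {\<zero>\<^bsub>M\<^esub>}" by auto
  qed
  then show ?thesis by (simp add: wdim_0_iff[OF assms])
qed

text \<open>A nonzero submodule contains a weight vector, as components are taken by polynomials.
  Inside the interval P and Q carry it to every weight without killing it, because QP and PQ are
  nonzero scalars there; and each weight space is a line.\<close>

lemma simple_obj_if_wdim:
  assumes t: "t \<in> Omega" and M: "M \<in> wmod t" and d: "\<And>j. wdim t M j = (if sim t j k then 1 else 0)"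
  shows "simple_obj t M"
proof -
  interpret gwa_wrep M t "mod_sc t M" "mod_gen t M GenXp" "mod_gen t M GenXm" using M by (simp add: wmod_iff)
  have "carrier M \<noteq> {\<zero>\<^bsub>M\<^esub>}" using d[of k] wdim_zero_module[OF M] by auto
  moreover have "U = carrier M" if U: "submodule U (GWA t) M" and nz: "U \<noteq> {\<zero>\<^bsub>M\<^esub>}" for U
  proof -
    interpret U: submodule U "GWA t" M by (rule U)
    have Usc: "mod_sc t M r v \<in> U" "mod_gen t M g v \<in> U" if "v \<in> U" for r g v
      using U.smult_closed that gwa_poly_simps(1,2) by blast+
    have Uc: "v \<in> carrier M" if "v \<in> U" for v using U.subset that by auto
    have U0: "\<zero>\<^bsub>M\<^esub> \<in> U" using U.one_closed by simp
    have Ua: "v \<oplus>\<^bsub>M\<^esub> w \<in> U" if "v \<in> U" "w \<in> U" for v w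
      using U.m_closed that by simp
    obtain v where v: "v \<in> U" "v \<noteq> \<zero>\<^bsub>M\<^esub>" using nz U0 by blast
    obtain j where j: "comp j v \<noteq> \<zero>\<^bsub>M\<^esub>" using nonzero_weight_vector[OF Uc[OF v(1)] v(2)] .
    have jW: "comp j v \<in> W j" using Uc[OF v(1)] by blast
    then have "W j \<noteq> {\<zero>\<^bsub>M\<^esub>}" using j by blast
    then have sj: "sim t j k" using d[of j] wdim_0_iff[OF M, of j] by (metis)
    have "comp j v \<in> U" unfolding comp_def by (rule Usc[OF v(1)])
    have ex: "\<exists>w\<in>U. w \<in> W i \<and> w \<noteq> \<zero>\<^bsub>M\<^esub>" if "sim t i k" for i
    proof -
      have "sim t i j" by (rule sim_trans[OF that sim_sym[OF sj]])
      then have "(\<exists>w\<in>U. w \<in> W i \<and> w \<noteq> \<zero>\<^bsub>M\<^esub>) = (\<exists>w\<in>U. w \<in> W j \<and> w \<noteq> \<zero>\<^bsub>M\<^esub>)"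
      proof (rule sim_induct)
        fix i assume "sim t i (i + 1)"
        then have nz: "poly t (of_int i + 1/2) \<noteq> 0" using sim_Suc_iff[OF t] by simp
        show "(\<exists>w\<in>U. w \<in> W i \<and> w \<noteq> \<zero>\<^bsub>M\<^esub>) = (\<exists>w\<in>U. w \<in> W (i + 1) \<and> w \<noteq> \<zero>\<^bsub>M\<^esub>)"
        proof
          assume "\<exists>w\<in>U. w \<in> W i \<and> w \<noteq> \<zero>\<^bsub>M\<^esub>"
          then obtain w where w: "w \<in> U" "w \<in> W i" "w \<noteq> \<zero>\<^bsub>M\<^esub>" by blast
          have "mod_gen t M GenXp w \<noteq> \<zero>\<^bsub>M\<^esub>"
            using QP_W[OF w(2)] sc_const_eq_zero[OF Uc[OF w(1)] _ nz] w(3) Q_zero by metis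
          then show "\<exists>w\<in>U. w \<in> W (i + 1) \<and> w \<noteq> \<zero>\<^bsub>M\<^esub>" using Usc(2)[OF w(1)] P_W[OF w(2)] by blast
        next
          assume "\<exists>w\<in>U. w \<in> W (i + 1) \<and> w \<noteq> \<zero>\<^bsub>M\<^esub>"
          then obtain w where w: "w \<in> U" "w \<in> W (i + 1)" "w \<noteq> \<zero>\<^bsub>M\<^esub>" by blast
          have e: "complex_of_int (i + 1) - 1/2 = of_int i + 1/2" by simp
          have "mod_gen t M GenXm w \<noteq> \<zero>\<^bsub>M\<^esub>"
            using PQ_W[OF w(2), unfolded e] sc_const_eq_zero[OF Uc[OF w(1)] _ nz] w(3) P_zero by metis
          then show "\<exists>w\<in>U. w \<in> W i \<and> w \<noteq> \<zero>\<^bsub>M\<^esub>" using Usc(2)[OF w(1)] Q_W[OF w(2)] by auto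
        qed
      qed
      then show ?thesis using \<open>comp j v \<in> U\<close> jW j by blast
    qed
    have WU: "x \<in> U" if x: "x \<in> W i" for x i
    proof (cases "sim t i k")
      case False
      then have "W i = {\<zero>\<^bsub>M\<^esub>}" using wdim_0_iff[OF M, of i] d[of i] by simp
      then show ?thesis using x U0 v by auto
    next
      case True
      obtain w where w: "w \<in> U" "w \<in> W i" "w \<noteq> \<zero>\<^bsub>M\<^esub>" using ex[OF True] by blast
      interpret V: cspace "wspace M (mod_sc t M) i" by (rule cspace_wspace)
      obtain e l where el: "dual_basis (wspace M (mod_sc t M) i) {..<Suc 0} e l"
        using has_dim_wdim[OF M, of i] True d[of i] unfolding has_dim_def by auto
      have ec: "e 0 \<in> W i" using dual_basisD(2)[OF el] by simp
      have exp: "y = mod_sc t M [:l 0 y:] (e 0)" if "y \<in> W i" for y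
      proof -
        have "mod_sc t M [:l 0 y:] (e 0) \<in> W i" by (rule W_closed(3)[OF ec])
        then have "(\<Oplus>\<^bsub>wspace M (mod_sc t M) i\<^esub>j\<in>{..<Suc 0}. l j y \<odot>\<^bsub>wspace M (mod_sc t M) i\<^esub> e j) = mod_sc t M [:l 0 y:] (e 0)"
          by (simp add: lessThan_Suc V.M.finsum_insert Pi_iff)
        then show ?thesis using dual_basisD(5)[OF el that] by simp
      qed
      have lw: "l 0 w \<noteq> 0" using exp[OF w(2)] w(3) W_carrier[OF ec] by fastforce
      have "mod_sc t M [:l 0 x / l 0 w:] w = mod_sc t M ([:l 0 x / l 0 w:] * [:l 0 w:]) (e 0)"
        using exp[OF w(2)] W_carrier[OF ec] by (simp only: sc_mult)
      also have "\<dots> = x" using exp[OF x] lw by simp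
      finally show ?thesis using Usc(1)[OF w(1)] by metis
    qed
    \<comment> \<open>Every vector is a sum of weight vectors, and all weight vectors already lie in
      U.\<close>
    have "x \<in> U" if "x \<in> carrier M" for x
      using that by (induction rule: weight_induct) (use WU Ua in blast)+
    then show "U = carrier M" using Uc by blast
  qed
  ultimately show ?thesis using M unfolding simple_obj_def simple_lmod_def by blast
qed

lemma lmod_hom_image_submodule:
  assumes M: "left_module R M" and N: "left_module R N" and f: "f \<in> lmod_hom R M N"
  shows "submodule (f ` carrier M) R N"
proof -
  interpret M: left_module R M by (rule M)
  interpret N: left_module R N by (rule N)
  interpret h: group_hom "add_monoid M" "add_monoid N" f
    using f M.M.a_group N.M.a_group by (simp add: group_hom_def group_hom_axioms_def lmod_hom_def)
  have "subgroup (f ` carrier M) (add_monoid N)" using h.img_is_subgroup by simp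
  moreover have "a \<odot>\<^bsub>N\<^esub> x \<in> f ` carrier M" if "a \<in> carrier R" "x \<in> f ` carrier M" for a x
    using that lmod_homD(3)[OF f, symmetric] M.smult_closed by auto
  ultimately show ?thesis by (simp add: submodule_def submodule_axioms_def)
qed

text \<open>A standard module embeds into M, and by simplicity its image is everything. The quotient
  is then zero, so additivity of dimensions leaves those of the standard module.\<close>

lemma wdim_of_simple_obj:
  assumes t: "t \<in> Omega" and M: "simple_obj t M"
  obtains k where "\<And>j. wdim t M j = (if sim t j k then 1 else 0)"
proof -
  have MW: "M \<in> wmod t" and nz: "carrier M \<noteq> {\<zero>\<^bsub>M\<^esub>}"
    and sub: "\<And>U. submodule U (GWA t) M \<Longrightarrow> U = {\<zero>\<^bsub>M\<^esub>} \<or> U = carrier M"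
    using M by (auto simp: simple_obj_def simple_lmod_def)
  obtain k where k: "\<And>S h. is_model t k S h \<Longrightarrow> \<exists>i\<in>lmod_hom (GWA t) S M. inj_on i (carrier S)"
    by (rule standard_submodule[OF t MW nz]) (rule that)
  obtain S h where S: "is_model t k S h" using model_exists[OF t] .
  then have SW: "S \<in> wmod t" by (simp add: is_model_def)
  obtain i where "i \<in> lmod_hom (GWA t) S M" "inj_on i (carrier S)" using k[OF S] by blast
  then obtain N where N: "N \<in> wmod t" "short_exact (GWA t) S M N" using quotient_exists[OF SW MW] by blast
  then obtain f g where f: "f \<in> lmod_hom (GWA t) S M" "inj_on f (carrier S)" and g: "g \<in> lmod_hom (GWA t) M N"
    "g ` carrier M = carrier N" "f ` carrier S = {x \<in> carrier M. g x = \<zero>\<^bsub>N\<^esub>}"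
    unfolding short_exact_def by blast
  have dS: "wdim t S j = (if sim t j k then 1 else 0)" for j by (rule is_model_wdim[OF t S])
  have M_left: "left_module (GWA t) M" and S_left: "left_module (GWA t) S" using MW SW by (simp_all add: wmod_iff)
  interpret S: left_module "GWA t" S by (rule S_left)
  interpret M: left_module "GWA t" M by (rule M_left)
  have "f ` carrier S \<noteq> {\<zero>\<^bsub>M\<^esub>}"
  proof
    assume im: "f ` carrier S = {\<zero>\<^bsub>M\<^esub>}"
    have "x = \<zero>\<^bsub>S\<^esub>" if "x \<in> carrier S" for x
    proof (rule inj_onD[OF f(2) _ that S.M.zero_closed])
      have "f x \<in> {\<zero>\<^bsub>M\<^esub>}" "f \<zero>\<^bsub>S\<^esub> \<in> {\<zero>\<^bsub>M\<^esub>}" using im that S.M.zero_closed by blast+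
      then show "f x = f \<zero>\<^bsub>S\<^esub>" by simp
    qed
    then have "carrier S = {\<zero>\<^bsub>S\<^esub>}" using S.M.zero_closed by blast
    then show False using wdim_zero_module[OF SW] dS[of k] by auto
  qed
  then have "f ` carrier S = carrier M"
    using sub[OF lmod_hom_image_submodule[OF S_left M_left f(1)]] by blast
  then have "g x = \<zero>\<^bsub>N\<^esub>" if "x \<in> carrier M" for x using g(3) that by blast
  then have "g ` carrier M = (\<lambda>_. \<zero>\<^bsub>N\<^esub>) ` carrier M" by (intro image_cong refl)
  also have "\<dots> = {\<zero>\<^bsub>N\<^esub>}" by (rule image_constant[OF M.M.zero_closed])
  finally have "g ` carrier M = {\<zero>\<^bsub>N\<^esub>}" .
  then have "carrier N = {\<zero>\<^bsub>N\<^esub>}" using g(2) by simp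
  then have "wdim t N j = 0" for j using wdim_zero_module[OF N(1)] by blast
  then have "wdim t M j = (if sim t j k then 1 else 0)" for j
    using wdim_exact[OF SW MW N] dS by simp
  then show thesis by (rule that)
qed

text \<open>Induction on the total dimension over the representatives in \<open>K\<close>, splitting off a simple submodule.\<close>

lemma additive_function_expansion:
  fixes V :: "(complex, 'x) module"
  assumes t: "t \<in> Omega" and V: "cspace V" and K: "finite K" "\<And>j. \<exists>!k. k \<in> K \<and> sim t j k"
    and L: "\<And>k. k \<in> K \<Longrightarrow> L k \<in> wmod t" "\<And>k j. k \<in> K \<Longrightarrow> wdim t (L k) j = (if sim t j k then 1 else 0)"
    and closed: "\<And>M. M \<in> wmod t \<Longrightarrow> \<chi> M \<in> carrier V"
    and additive: "\<And>M M' M''. M \<in> wmod t \<Longrightarrow> M' \<in> wmod t \<Longrightarrow> M'' \<in> wmod t \<Longrightarrow>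
      short_exact (GWA t) M M'' M' \<Longrightarrow> \<chi> M'' = \<chi> M \<oplus>\<^bsub>V\<^esub> \<chi> M'"
    and M: "M \<in> wmod t"
  shows "\<chi> M = (\<Oplus>\<^bsub>V\<^esub>k\<in>K. of_nat (wdim t M k) \<odot>\<^bsub>V\<^esub> \<chi> (L k))"
proof -
  interpret V: cspace V by (rule V)
  \<comment> \<open>For a zero module N, the sequence N, N, N with identity maps is exact, so \<chi>
    N = \<chi> N + \<chi> N.\<close>
  have zero: "\<chi> N = \<zero>\<^bsub>V\<^esub>" if N: "N \<in> wmod t" "carrier N = {\<zero>\<^bsub>N\<^esub>}" for N
  proof -
    interpret N: left_module "GWA t" N using N by (simp add: wmod_iff)
    have "(\<lambda>x. x) \<in> lmod_hom (GWA t) N N" by (simp add: lmod_hom_def hom_def)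
    moreover have "(\<lambda>x. x) ` carrier N = {x \<in> carrier N. x = \<zero>\<^bsub>N\<^esub>}" using N(2) by auto
    ultimately have "short_exact (GWA t) N N N"
      unfolding short_exact_def by (intro exI[of _ "\<lambda>x. x"] conjI) auto
    then have "\<chi> N = \<chi> N \<oplus>\<^bsub>V\<^esub> \<chi> N" using additive N(1) by blast
    then show ?thesis using closed[OF N(1)] V.M.add.r_cancel_one'[of "\<chi> N" "\<chi> N"] by simp
  qed
  have quot: "\<exists>k0 S N. S \<in> wmod t \<and> N \<in> wmod t \<and> short_exact (GWA t) S N' N \<and> (\<exists>h. is_model t k0 S h)"
    if N': "N' \<in> wmod t" "carrier N' \<noteq> {\<zero>\<^bsub>N'\<^esub>}" for N'
  proof -
    obtain k where k: "\<And>S h. is_model t k S h \<Longrightarrow> \<exists>i\<in>lmod_hom (GWA t) S N'. inj_on i (carrier S)"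
      by (rule standard_submodule[OF t N']) (rule that)
    obtain S h where S: "is_model t k S h" using model_exists[OF t] .
    then have SW: "S \<in> wmod t" by (simp add: is_model_def)
    obtain i where "i \<in> lmod_hom (GWA t) S N'" "inj_on i (carrier S)" using k[OF S] by blast
    then obtain N where "N \<in> wmod t" "short_exact (GWA t) S N' N" using quotient_exists[OF SW N'(1)] by blast
    then show ?thesis using S SW by blast
  qed
  \<comment> \<open>Any copy S embeds into \<open>L k\<close> with a quotient of dimension zero at
    every weight. Thus \<chi> cannot distinguish S from \<open>L k\<close>, and no isomorphism
    between them has to be constructed.\<close>
  have simple: "\<chi> S = \<chi> (L k)" if k: "k \<in> K" and S: "is_model t k S h" for k S h
  proof -
    have Lnz: "carrier (L k) \<noteq> {\<zero>\<^bsub>L k\<^esub>}" using wdim_zero_module[OF L(1)[OF k]] L(2)[OF k, of k] by auto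
    obtain k1 where k1: "\<And>S h. is_model t k1 S h \<Longrightarrow> \<exists>i\<in>lmod_hom (GWA t) S (L k). inj_on i (carrier S)"
      by (rule standard_submodule[OF t L(1)[OF k] Lnz]) (rule that)
    have quot1: "\<exists>N. N \<in> wmod t \<and> short_exact (GWA t) S' (L k) N" if S': "is_model t k1 S' h'" for S' h'
    proof -
      have SW: "S' \<in> wmod t" using S' by (simp add: is_model_def)
      obtain i where "i \<in> lmod_hom (GWA t) S' (L k)" "inj_on i (carrier S')" using k1[OF S'] by blast
      then show ?thesis using quotient_exists[OF SW L(1)[OF k]] by metis
    qed
    \<comment> \<open>The standard module found inside \<open>L k\<close> has a nonzero weight space
      at \<open>k1\<close>, so \<open>L k\<close> has one too, which places \<open>k1\<close> in the
      interval of k.\<close>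
    have sim: "sim t k1 k"
    proof -
      obtain S' h' where S': "is_model t k1 S' h'" using model_exists[OF t] .
      then have SW: "S' \<in> wmod t" by (simp add: is_model_def)
      obtain N where N: "N \<in> wmod t" "short_exact (GWA t) S' (L k) N" using quot1[OF S'] by blast
      have "wdim t (L k) k1 \<noteq> 0"
        using wdim_exact[OF SW L(1)[OF k] N, of k1] is_model_wdim[OF t S', of k1] by simp
      then show ?thesis using L(2)[OF k, of k1] by (simp split: if_splits)
    qed
    have S1: "is_model t k1 S h" using S is_model_cong[OF sim] by simp
    then have SW: "S \<in> wmod t" by (simp add: is_model_def)
    obtain N where N: "N \<in> wmod t" "short_exact (GWA t) S (L k) N" using quot1[OF S1] by blast
    have "wdim t N j = 0" for j
      using wdim_exact[OF SW L(1)[OF k] N, of j] is_model_wdim[OF t S, of j] L(2)[OF k, of j] by simp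
    then have "\<chi> N = \<zero>\<^bsub>V\<^esub>" using zero[OF N(1)] wdim_zero_module[OF N(1)] by blast
    then show ?thesis using additive[OF SW N(1) L(1)[OF k] N(2)] closed[OF SW] by simp
  qed
  have Lc: "\<chi> (L k) \<in> carrier V" if "k \<in> K" for k using closed L(1) that by blast
  show ?thesis
    using M
  proof (induction "\<Sum>k\<in>K. wdim t M k" arbitrary: M rule: less_induct)
    case less
    show ?case
    proof (cases "carrier M = {\<zero>\<^bsub>M\<^esub>}")
      case True
      then have "wdim t M k = 0" for k using wdim_zero_module[OF less.prems] by blast
      then have "(\<Oplus>\<^bsub>V\<^esub>k\<in>K. of_nat (wdim t M k) \<odot>\<^bsub>V\<^esub> \<chi> (L k)) = \<zero>\<^bsub>V\<^esub>"
        using Lc V.smult_l_null by (intro V.M.add.finprod_one_eqI) simp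
      then show ?thesis using zero[OF less.prems True] by simp
    next
      case False
      obtain k0 S N h where SN: "S \<in> wmod t" "N \<in> wmod t" "short_exact (GWA t) S M N" "is_model t k0 S h"
        using quot[OF less.prems False] by blast
      \<comment> \<open>The interval found in M is moved to its representative in K; copies of the
        standard module are the same for both.\<close>
      obtain k where k: "k \<in> K" "sim t k0 k" using K(2)[of k0] by blast
      have S: "is_model t k S h" using SN(4) is_model_cong[OF k(2)] by simp
      have dS: "wdim t S j = (if j = k then 1 else 0)" if "j \<in> K" for j
        using is_model_wdim[OF t S, of j] K(2)[of j] k(1) that sim_refl by metis
      have dM: "wdim t M j = wdim t S j + wdim t N j" for j by (rule wdim_exact[OF SN(1) less.prems SN(2,3)])
      have "(\<Sum>k\<in>K. wdim t M k) = (\<Sum>k\<in>K. wdim t S k) + (\<Sum>k\<in>K. wdim t N k)" by (simp add: dM sum.distrib)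
      \<comment> \<open>S meets exactly one representative, in dimension one, so the induction
        measure drops by one from M to N.\<close>
      also have "(\<Sum>j\<in>K. wdim t S j) = 1" using K(1) k(1) by (simp add: dS)
      finally have "\<chi> N = (\<Oplus>\<^bsub>V\<^esub>k\<in>K. of_nat (wdim t N k) \<odot>\<^bsub>V\<^esub> \<chi> (L k))" using less.hyps[OF _ SN(2)] by simp
      moreover have "\<chi> S = (\<Oplus>\<^bsub>V\<^esub>j\<in>K. of_nat (wdim t S j) \<odot>\<^bsub>V\<^esub> \<chi> (L j))"
      proof -
        have "(\<Oplus>\<^bsub>V\<^esub>j\<in>K. of_nat (wdim t S j) \<odot>\<^bsub>V\<^esub> \<chi> (L j)) = (\<Oplus>\<^bsub>V\<^esub>j\<in>K. (if j = k then 1 else 0) \<odot>\<^bsub>V\<^esub> \<chi> (L j))"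
          by (rule V.M.finsum_cong') (use Lc dS V.smult_closed in auto)
        also have "\<dots> = \<chi> (L k)" by (rule V.comb_delta[OF K(1) Lc k(1)])
        finally show ?thesis using simple[OF k(1) S] by simp
      qed
      moreover have "\<chi> M = \<chi> S \<oplus>\<^bsub>V\<^esub> \<chi> N" by (rule additive[OF SN(1,2) less.prems SN(3)])
      ultimately show ?thesis using V.comb_add[OF Lc, of K] dM by simp
    qed
  qed
qed

subsection \<open>Tensor products of weight modules\<close>

lemma (in abelian_monoid) finsum_Times:
  assumes "finite A" "finite B" "\<And>a b. a \<in> A \<Longrightarrow> b \<in> B \<Longrightarrow> f a b \<in> carrier G"
  shows "(\<Oplus>p\<in>A \<times> B. f (fst p) (snd p)) = (\<Oplus>a\<in>A. \<Oplus>b\<in>B. f a b)"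
  using assms(1,3)
proof (induction A rule: finite_induct)
  case (insert a A)
  have "(\<Oplus>p\<in>insert a A \<times> B. f (fst p) (snd p)) = (\<Oplus>p\<in>Pair a ` B \<union> A \<times> B. f (fst p) (snd p))"
    by (rule arg_cong[of _ _ "finsum G _"]) auto
  also have "\<dots> = (\<Oplus>p\<in>Pair a ` B. f (fst p) (snd p)) \<oplus> (\<Oplus>p\<in>A \<times> B. f (fst p) (snd p))"
    by (rule finsum_Un_disjoint) (use insert assms(2) in auto)
  also have "(\<Oplus>p\<in>Pair a ` B. f (fst p) (snd p)) = (\<Oplus>b\<in>B. f a b)"
    by (subst finsum_reindex) (use insert in \<open>auto simp: inj_on_def\<close>)
  also have "(\<Oplus>p\<in>A \<times> B. f (fst p) (snd p)) = (\<Oplus>a\<in>A. \<Oplus>b\<in>B. f a b)"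
    using insert by simp
  finally show ?case
    using insert by (subst finsum_insert) (auto intro!: finsum_closed)
qed simp

locale gwa_tensor =
  A: gwa_rep M t sc P Q + B: gwa_rep M' u sc' P' Q'
  for M :: "('v, 'm) ring_scheme" and t and sc and P Q
    and M' :: "('w, 'n) ring_scheme" and u and sc' and P' Q'
begin

sublocale balanced UNIV sc sc' "add_monoid M" "add_monoid M'"
  by (intro balanced.intro balanced_axioms.intro A.a_comm_group B.a_comm_group) auto

text \<open>The tensor group rewritten additively, so that the locales for representations apply to
  it.\<close>

definition Tgrp :: "((('v \<times> 'w) \<Rightarrow>\<^sub>0 int) set) ring" where
  "Tgrp = \<lparr>carrier = carrier T, monoid.mult = undefined, monoid.one = undefined,
     ring.zero = \<one>\<^bsub>T\<^esub>, ring.add = (\<otimes>\<^bsub>T\<^esub>)\<rparr>"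

lemma Tgrp_simps [simp]:
  "carrier Tgrp = carrier T" "\<zero>\<^bsub>Tgrp\<^esub> = \<one>\<^bsub>T\<^esub>" "X \<oplus>\<^bsub>Tgrp\<^esub> Y = X \<otimes>\<^bsub>T\<^esub> Y"
  by (simp_all add: Tgrp_def)

lemma Tgrp_abelian_group: "abelian_group Tgrp"
proof (rule abelian_groupI)
  show "\<exists>Y\<in>carrier Tgrp. Y \<oplus>\<^bsub>Tgrp\<^esub> X = \<zero>\<^bsub>Tgrp\<^esub>" if "X \<in> carrier Tgrp" for X
    using that by (intro bexI[of _ "inv\<^bsub>T\<^esub> X"]) simp_all
  show "X \<oplus>\<^bsub>Tgrp\<^esub> Y = Y \<oplus>\<^bsub>Tgrp\<^esub> X" if "X \<in> carrier Tgrp" "Y \<in> carrier Tgrp" for X Y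
    using that by (simp add: T.m_comm)
qed (simp_all add: T.m_assoc)

sublocale TT: abelian_group Tgrp by (rule Tgrp_abelian_group)

definition induced :: "('v \<Rightarrow> 'v) \<Rightarrow> ('w \<Rightarrow> 'w) \<Rightarrow> (('v \<times> 'w) \<Rightarrow>\<^sub>0 int) set \<Rightarrow> (('v \<times> 'w) \<Rightarrow>\<^sub>0 int) set" where
  "induced f g = (SOME \<phi>. \<phi> \<in> hom T T \<and> (\<forall>v\<in>carrier M. \<forall>w\<in>carrier M'. \<phi> (pure v w) = pure (f v) (g w)))"

text \<open>The hypothesis \<open>bal\<close> is weaker than linearity over \<complex>[z]; this
  allows operators such as P \<otimes> P' whose factors commute with polynomials only up to a
  shift.\<close>

lemma induced:
  assumes f: "\<And>v. v \<in> carrier M \<Longrightarrow> f v \<in> carrier M"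
      "\<And>v v'. v \<in> carrier M \<Longrightarrow> v' \<in> carrier M \<Longrightarrow> f (v \<oplus>\<^bsub>M\<^esub> v') = f v \<oplus>\<^bsub>M\<^esub> f v'"
    and g: "\<And>w. w \<in> carrier M' \<Longrightarrow> g w \<in> carrier M'"
      "\<And>w w'. w \<in> carrier M' \<Longrightarrow> w' \<in> carrier M' \<Longrightarrow> g (w \<oplus>\<^bsub>M'\<^esub> w') = g w \<oplus>\<^bsub>M'\<^esub> g w'"
    and bal: "\<And>r v w. v \<in> carrier M \<Longrightarrow> w \<in> carrier M' \<Longrightarrow> pure (f (sc r v)) (g w) = pure (f v) (g (sc' r w))"
  shows "induced f g \<in> hom T T"
    and "v \<in> carrier M \<Longrightarrow> w \<in> carrier M' \<Longrightarrow> induced f g (pure v w) = pure (f v) (g w)"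
proof -
  obtain \<phi> where "\<phi> \<in> hom T T" "\<And>v w. v \<in> carrier (add_monoid M) \<Longrightarrow> w \<in> carrier (add_monoid M') \<Longrightarrow> \<phi> (pure v w) = pure (f v) (g w)"
    by (rule tensor_universal[OF T.comm_group_axioms, of "\<lambda>v w. pure (f v) (g w)"])
      (use f g bal pure_closed pure_mult_left pure_mult_right in auto)
  then have "\<exists>\<phi>. \<phi> \<in> hom T T \<and> (\<forall>v\<in>carrier M. \<forall>w\<in>carrier M'. \<phi> (pure v w) = pure (f v) (g w))" by auto
  from someI_ex[OF this] show "induced f g \<in> hom T T"
    and "v \<in> carrier M \<Longrightarrow> w \<in> carrier M' \<Longrightarrow> induced f g (pure v w) = pure (f v) (g w)"
    unfolding induced_def by auto
qed

definition "tsc r = induced (sc r) (\<lambda>w. w)"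
definition "tP = induced P P'"
definition "tQ = induced Q Q'"

lemma pure_sc: "v \<in> carrier M \<Longrightarrow> w \<in> carrier M' \<Longrightarrow> pure (sc r v) w = pure v (sc' r w)"
  using pure_balanced[of r v w] by simp

lemma tsc: "tsc r \<in> hom T T" "v \<in> carrier M \<Longrightarrow> w \<in> carrier M' \<Longrightarrow> tsc r (pure v w) = pure (sc r v) w"
proof -
  have *: "pure (sc r (sc s v)) w = pure (sc r v) (sc' s w)" if "v \<in> carrier M" "w \<in> carrier M'" for s v w
    using that pure_sc[of "sc r v" w s] by (simp add: A.sc_commute[of v r s])
  note i = induced[of "sc r" "\<lambda>w. w", OF A.sc_closed A.sc_radd _ _ *, folded tsc_def]
  show "tsc r \<in> hom T T" by (rule i) simp_all
  show "v \<in> carrier M \<Longrightarrow> w \<in> carrier M' \<Longrightarrow> tsc r (pure v w) = pure (sc r v) w" by (rule i) simp_all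
qed

text \<open>P and P' twist polynomials by the same automorphism \<open>shift 1\<close>, so the
  twisted scalar can be moved across the tensor sign.\<close>

lemma tP: "tP \<in> hom T T" "v \<in> carrier M \<Longrightarrow> w \<in> carrier M' \<Longrightarrow> tP (pure v w) = pure (P v) (P' w)"
proof -
  have *: "pure (P (sc s v)) (P' w) = pure (P v) (P' (sc' s w))" if "v \<in> carrier M" "w \<in> carrier M'" for s v w
    using that pure_sc[of "P v" "P' w" "shift 1 s"] by (simp add: A.P_sc B.P_sc)
  note i = induced[of P P', OF A.P_closed A.P_add B.P_closed B.P_add *, folded tP_def]
  show "tP \<in> hom T T" by (rule i)
  show "v \<in> carrier M \<Longrightarrow> w \<in> carrier M' \<Longrightarrow> tP (pure v w) = pure (P v) (P' w)" by (rule i)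
qed

lemma tQ: "tQ \<in> hom T T" "v \<in> carrier M \<Longrightarrow> w \<in> carrier M' \<Longrightarrow> tQ (pure v w) = pure (Q v) (Q' w)"
proof -
  have *: "pure (Q (sc s v)) (Q' w) = pure (Q v) (Q' (sc' s w))" if "v \<in> carrier M" "w \<in> carrier M'" for s v w
    using that pure_sc[of "Q v" "Q' w" "shift (-1) s"] by (simp add: A.Q_sc B.Q_sc)
  note i = induced[of Q Q', OF A.Q_closed A.Q_add B.Q_closed B.Q_add *, folded tQ_def]
  show "tQ \<in> hom T T" by (rule i)
  show "v \<in> carrier M \<Longrightarrow> w \<in> carrier M' \<Longrightarrow> tQ (pure v w) = pure (Q v) (Q' w)" by (rule i)
qed

lemma T_induct [consumes 1, case_names pure add]:
  assumes "X \<in> carrier T"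
    and "\<And>v w. v \<in> carrier M \<Longrightarrow> w \<in> carrier M' \<Longrightarrow> R (pure v w)"
    and "\<And>X Y. X \<in> carrier T \<Longrightarrow> Y \<in> carrier T \<Longrightarrow> R X \<Longrightarrow> R Y \<Longrightarrow> R (X \<otimes>\<^bsub>T\<^esub> Y)"
  shows "R X"
  by (rule tensor_induct[OF assms(1)]) (use assms in auto)

lemma T_closed:
  "X \<in> carrier T \<Longrightarrow> tsc r X \<in> carrier T" "X \<in> carrier T \<Longrightarrow> tP X \<in> carrier T" "X \<in> carrier T \<Longrightarrow> tQ X \<in> carrier T"
  "v \<in> carrier M \<Longrightarrow> w \<in> carrier M' \<Longrightarrow> pure v w \<in> carrier T"
  using hom_in_carrier[OF tsc(1)] hom_in_carrier[OF tP(1)] hom_in_carrier[OF tQ(1)] pure_closed by auto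

lemma T_mult:
  assumes "X \<in> carrier T" "Y \<in> carrier T"
  shows "tsc r (X \<otimes>\<^bsub>T\<^esub> Y) = tsc r X \<otimes>\<^bsub>T\<^esub> tsc r Y" "tP (X \<otimes>\<^bsub>T\<^esub> Y) = tP X \<otimes>\<^bsub>T\<^esub> tP Y"
    "tQ (X \<otimes>\<^bsub>T\<^esub> Y) = tQ X \<otimes>\<^bsub>T\<^esub> tQ Y"
  using hom_mult[OF tsc(1)] hom_mult[OF tP(1)] hom_mult[OF tQ(1)] assms by auto

lemma shift_mult: "shift a (r * s) = shift a r * shift a s"
  by (simp add: shift_def pcompose_mult)

lemma pure_sc2:
  assumes "v \<in> carrier M" "w \<in> carrier M'" shows "pure (sc r v) (sc' s w) = pure (sc (r * s) v) w"
  using assms pure_sc[of "sc r v" w s] by (simp add: mult.commute[of r] A.sc_mult)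

lemma pure_add_left:
  "v \<in> carrier M \<Longrightarrow> v' \<in> carrier M \<Longrightarrow> w \<in> carrier M' \<Longrightarrow> pure (v \<oplus>\<^bsub>M\<^esub> v') w = pure v w \<otimes>\<^bsub>T\<^esub> pure v' w"
  using pure_mult_left[of v v' w] by simp

lemma T_4: "a \<in> carrier T \<Longrightarrow> b \<in> carrier T \<Longrightarrow> c \<in> carrier T \<Longrightarrow> d \<in> carrier T \<Longrightarrow>
    (a \<otimes>\<^bsub>T\<^esub> b) \<otimes>\<^bsub>T\<^esub> (c \<otimes>\<^bsub>T\<^esub> d) = (a \<otimes>\<^bsub>T\<^esub> c) \<otimes>\<^bsub>T\<^esub> (b \<otimes>\<^bsub>T\<^esub> d)"
  by (simp add: T.m_ac)

text \<open>On pure tensors PQ multiplies one factor by the shifted t and the other by the shifted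
  u. Over \<complex>[z] these combine to the shifted product, which is why the degree of the tensor
  product is t u.\<close>

lemma tensor_rep: "gwa_rep Tgrp (t * u) tsc tP tQ"
proof
  fix X r s assume "X \<in> carrier Tgrp"
  then have X: "X \<in> carrier T" by simp
  have "tsc (r + s) X = tsc r X \<otimes>\<^bsub>T\<^esub> tsc s X"
    using X by (induction rule: T_induct) (simp_all add: tsc(2) A.sc_ladd pure_add_left T_mult T_closed T_4)
  then show "tsc (r + s) X = tsc r X \<oplus>\<^bsub>Tgrp\<^esub> tsc s X" by simp
  show "tsc (r * s) X = tsc r (tsc s X)"
    using X by (induction rule: T_induct) (simp_all add: tsc(2) A.sc_mult T_mult T_closed)
  show "tsc 1 X = X"
    using X by (induction rule: T_induct) (simp_all add: tsc(2) T_mult T_closed)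
  show "tP (tsc r X) = tsc (shift 1 r) (tP X)"
    using X by (induction rule: T_induct) (simp_all add: tsc(2) tP(2) A.P_sc T_mult T_closed)
  show "tQ (tsc r X) = tsc (shift (- 1) r) (tQ X)"
    using X by (induction rule: T_induct) (simp_all add: tsc(2) tQ(2) A.Q_sc T_mult T_closed)
  show "tP (tQ X) = tsc (shift (1 / 2) (t * u)) X"
    using X by (induction rule: T_induct)
      (simp_all add: tsc(2) tP(2) tQ(2) A.PQ B.PQ T_mult T_closed pure_sc2 shift_mult)
  show "tQ (tP X) = tsc (shift (- 1 / 2) (t * u)) X"
    using X by (induction rule: T_induct)
      (simp_all add: tsc(2) tP(2) tQ(2) A.QP B.QP T_mult T_closed pure_sc2 shift_mult)
qed (simp_all add: T_mult T_closed)

end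

locale gwa_wtensor =
  A: gwa_wrep M t sc P Q + B: gwa_wrep M' u sc' P' Q'
  for M :: "('v, 'm) ring_scheme" and t and sc and P Q
    and M' :: "('w, 'n) ring_scheme" and u and sc' and P' Q'
begin

sublocale gwa_tensor M t sc P Q M' u sc' P' Q' ..

sublocale R: gwa_rep Tgrp "t * u" tsc tP tQ by (rule tensor_rep)

sublocale R: gwa_local_rep Tgrp "t * u" tsc tP tQ
proof
  fix X assume "X \<in> carrier Tgrp"
  then have "X \<in> carrier T" by simp
  then show "\<exists>F. finite F \<and> tsc (pann F) X = \<zero>\<^bsub>Tgrp\<^esub>"
  proof (induction rule: T_induct)
    case (pure v w)
    obtain F where "finite F" "sc (pann F) v = \<zero>\<^bsub>M\<^esub>" using A.annihilated[OF pure(1)] by blast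
    then show ?case using pure pure_one_left[of w] by (intro exI[of _ F]) (simp add: tsc(2))
  next
    case (add X Y)
    then show ?case using R.annihilated_add[of X Y] by simp
  qed
qed

text \<open>The interpolation polynomial l is idempotent on the common node set, so lv \<otimes> w =
  l(lv) \<otimes> w = lv \<otimes> lw. Hence only equal weights of the two factors
  contribute.\<close>

lemma comp_pure:
  assumes v: "v \<in> carrier M" and w: "w \<in> carrier M'"
  shows "R.comp k (pure v w) = pure (A.comp k v) (B.comp k w)"
proof -
  obtain F where F: "finite F" "sc (pann F) v = \<zero>\<^bsub>M\<^esub>" using A.annihilated[OF v] by blast
  obtain G where G: "finite G" "sc' (pann G) w = \<zero>\<^bsub>M'\<^esub>" using B.annihilated[OF w] by blast
  let ?H = "F \<union> G"
  have H: "finite ?H" "sc (pann ?H) v = \<zero>\<^bsub>M\<^esub>" "sc' (pann ?H) w = \<zero>\<^bsub>M'\<^esub>"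
    using F G A.pann_mono[OF v, of ?H F] B.pann_mono[OF w, of ?H G] by auto
  let ?l = "lagrange ?H k"
  have "tsc (pann ?H) (pure v w) = \<zero>\<^bsub>Tgrp\<^esub>" using v w H pure_one_left[of w] by (simp add: tsc(2))
  then have "R.comp k (pure v w) = pure (sc ?l v) w"
    using v w H T_closed(4)[OF v w] by (subst R.comp_eq[of _ ?H]) (simp_all add: tsc(2))
  also have "sc ?l v = sc (?l * ?l) v"
    by (rule A.sc_agree[OF v H(1,2)]) (use H in \<open>auto simp: poly_lagrange\<close>)
  also have "pure (sc (?l * ?l) v) w = pure (sc ?l v) (sc' ?l w)"
    using v w by (simp add: pure_sc2)
  also have "\<dots> = pure (A.comp k v) (B.comp k w)"
    by (simp add: A.comp_eq[OF v H(1,2)] B.comp_eq[OF w H(1,3)])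
  finally show ?thesis .
qed

text \<open>On components of weight k a polynomial r acts as r(k) in either factor, so the product
  of the two forms is balanced and descends to the tensor group.\<close>

lemma form_exists:
  assumes l: "lin_form (wspace M sc k) l" and l': "lin_form (wspace M' sc' k) l'"
  obtains \<theta> where "\<And>X Y. X \<in> carrier T \<Longrightarrow> Y \<in> carrier T \<Longrightarrow> \<theta> (X \<otimes>\<^bsub>T\<^esub> Y) = \<theta> X + \<theta> Y"
    "\<And>v w. v \<in> carrier M \<Longrightarrow> w \<in> carrier M' \<Longrightarrow> \<theta> (pure v w) = l (A.comp k v) * l' (B.comp k w)"
proof -
  have CC: "comm_group (add_monoid CC)"
    using abelian_group.a_comm_group[OF ring.is_abelian_group[OF class_ring_ring]] .
  have la: "l (x \<oplus>\<^bsub>M\<^esub> y) = l x + l y" "l (sc [:c:] x) = c * l x" if "x \<in> A.W k" "y \<in> A.W k" for x y c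
    using l that by (auto simp: lin_form_def)
  have la': "l' (x \<oplus>\<^bsub>M'\<^esub> y) = l' x + l' y" "l' (sc' [:c:] x) = c * l' x" if "x \<in> B.W k" "y \<in> B.W k" for x y c
    using l' that by (auto simp: lin_form_def)
  have s: "l (A.comp k (sc r v)) = poly r (of_int k) * l (A.comp k v)" if "v \<in> carrier M" for r v
    using A.comp_sc[OF that, of k r] A.sc_W[OF A.comp_W[OF that], of r k] la(2)[OF A.comp_W[OF that] A.comp_W[OF that]] by simp
  have s': "l' (B.comp k (sc' r v)) = poly r (of_int k) * l' (B.comp k v)" if "v \<in> carrier M'" for r v
    using B.comp_sc[OF that, of k r] B.sc_W[OF B.comp_W[OF that], of r k] la'(2)[OF B.comp_W[OF that] B.comp_W[OF that]] by simp
  obtain \<theta> where \<theta>: "\<theta> \<in> hom T (add_monoid CC)"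
    "\<And>v w. v \<in> carrier (add_monoid M) \<Longrightarrow> w \<in> carrier (add_monoid M') \<Longrightarrow> \<theta> (pure v w) = l (A.comp k v) * l' (B.comp k w)"
  proof (rule tensor_universal[OF CC, of "\<lambda>v w. l (A.comp k v) * l' (B.comp k w)"], goal_cases)
    case (2 g g' h) then show ?case by (simp add: A.comp_add la(1) algebra_simps)
  next
    case (3 g h h') then show ?case by (simp add: B.comp_add la'(1) algebra_simps)
  next
    case (4 r g h) then show ?case by (simp add: s s')
  next
    case (5 \<phi>) then show ?case by blast
  qed simp
  show thesis by (rule that[of \<theta>]) (use \<theta> hom_mult[OF \<theta>(1)] in auto)
qed

text \<open>The products of basis vectors are tested against the forms from
  \<open>form_exists\<close>, which are biorthogonal to them. This avoids any separate argument that
  the pure tensors are independent.\<close>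

lemma tensor_dim:
  assumes n: "has_dim (wspace M sc k) n" and m: "has_dim (wspace M' sc' k) m"
  shows "has_dim (wspace Tgrp tsc k) (n * m)"
proof -
  interpret V: cspace "wspace M sc k" by (rule A.cspace_wspace)
  interpret V': cspace "wspace M' sc' k" by (rule B.cspace_wspace)
  interpret X: cspace "wspace Tgrp tsc k" by (rule R.cspace_wspace)
  obtain e l where d: "dual_basis (wspace M sc k) {..<n} e l" using n by (auto simp: has_dim_def)
  obtain e' l' where d': "dual_basis (wspace M' sc' k) {..<m} e' l'" using m by (auto simp: has_dim_def)
  have eW: "e i \<in> A.W k" if "i < n" for i using dual_basisD(2)[OF d] that by simp
  have eW': "e' i \<in> B.W k" if "i < m" for i using dual_basisD(2)[OF d'] that by simp
  have ec: "e i \<in> carrier M" if "i < n" for i using eW[OF that] by blast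
  have ec': "e' i \<in> carrier M'" if "i < m" for i using eW'[OF that] by blast
  let ?I = "{..<n} \<times> {..<m}"
  have "\<exists>\<theta>. (\<forall>X\<in>carrier T. \<forall>Y\<in>carrier T. \<theta> (X \<otimes>\<^bsub>T\<^esub> Y) = \<theta> X + \<theta> Y) \<and>
     (\<forall>v\<in>carrier M. \<forall>w\<in>carrier M'. \<theta> (pure v w) = l (fst p) (A.comp k v) * l' (snd p) (B.comp k w))"
    if "p \<in> ?I" for p
  proof -
    have "lin_form (wspace M sc k) (l (fst p))" "lin_form (wspace M' sc' k) (l' (snd p))"
      using that dual_basisD(3)[OF d] dual_basisD(3)[OF d'] by auto
    from form_exists[OF this] show ?thesis by metis
  qed
  then obtain \<theta> where \<theta>: "\<And>p X Y. p \<in> ?I \<Longrightarrow> X \<in> carrier T \<Longrightarrow> Y \<in> carrier T \<Longrightarrow> \<theta> p (X \<otimes>\<^bsub>T\<^esub> Y) = \<theta> p X + \<theta> p Y"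
     "\<And>p v w. p \<in> ?I \<Longrightarrow> v \<in> carrier M \<Longrightarrow> w \<in> carrier M' \<Longrightarrow> \<theta> p (pure v w) = l (fst p) (A.comp k v) * l' (snd p) (B.comp k w)"
    by metis
  define E where "E p = pure (e (fst p)) (e' (snd p))" for p
  have EW: "E p \<in> R.W k" if "p \<in> ?I" for p
  proof -
    have ij: "fst p < n" "snd p < m" using that by auto
    have "tsc [:- of_int k, 1:] (E p) = pure (sc [:- of_int k, 1:] (e (fst p))) (e' (snd p))"
      unfolding E_def by (rule tsc(2)[OF ec ec']) (rule ij)+
    also have "sc [:- of_int k, 1:] (e (fst p)) = \<zero>\<^bsub>M\<^esub>" using eW[OF ij(1)] unfolding A.W_iff by blast
    also have "pure \<zero>\<^bsub>M\<^esub> (e' (snd p)) = \<one>\<^bsub>T\<^esub>" using pure_one_left[of "e' (snd p)"] ec'[OF ij(2)] by simp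
    finally show ?thesis
      unfolding R.W_iff using T_closed(4)[OF ec[OF ij(1)] ec'[OF ij(2)]] by (simp add: E_def)
  qed
  have Ec: "E p \<in> carrier T" if "p \<in> ?I" for p using R.W_carrier[OF EW[OF that]] by simp
  have TC: "X \<in> carrier Tgrp" if "X \<in> carrier T" for X using that by simp
  have tsc_add: "tsc [:a + b:] X = tsc [:a:] X \<oplus>\<^bsub>Tgrp\<^esub> tsc [:b:] X" if "X \<in> carrier T" for a b X
    using R.sc_ladd[OF TC[OF that], of "[:a:]" "[:b:]"] by simp
  \<comment> \<open>Both sides are additive in X, so only pure tensors have to be expanded; there
    the components of v and w are written in their bases.\<close>
  have expand: "R.comp k X = (\<Oplus>\<^bsub>Tgrp\<^esub>p\<in>?I. tsc [:\<theta> p X:] (E p))" if "X \<in> carrier T" for X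
    using that
  proof (induction rule: T_induct)
    case (pure v w)
    have cv: "A.comp k v \<in> A.W k" and cw: "B.comp k w \<in> B.W k" using pure by auto
    have lv: "A.comp k v = (\<Oplus>\<^bsub>M\<^esub>i\<in>{..<n}. sc [:l i (A.comp k v):] (e i))"
      using dual_basisD(5)[OF d cv] A.finsum_wspace[of "\<lambda>i. sc [:l i (A.comp k v):] (e i)" "{..<n}" k] eW by (auto simp: Pi_iff)
    have lw: "B.comp k w = (\<Oplus>\<^bsub>M'\<^esub>i\<in>{..<m}. sc' [:l' i (B.comp k w):] (e' i))"
      using dual_basisD(5)[OF d' cw] B.finsum_wspace[of "\<lambda>i. sc' [:l' i (B.comp k w):] (e' i)" "{..<m}" k] eW' by (auto simp: Pi_iff)
    have left: "pure (\<Oplus>\<^bsub>M\<^esub>i\<in>J. x i) y = (\<Oplus>\<^bsub>Tgrp\<^esub>i\<in>J. pure (x i) y)"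
      if "finite J" "\<And>i. i \<in> J \<Longrightarrow> x i \<in> carrier M" "y \<in> carrier M'" for J :: "nat set" and x y
      using that
    proof (induction J rule: finite_induct)
      case empty
      then show ?case using pure_one_left[of y] by simp
    next
      case (insert i J)
      have "(\<Oplus>\<^bsub>M\<^esub>i\<in>J. x i) \<in> carrier M" by (rule A.finsum_closed) (use insert in auto)
      then show ?case using insert T_closed(4) by (simp add: A.finsum_insert TT.finsum_insert Pi_iff pure_add_left)
    qed
    have right: "pure x (\<Oplus>\<^bsub>M'\<^esub>i\<in>J. y i) = (\<Oplus>\<^bsub>Tgrp\<^esub>i\<in>J. pure x (y i))"
      if "finite J" "\<And>i. i \<in> J \<Longrightarrow> y i \<in> carrier M'" "x \<in> carrier M" for J :: "nat set" and x y
      using that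
    proof (induction J rule: finite_induct)
      case empty
      then show ?case using pure_one_right[of x] by simp
    next
      case (insert i J)
      have "(\<Oplus>\<^bsub>M'\<^esub>i\<in>J. y i) \<in> carrier M'" by (rule B.finsum_closed) (use insert in auto)
      then show ?case
        using insert T_closed(4) pure_mult_right[of x "y i" "\<Oplus>\<^bsub>M'\<^esub>i\<in>J. y i"]
        by (simp add: B.finsum_insert TT.finsum_insert Pi_iff)
    qed
    let ?x = "\<lambda>i. sc [:l i (A.comp k v):] (e i)" and ?y = "\<lambda>j. sc' [:l' j (B.comp k w):] (e' j)"
    have xc: "?x i \<in> carrier M" if "i < n" for i using ec[OF that] by blast
    have yc: "?y j \<in> carrier M'" if "j < m" for j using ec'[OF that] by blast
    have "R.comp k (pure v w) = pure (\<Oplus>\<^bsub>M\<^esub>i\<in>{..<n}. ?x i) (\<Oplus>\<^bsub>M'\<^esub>j\<in>{..<m}. ?y j)"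
      using comp_pure[OF pure] lv lw by simp
    also have "\<dots> = (\<Oplus>\<^bsub>Tgrp\<^esub>i\<in>{..<n}. pure (?x i) (\<Oplus>\<^bsub>M'\<^esub>j\<in>{..<m}. ?y j))"
      by (rule left) (use xc yc B.finsum_closed[of ?y "{..<m}"] in auto)
    also have "\<dots> = (\<Oplus>\<^bsub>Tgrp\<^esub>i\<in>{..<n}. \<Oplus>\<^bsub>Tgrp\<^esub>j\<in>{..<m}. pure (?x i) (?y j))"
    proof (rule TT.finsum_cong')
      fix i assume i: "i \<in> {..<n}"
      then have x: "?x i \<in> carrier M" using xc by blast
      show "pure (?x i) (\<Oplus>\<^bsub>M'\<^esub>j\<in>{..<m}. ?y j) = (\<Oplus>\<^bsub>Tgrp\<^esub>j\<in>{..<m}. pure (?x i) (?y j))"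
        by (rule right) (use x yc in blast)+
    next
      show "(\<lambda>i. \<Oplus>\<^bsub>Tgrp\<^esub>j\<in>{..<m}. pure (?x i) (?y j)) \<in> {..<n} \<rightarrow> carrier Tgrp"
        by (intro Pi_I TT.finsum_closed) (use xc yc T_closed(4) in auto)
    qed simp
    also have "\<dots> = (\<Oplus>\<^bsub>Tgrp\<^esub>p\<in>?I. pure (?x (fst p)) (?y (snd p)))"
      by (rule TT.finsum_Times[symmetric]) (use xc yc T_closed(4) in auto)
    also have "\<dots> = (\<Oplus>\<^bsub>Tgrp\<^esub>p\<in>?I. tsc [:\<theta> p (pure v w):] (E p))"
    proof (rule TT.finsum_cong')
      show "(\<lambda>p. tsc [:\<theta> p (pure v w):] (E p)) \<in> ?I \<rightarrow> carrier Tgrp" using Ec T_closed(1) by auto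
      fix p assume p: "p \<in> ?I"
      then have "fst p < n" "snd p < m" by auto
      then show "pure (?x (fst p)) (?y (snd p)) = tsc [:\<theta> p (pure v w):] (E p)"
        using ec[of "fst p"] ec'[of "snd p"] by (simp add: E_def pure_sc2 tsc(2) \<theta>(2)[OF p pure] mult.commute)
    qed simp
    finally show ?case .
  next
    case (add X Y)
    have "R.comp k (X \<otimes>\<^bsub>T\<^esub> Y) = R.comp k X \<oplus>\<^bsub>Tgrp\<^esub> R.comp k Y"
      using R.comp_add[of X Y k] add by simp
    also have "\<dots> = (\<Oplus>\<^bsub>Tgrp\<^esub>p\<in>?I. tsc [:\<theta> p X:] (E p) \<oplus>\<^bsub>Tgrp\<^esub> tsc [:\<theta> p Y:] (E p))"
      unfolding add.IH by (rule TT.finsum_addf[symmetric]) (use Ec T_closed(1) in auto)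
    also have "\<dots> = (\<Oplus>\<^bsub>Tgrp\<^esub>p\<in>?I. tsc [:\<theta> p (X \<otimes>\<^bsub>T\<^esub> Y):] (E p))"
      by (rule TT.finsum_cong') (use Ec T_closed(1) tsc_add \<theta>(1) add in auto)
    finally show ?case .
  qed
  have "dual_basis (wspace Tgrp tsc k) ?I E \<theta>"
    unfolding dual_basis_def
  proof (intro conjI ballI)
    fix p assume p: "p \<in> ?I"
    show "E p \<in> R.W k" by (rule EW[OF p])
    have "\<theta> p (tsc [:c:] X) = c * \<theta> p X" if "X \<in> carrier T" for c X
      using that
    proof (induction rule: T_induct)
      case (pure v w)
      have "lin_form (wspace M sc k) (l (fst p))" using dual_basisD(3)[OF d] p by auto
      then have "l (fst p) (sc [:c:] (A.comp k v)) = c * l (fst p) (A.comp k v)"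
        using A.comp_W[OF pure(1)] by (auto simp: lin_form_def)
      then show ?case using pure by (simp add: tsc(2) \<theta>(2)[OF p] A.comp_sc)
    next
      case (add X Y)
      then show ?case by (simp add: T_mult \<theta>(1)[OF p] T_closed ring_distribs)
    qed
    then show "lin_form (wspace Tgrp tsc k) (\<theta> p)"
      using \<theta>(1)[OF p] R.W_carrier unfolding lin_form_def by fastforce
    fix q assume q: "q \<in> ?I"
    have "\<theta> p (E q) = l (fst p) (e (fst q)) * l' (snd p) (e' (snd q))"
      using q ec ec' eW[of "fst q"] eW'[of "snd q"] unfolding E_def by (auto simp: \<theta>(2)[OF p] A.comp_of_W B.comp_of_W)
    also have "\<dots> = (if p = q then 1 else 0)"
      using p q dual_basisD(4)[OF d, of "fst p" "fst q"] dual_basisD(4)[OF d', of "snd p" "snd q"]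
      by (auto simp: prod_eq_iff)
    finally show "\<theta> p (E q) = (if p = q then 1 else 0)" .
  next
    fix X assume X: "X \<in> R.W k"
    then have "X \<in> carrier T" using R.W_carrier[OF X] by simp
    have "X = R.comp k X" using R.comp_of_W[OF X, of k] by simp
    also have "\<dots> = (\<Oplus>\<^bsub>Tgrp\<^esub>p\<in>?I. tsc [:\<theta> p X:] (E p))" by (rule expand[OF \<open>X \<in> carrier T\<close>])
    also have "\<dots> = (\<Oplus>\<^bsub>wspace Tgrp tsc k\<^esub>p\<in>?I. tsc [:\<theta> p X:] (E p))"
      by (rule R.finsum_wspace[symmetric]) (use EW R.W_closed(3) in blast)
    finally show "X = (\<Oplus>\<^bsub>wspace Tgrp tsc k\<^esub>p\<in>?I. \<theta> p X \<odot>\<^bsub>wspace Tgrp tsc k\<^esub> E p)" by simp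
  qed simp
  from X.dual_basis_imp_has_dim[OF this] show ?thesis by (simp add: card_cartesian_product)
qed

lemma tensor_wrep: "gwa_wrep Tgrp (t * u) tsc tP tQ"
proof
  show "\<exists>n. has_dim (wspace Tgrp tsc k) n" for k
    using A.findim[of k] B.findim[of k] tensor_dim by blast
qed

end

section \<open>Copies of tensor products inside the universe of carriers\<close>

lemma inj_univ_pair: "\<exists>p :: univ \<times> univ \<Rightarrow> univ. inj p"
proof -
  \<comment> \<open>Two sequences of finite support are interleaved at the even and the odd
    places.\<close>
  define h :: "univ \<times> univ \<Rightarrow> nat \<Rightarrow> complex" where
    "h = (\<lambda>(f, g) n. if even n then poly_mapping.lookup f (n div 2) else poly_mapping.lookup g (n div 2))"
  have fin: "finite {n. h x n \<noteq> 0}" for x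
  proof (rule finite_subset)
    show "{n. h x n \<noteq> 0} \<subseteq> (\<lambda>n. 2 * n) ` Poly_Mapping.keys (fst x) \<union> (\<lambda>n. 2 * n + 1) ` Poly_Mapping.keys (snd x)"
    proof
      fix n assume "n \<in> {n. h x n \<noteq> 0}"
      then show "n \<in> (\<lambda>n. 2 * n) ` Poly_Mapping.keys (fst x) \<union> (\<lambda>n. 2 * n + 1) ` Poly_Mapping.keys (snd x)"
        by (cases "even n") (auto simp: h_def in_keys_iff image_iff split: prod.splits intro!: bexI[of _ "n div 2"])
    qed
  qed simp
  have "inj (\<lambda>x. Abs_poly_mapping (h x))"
  proof (rule injI)
    fix x y assume "Abs_poly_mapping (h x) = Abs_poly_mapping (h y)"
    then have eq: "h x = h y" by (simp add: Abs_poly_mapping_inject fin)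
    have "poly_mapping.lookup (fst x) n = poly_mapping.lookup (fst y) n" for n
      using fun_cong[OF eq, of "2 * n"] by (simp add: h_def split: prod.splits)
    moreover have "poly_mapping.lookup (snd x) n = poly_mapping.lookup (snd y) n" for n
      using fun_cong[OF eq, of "2 * n + 1"] by (simp add: h_def split: prod.splits)
    ultimately show "x = y" by (simp add: prod_eq_iff poly_mapping_eqI)
  qed
  then show ?thesis by blast
qed

text \<open>Elements of a tensor product are cosets of formal integer combinations of pairs, and a
  coset is to be named by an encoded representative. A combination is coded as a list of points with
  coefficients, and lists are coded by iterated pairing.\<close>

lemma inj_frag_univ: "\<exists>f :: ((univ \<times> univ) \<Rightarrow>\<^sub>0 int) \<Rightarrow> univ. inj f"
proof -
  obtain p :: "univ \<times> univ \<Rightarrow> univ" where p: "inj p" using inj_univ_pair by blast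
  define num :: "nat \<Rightarrow> univ" where "num n = Poly_Mapping.single n 1" for n
  have num: "num m = num n \<longleftrightarrow> m = n" for m n
    by (auto simp: num_def) (metis lookup_single_eq lookup_single_not_eq zero_neq_one)
  define q :: "(univ \<times> univ) \<times> int \<Rightarrow> univ" where "q = (\<lambda>(x, k). p (p x, num (int_encode k)))"
  have q: "q x = q y \<longleftrightarrow> x = y" for x y
    by (auto simp: q_def inj_eq[OF p] num inj_eq[OF inj_int_encode] split: prod.splits)
  \<comment> \<open>The tags \<open>num 0\<close> and \<open>num 1\<close> separate the empty list
    from a nonempty one; decoding then proceeds through the injective pairing.\<close>
  define enc :: "((univ \<times> univ) \<times> int) list \<Rightarrow> univ" where
    "enc = rec_list (p (num 0, num 0)) (\<lambda>x _ r. p (num 1, p (q x, r)))"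
  have enc: "enc xs = enc ys \<Longrightarrow> xs = ys" for xs ys
  proof (induction xs arbitrary: ys)
    case Nil
    then show ?case by (cases ys) (auto simp: enc_def inj_eq[OF p] num)
  next
    case (Cons x xs)
    then show ?case by (cases ys) (auto simp: enc_def inj_eq[OF p] num q)
  qed
  define graph :: "((univ \<times> univ) \<Rightarrow>\<^sub>0 int) \<Rightarrow> ((univ \<times> univ) \<times> int) set" where
    "graph x = (\<lambda>a. (a, poly_mapping.lookup x a)) ` Poly_Mapping.keys x" for x
  have graph: "x = y" if "graph x = graph y" for x y
  proof (rule poly_mapping_eqI)
    fix a
    have mem: "(a, k) \<in> graph z \<longleftrightarrow> k \<noteq> 0 \<and> poly_mapping.lookup z a = k" for k z
      by (auto simp: graph_def in_keys_iff)
    have "(a, k) \<in> graph x \<longleftrightarrow> (a, k) \<in> graph y" for k by (simp only: that)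
    then have e: "(k \<noteq> 0 \<and> poly_mapping.lookup x a = k) \<longleftrightarrow> (k \<noteq> 0 \<and> poly_mapping.lookup y a = k)" for k
      by (simp only: mem)
    show "poly_mapping.lookup x a = poly_mapping.lookup y a" by (metis e)
  qed
  have "\<exists>l. set l = graph x" for x unfolding graph_def by (rule finite_list) simp
  then obtain l where l: "\<And>x. set (l x) = graph x" by metis
  have "inj (\<lambda>x. enc (l x))" by (rule injI) (metis enc l graph)
  then show ?thesis by blast
qed

text \<open>Distinct cosets are disjoint, so the chosen representative determines its coset.
  Composed with the encoding of combinations this injects the tensor group into
  \<open>univ\<close>.\<close>

lemma (in balanced) T_representative:
  assumes "X \<in> carrier T" "Y \<in> carrier T" "(SOME x. x \<in> X) = (SOME x. x \<in> Y)"
  shows "X = Y"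
proof -
  let ?F = "free_Abelian_group (carrier G \<times> carrier H)" and ?N = "tensor_null S a b G H"
  have sub: "subgroup ?N ?F"
    unfolding tensor_null_def by (rule group.generate_is_subgroup[OF group_free_Abelian_group relators_carrier])
  have rc: "Z \<in> rcosets\<^bsub>?F\<^esub> ?N" if "Z \<in> carrier T" for Z
    using that by (simp add: tensor_group_def FactGroup_def)
  have ne: "(SOME x. x \<in> Z) \<in> Z" if Z: "Z \<in> carrier T" for Z
  proof -
    obtain x where "x \<in> carrier ?F" "Z = ?N #>\<^bsub>?F\<^esub> x" using rc[OF Z] by (auto simp: RCOSETS_def)
    then have "x \<in> Z" using group.rcos_self[OF group_free_Abelian_group _ sub] by blast
    then show ?thesis by (rule someI)
  qed
  have "(SOME x. x \<in> X) \<in> X \<inter> Y" using ne[OF assms(1)] ne[OF assms(2)] assms(3) by simp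
  then show ?thesis
    using group.rcos_disjoint[OF group_free_Abelian_group sub] rc assms(1,2)
    unfolding pairwise_def disjnt_def by blast
qed

lemma is_tensor_exists:
  assumes M: "M \<in> wmod t" and M': "M' \<in> wmod u"
  shows "\<exists>N. is_tensor t M u M' N"
proof -
  interpret gwa_wtensor M t "mod_sc t M" "mod_gen t M GenXp" "mod_gen t M GenXm"
    M' u "mod_sc u M'" "mod_gen u M' GenXp" "mod_gen u M' GenXm"
    using M M' by (simp add: wmod_iff gwa_wtensor_def)
  obtain enc :: "((univ \<times> univ) \<Rightarrow>\<^sub>0 int) \<Rightarrow> univ" where enc: "inj enc" using inj_frag_univ by blast
  define f where "f X = enc (SOME x. x \<in> X)" for X
  have inj: "inj_on f (carrier T)"
  proof (rule inj_onI)
    fix X Y assume XY: "X \<in> carrier T" "Y \<in> carrier T" "f X = f Y"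
    show "X = Y" by (rule T_representative[OF XY(1,2)], rule injD[OF enc XY(3)[unfolded f_def]])
  qed
  obtain N where N: "N \<in> wmod (t * u)" "f ` carrier Tgrp = carrier N" "f \<zero>\<^bsub>Tgrp\<^esub> = \<zero>\<^bsub>N\<^esub>"
    "\<And>X Y. X \<in> carrier Tgrp \<Longrightarrow> Y \<in> carrier Tgrp \<Longrightarrow> f (X \<oplus>\<^bsub>Tgrp\<^esub> Y) = f X \<oplus>\<^bsub>N\<^esub> f Y"
    "\<And>r X. X \<in> carrier Tgrp \<Longrightarrow> f (tsc r X) = mod_sc (t * u) N r (f X)"
    "\<And>X. X \<in> carrier Tgrp \<Longrightarrow> f (tP X) = mod_gen (t * u) N GenXp (f X)"
    "\<And>X. X \<in> carrier Tgrp \<Longrightarrow> f (tQ X) = mod_gen (t * u) N GenXm (f X)"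
    by (rule wmod_realize[where f = f, OF tensor_wrep]) (auto dest!: inj_onD[OF inj])
  have "f \<in> iso T (add_monoid N)"
    using N(2,4) inj by (auto simp: iso_def hom_def bij_betw_def)
  moreover have "left_module (GWA (t * u)) N" using N(1) by (simp add: wmod_iff)
  ultimately have "is_tensor t M u M' N"
    unfolding is_tensor_def Let_def
    by (intro conjI bexI[of _ f] ballI allI)
      (use N(5-7) T_closed(4) in \<open>auto simp: tsc(2)[symmetric] tP(2)[symmetric] tQ(2)[symmetric]\<close>)
  then show ?thesis by blast
qed

text \<open>It is stated for every N with the tensor property because \<open>tensor_mod\<close> is
  an unspecified choice. The isomorphism carries over dimensions from the abstract tensor
  group.\<close>

lemma is_tensor_wmod:
  assumes M: "M \<in> wmod t" and M': "M' \<in> wmod u" and N: "is_tensor t M u M' N"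
  shows "N \<in> wmod (t * u)" and "wdim (t * u) N k = wdim t M k * wdim u M' k"
proof -
  interpret gwa_wtensor M t "mod_sc t M" "mod_gen t M GenXp" "mod_gen t M GenXm"
    M' u "mod_sc u M'" "mod_gen u M' GenXp" "mod_gen u M' GenXm"
    using M M' by (simp add: wmod_iff gwa_wtensor_def)
  have NL: "left_module (GWA (t * u)) N" using N unfolding is_tensor_def by blast
  interpret N: gwa_rep N "t * u" "mod_sc (t * u) N" "mod_gen (t * u) N GenXp" "mod_gen (t * u) N GenXm"
    by (rule gwa_rep_of_module[OF NL])
  obtain \<phi> where \<phi>: "\<phi> \<in> iso T (add_monoid N)"
    and sc: "\<And>v w r. v \<in> carrier M \<Longrightarrow> w \<in> carrier M' \<Longrightarrow> mod_sc (t * u) N r (\<phi> (pure v w)) = \<phi> (pure (mod_sc t M r v) w)"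
    and gen: "\<And>v w g. v \<in> carrier M \<Longrightarrow> w \<in> carrier M' \<Longrightarrow> g \<in> {GenXp, GenXm} \<Longrightarrow>
      mod_gen (t * u) N g (\<phi> (pure v w)) = \<phi> (pure (mod_gen t M g v) (mod_gen u M' g w))"
    using N unfolding is_tensor_def Let_def by blast
  have bij: "bij_betw \<phi> (carrier T) (carrier N)" and hom: "\<phi> \<in> hom T (add_monoid N)"
    using \<phi> by (auto simp: iso_def)
  have mult: "\<phi> (X \<otimes>\<^bsub>T\<^esub> Y) = \<phi> X \<oplus>\<^bsub>N\<^esub> \<phi> Y" if "X \<in> carrier T" "Y \<in> carrier T" for X Y
    using hom_mult[OF hom that] by simp
  have cl: "\<phi> X \<in> carrier N" if "X \<in> carrier T" for X using hom_in_carrier[OF hom that] by simp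
  have one: "\<phi> \<one>\<^bsub>T\<^esub> = \<zero>\<^bsub>N\<^esub>"
    using hom_one[OF hom T.is_group N.a_group] by simp
  have sc': "\<phi> (tsc r X) = mod_sc (t * u) N r (\<phi> X)" if "X \<in> carrier T" for r X
    using that by (induction rule: T_induct) (simp_all add: tsc(2) sc T_mult T_closed mult N.sc_radd cl)
  have P': "\<phi> (tP X) = mod_gen (t * u) N GenXp (\<phi> X)" if "X \<in> carrier T" for X
    using that by (induction rule: T_induct) (simp_all add: tP(2) gen T_mult T_closed mult N.P_add cl)
  have Q': "\<phi> (tQ X) = mod_gen (t * u) N GenXm (\<phi> X)" if "X \<in> carrier T" for X
    using that by (induction rule: T_induct) (simp_all add: tQ(2) gen T_mult T_closed mult N.Q_add cl)
  have "wrep (t * u) N"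
    by (rule gwa_wrep_image[where f = \<phi>, OF tensor_wrep])
      (use bij in \<open>simp_all add: bij_betw_def one mult sc' P' Q'\<close>)
  then show NW: "N \<in> wmod (t * u)" using NL by (simp add: wmod_iff)
  show "wdim (t * u) N k = wdim t M k * wdim u M' k"
    by (rule iso_wdim[where h = \<phi>, OF tensor_wrep NW _ _ _ tensor_dim[OF has_dim_wdim[OF M] has_dim_wdim[OF M']]])
      (use bij in \<open>simp_all add: mult sc'\<close>)
qed

lemma tensor_mod:
  assumes "M \<in> wmod t" "M' \<in> wmod u"
  shows "tensor_mod t M u M' \<in> wmod (t * u)"
    and "wdim (t * u) (tensor_mod t M u M') k = wdim t M k * wdim u M' k"
  using is_tensor_wmod[OF assms] someI_ex[OF is_tensor_exists[OF assms]] unfolding tensor_mod_def by blast+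

subsection \<open>Complexified Grothendieck groups\<close>

lemma int_pow_class_ring: "x [^]\<^bsub>add_monoid class_ring\<^esub> (n :: int) = of_int n * (x :: 'a::ring_1)"
proof -
  have nat: "x [^]\<^bsub>add_monoid class_ring\<^esub> (m :: nat) = of_nat m * x" for m
    by (induction m) (simp_all add: nat_pow_def algebra_simps)
  have grp: "group (add_monoid (class_ring :: 'a ring))"
    using abelian_group.a_group[OF ring.is_abelian_group[OF class_ring_ring]] .
  have inv: "inv\<^bsub>add_monoid class_ring\<^esub> y = - y" for y :: 'a
    using class_ring_a_inv[of y] by (simp add: a_inv_def)
  show ?thesis
  proof (cases n)
    case (nonneg m)
    then show ?thesis by (simp only: int_pow_int nat of_int_of_nat_eq)
  next
    case (neg m)
    have "x [^]\<^bsub>add_monoid class_ring\<^esub> (- int (Suc m)) = inv\<^bsub>add_monoid class_ring\<^esub> (x [^]\<^bsub>add_monoid class_ring\<^esub> (int (Suc m)))"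
      by (rule group.int_pow_neg[OF grp]) simp
    also have "\<dots> = - (of_nat (Suc m) * x)" unfolding inv int_pow_int nat ..
    finally show ?thesis by (simp add: neg algebra_simps)
  qed
qed

text \<open>An opaque name keeps the simplifier from rewriting inside the tensor groups.\<close>

definition addC :: "complex monoid" where "addC = add_monoid CC"

lemma addC_simps [simp]:
  "carrier addC = UNIV" "x \<otimes>\<^bsub>addC\<^esub> y = x + y" "\<one>\<^bsub>addC\<^esub> = 0" "inv\<^bsub>addC\<^esub> x = - x"
  using class_ring_a_inv[of x] by (simp_all add: addC_def a_inv_def)

lemma addC_pow: "x [^]\<^bsub>addC\<^esub> (n :: int) = of_int n * x"
  unfolding addC_def by (rule int_pow_class_ring)

lemma addC_comm_group: "comm_group addC"
  unfolding addC_def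
  using abelian_group.a_comm_group[OF ring.is_abelian_group[OF class_ring_ring]] .

locale cplx = comm_group G for G :: "'g monoid"
begin

sublocale balanced "UNIV :: int set" "\<lambda>n c. c [^]\<^bsub>addC\<^esub> n" "\<lambda>n g. g [^]\<^bsub>G\<^esub> n" addC G
  by (intro balanced.intro balanced_axioms.intro addC_comm_group comm_group_axioms) (auto intro: int_pow_closed)

abbreviation "V \<equiv> complexification G"

lemma V_simps [simp]:
  "carrier V = carrier T" "\<zero>\<^bsub>V\<^esub> = \<one>\<^bsub>T\<^esub>" "X \<oplus>\<^bsub>V\<^esub> Y = X \<otimes>\<^bsub>T\<^esub> Y"
  unfolding complexification_def addC_def[symmetric] by simp_all

lemma scaling_hom:
  obtains m where "m \<in> hom T T" "\<And>d g. g \<in> carrier G \<Longrightarrow> m (pure d g) = pure (c * d) g"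
proof -
  obtain m where "m \<in> hom T T" "\<And>d g. d \<in> carrier addC \<Longrightarrow> g \<in> carrier G \<Longrightarrow> m (pure d g) = pure (c * d) g"
  proof (rule tensor_universal[OF T.comm_group_axioms, of "\<lambda>d g. pure (c * d) g"], goal_cases)
    case (1 d g) then show ?case by (intro pure_closed) auto
  next
    case (2 d d' g) then show ?case using pure_mult_left[of "c * d" "c * d'" g] by (simp add: ring_distribs)
  next
    case (3 d g g') then show ?case by (intro pure_mult_right) auto
  next
    case (4 n d g) then show ?case
      using pure_balanced[of n "c * d" g] by (simp add: addC_pow mult.left_commute)
  next
    case (5 m) then show ?case by blast
  qed
  then show thesis using that by simp
qed

text \<open>The scalar multiple is defined as a union over representatives. Scaling by c also exists
  abstractly, as a homomorphism m from the universal property. Every representative of X leads to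
  the coset m X, so the union is that single coset.\<close>

lemma smult_hom: "(\<lambda>X. c \<odot>\<^bsub>V\<^esub> X) \<in> hom T T"
  and smult_pure: "g \<in> carrier G \<Longrightarrow> c \<odot>\<^bsub>V\<^esub> pure d g = pure (c * d) g"
proof -
  obtain m where m: "m \<in> hom T T" "\<And>d g. g \<in> carrier G \<Longrightarrow> m (pure d g) = pure (c * d) g"
    by (rule scaling_hom[of c]) (rule that)
  let ?S = "carrier addC \<times> carrier G"
  let ?c = "tensor_coset (UNIV :: int set) (\<lambda>n c. c [^]\<^bsub>addC\<^esub> n) (\<lambda>n g. g [^]\<^bsub>G\<^esub> n) addC G"
  let ?f = "frag_extend (\<lambda>(d, g). frag_of (c * d, g))"
  interpret m: group_hom T T m by (simp add: group_hom_def group_hom_axioms_def m T.is_group)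
  have ch: "?c \<in> hom (free_Abelian_group ?S) T"
    unfolding T_def ext[OF pure_def'] by (rule pres_class_hom[OF relators_carrier])
  interpret ch: group_hom "free_Abelian_group ?S" T ?c
    by (rule group_hom.intro[OF group_free_Abelian_group T.is_group group_hom_axioms.intro[OF ch]])
  have diff: "?c (x - y) = ?c x \<otimes>\<^bsub>T\<^esub> inv\<^bsub>T\<^esub> ?c y"
    if "Poly_Mapping.keys x \<subseteq> ?S" "Poly_Mapping.keys y \<subseteq> ?S" for x y
    using ch.hom_mult[of x "inv\<^bsub>free_Abelian_group ?S\<^esub> y"] ch.hom_inv[of y] that by simp
  \<comment> \<open>The condition on keys is carried along so that the coset map, a homomorphism
    only on the free group over these generators, may be applied to the image.\<close>
  have "Poly_Mapping.keys (?f x) \<subseteq> ?S \<and> ?c (?f x) = m (?c x)" if "Poly_Mapping.keys x \<subseteq> ?S" for x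
    using that
  proof (rule free_Abelian_group_induct)
    show "Poly_Mapping.keys (?f 0) \<subseteq> ?S \<and> ?c (?f 0) = m (?c 0)"
      using ch.hom_one m.hom_one by simp
  next
    fix x y assume xy: "Poly_Mapping.keys x \<subseteq> ?S" "Poly_Mapping.keys y \<subseteq> ?S"
      "Poly_Mapping.keys (?f x) \<subseteq> ?S \<and> ?c (?f x) = m (?c x)" "Poly_Mapping.keys (?f y) \<subseteq> ?S \<and> ?c (?f y) = m (?c y)"
    have k: "Poly_Mapping.keys (?f x - ?f y) \<subseteq> ?S" using xy(3,4) keys_diff[of "?f x" "?f y"] by blast
    have "?c x \<in> carrier T" "?c y \<in> carrier T" using ch.hom_closed xy by simp_all
    then show "Poly_Mapping.keys (?f (x - y)) \<subseteq> ?S \<and> ?c (?f (x - y)) = m (?c (x - y))"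
      using k xy diff m.hom_mult m.hom_inv by (simp add: frag_extend_diff)
  next
    fix a assume "a \<in> ?S"
    then show "Poly_Mapping.keys (?f (frag_of a)) \<subseteq> ?S \<and> ?c (?f (frag_of a)) = m (?c (frag_of a))"
      using m(2) by auto
  qed
  then have fm: "?c (?f x) = m (?c x)" if "Poly_Mapping.keys x \<subseteq> ?S" for x using that by blast
  have sm: "c \<odot>\<^bsub>V\<^esub> X = m X" if X: "X \<in> carrier T" for X
  proof -
    let ?N = "tensor_null (UNIV :: int set) (\<lambda>n c. c [^]\<^bsub>addC\<^esub> n) (\<lambda>n g. g [^]\<^bsub>G\<^esub> n) addC G"
    have sub: "subgroup ?N (free_Abelian_group ?S)"
      unfolding tensor_null_def by (rule group.generate_is_subgroup[OF group_free_Abelian_group relators_carrier])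
    obtain x where x: "Poly_Mapping.keys x \<subseteq> ?S" "X = ?c x"
      using X by (auto simp: tensor_group_def FactGroup_def RCOSETS_def tensor_coset_def)
    have xX: "x \<in> X"
      using group.rcos_self[OF group_free_Abelian_group _ sub, of x] x by (simp add: tensor_coset_def)
    have "?c (?f y) = m X" if "y \<in> X" for y
    proof -
      have y: "y \<in> carrier (free_Abelian_group ?S)"
      proof (rule subsetD)
        show "?N #>\<^bsub>free_Abelian_group ?S\<^esub> x \<subseteq> carrier (free_Abelian_group ?S)"
          by (rule monoid.r_coset_subset_G[OF group.is_monoid[OF group_free_Abelian_group] subgroup.subset[OF sub]])
            (use x in simp)
        show "y \<in> ?N #>\<^bsub>free_Abelian_group ?S\<^esub> x" using that x(2) by (simp only: tensor_coset_def)
      qed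
      have "?c x = ?c y"
        using group.repr_independence[OF group_free_Abelian_group _ _ sub, of y x] that x
        by (simp add: tensor_coset_def)
      then show ?thesis using fm[of y] y x by simp
    qed
    then have "(\<Union>y\<in>X. ?c (?f y)) = m X" using xX by blast
    then show ?thesis unfolding complexification_def addC_def[symmetric] by simp
  qed
  show "(\<lambda>X. c \<odot>\<^bsub>V\<^esub> X) \<in> hom T T"
    using m(1) sm by (simp add: hom_def Pi_def)
  show "g \<in> carrier G \<Longrightarrow> c \<odot>\<^bsub>V\<^esub> pure d g = pure (c * d) g"
    using sm m(2) pure_closed[of d g] by simp
qed

lemma complexification_module: "module CC V"
proof (rule moduleI[OF class_ring_cring])
  show "abelian_group V"
  proof (rule abelian_groupI)
    show "\<exists>Y\<in>carrier V. Y \<oplus>\<^bsub>V\<^esub> X = \<zero>\<^bsub>V\<^esub>" if "X \<in> carrier V" for X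
      using that by (intro bexI[of _ "inv\<^bsub>T\<^esub> X"]) simp_all
    show "X \<oplus>\<^bsub>V\<^esub> Y = Y \<oplus>\<^bsub>V\<^esub> X" if "X \<in> carrier V" "Y \<in> carrier V" for X Y
      using that by (simp add: T.m_comm)
  qed (simp_all add: T.m_assoc)
  have cl: "c \<odot>\<^bsub>V\<^esub> X \<in> carrier T" if "X \<in> carrier T" for c X
    using hom_in_carrier[OF smult_hom that] .
  have mu: "c \<odot>\<^bsub>V\<^esub> (X \<otimes>\<^bsub>T\<^esub> Y) = (c \<odot>\<^bsub>V\<^esub> X) \<otimes>\<^bsub>T\<^esub> (c \<odot>\<^bsub>V\<^esub> Y)" if "X \<in> carrier T" "Y \<in> carrier T" for c X Y
    using hom_mult[OF smult_hom that] .
  show "a \<odot>\<^bsub>V\<^esub> X \<in> carrier V" if "X \<in> carrier V" for a X using cl that by simp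
  show "a \<odot>\<^bsub>V\<^esub> (X \<oplus>\<^bsub>V\<^esub> Y) = a \<odot>\<^bsub>V\<^esub> X \<oplus>\<^bsub>V\<^esub> a \<odot>\<^bsub>V\<^esub> Y" if "X \<in> carrier V" "Y \<in> carrier V" for a X Y
    using mu that by simp
  fix a b X assume "X \<in> carrier V"
  then have X: "X \<in> carrier T" by simp
  have "(a + b) \<odot>\<^bsub>V\<^esub> X = (a \<odot>\<^bsub>V\<^esub> X) \<otimes>\<^bsub>T\<^esub> (b \<odot>\<^bsub>V\<^esub> X)"
    using X
  proof (induction rule: tensor_induct)
    case (pure d g)
    then show ?case using pure_mult_left[of "a * d" "b * d" g] by (simp add: smult_pure ring_distribs)
  next
    case (mult X Y)
    then show ?case using cl by (simp add: mu T.m_ac)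
  qed
  then show "(a \<oplus>\<^bsub>CC\<^esub> b) \<odot>\<^bsub>V\<^esub> X = a \<odot>\<^bsub>V\<^esub> X \<oplus>\<^bsub>V\<^esub> b \<odot>\<^bsub>V\<^esub> X" by simp
  have "(a * b) \<odot>\<^bsub>V\<^esub> X = a \<odot>\<^bsub>V\<^esub> (b \<odot>\<^bsub>V\<^esub> X)"
    using X by (induction rule: tensor_induct) (simp_all add: smult_pure mult.assoc mu cl)
  then show "(a \<otimes>\<^bsub>CC\<^esub> b) \<odot>\<^bsub>V\<^esub> X = a \<odot>\<^bsub>V\<^esub> (b \<odot>\<^bsub>V\<^esub> X)" by simp
  have "1 \<odot>\<^bsub>V\<^esub> X = X"
    using X by (induction rule: tensor_induct) (simp_all add: smult_pure mu)
  then show "\<one>\<^bsub>CC\<^esub> \<odot>\<^bsub>V\<^esub> X = X" by simp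
qed

end

section \<open>External direct sums of complex vector spaces\<close>

lemma dsum_carrier:
  assumes "\<And>i. i \<in> I \<Longrightarrow> abelian_group (V i)"
  shows "x \<in> carrier (dsum I V) \<longleftrightarrow> x \<in> (\<Pi>\<^sub>E i\<in>I. carrier (V i)) \<and> finite {i \<in> I. x i \<noteq> \<zero>\<^bsub>V i\<^esub>}"
proof -
  have "group (add_monoid (V i))" if "i \<in> I" for i using abelian_group.a_group[OF assms[OF that]] .
  then show ?thesis by (simp add: dsum_def carrier_sum_group)
qed

lemma dsum_simps [simp]:
  "x \<oplus>\<^bsub>dsum I V\<^esub> y = (\<lambda>i\<in>I. x i \<oplus>\<^bsub>V i\<^esub> y i)" "\<zero>\<^bsub>dsum I V\<^esub> = (\<lambda>i\<in>I. \<zero>\<^bsub>V i\<^esub>)"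
  "c \<odot>\<^bsub>dsum I V\<^esub> x = (\<lambda>i\<in>I. c \<odot>\<^bsub>V i\<^esub> x i)"
  by (simp_all add: dsum_def)

lemma dsum_module:
  assumes V: "\<And>i. i \<in> I \<Longrightarrow> module CC (V i)"
  shows "module CC (dsum I V)"
proof -
  have ag: "abelian_group (V i)" if "i \<in> I" for i using V[OF that] by (simp add: module_def)
  have car: "x \<in> carrier (dsum I V) \<longleftrightarrow> x \<in> (\<Pi>\<^sub>E i\<in>I. carrier (V i)) \<and> finite {i \<in> I. x i \<noteq> \<zero>\<^bsub>V i\<^esub>}" for x
    by (rule dsum_carrier) (rule ag)
  note s = module.smult_closed[OF V] module.smult_l_distr[OF V] module.smult_r_distr[OF V]
    module.smult_assoc1[OF V] module.smult_one[OF V] module.smult_r_null[OF V]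
  note am = abelian_group.axioms(1)[OF ag]
  note closed = abelian_monoid.a_closed[OF am] abelian_monoid.zero_closed[OF am] abelian_group.a_inv_closed[OF ag]
  note zero_neg = abelian_monoid.l_zero[OF am] abelian_group.l_neg[OF ag]
  have neg_zero: "\<ominus>\<^bsub>V i\<^esub> \<zero>\<^bsub>V i\<^esub> = \<zero>\<^bsub>V i\<^esub>" if "i \<in> I" for i
    using abelian_group.minus_equality[OF ag[OF that]] closed(2)[OF that] zero_neg(1)[OF that] by metis
  have mem: "x i \<in> carrier (V i)" if "x \<in> carrier (dsum I V)" "i \<in> I" for x i
    using that by (auto simp: car)
  have ext: "x = (\<lambda>i\<in>I. x i)" if "x \<in> carrier (dsum I V)" for x
    using that by (auto simp: car PiE_def extensional_def restrict_def)
  have zero: "\<zero>\<^bsub>dsum I V\<^esub> \<in> carrier (dsum I V)"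
    by (auto simp: car closed)
  have pointwise: "(\<lambda>i\<in>I. f i) \<in> carrier (dsum I V)"
    if "\<And>i. i \<in> I \<Longrightarrow> f i \<in> carrier (V i)" "A \<subseteq> I" "finite A" "\<And>i. i \<in> I \<Longrightarrow> i \<notin> A \<Longrightarrow> f i = \<zero>\<^bsub>V i\<^esub>" for f A
  proof -
    have "{i \<in> I. (\<lambda>i\<in>I. f i) i \<noteq> \<zero>\<^bsub>V i\<^esub>} \<subseteq> A" using that(4) by auto
    then have "finite {i \<in> I. (\<lambda>i\<in>I. f i) i \<noteq> \<zero>\<^bsub>V i\<^esub>}" using that(3) by (rule finite_subset)
    moreover have "(\<lambda>i\<in>I. f i) \<in> (\<Pi>\<^sub>E i\<in>I. carrier (V i))" using that(1) by auto
    ultimately show ?thesis unfolding car by blast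
  qed
  have supp: "finite {i \<in> I. x i \<noteq> \<zero>\<^bsub>V i\<^esub>}" if "x \<in> carrier (dsum I V)" for x using that by (simp add: car)
  have add: "x \<oplus>\<^bsub>dsum I V\<^esub> y \<in> carrier (dsum I V)" if "x \<in> carrier (dsum I V)" "y \<in> carrier (dsum I V)" for x y
    unfolding dsum_simps
    by (rule pointwise[of _ "{i \<in> I. x i \<noteq> \<zero>\<^bsub>V i\<^esub>} \<union> {i \<in> I. y i \<noteq> \<zero>\<^bsub>V i\<^esub>}"])
      (use supp that in \<open>auto simp: mem closed zero_neg\<close>)
  have sm: "c \<odot>\<^bsub>dsum I V\<^esub> x \<in> carrier (dsum I V)" if "x \<in> carrier (dsum I V)" for c x
    unfolding dsum_simps
    by (rule pointwise[of _ "{i \<in> I. x i \<noteq> \<zero>\<^bsub>V i\<^esub>}"]) (use supp that in \<open>auto simp: mem s\<close>)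
  have neg: "(\<lambda>i\<in>I. \<ominus>\<^bsub>V i\<^esub> x i) \<in> carrier (dsum I V)" if "x \<in> carrier (dsum I V)" for x
    by (rule pointwise[of _ "{i \<in> I. x i \<noteq> \<zero>\<^bsub>V i\<^esub>}"]) (use supp that in \<open>auto simp: mem closed neg_zero\<close>)
  show ?thesis
  proof (rule moduleI[OF class_ring_cring])
    show "abelian_group (dsum I V)"
    proof (rule abelian_groupI)
      fix x y z assume x: "x \<in> carrier (dsum I V)" and y: "y \<in> carrier (dsum I V)" and z: "z \<in> carrier (dsum I V)"
      show "x \<oplus>\<^bsub>dsum I V\<^esub> y \<in> carrier (dsum I V)" by (rule add[OF x y])
      show "x \<oplus>\<^bsub>dsum I V\<^esub> y \<oplus>\<^bsub>dsum I V\<^esub> z = x \<oplus>\<^bsub>dsum I V\<^esub> (y \<oplus>\<^bsub>dsum I V\<^esub> z)"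
        by (auto intro!: restrict_ext simp: abelian_monoid.a_assoc[OF am] mem[OF x] mem[OF y] mem[OF z])
      show "x \<oplus>\<^bsub>dsum I V\<^esub> y = y \<oplus>\<^bsub>dsum I V\<^esub> x"
        unfolding dsum_simps
        by (rule restrict_ext) (intro abelian_monoid.a_comm[OF am] mem[OF x] mem[OF y])
    next
      fix x assume x: "x \<in> carrier (dsum I V)"
      show "\<zero>\<^bsub>dsum I V\<^esub> \<oplus>\<^bsub>dsum I V\<^esub> x = x"
        by (subst (2) ext[OF x]) (auto intro!: restrict_ext simp: zero_neg mem[OF x])
      show "\<exists>y\<in>carrier (dsum I V). y \<oplus>\<^bsub>dsum I V\<^esub> x = \<zero>\<^bsub>dsum I V\<^esub>"
        by (intro bexI[OF _ neg[OF x]]) (auto intro!: restrict_ext simp: zero_neg mem[OF x])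
    qed (rule zero)
    fix a b x y assume x: "x \<in> carrier (dsum I V)"
    show "a \<odot>\<^bsub>dsum I V\<^esub> x \<in> carrier (dsum I V)" by (rule sm[OF x])
    show "(a \<oplus>\<^bsub>CC\<^esub> b) \<odot>\<^bsub>dsum I V\<^esub> x = a \<odot>\<^bsub>dsum I V\<^esub> x \<oplus>\<^bsub>dsum I V\<^esub> b \<odot>\<^bsub>dsum I V\<^esub> x"
      using s(2) by (auto intro!: restrict_ext simp: mem[OF x])
    show "a \<odot>\<^bsub>dsum I V\<^esub> (x \<oplus>\<^bsub>dsum I V\<^esub> y) = a \<odot>\<^bsub>dsum I V\<^esub> x \<oplus>\<^bsub>dsum I V\<^esub> a \<odot>\<^bsub>dsum I V\<^esub> y"
      if "y \<in> carrier (dsum I V)"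
      using s(3) by (auto intro!: restrict_ext simp: mem[OF x] mem[OF that])
    show "(a \<otimes>\<^bsub>CC\<^esub> b) \<odot>\<^bsub>dsum I V\<^esub> x = a \<odot>\<^bsub>dsum I V\<^esub> (b \<odot>\<^bsub>dsum I V\<^esub> x)"
      using s(4) by (auto intro!: restrict_ext simp: mem[OF x])
    show "\<one>\<^bsub>CC\<^esub> \<odot>\<^bsub>dsum I V\<^esub> x = x"
      using s(5) by (subst (2) ext[OF x]) (auto intro!: restrict_ext simp: mem[OF x])
  qed
qed

section \<open>Classes and dimensions in the Grothendieck groups\<close>

lemma K0_relators_carrier: "K0_relators t \<subseteq> carrier (free_Abelian_group (wmod t))"
proof -
  have 1: "Poly_Mapping.keys (frag_of x - frag_of y) \<subseteq> {x, y}" for x y :: gmod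
    using keys_diff[of "frag_of x" "frag_of y"] by auto
  have "Poly_Mapping.keys (frag_of x - frag_of y - frag_of z) \<subseteq> {x, y, z}" for x y z :: gmod
    using keys_diff[of "frag_of x - frag_of y" "frag_of z"] 1[of x y] by auto
  then show ?thesis
    unfolding K0_relators_def carrier_free_Abelian_group_iff subset_iff by blast
qed

lemma K0_comm_group: "comm_group (K0 t)"
  unfolding K0_def K0_null_def by (rule pres_comm_group[OF K0_relators_carrier])

lemma K0_class_closed: "M \<in> wmod t \<Longrightarrow> K0_class t M \<in> carrier (K0 t)"
  unfolding K0_def K0_class_def K0_null_def by (rule pres_class_closed[OF K0_relators_carrier]) simp

lemma K0_class_exact:
  assumes M: "M \<in> wmod t" "M' \<in> wmod t" "M'' \<in> wmod t" and ex: "short_exact (GWA t) M M'' M'"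
  shows "K0_class t M'' = K0_class t M \<otimes>\<^bsub>K0 t\<^esub> K0_class t M'"
proof -
  have "K0_class t M'' = K0_null t #>\<^bsub>free_Abelian_group (wmod t)\<^esub> (frag_of M + frag_of M')"
    unfolding K0_class_def K0_null_def
  proof (rule pres_class_eq[OF K0_relators_carrier])
    show "frag_of M'' - (frag_of M + frag_of M') \<in> K0_relators t"
      using M ex unfolding K0_relators_def diff_diff_eq[symmetric] by blast
    show "Poly_Mapping.keys (frag_of M + frag_of M') \<subseteq> wmod t"
      using M keys_add[of "frag_of M" "frag_of M'"] by auto
  qed (use M in simp)
  also have "\<dots> = K0_class t M \<otimes>\<^bsub>K0 t\<^esub> K0_class t M'"
    unfolding K0_def K0_class_def K0_null_def by (rule pres_class_add[OF K0_relators_carrier]) (use M in auto)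
  finally show ?thesis .
qed

text \<open>Dimension at a fixed weight is additive on short exact sequences, so it factors through
  the relators. Complex values prepare its extension to a linear form.\<close>

lemma K0_dim_hom:
  obtains h where "h \<in> hom (K0 t) addC" "\<And>M. M \<in> wmod t \<Longrightarrow> h (K0_class t M) = of_nat (wdim t M k)"
proof -
  have rel: "h r = \<one>\<^bsub>addC\<^esub>"
    if h: "h \<in> hom (free_Abelian_group (wmod t)) addC" "\<And>M. M \<in> wmod t \<Longrightarrow> h (frag_of M) = of_nat (wdim t M k)"
      and "r \<in> K0_relators t" for h r
  proof -
    obtain M M' M'' where r: "r = frag_of M'' - frag_of M - frag_of M'" "M \<in> wmod t" "M' \<in> wmod t" "M'' \<in> wmod t"
      "short_exact (GWA t) M M'' M'" using \<open>r \<in> K0_relators t\<close> unfolding K0_relators_def by blast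
    have "h r = h (frag_of M'') - h (frag_of M) - h (frag_of M')"
      using hom_frag_relators(2)[OF h(1) addC_comm_group r(2,3,4)] by (simp add: r(1))
    then show ?thesis using h(2) r wdim_exact[OF r(2,4,3,5), of k] by simp
  qed
  obtain h where "h \<in> hom (K0 t) addC" "\<And>M. M \<in> wmod t \<Longrightarrow> h (K0_class t M) = of_nat (wdim t M k)"
    unfolding K0_def K0_class_def K0_null_def
    using pres_universal[OF K0_relators_carrier addC_comm_group, of "\<lambda>M. of_nat (wdim t M k)" t] rel
    by (metis (no_types, lifting) UNIV_I addC_simps(1) subsetI)
  then show thesis by (rule that)
qed

lemma graded_cplx: "cplx (K0 t)"
  using K0_comm_group by (simp add: cplx_def)

lemma graded_module: "module CC (graded_part t)"
  by (rule cplx.complexification_module[OF graded_cplx])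

text \<open>The element 1 \<otimes> [M], written with \<open>addC\<close> so that the facts of the
  locale \<open>cplx\<close> match syntactically; \<open>cplx_coset_mclass\<close> links it to the
  form used in \<open>cls\<close>.\<close>

definition mclass :: "complex poly \<Rightarrow> gmod \<Rightarrow> ((complex \<times> (gmod \<Rightarrow>\<^sub>0 int) set) \<Rightarrow>\<^sub>0 int) set" where
  "mclass t M = pure_tensor (UNIV :: int set) (\<lambda>n c. c [^]\<^bsub>addC\<^esub> n) (\<lambda>n g. g [^]\<^bsub>K0 t\<^esub> n) addC (K0 t) 1 (K0_class t M)"

lemma cplx_coset_mclass: "cplx_coset (K0 t) (frag_of (1, K0_class t M)) = mclass t M"
  by (simp only: mclass_def addC_def)

lemma mclass_closed: "M \<in> wmod t \<Longrightarrow> mclass t M \<in> carrier (graded_part t)"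
proof -
  interpret cplx "K0 t" by (rule graded_cplx)
  show "M \<in> wmod t \<Longrightarrow> mclass t M \<in> carrier (graded_part t)"
    unfolding mclass_def using pure_closed[of 1 "K0_class t M"] K0_class_closed[of M t] by simp
qed

lemma mclass_exact:
  assumes M: "M \<in> wmod t" "M' \<in> wmod t" "M'' \<in> wmod t" and ex: "short_exact (GWA t) M M'' M'"
  shows "mclass t M'' = mclass t M \<oplus>\<^bsub>graded_part t\<^esub> mclass t M'"
proof -
  interpret cplx "K0 t" by (rule graded_cplx)
  show ?thesis
    unfolding mclass_def K0_class_exact[OF assms]
    using pure_mult_right[of 1 "K0_class t M" "K0_class t M'"] K0_class_closed M by simp
qed

text \<open>Pure tensors are c \<otimes> Y with Y in the Grothendieck group, and Y is a difference
  of classes. Negatives are absorbed into the scalar, so multiples of classes and sums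
  suffice.\<close>

lemma graded_induct [consumes 2, case_names mclass add]:
  assumes X: "X \<in> carrier (graded_part t)" and t: "t \<in> Omega"
    and cls: "\<And>c M. M \<in> wmod t \<Longrightarrow> R (c \<odot>\<^bsub>graded_part t\<^esub> mclass t M)"
    and add: "\<And>X Y. X \<in> carrier (graded_part t) \<Longrightarrow> Y \<in> carrier (graded_part t) \<Longrightarrow> R X \<Longrightarrow> R Y
      \<Longrightarrow> R (X \<oplus>\<^bsub>graded_part t\<^esub> Y)"
  shows "R X"
proof -
  interpret cplx "K0 t" by (rule graded_cplx)
  have sm: "c \<odot>\<^bsub>graded_part t\<^esub> mclass t M = pure c (K0_class t M)" if "M \<in> wmod t" for c M
    unfolding mclass_def using smult_pure[OF K0_class_closed[OF that], of c 1] by simp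
  have pure: "\<forall>c. R (pure c Y)" if Y: "Y \<in> carrier (K0 t)" for Y
  proof (rule pres_induct[where P = "\<lambda>Y. \<forall>c. R (pure c Y)", OF K0_relators_carrier Y[unfolded K0_def K0_null_def], folded K0_null_def, folded K0_class_def K0_def])
    \<comment> \<open>The zero element is reached as 0 times a class, which requires some object; t
      in \<open>Omega\<close> supplies a standard module.\<close>
    obtain S h where "is_model t 0 S h" using model_exists[OF t] .
    then have S: "S \<in> wmod t" by (simp add: is_model_def)
    have "R (pure 0 (K0_class t S))" using cls[OF S, of 0] sm[OF S] by simp
    then have "R \<one>\<^bsub>T\<^esub>" using pure_one_left[OF K0_class_closed[OF S]] by simp
    then show "\<forall>c. R (pure c \<one>\<^bsub>K0 t\<^esub>)" using pure_one_right by simp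
  next
    fix M assume M: "M \<in> wmod t"
    show "\<forall>c. R (pure c (K0_class t M))" using cls[OF M] sm[OF M] by simp
  next
    fix Y Z assume YZ: "Y \<in> carrier (K0 t)" "Z \<in> carrier (K0 t)" "\<forall>c. R (pure c Y)" "\<forall>c. R (pure c Z)"
    show "\<forall>c. R (pure c (Y \<otimes>\<^bsub>K0 t\<^esub> inv\<^bsub>K0 t\<^esub> Z))"
    proof
      fix c
      have "pure c (Y \<otimes>\<^bsub>K0 t\<^esub> inv\<^bsub>K0 t\<^esub> Z) = pure c Y \<otimes>\<^bsub>T\<^esub> pure (- c) Z"
        using YZ pure_mult_right[of c Y "inv\<^bsub>K0 t\<^esub> Z"] pure_inv_right[of c Z] pure_inv_left[of c Z] by simp
      then show "R (pure c (Y \<otimes>\<^bsub>K0 t\<^esub> inv\<^bsub>K0 t\<^esub> Z))"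
        using add[of "pure c Y" "pure (- c) Z"] YZ pure_closed by simp
    qed
  qed
  show ?thesis
    using X unfolding V_simps
    by (rule tensor_induct) (use pure add in auto)
qed

text \<open>The pairing of c and Y to c h(Y) is balanced over the integers, where h is the dimension
  homomorphism. This extends the dimension at weight k to a complex-linear form.\<close>

lemma theta_exists:
  "\<exists>\<theta>. lin_form (graded_part t) \<theta> \<and> (\<forall>M\<in>wmod t. \<theta> (mclass t M) = of_nat (wdim t M k))"
proof -
  interpret cplx "K0 t" by (rule graded_cplx)
  obtain h where h: "h \<in> hom (K0 t) addC" "\<And>M. M \<in> wmod t \<Longrightarrow> h (K0_class t M) = of_nat (wdim t M k)"
    by (rule K0_dim_hom[of t k]) (rule that)
  interpret h: group_hom "K0 t" addC h
    by (simp add: group_hom_def group_hom_axioms_def h is_group comm_group.axioms(2)[OF addC_comm_group])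
  obtain \<theta> where \<theta>: "\<theta> \<in> hom T addC"
    "\<And>c Y. c \<in> carrier addC \<Longrightarrow> Y \<in> carrier (K0 t) \<Longrightarrow> \<theta> (pure c Y) = c * h Y"
  proof (rule tensor_universal[OF addC_comm_group, of "\<lambda>c Y. c * h Y"], goal_cases)
    case (3 c Y Z) then show ?case using h.hom_mult[of Y Z] by (simp add: ring_distribs)
  next
    case (4 n c Y)
    have "h (Y [^]\<^bsub>K0 t\<^esub> n) = of_int n * h Y"
      using h.hom_int_pow[of Y n] 4 by (simp add: addC_pow)
    then show ?case by (simp add: addC_pow)
  next
    case (5 \<phi>) then show ?case by blast
  qed (simp_all add: ring_distribs)
  have add: "\<theta> (X \<otimes>\<^bsub>T\<^esub> Y) = \<theta> X + \<theta> Y" if "X \<in> carrier T" "Y \<in> carrier T" for X Y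
    using hom_mult[OF \<theta>(1) that] by simp
  have "\<theta> (c \<odot>\<^bsub>graded_part t\<^esub> X) = c * \<theta> X" if "X \<in> carrier T" for c X
    using that
  proof (induction rule: tensor_induct)
    case (pure d g)
    then show ?case using \<theta>(2)[of "c * d" g] \<theta>(2)[of d g] by (simp add: smult_pure mult.assoc)
  next
    case (mult X Y)
    then show ?case
      using hom_mult[OF smult_hom mult(1,2)] hom_in_carrier[OF smult_hom] by (simp add: add ring_distribs)
  qed
  then have "lin_form (graded_part t) \<theta>" using add by (simp add: lin_form_def)
  moreover have "\<theta> (mclass t M) = of_nat (wdim t M k)" if "M \<in> wmod t" for M
    unfolding mclass_def using \<theta>(2)[of 1 "K0_class t M"] K0_class_closed[OF that] h(2)[OF that] by simp
  ultimately show ?thesis by blast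
qed

subsection \<open>Intervals between consecutive roots\<close>

definition cell :: "complex poly \<Rightarrow> nat \<Rightarrow> int set" where
  "cell t i = {k. ext_root t i < ereal (of_int k) \<and> ereal (of_int k) < ext_root t (Suc i)}"

context
  fixes t assumes t: "t \<in> Omega"
begin

private abbreviation "rs \<equiv> sorted_list_of_set (root_set t)"

lemma length_roots: "length rs = num_roots t"
  by (simp add: num_roots_def)

lemma roots_nth_mono: "m < m' \<Longrightarrow> m' < num_roots t \<Longrightarrow> rs ! m < rs ! m'"
  using sorted_wrt_nth_less[OF strict_sorted_list_of_set[of "root_set t"], of m m'] length_roots by simp

lemma roots_nth_mem: "m < num_roots t \<Longrightarrow> rs ! m \<in> root_set t"
  using nth_mem[of m rs] length_roots finite_root_set[OF t] by simp

lemma root_set_nth: "x \<in> root_set t \<longleftrightarrow> (\<exists>m<num_roots t. x = rs ! m)"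
proof -
  have "x \<in> root_set t \<longleftrightarrow> x \<in> set rs" using finite_root_set[OF t] by simp
  then show ?thesis using length_roots by (auto simp: in_set_conv_nth)
qed

lemma root_not_int: "x \<in> root_set t \<Longrightarrow> x \<noteq> real_of_int k"
proof
  assume "x \<in> root_set t" "x = real_of_int k"
  moreover obtain m :: int where "x = of_int m + 1/2" using Omega_root[OF t \<open>x \<in> root_set t\<close>] .
  ultimately have "real_of_int (2 * k) = real_of_int (2 * m + 1)" by simp
  then have "2 * k = 2 * m + 1" by (simp only: of_int_eq_iff)
  then show False by presburger
qed

lemma ext_root_nth: "0 < i \<Longrightarrow> i \<le> num_roots t \<Longrightarrow> ext_root t i = ereal (rs ! (i - 1))"
  by (simp add: ext_root_def)

text \<open>The roots are listed increasingly, so lying in the i-th interval means that exactly the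
  first i roots are to the left. No root is an integer, hence "not left" is "right".\<close>

lemma cell_iff:
  assumes "i \<le> num_roots t"
  shows "k \<in> cell t i \<longleftrightarrow> (\<forall>m<num_roots t. rs ! m < real_of_int k \<longleftrightarrow> m < i)"
proof -
  have l: "ext_root t i < ereal (of_int k) \<longleftrightarrow> (\<forall>m<i. rs ! m < real_of_int k)"
  proof (cases "i = 0")
    case False
    then have "rs ! m \<le> rs ! (i - 1)" if "m < i" for m
    proof (cases "m = i - 1")
      case False
      then have "m < i - 1" "i - 1 < num_roots t" using that assms by linarith+
      then show ?thesis using roots_nth_mono[of m "i - 1"] by simp
    qed simp
    then show ?thesis using False ext_root_nth[of i] assms by (auto dest: spec[of _ "i - 1"] intro: le_less_trans)
  qed (simp add: ext_root_def)
  have r: "ereal (of_int k) < ext_root t (Suc i) \<longleftrightarrow> (\<forall>m<num_roots t. m \<ge> i \<longrightarrow> real_of_int k < rs ! m)"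
  proof (cases "i = num_roots t")
    case False
    then have i: "i < num_roots t" using assms by simp
    have "rs ! i \<le> rs ! m" if "m \<ge> i" "m < num_roots t" for m
      using that roots_nth_mono[of i m] by (cases "m = i") auto
    then show ?thesis using i ext_root_nth[of "Suc i"] by (auto dest: spec[of _ i] intro: less_le_trans)
  qed (simp add: ext_root_def)
  have nl: "real_of_int k < rs ! m \<longleftrightarrow> \<not> rs ! m < real_of_int k" if "m < num_roots t" for m
    using root_not_int[OF roots_nth_mem[OF that], of k] by (intro iffI) linarith+
  show ?thesis
    unfolding cell_def mem_Collect_eq l r
  proof (rule iffI)
    assume A: "(\<forall>m<i. rs ! m < real_of_int k) \<and> (\<forall>m<num_roots t. i \<le> m \<longrightarrow> real_of_int k < rs ! m)"
    show "\<forall>m<num_roots t. rs ! m < real_of_int k \<longleftrightarrow> m < i"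
    proof (intro allI impI)
      fix m assume "m < num_roots t"
      then show "rs ! m < real_of_int k \<longleftrightarrow> m < i" using A nl[of m] by (cases "m < i") auto
    qed
  next
    assume B: "\<forall>m<num_roots t. rs ! m < real_of_int k \<longleftrightarrow> m < i"
    then show "(\<forall>m<i. rs ! m < real_of_int k) \<and> (\<forall>m<num_roots t. i \<le> m \<longrightarrow> real_of_int k < rs ! m)"
      using nl assms by (simp add: less_le_trans)
  qed
qed

lemma cell_sim:
  assumes i: "i \<le> num_roots t" and k: "k \<in> cell t i"
  shows "j \<in> cell t i \<longleftrightarrow> sim t j k"
proof -
  have "sim t j k \<longleftrightarrow> (\<forall>m<num_roots t. rs ! m < real_of_int j \<longleftrightarrow> rs ! m < real_of_int k)"
    unfolding sim_def Ball_def root_set_nth by metis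
  also have "\<dots> \<longleftrightarrow> (\<forall>m<num_roots t. rs ! m < real_of_int j \<longleftrightarrow> m < i)"
    using k unfolding cell_iff[OF i] by simp
  finally show ?thesis unfolding cell_iff[OF i] by (rule sym)
qed

text \<open>The indices of the roots to the left of k form an initial segment, and its length is the
  number of the interval.\<close>

lemma cell_exists: "\<exists>i\<le>num_roots t. k \<in> cell t i"
proof -
  let ?A = "{m. m < num_roots t \<and> rs ! m < real_of_int k}"
  have down: "m' \<in> ?A" if "m \<in> ?A" "m' < m" for m m'
    using that roots_nth_mono[of m' m] by auto
  have fin: "finite ?A" by simp
  have "?A = {..<card ?A}"
  proof -
    obtain N where "?A = {..<N}"
    proof (cases "?A = {}")
      case True then show thesis using that[of 0] by simp
    next
      case False
      have "?A = {..<Suc (Max ?A)}"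
      proof
        show "?A \<subseteq> {..<Suc (Max ?A)}" using Max_ge[OF fin] by (auto simp: less_Suc_eq_le)
        show "{..<Suc (Max ?A)} \<subseteq> ?A"
        proof
          fix m assume "m \<in> {..<Suc (Max ?A)}"
          then have "m < Max ?A \<or> m = Max ?A" by (simp add: less_Suc_eq)
          then show "m \<in> ?A"
            using down[OF Max_in[OF fin False]] Max_in[OF fin False] by (elim disjE) (simp only:)+
        qed
      qed
      then show thesis by (rule that)
    qed
    then show ?thesis by simp
  qed
  then have "rs ! m < real_of_int k \<longleftrightarrow> m < card ?A" if "m < num_roots t" for m
    using that by blast
  moreover have "card ?A \<le> num_roots t"
    using card_mono[of "{..<num_roots t}" ?A] by auto
  ultimately show ?thesis using cell_iff[of "card ?A" k] by blast
qed

lemma cell_disjoint: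
  assumes "i \<le> num_roots t" "j \<le> num_roots t" "k \<in> cell t i" "k \<in> cell t j"
  shows "i = j"
proof (rule ccontr)
  assume "i \<noteq> j"
  then consider "i < j" | "j < i" by linarith
  then show False
    using assms(3,4) unfolding cell_iff[OF assms(1)] cell_iff[OF assms(2)]
    by cases (metis assms(1,2) less_irrefl less_le_trans)+
qed

lemma ext_root_less: "i \<le> num_roots t \<Longrightarrow> ext_root t i < ext_root t (Suc i)"
  using roots_nth_mono[of "i - 1" i] ext_root_nth[of i] ext_root_nth[of "Suc i"]
  by (cases "i = 0"; cases "i = num_roots t") (auto simp: ext_root_def)

lemma ext_root_values:
  assumes "i \<le> num_roots t"
  shows "ext_root t i = -\<infinity> \<or> (\<exists>m::int. ext_root t i = ereal (of_int m + 1/2))"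
    and "ext_root t (Suc i) = \<infinity> \<or> (\<exists>m::int. ext_root t (Suc i) = ereal (of_int m + 1/2))"
proof -
  have half: "\<exists>m::int. ext_root t j = ereal (of_int m + 1/2)" if "0 < j" "j \<le> num_roots t" for j
  proof -
    have j: "j - 1 < num_roots t" using that by linarith
    obtain m :: int where "rs ! (j - 1) = of_int m + 1/2"
      by (rule Omega_root[OF t roots_nth_mem[OF j]]) (rule that)
    then show ?thesis using ext_root_nth[OF that] by auto
  qed
  show "ext_root t i = -\<infinity> \<or> (\<exists>m::int. ext_root t i = ereal (of_int m + 1/2))"
    using half[of i] assms by (cases "i = 0") (auto simp: ext_root_def)
  show "ext_root t (Suc i) = \<infinity> \<or> (\<exists>m::int. ext_root t (Suc i) = ereal (of_int m + 1/2))"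
    using half[of "Suc i"] assms by (cases "i = num_roots t") (auto simp: ext_root_def)
qed

end

text \<open>Two distinct ends of this kind always have an integer between them. The fact is needed
  for the intervals of one polynomial and again for overlaps of intervals of two
  polynomials.\<close>

lemma half_integer_gap:
  fixes a b :: ereal
  assumes a: "a = -\<infinity> \<or> (\<exists>m::int. a = ereal (of_int m + 1/2))"
    and b: "b = \<infinity> \<or> (\<exists>m::int. b = ereal (of_int m + 1/2))" and "a < b"
  shows "\<exists>k::int. a < ereal (of_int k) \<and> ereal (of_int k) < b"
  using a
proof
  assume am: "a = -\<infinity>"
  from b show ?thesis
  proof
    assume "b = \<infinity>" then show ?thesis using am by auto
  next
    assume "\<exists>m::int. b = ereal (of_int m + 1/2)"
    then obtain m :: int where "b = ereal (of_int m + 1/2)" by blast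
    then show ?thesis using am by (intro exI[of _ m]) simp
  qed
next
  assume "\<exists>m::int. a = ereal (of_int m + 1/2)"
  then obtain m :: int where m: "a = ereal (of_int m + 1/2)" by blast
  from b show ?thesis
  proof
    assume "b = \<infinity>" then show ?thesis using m by (intro exI[of _ "m + 1"]) simp
  next
    assume "\<exists>n::int. b = ereal (of_int n + 1/2)"
    then obtain n :: int where n: "b = ereal (of_int n + 1/2)" by blast
    then have "m < n" using m \<open>a < b\<close> by simp
    then have "real_of_int m + 1 \<le> real_of_int n" by linarith
    then show ?thesis using m n by (intro exI[of _ "m + 1"]) auto
  qed
qed

lemma cell_nonempty: "t \<in> Omega \<Longrightarrow> i \<le> num_roots t \<Longrightarrow> cell t i \<noteq> {}"
  using half_integer_gap[OF ext_root_values ext_root_less] by (fastforce simp: cell_def)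

section \<open>The classes of the simple modules as a basis of each graded part\<close>

definition cell_point :: "complex poly \<Rightarrow> nat \<Rightarrow> int" where
  "cell_point t i = (SOME k. k \<in> cell t i)"

lemma cell_point: "t \<in> Omega \<Longrightarrow> i \<le> num_roots t \<Longrightarrow> cell_point t i \<in> cell t i"
  unfolding cell_point_def using cell_nonempty by (metis some_in_eq)

text \<open>The standard module shows that the choice in \<open>M_interval\<close> is possible; the
  support of a simple object determines its dimensions. The ends a and b enter only through the
  integers between them, because for products they arise as a maximum and a minimum and not as
  numbered roots.\<close>

lemma simple_by_support:
  assumes t: "t \<in> Omega" and I: "{k::int. a < ereal (of_int k) \<and> ereal (of_int k) < b} = {j. sim t j k}"
  shows "M_interval t a b \<in> wmod t" and "wdim t (M_interval t a b) j = (if sim t j k then 1 else 0)"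
proof -
  let ?Q = "\<lambda>M. simple_obj t M \<and> Supp t M = {pt_ideal k | k. a < ereal (of_int k) \<and> ereal (of_int k) < b}"
  have S: "{pt_ideal k | k. a < ereal (of_int k) \<and> ereal (of_int k) < b} = pt_ideal ` {j. sim t j k}"
    unfolding I[symmetric] by blast
  obtain N h where N: "is_model t k N h" using model_exists[OF t] .
  then have NW: "N \<in> wmod t" by (simp add: is_model_def)
  have "simple_obj t N" by (rule simple_obj_if_wdim[OF t NW is_model_wdim[OF t N]])
  moreover have "Supp t N = pt_ideal ` {j. sim t j k}"
    unfolding Supp_wdim[OF NW] is_model_wdim[OF t N] by simp
  ultimately have QN: "?Q N" unfolding S by (rule conjI)
  have "?Q (M_interval t a b)" unfolding M_interval_def by (rule someI[of ?Q N, OF QN])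
  then have M: "simple_obj t (M_interval t a b)" "Supp t (M_interval t a b) = pt_ideal ` {j. sim t j k}"
    using S by auto
  show MW: "M_interval t a b \<in> wmod t" using M(1) by (simp add: simple_obj_def)
  obtain k' where k': "\<And>j. wdim t (M_interval t a b) j = (if sim t j k' then 1 else 0)"
    using wdim_of_simple_obj[OF t M(1)] by blast
  have "pt_ideal ` {j. sim t j k'} = pt_ideal ` {j. sim t j k}"
  proof -
    have "{j. (if sim t j k' then 1 else 0 :: nat) \<noteq> 0} = {j. sim t j k'}" by auto
    then show ?thesis using M(2) unfolding Supp_wdim[OF MW] k' by (simp only:)
  qed
  then have "{j. sim t j k'} = {j. sim t j k}" by (simp only: inj_image_eq_iff[OF inj_pt_ideal])
  then show "wdim t (M_interval t a b) j = (if sim t j k then 1 else 0)" unfolding k' by (simp add: set_eq_iff)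
qed

lemma sim_one: "sim 1 j k"
  by (simp add: sim_def root_set_def)

lemma M1: "M1 \<in> wmod 1" "wdim 1 M1 j = 1"
proof -
  obtain N h where N: "is_model 1 0 N h" using model_exists[OF one_Omega] .
  then have "simple_obj 1 N"
    using simple_obj_if_wdim[OF one_Omega _ is_model_wdim[OF one_Omega N]] by (simp add: is_model_def)
  then have M: "simple_obj 1 M1" unfolding M1_def by (rule someI)
  then show "M1 \<in> wmod 1" by (simp add: simple_obj_def)
  show "wdim 1 M1 j = 1" using wdim_of_simple_obj[OF one_Omega M] sim_one by metis
qed

lemma simple_rep:
  assumes t: "t \<in> Omega" and i: "i \<le> num_roots t"
  shows "simple_rep t i \<in> wmod t" and "wdim t (simple_rep t i) j = (if j \<in> cell t i then 1 else 0)"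
proof -
  have c: "cell t i = {j. sim t j (cell_point t i)}"
    using cell_sim[OF t i cell_point[OF t i]] by blast
  show "simple_rep t i \<in> wmod t"
    using M1 simple_by_support(1)[OF t c[unfolded cell_def]] by (simp add: simple_rep_def)
  show "wdim t (simple_rep t i) j = (if j \<in> cell t i then 1 else 0)"
  proof (cases "t = 1")
    case True
    then show ?thesis using M1 c sim_one by (simp add: simple_rep_def)
  next
    case False
    then show ?thesis
      using simple_by_support(2)[OF t c[unfolded cell_def]] cell_sim[OF t i cell_point[OF t i], of j]
      by (simp add: simple_rep_def)
  qed
qed

definition \<theta> :: "complex poly \<Rightarrow> int \<Rightarrow> ((complex \<times> (gmod \<Rightarrow>\<^sub>0 int) set) \<Rightarrow>\<^sub>0 int) set \<Rightarrow> complex" where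
  "\<theta> t k = (SOME f. lin_form (graded_part t) f \<and> (\<forall>M\<in>wmod t. f (mclass t M) = of_nat (wdim t M k)))"

lemma \<theta>: "lin_form (graded_part t) (\<theta> t k)" "M \<in> wmod t \<Longrightarrow> \<theta> t k (mclass t M) = of_nat (wdim t M k)"
  using someI_ex[OF theta_exists[of t k]] unfolding \<theta>_def by blast+

lemma graded_cspace: "cspace (graded_part t)"
  by (rule cspace.intro[OF graded_module])

text \<open>The general expansion is indexed by integers representing the intervals. The map
  \<open>ix\<close> recovers the number of the interval, and the sum is reindexed
  accordingly.\<close>

lemma mclass_expansion:
  assumes t: "t \<in> Omega" and M: "M \<in> wmod t"
  shows "mclass t M = (\<Oplus>\<^bsub>graded_part t\<^esub>i\<in>{0..num_roots t}.
    of_nat (wdim t M (cell_point t i)) \<odot>\<^bsub>graded_part t\<^esub> mclass t (simple_rep t i))"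
proof -
  let ?I = "{0..num_roots t}" and ?K = "cell_point t ` {0..num_roots t}"
  interpret V: cspace "graded_part t" by (rule graded_cspace)
  define ix where "ix k = (THE i. i \<in> ?I \<and> k \<in> cell t i)" for k
  have ix: "ix (cell_point t i) = i" if "i \<in> ?I" for i
    unfolding ix_def using that cell_point[OF t] cell_disjoint[OF t] by (intro the_equality) auto
  have inj: "inj_on (cell_point t) ?I" by (rule inj_on_inverseI) (rule ix)
  have "mclass t M = (\<Oplus>\<^bsub>graded_part t\<^esub>k\<in>?K. of_nat (wdim t M k) \<odot>\<^bsub>graded_part t\<^esub> mclass t (simple_rep t (ix k)))"
  proof (rule additive_function_expansion[OF t graded_cspace _ _ _ _ mclass_closed mclass_exact M])
    show "\<exists>!k. k \<in> ?K \<and> sim t j k" for j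
    proof -
      obtain i where i: "i \<le> num_roots t" "j \<in> cell t i" using cell_exists[OF t] by blast
      have s: "sim t j (cell_point t i') \<longleftrightarrow> i' = i" if "i' \<in> ?I" for i'
        using cell_sim[OF t _ cell_point[OF t], of i' j] cell_disjoint[OF t, of i' i j] i that by auto
      show ?thesis by (rule ex1I[of _ "cell_point t i"]) (use s i in auto)
    qed
    show "simple_rep t (ix k) \<in> wmod t" if "k \<in> ?K" for k
      using that ix simple_rep(1)[OF t] by auto
    show "wdim t (simple_rep t (ix k)) j = (if sim t j k then 1 else 0)" if "k \<in> ?K" for k j
      using that ix simple_rep(2)[OF t] cell_sim[OF t _ cell_point[OF t]] by auto
  qed simp
  also have "\<dots> = (\<Oplus>\<^bsub>graded_part t\<^esub>i\<in>?I.
      of_nat (wdim t M (cell_point t i)) \<odot>\<^bsub>graded_part t\<^esub> mclass t (simple_rep t (ix (cell_point t i))))"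
    by (rule V.M.finsum_reindex[OF _ inj])
      (use ix simple_rep(1)[OF t] mclass_closed V.smult_closed in auto)
  also have "\<dots> = (\<Oplus>\<^bsub>graded_part t\<^esub>i\<in>?I.
      of_nat (wdim t M (cell_point t i)) \<odot>\<^bsub>graded_part t\<^esub> mclass t (simple_rep t i))"
    by (rule V.M.finsum_cong') (use ix simple_rep(1)[OF t] mclass_closed V.smult_closed in auto)
  finally show ?thesis .
qed

text \<open>The coordinates are dimensions at one point of each interval. Biorthogonality holds as
  the intervals are disjoint, and the spanning property is \<open>mclass_expansion\<close> extended
  linearly.\<close>

lemma graded_dual_basis:
  assumes t: "t \<in> Omega"
  shows "dual_basis (graded_part t) {0..num_roots t} (\<lambda>i. mclass t (simple_rep t i)) (\<lambda>i. \<theta> t (cell_point t i))"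
  unfolding dual_basis_def
proof (intro conjI ballI)
  let ?I = "{0..num_roots t}"
  interpret V: cspace "graded_part t" by (rule graded_cspace)
  have ec: "mclass t (simple_rep t i) \<in> carrier (graded_part t)" if "i \<in> ?I" for i
    using simple_rep(1)[OF t] that mclass_closed by simp
  fix i assume i: "i \<in> ?I"
  show "mclass t (simple_rep t i) \<in> carrier (graded_part t)" by (rule ec[OF i])
  show "lin_form (graded_part t) (\<theta> t (cell_point t i))" by (rule \<theta>)
  fix j assume j: "j \<in> ?I"
  show "\<theta> t (cell_point t i) (mclass t (simple_rep t j)) = (if i = j then 1 else 0)"
    using i j \<theta>(2)[OF simple_rep(1)[OF t]] simple_rep(2)[OF t, of j "cell_point t i"] cell_point[OF t]
      cell_disjoint[OF t, of i j "cell_point t i"] by auto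
next
  let ?I = "{0..num_roots t}"
  interpret V: cspace "graded_part t" by (rule graded_cspace)
  have ec: "mclass t (simple_rep t i) \<in> carrier (graded_part t)" if "i \<in> ?I" for i
    using simple_rep(1)[OF t] that mclass_closed by simp
  fix X assume "X \<in> carrier (graded_part t)"
  from this t show "X = (\<Oplus>\<^bsub>graded_part t\<^esub>i\<in>?I. \<theta> t (cell_point t i) X \<odot>\<^bsub>graded_part t\<^esub> mclass t (simple_rep t i))"
  proof (induction rule: graded_induct)
    case (mclass c M)
    have "c \<odot>\<^bsub>graded_part t\<^esub> mclass t M = c \<odot>\<^bsub>graded_part t\<^esub> (\<Oplus>\<^bsub>graded_part t\<^esub>i\<in>?I.
        of_nat (wdim t M (cell_point t i)) \<odot>\<^bsub>graded_part t\<^esub> mclass t (simple_rep t i))"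
      by (rule arg_cong[OF mclass_expansion[OF t mclass]])
    also have "\<dots> = (\<Oplus>\<^bsub>graded_part t\<^esub>i\<in>?I.
        (c * of_nat (wdim t M (cell_point t i))) \<odot>\<^bsub>graded_part t\<^esub> mclass t (simple_rep t i))"
      by (rule V.comb_smult[OF _ ec]) simp_all
    also have "\<dots> = (\<Oplus>\<^bsub>graded_part t\<^esub>i\<in>?I.
        \<theta> t (cell_point t i) (c \<odot>\<^bsub>graded_part t\<^esub> mclass t M) \<odot>\<^bsub>graded_part t\<^esub> mclass t (simple_rep t i))"
      using \<theta>(1)[of t] \<theta>(2)[OF mclass] mclass_closed[OF mclass] by (simp add: lin_form_def)
    finally show ?case .
  next
    case (add X Y)
    have "X \<oplus>\<^bsub>graded_part t\<^esub> Y = (\<Oplus>\<^bsub>graded_part t\<^esub>i\<in>?I. \<theta> t (cell_point t i) X \<odot>\<^bsub>graded_part t\<^esub> mclass t (simple_rep t i))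
      \<oplus>\<^bsub>graded_part t\<^esub> (\<Oplus>\<^bsub>graded_part t\<^esub>i\<in>?I. \<theta> t (cell_point t i) Y \<odot>\<^bsub>graded_part t\<^esub> mclass t (simple_rep t i))"
      by (rule arg_cong2[OF add(3,4)])
    also have "\<dots> = (\<Oplus>\<^bsub>graded_part t\<^esub>i\<in>?I. (\<theta> t (cell_point t i) X + \<theta> t (cell_point t i) Y) \<odot>\<^bsub>graded_part t\<^esub> mclass t (simple_rep t i))"
      by (rule V.comb_add[OF ec])
    also have "\<dots> = (\<Oplus>\<^bsub>graded_part t\<^esub>i\<in>?I. \<theta> t (cell_point t i) (X \<oplus>\<^bsub>graded_part t\<^esub> Y) \<odot>\<^bsub>graded_part t\<^esub> mclass t (simple_rep t i))"
      using \<theta>(1)[of t] add(1,2) by (simp add: lin_form_def)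
    finally show ?case .
  qed
qed simp

subsection \<open>The graded algebra as an algebra of functions\<close>

text \<open>The linear extension of dimension functions to the whole algebra: the value at weight k
  of the component of degree t.\<close>

definition \<Theta> :: "alg_elt \<Rightarrow> complex poly \<Rightarrow> int \<Rightarrow> complex" where
  "\<Theta> x t k = \<theta> t k (x t)"

lemma alg_module: "module CC alg_space"
  unfolding alg_space_def by (rule dsum_module[OF graded_module])

interpretation AS: module CC alg_space
  by (rule alg_module)

lemma graded_abelian_group: "abelian_group (graded_part t)"
  using graded_module[of t] by (simp add: module_def)

lemma alg_carrier:
  "x \<in> carrier alg_space \<longleftrightarrow> x \<in> (\<Pi>\<^sub>E t\<in>Omega. carrier (graded_part t)) \<and> finite {t \<in> Omega. x t \<noteq> \<zero>\<^bsub>graded_part t\<^esub>}"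
  unfolding alg_space_def by (rule dsum_carrier[OF graded_abelian_group])

lemma alg_ops:
  "x \<oplus>\<^bsub>alg_space\<^esub> y = (\<lambda>t\<in>Omega. x t \<oplus>\<^bsub>graded_part t\<^esub> y t)"
  "c \<odot>\<^bsub>alg_space\<^esub> x = (\<lambda>t\<in>Omega. c \<odot>\<^bsub>graded_part t\<^esub> x t)"
  "\<zero>\<^bsub>alg_space\<^esub> = (\<lambda>t\<in>Omega. \<zero>\<^bsub>graded_part t\<^esub>)"
  unfolding alg_space_def by simp_all

lemma alg_component: "x \<in> carrier alg_space \<Longrightarrow> t \<in> Omega \<Longrightarrow> x t \<in> carrier (graded_part t)"
  by (auto simp: alg_carrier)

lemma \<theta>_zero: "\<theta> t k \<zero>\<^bsub>graded_part t\<^esub> = 0"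
  by (rule cspace.lin_form_zero[OF graded_cspace \<theta>(1)])

lemma \<Theta>_add:
  "x \<in> carrier alg_space \<Longrightarrow> y \<in> carrier alg_space \<Longrightarrow> t \<in> Omega \<Longrightarrow>
    \<Theta> (x \<oplus>\<^bsub>alg_space\<^esub> y) t k = \<Theta> x t k + \<Theta> y t k"
  using \<theta>(1)[of t k] by (simp add: \<Theta>_def alg_ops lin_form_def alg_component)

lemma \<Theta>_smult:
  "x \<in> carrier alg_space \<Longrightarrow> t \<in> Omega \<Longrightarrow> \<Theta> (c \<odot>\<^bsub>alg_space\<^esub> x) t k = c * \<Theta> x t k"
  using \<theta>(1)[of t k] by (simp add: \<Theta>_def alg_ops lin_form_def alg_component)

text \<open>The values at the points \<open>cell_point t i\<close> are the coordinates in the basis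
  of simple classes, so they determine every component.\<close>

lemma \<Theta>_inj:
  assumes x: "x \<in> carrier alg_space" and y: "y \<in> carrier alg_space"
    and eq: "\<And>t i. t \<in> Omega \<Longrightarrow> i \<le> num_roots t \<Longrightarrow> \<Theta> x t (cell_point t i) = \<Theta> y t (cell_point t i)"
  shows "x = y"
proof (rule PiE_ext[of _ Omega "\<lambda>t. carrier (graded_part t)"])
  show "x \<in> (\<Pi>\<^sub>E t\<in>Omega. carrier (graded_part t))" "y \<in> (\<Pi>\<^sub>E t\<in>Omega. carrier (graded_part t))"
    using x y by (simp_all add: alg_carrier)
  fix t assume t: "t \<in> Omega"
  interpret V: cspace "graded_part t" by (rule graded_cspace)
  note d = dual_basisD[OF graded_dual_basis[OF t]]
  have "x t = (\<Oplus>\<^bsub>graded_part t\<^esub>i\<in>{0..num_roots t}. \<Theta> x t (cell_point t i) \<odot>\<^bsub>graded_part t\<^esub> mclass t (simple_rep t i))"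
    unfolding \<Theta>_def by (rule d(5)[OF alg_component[OF x t]])
  also have "\<dots> = (\<Oplus>\<^bsub>graded_part t\<^esub>i\<in>{0..num_roots t}. \<Theta> y t (cell_point t i) \<odot>\<^bsub>graded_part t\<^esub> mclass t (simple_rep t i))"
    by (rule V.M.finsum_cong') (use eq[OF t] d(2) V.smult_closed in auto)
  also have "\<dots> = y t"
    unfolding \<Theta>_def by (rule d(5)[OF alg_component[OF y t], symmetric])
  finally show "x t = y t" .
qed

lemma finite_support_closed:
  assumes "finite A" "\<And>t. t \<in> Omega \<Longrightarrow> f t \<in> carrier (graded_part t)"
    "\<And>t. t \<in> Omega \<Longrightarrow> t \<notin> A \<Longrightarrow> f t = \<zero>\<^bsub>graded_part t\<^esub>"
  shows "(\<lambda>t\<in>Omega. f t) \<in> carrier alg_space"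
proof -
  have "{t \<in> Omega. (\<lambda>t\<in>Omega. f t) t \<noteq> \<zero>\<^bsub>graded_part t\<^esub>} \<subseteq> A" using assms(3) by auto
  then have "finite {t \<in> Omega. (\<lambda>t\<in>Omega. f t) t \<noteq> \<zero>\<^bsub>graded_part t\<^esub>}" using assms(1) by (rule finite_subset)
  moreover have "(\<lambda>t\<in>Omega. f t) \<in> (\<Pi>\<^sub>E t\<in>Omega. carrier (graded_part t))" using assms(2) by auto
  ultimately show ?thesis unfolding alg_carrier by blast
qed

lemma graded_zero_closed: "\<zero>\<^bsub>graded_part t\<^esub> \<in> carrier (graded_part t)"
  by (rule abelian_monoid.zero_closed[OF abelian_group.axioms(1)[OF graded_abelian_group]])

lemma cls_eq: "cls t M = (\<lambda>s\<in>Omega. if s = t then mclass t M else \<zero>\<^bsub>graded_part s\<^esub>)"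
  unfolding cls_def cplx_coset_mclass ..

lemma cls_closed: "M \<in> wmod t \<Longrightarrow> cls t M \<in> carrier alg_space"
  unfolding cls_eq by (rule finite_support_closed[of "{t}"]) (auto simp: mclass_closed graded_zero_closed)

lemma \<Theta>_cls:
  "M \<in> wmod t \<Longrightarrow> s \<in> Omega \<Longrightarrow> \<Theta> (cls t M) s k = (if s = t then of_nat (wdim t M k) else 0)"
  by (simp add: \<Theta>_def cls_eq \<theta>(2) \<theta>_zero)

text \<open>Equality of classes is thereby reduced to equality of dimensions. The isomorphisms
  behind commutativity and associativity of the tensor product never have to be written
  down.\<close>

lemma cls_cong:
  assumes "M \<in> wmod t" "N \<in> wmod t" "\<And>k. wdim t M k = wdim t N k"
  shows "cls t M = cls t N"
  by (rule \<Theta>_inj[OF cls_closed[OF assms(1)] cls_closed[OF assms(2)]]) (simp add: \<Theta>_cls assms)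

lemma alg_induct [consumes 1, case_names cls add]:
  assumes x: "x \<in> carrier alg_space"
    and cls: "\<And>c t i. t \<in> Omega \<Longrightarrow> i \<le> num_roots t \<Longrightarrow> R (c \<odot>\<^bsub>alg_space\<^esub> cls t (simple_rep t i))"
    and add: "\<And>x y. x \<in> carrier alg_space \<Longrightarrow> y \<in> carrier alg_space \<Longrightarrow> R x \<Longrightarrow> R y \<Longrightarrow> R (x \<oplus>\<^bsub>alg_space\<^esub> y)"
  shows "R x"
proof -
  define sing :: "complex poly \<Rightarrow> _ \<Rightarrow> alg_elt" where
    "sing t v = (\<lambda>s\<in>Omega. if s = t then v else \<zero>\<^bsub>graded_part s\<^esub>)" for t v
  have sing_closed: "sing t v \<in> carrier alg_space" if "v \<in> carrier (graded_part t)" for t v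
    unfolding sing_def by (rule finite_support_closed[of "{t}"]) (use that in \<open>auto simp: graded_zero_closed\<close>)
  have lz: "\<zero>\<^bsub>graded_part s\<^esub> \<oplus>\<^bsub>graded_part s\<^esub> v = v" if "v \<in> carrier (graded_part s)" for s v
    using that by (rule abelian_monoid.l_zero[OF abelian_group.axioms(1)[OF graded_abelian_group]])
  have rz: "v \<oplus>\<^bsub>graded_part s\<^esub> \<zero>\<^bsub>graded_part s\<^esub> = v" if "v \<in> carrier (graded_part s)" for s v
    using that by (rule abelian_monoid.r_zero[OF abelian_group.axioms(1)[OF graded_abelian_group]])
  have sing_add: "sing t (v \<oplus>\<^bsub>graded_part t\<^esub> w) = sing t v \<oplus>\<^bsub>alg_space\<^esub> sing t w" for t v w
    unfolding sing_def alg_ops by (rule restrict_ext) (simp add: lz graded_zero_closed)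
  have sing_cls: "sing t (c \<odot>\<^bsub>graded_part t\<^esub> mclass t M) = c \<odot>\<^bsub>alg_space\<^esub> cls t M" for c t M
    unfolding sing_def alg_ops cls_eq
    by (rule restrict_ext) (use module.smult_r_null[OF graded_module] in auto)
  \<comment> \<open>Zero is not a separate case of the induction; it is 0 times a class.\<close>
  have R0: "R \<zero>\<^bsub>alg_space\<^esub>"
    using cls[OF one_Omega, of 0 0] AS.smult_l_null[OF cls_closed[OF simple_rep(1)[OF one_Omega, of 0]]] by simp
  have R_sing: "R (sing t v)" if t: "t \<in> Omega" and v: "v \<in> carrier (graded_part t)" for t v
  proof -
    interpret V: cspace "graded_part t" by (rule graded_cspace)
    note d = dual_basisD[OF graded_dual_basis[OF t]]
    define u where "u i = \<theta> t (cell_point t i) v \<odot>\<^bsub>graded_part t\<^esub> mclass t (simple_rep t i)" for i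
    have uc: "u i \<in> carrier (graded_part t)" if "i \<in> {0..num_roots t}" for i
      unfolding u_def using d(2)[OF that] by (simp add: V.smult_closed del: cplx.V_simps)
    have "R (sing t (\<Oplus>\<^bsub>graded_part t\<^esub>i\<in>J. u i))" if "finite J" "J \<subseteq> {0..num_roots t}" for J
      using that
    proof (induction J rule: finite_induct)
      case empty
      have "sing t \<zero>\<^bsub>graded_part t\<^esub> = \<zero>\<^bsub>alg_space\<^esub>" unfolding sing_def alg_ops by (rule restrict_ext) simp
      then show ?case using R0 by (simp del: cplx.V_simps)
    next
      case (insert i J)
      have c: "u i \<in> carrier (graded_part t)" "u \<in> J \<rightarrow> carrier (graded_part t)" using insert uc by auto
      have "(\<Oplus>\<^bsub>graded_part t\<^esub>i\<in>insert i J. u i) = u i \<oplus>\<^bsub>graded_part t\<^esub> (\<Oplus>\<^bsub>graded_part t\<^esub>i\<in>J. u i)"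
        by (rule V.M.finsum_insert[OF insert.hyps c(2,1)])
      moreover have "R (sing t (u i))"
        unfolding u_def sing_cls using insert by (intro cls[OF t]) auto
      ultimately show ?case
        using insert add[OF sing_closed[OF c(1)] sing_closed[OF V.M.finsum_closed[OF c(2)]]] by (simp add: sing_add)
    qed
    from this[of "{0..num_roots t}"] show ?thesis
      using d(5)[OF v] unfolding u_def by simp
  qed
  let ?F = "{t \<in> Omega. x t \<noteq> \<zero>\<^bsub>graded_part t\<^esub>}"
  have fin: "finite ?F" using x by (simp add: alg_carrier)
  define part where "part A = (\<lambda>s\<in>Omega. if s \<in> A then x s else \<zero>\<^bsub>graded_part s\<^esub>)" for A
  have part_closed: "part A \<in> carrier alg_space" if "finite A" for A
    unfolding part_def by (rule finite_support_closed[OF that]) (use alg_component[OF x] graded_zero_closed in auto)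
  have "R (part A)" if "finite A" "A \<subseteq> ?F" for A
    using that
  proof (induction A rule: finite_induct)
    case empty
    have "part {} = \<zero>\<^bsub>alg_space\<^esub>" unfolding part_def alg_ops by simp
    then show ?case using R0 by simp
  next
    case (insert t A)
    have t: "t \<in> Omega" using insert by auto
    have "part (insert t A) = sing t (x t) \<oplus>\<^bsub>alg_space\<^esub> part A"
      unfolding part_def sing_def alg_ops
      by (rule restrict_ext) (use insert(2) alg_component[OF x] in \<open>auto simp: lz rz graded_zero_closed\<close>)
    then show ?case
      using add[OF sing_closed[OF alg_component[OF x t]] part_closed[OF insert(1)] R_sing[OF t alg_component[OF x t]]] insert
      by simp
  qed
  from this[OF fin] have "R (part ?F)" by simp
  moreover have "part ?F = x"
  proof (rule PiE_ext[of _ Omega "\<lambda>t. carrier (graded_part t)"])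
    show "part ?F \<in> (\<Pi>\<^sub>E t\<in>Omega. carrier (graded_part t))" "x \<in> (\<Pi>\<^sub>E t\<in>Omega. carrier (graded_part t))"
      using part_closed[OF fin] x by (simp_all add: alg_carrier)
    show "part ?F t = x t" if "t \<in> Omega" for t using that by (simp add: part_def)
  qed
  ultimately show ?thesis by simp
qed

section \<open>Existence and laws of the multiplication\<close>

definition cofactor :: "complex poly \<Rightarrow> complex poly set" where
  "cofactor s = {t \<in> Omega. \<exists>u\<in>Omega. s = t * u}"

text \<open>The dimension function that a product must have: a Cauchy product over factorizations s
  = t u within \<open>Omega\<close>, with values at each weight multiplied pointwise. Restricting t
  to the support of x makes the sum finite.\<close>

definition conv :: "alg_elt \<Rightarrow> alg_elt \<Rightarrow> complex poly \<Rightarrow> int \<Rightarrow> complex" where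
  "conv x y s k = (\<Sum>t\<in>{t \<in> Omega. x t \<noteq> \<zero>\<^bsub>graded_part t\<^esub>} \<inter> cofactor s. \<Theta> x t k * \<Theta> y (s div t) k)"

text \<open>Additivity in x compares sums over different supports; a common finite index set removes
  the mismatch, as the added terms vanish.\<close>

lemma conv_superset:
  assumes "finite A" "{t \<in> Omega. x t \<noteq> \<zero>\<^bsub>graded_part t\<^esub>} \<subseteq> A"
  shows "conv x y s k = (\<Sum>t\<in>A \<inter> cofactor s. \<Theta> x t k * \<Theta> y (s div t) k)"
  unfolding conv_def
  by (rule sum.mono_neutral_left) (use assms in \<open>auto simp: cofactor_def \<Theta>_def \<theta>_zero\<close>)

lemma cofactor_div:
  assumes "t \<in> cofactor s" shows "t \<in> Omega" "s div t \<in> Omega" "s = t * (s div t)"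
proof -
  obtain u where u: "t \<in> Omega" "u \<in> Omega" "s = t * u" using assms by (auto simp: cofactor_def)
  then have "s div t = u" using Omega_nonzero by simp
  then show "t \<in> Omega" "s div t \<in> Omega" "s = t * (s div t)" using u by auto
qed

lemma alg_support_finite: "x \<in> carrier alg_space \<Longrightarrow> finite {t \<in> Omega. x t \<noteq> \<zero>\<^bsub>graded_part t\<^esub>}"
  by (simp add: alg_carrier)

lemma conv_add_left:
  assumes x: "x \<in> carrier alg_space" and x': "x' \<in> carrier alg_space"
  shows "conv (x \<oplus>\<^bsub>alg_space\<^esub> x') y s k = conv x y s k + conv x' y s k"
proof -
  let ?A = "{t \<in> Omega. x t \<noteq> \<zero>\<^bsub>graded_part t\<^esub>} \<union> {t \<in> Omega. x' t \<noteq> \<zero>\<^bsub>graded_part t\<^esub>} \<union>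
    {t \<in> Omega. (x \<oplus>\<^bsub>alg_space\<^esub> x') t \<noteq> \<zero>\<^bsub>graded_part t\<^esub>}"
  have fin: "finite ?A" using alg_support_finite[OF x] alg_support_finite[OF x'] alg_support_finite[OF AS.M.a_closed[OF x x']] by blast
  show ?thesis
    using cofactor_div(1)
    by (subst (1 2 3) conv_superset[OF fin]) (auto simp: sum.distrib[symmetric] \<Theta>_add[OF x x'] ring_distribs intro!: sum.cong)
qed

lemma conv_smult_left:
  assumes x: "x \<in> carrier alg_space"
  shows "conv (c \<odot>\<^bsub>alg_space\<^esub> x) y s k = c * conv x y s k"
proof -
  let ?A = "{t \<in> Omega. x t \<noteq> \<zero>\<^bsub>graded_part t\<^esub>} \<union> {t \<in> Omega. (c \<odot>\<^bsub>alg_space\<^esub> x) t \<noteq> \<zero>\<^bsub>graded_part t\<^esub>}"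
  have fin: "finite ?A" using alg_support_finite[OF x] alg_support_finite[OF AS.smult_closed[OF _ x, of c]] by simp
  show ?thesis
    using cofactor_div(1)
    by (subst (1 2) conv_superset[OF fin]) (auto simp: sum_distrib_left \<Theta>_smult[OF x] mult.assoc intro!: sum.cong)
qed

lemma conv_add_right:
  assumes "y \<in> carrier alg_space" "y' \<in> carrier alg_space"
  shows "conv x (y \<oplus>\<^bsub>alg_space\<^esub> y') s k = conv x y s k + conv x y' s k"
  unfolding conv_def sum.distrib[symmetric]
  by (rule sum.cong) (use cofactor_div in \<open>auto simp: \<Theta>_add[OF assms] ring_distribs\<close>)

lemma conv_smult_right:
  assumes "y \<in> carrier alg_space"
  shows "conv x (c \<odot>\<^bsub>alg_space\<^esub> y) s k = c * conv x y s k"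
  unfolding conv_def sum_distrib_left
  by (rule sum.cong) (use cofactor_div in \<open>auto simp: \<Theta>_smult[OF assms] mult.left_commute\<close>)

lemma conv_cls:
  assumes t: "t \<in> Omega" and u: "u \<in> Omega" and M: "M \<in> wmod t" and N: "N \<in> wmod u"
  shows "conv (cls t M) (cls u N) s k = (if s = t * u then of_nat (wdim t M k) * of_nat (wdim u N k) else 0)"
proof -
  have "conv (cls t M) (cls u N) s k = (\<Sum>r\<in>{t} \<inter> cofactor s. \<Theta> (cls t M) r k * \<Theta> (cls u N) (s div r) k)"
    by (rule conv_superset) (auto simp: cls_eq)
  also have "\<dots> = (if s = t * u then of_nat (wdim t M k) * of_nat (wdim u N k) else 0)"
  proof (cases "t \<in> cofactor s")
    case True
    have "s div t = u \<longleftrightarrow> s = t * u" using cofactor_div(3)[OF True] Omega_nonzero[OF t] by auto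
    then show ?thesis using True cofactor_div(2)[OF True] by (simp add: \<Theta>_cls[OF M t] \<Theta>_cls[OF N])
  next
    case False
    then have "s \<noteq> t * u" using t u by (auto simp: cofactor_def)
    then show ?thesis using False by simp
  qed
  finally show ?thesis .
qed

text \<open>The convolution has to be the dimension function of an actual element. By bilinearity
  this is needed only for two simple classes, where the class of their tensor product provides
  it.\<close>

lemma mult_exists:
  assumes x: "x \<in> carrier alg_space" and y: "y \<in> carrier alg_space"
  shows "\<exists>z\<in>carrier alg_space. \<forall>s\<in>Omega. \<forall>k. \<Theta> z s k = conv x y s k"
  using x
proof (induction rule: alg_induct)
  case (cls c t i)
  show ?case
    using y
  proof (induction rule: alg_induct)
    case (cls d u j)
    let ?M = "simple_rep t i" and ?N = "simple_rep u j"
    have M: "?M \<in> wmod t" and N: "?N \<in> wmod u" using simple_rep(1) cls \<open>t \<in> Omega\<close> \<open>i \<le> num_roots t\<close> by auto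
    have T: "tensor_mod t ?M u ?N \<in> wmod (t * u)" by (rule tensor_mod(1)[OF M N])
    note cl = cls_closed[OF M] cls_closed[OF N] cls_closed[OF T]
    show ?case
    proof (rule bexI[of _ "(c * d) \<odot>\<^bsub>alg_space\<^esub> cls (t * u) (tensor_mod t ?M u ?N)"])
      show "(c * d) \<odot>\<^bsub>alg_space\<^esub> cls (t * u) (tensor_mod t ?M u ?N) \<in> carrier alg_space"
        using AS.smult_closed cl(3) by simp
      have "d \<odot>\<^bsub>alg_space\<^esub> cls u ?N \<in> carrier alg_space" using AS.smult_closed cl(2) by simp
      then show "\<forall>s\<in>Omega. \<forall>k. \<Theta> ((c * d) \<odot>\<^bsub>alg_space\<^esub> cls (t * u) (tensor_mod t ?M u ?N)) s k =
          conv (c \<odot>\<^bsub>alg_space\<^esub> cls t ?M) (d \<odot>\<^bsub>alg_space\<^esub> cls u ?N) s k"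
        using cl \<open>t \<in> Omega\<close> cls(1)
        by (simp add: conv_smult_left conv_smult_right \<Theta>_smult \<Theta>_cls[OF T] conv_cls[OF _ _ M N] tensor_mod(2)[OF M N])
    qed
  next
    case (add y y')
    then obtain z z' where "z \<in> carrier alg_space" "z' \<in> carrier alg_space"
      "\<forall>s\<in>Omega. \<forall>k. \<Theta> z s k = conv (c \<odot>\<^bsub>alg_space\<^esub> cls t (simple_rep t i)) y s k"
      "\<forall>s\<in>Omega. \<forall>k. \<Theta> z' s k = conv (c \<odot>\<^bsub>alg_space\<^esub> cls t (simple_rep t i)) y' s k" by blast
    then show ?case
      using add by (intro bexI[of _ "z \<oplus>\<^bsub>alg_space\<^esub> z'"]) (simp_all add: \<Theta>_add conv_add_right)
  qed
next
  case (add x x')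
  then obtain z z' where "z \<in> carrier alg_space" "z' \<in> carrier alg_space"
    "\<forall>s\<in>Omega. \<forall>k. \<Theta> z s k = conv x y s k" "\<forall>s\<in>Omega. \<forall>k. \<Theta> z' s k = conv x' y s k" by blast
  then show ?case
    using add by (intro bexI[of _ "z \<oplus>\<^bsub>alg_space\<^esub> z'"]) (simp_all add: \<Theta>_add conv_add_left)
qed

lemma bilinear_onI:
  fixes V :: "(complex, 'v) module"
  assumes "\<And>x y. x \<in> carrier V \<Longrightarrow> y \<in> carrier V \<Longrightarrow> \<mu> x y \<in> carrier V"
    "\<And>x y z. x \<in> carrier V \<Longrightarrow> y \<in> carrier V \<Longrightarrow> z \<in> carrier V \<Longrightarrow> \<mu> (x \<oplus>\<^bsub>V\<^esub> y) z = \<mu> x z \<oplus>\<^bsub>V\<^esub> \<mu> y z"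
    "\<And>x y z. x \<in> carrier V \<Longrightarrow> y \<in> carrier V \<Longrightarrow> z \<in> carrier V \<Longrightarrow> \<mu> z (x \<oplus>\<^bsub>V\<^esub> y) = \<mu> z x \<oplus>\<^bsub>V\<^esub> \<mu> z y"
    "\<And>c x y. x \<in> carrier V \<Longrightarrow> y \<in> carrier V \<Longrightarrow> \<mu> (c \<odot>\<^bsub>V\<^esub> x) y = c \<odot>\<^bsub>V\<^esub> \<mu> x y"
    "\<And>c x y. x \<in> carrier V \<Longrightarrow> y \<in> carrier V \<Longrightarrow> \<mu> x (c \<odot>\<^bsub>V\<^esub> y) = c \<odot>\<^bsub>V\<^esub> \<mu> x y"
  shows "bilinear_on V \<mu>"
  using assms by (simp add: bilinear_on_def lmod_hom_def hom_def Pi_def)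

lemma bilinear_onD:
  assumes "bilinear_on V \<mu>"
  shows "x \<in> carrier V \<Longrightarrow> y \<in> carrier V \<Longrightarrow> \<mu> x y \<in> carrier V"
    "x \<in> carrier V \<Longrightarrow> y \<in> carrier V \<Longrightarrow> z \<in> carrier V \<Longrightarrow> \<mu> (x \<oplus>\<^bsub>V\<^esub> y) z = \<mu> x z \<oplus>\<^bsub>V\<^esub> \<mu> y z"
    "x \<in> carrier V \<Longrightarrow> y \<in> carrier V \<Longrightarrow> z \<in> carrier V \<Longrightarrow> \<mu> z (x \<oplus>\<^bsub>V\<^esub> y) = \<mu> z x \<oplus>\<^bsub>V\<^esub> \<mu> z y"
    "x \<in> carrier V \<Longrightarrow> y \<in> carrier V \<Longrightarrow> \<mu> (c \<odot>\<^bsub>V\<^esub> x) y = c \<odot>\<^bsub>V\<^esub> \<mu> x y"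
    "x \<in> carrier V \<Longrightarrow> y \<in> carrier V \<Longrightarrow> \<mu> x (c \<odot>\<^bsub>V\<^esub> y) = c \<odot>\<^bsub>V\<^esub> \<mu> x y"
  using assms by (simp_all add: bilinear_on_def lmod_hom_def hom_def Pi_def)

text \<open>The product is chosen by its dimension function. Since this function determines the
  element, bilinearity and the values on classes follow from the corresponding facts about
  \<open>conv\<close>.\<close>

lemma tensor_mult_exists: "\<exists>\<mu>. is_tensor_mult \<mu>"
proof -
  define \<mu> where "\<mu> x y = (SOME z. z \<in> carrier alg_space \<and> (\<forall>s\<in>Omega. \<forall>k. \<Theta> z s k = conv x y s k))" for x y
  have \<mu>: "\<mu> x y \<in> carrier alg_space" "\<And>s k. s \<in> Omega \<Longrightarrow> \<Theta> (\<mu> x y) s k = conv x y s k"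
    if "x \<in> carrier alg_space" "y \<in> carrier alg_space" for x y
  proof -
    have "\<exists>z. z \<in> carrier alg_space \<and> (\<forall>s\<in>Omega. \<forall>k. \<Theta> z s k = conv x y s k)" using mult_exists[OF that] by blast
    from someI_ex[OF this] show "\<mu> x y \<in> carrier alg_space" "\<And>s k. s \<in> Omega \<Longrightarrow> \<Theta> (\<mu> x y) s k = conv x y s k"
      unfolding \<mu>_def by blast+
  qed
  have sm: "c \<odot>\<^bsub>alg_space\<^esub> x \<in> carrier alg_space" if "x \<in> carrier alg_space" for c x
    using AS.smult_closed that by simp
  have "bilinear_on alg_space \<mu>"
  proof (rule bilinear_onI, goal_cases)
    case (2 x y z)
    show ?case
      by (rule \<Theta>_inj) (use 2 in \<open>simp_all add: \<mu> \<Theta>_add conv_add_left\<close>)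
  next
    case (3 x y z)
    show ?case
      by (rule \<Theta>_inj) (use 3 in \<open>simp_all add: \<mu> \<Theta>_add conv_add_right\<close>)
  next
    case (4 c x y)
    show ?case
      by (rule \<Theta>_inj) (use 4 in \<open>simp_all add: \<mu> sm \<Theta>_smult conv_smult_left\<close>)
  next
    case (5 c x y)
    show ?case
      by (rule \<Theta>_inj) (use 5 in \<open>simp_all add: \<mu> sm \<Theta>_smult conv_smult_right\<close>)
  qed (rule \<mu>(1))
  moreover have "\<mu> (cls t M) (cls u N) = cls (t * u) (tensor_mod t M u N)"
    if "t \<in> Omega" "u \<in> Omega" "M \<in> wmod t" "N \<in> wmod u" for t u M N
    by (rule \<Theta>_inj) (use that in \<open>simp_all add: \<mu> cls_closed tensor_mod \<Theta>_cls conv_cls\<close>)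
  ultimately show ?thesis unfolding is_tensor_mult_def by blast
qed

lemma alg_mult: "is_tensor_mult alg_mult"
  unfolding alg_mult_def using tensor_mult_exists by (rule someI_ex)

lemmas alg_mult_linear = bilinear_onD[OF conjunct1[OF alg_mult[unfolded is_tensor_mult_def]]]

lemma alg_mult_cls:
  "t \<in> Omega \<Longrightarrow> u \<in> Omega \<Longrightarrow> M \<in> wmod t \<Longrightarrow> N \<in> wmod u \<Longrightarrow>
    alg_mult (cls t M) (cls u N) = cls (t * u) (tensor_mod t M u N)"
  using alg_mult unfolding is_tensor_mult_def by blast

text \<open>After reduction to simple classes both sides are classes of tensor products with the
  same dimension function. Associativity below has the same proof with three nested
  inductions.\<close>

lemma alg_mult_commute:
  assumes x: "x \<in> carrier alg_space" and y: "y \<in> carrier alg_space"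
  shows "alg_mult x y = alg_mult y x"
  using x
proof (induction rule: alg_induct)
  case (cls c t i)
  note M = simple_rep(1)[OF cls]
  have "alg_mult (cls t (simple_rep t i)) y = alg_mult y (cls t (simple_rep t i))"
    using y
  proof (induction rule: alg_induct)
    case (cls d u j)
    note N = simple_rep(1)[OF cls]
    have "cls (t * u) (tensor_mod t (simple_rep t i) u (simple_rep u j)) = cls (u * t) (tensor_mod u (simple_rep u j) t (simple_rep t i))"
      unfolding mult.commute[of u t]
      by (rule cls_cong) (use tensor_mod[OF M N] tensor_mod[OF N M] in \<open>simp_all add: mult.commute\<close>)
    then show ?case
      using M N \<open>t \<in> Omega\<close> cls by (simp add: alg_mult_linear alg_mult_cls cls_closed)
  qed (use cls_closed[OF M] in \<open>simp add: alg_mult_linear\<close>)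
  then show ?case using y cls_closed[OF M] by (simp add: alg_mult_linear)
qed (use y in \<open>simp add: alg_mult_linear\<close>)

lemma alg_mult_assoc:
  assumes x: "x \<in> carrier alg_space" and y: "y \<in> carrier alg_space" and z: "z \<in> carrier alg_space"
  shows "alg_mult (alg_mult x y) z = alg_mult x (alg_mult y z)"
  using x
proof (induction rule: alg_induct)
  case (cls c t i)
  note t = cls(1) and M = simple_rep(1)[OF cls]
  let ?M = "simple_rep t i"
  have "alg_mult (alg_mult (cls t ?M) y) z = alg_mult (cls t ?M) (alg_mult y z)"
    using y
  proof (induction rule: alg_induct)
    case (cls d u j)
    note u = cls(1) and N = simple_rep(1)[OF cls]
    let ?N = "simple_rep u j"
    have "alg_mult (alg_mult (cls t ?M) (cls u ?N)) z = alg_mult (cls t ?M) (alg_mult (cls u ?N) z)"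
      using z
    proof (induction rule: alg_induct)
      case (cls e v l)
      note v = cls(1) and L = simple_rep(1)[OF cls]
      let ?L = "simple_rep v l"
      have "cls (t * u * v) (tensor_mod (t * u) (tensor_mod t ?M u ?N) v ?L) =
        cls (t * (u * v)) (tensor_mod t ?M (u * v) (tensor_mod u ?N v ?L))"
        unfolding mult.assoc
        by (rule cls_cong)
          (use tensor_mod[OF tensor_mod(1)[OF M N] L] tensor_mod[OF M tensor_mod(1)[OF N L]]
            tensor_mod(2)[OF M N] tensor_mod(2)[OF N L] in \<open>simp_all add: mult.assoc\<close>)
      then show ?case
        using t u v M N L by (simp add: alg_mult_linear alg_mult_cls cls_closed tensor_mod(1) Omega_mult)
    next
      case (add z z')
      then show ?case using cls_closed[OF M] cls_closed[OF N] by (simp add: alg_mult_linear)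
    qed
    then show ?case using cls_closed[OF M] cls_closed[OF N] z by (simp add: alg_mult_linear)
  next
    case (add y y')
    then show ?case using cls_closed[OF M] z by (simp add: alg_mult_linear)
  qed
  then show ?case using y z cls_closed[OF M] by (simp add: alg_mult_linear)
next
  case (add x x')
  then show ?case using y z by (simp add: alg_mult_linear)
qed

lemma cls_M1_closed: "cls 1 M1 \<in> carrier alg_space"
  by (rule cls_closed[OF M1(1)])

text \<open>All weight spaces of \<open>M1\<close> are lines, so tensoring with it leaves every
  dimension unchanged.\<close>

lemma alg_mult_one:
  assumes x: "x \<in> carrier alg_space" shows "alg_mult (cls 1 M1) x = x"
  using x
proof (induction rule: alg_induct)
  case (cls c t i)
  note M = simple_rep(1)[OF cls]
  have "cls (1 * t) (tensor_mod 1 M1 t (simple_rep t i)) = cls t (simple_rep t i)"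
    unfolding mult_1
    by (rule cls_cong) (use tensor_mod[OF M1(1) M] M M1(2) in simp_all)
  then show ?case
    using cls M M1(1) one_Omega by (simp add: alg_mult_linear alg_mult_cls cls_closed)
qed (use cls_M1_closed in \<open>simp add: alg_mult_linear\<close>)

section \<open>The graded linear isomorphism\<close>

lemma lines_carrier:
  "w \<in> carrier (dsum Omega simple_lines) \<longleftrightarrow>
    w \<in> (\<Pi>\<^sub>E s\<in>Omega. extensional {0..num_roots s}) \<and> finite {s \<in> Omega. w s \<noteq> (\<lambda>i\<in>{0..num_roots s}. 0)}"
proof -
  have line: "module CC complex_line"
  proof (rule moduleI[OF class_ring_cring])
    show "abelian_group complex_line"
      by (rule abelian_groupI) (auto simp: complex_line_def intro: exI[of _ "- x" for x])
  qed (simp_all add: complex_line_def algebra_simps)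
  have ag: "abelian_group complex_line" using line by (simp add: module_def)
  have lines: "abelian_group (simple_lines s)" for s
    using dsum_module[of "{0..num_roots s}" "\<lambda>_. complex_line"] line by (simp add: module_def)
  have "carrier (simple_lines s) = extensional {0..num_roots s}" for s
    using dsum_carrier[of "{0..num_roots s}" "\<lambda>_. complex_line", OF ag]
    by (auto simp: complex_line_def PiE_def)
  then show ?thesis
    using dsum_carrier[of Omega simple_lines, OF lines] by (simp add: complex_line_def)
qed

definition alg_coords :: "alg_elt \<Rightarrow> complex poly \<Rightarrow> nat \<Rightarrow> complex" where
  "alg_coords x = (\<lambda>s\<in>Omega. \<lambda>i\<in>{0..num_roots s}. \<Theta> x s (cell_point s i))"

text \<open>This yields both that coordinate families have finite support and that the coordinate
  map identifies the homogeneous elements of each degree.\<close>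

lemma component_zero_iff:
  assumes x: "x \<in> carrier alg_space" and s: "s \<in> Omega"
  shows "alg_coords x s = (\<lambda>i\<in>{0..num_roots s}. 0) \<longleftrightarrow> x s = \<zero>\<^bsub>graded_part s\<^esub>"
proof
  assume "x s = \<zero>\<^bsub>graded_part s\<^esub>"
  then show "alg_coords x s = (\<lambda>i\<in>{0..num_roots s}. 0)"
    using s by (simp add: alg_coords_def \<Theta>_def \<theta>_zero del: cplx.V_simps)
next
  assume z: "alg_coords x s = (\<lambda>i\<in>{0..num_roots s}. 0)"
  interpret V: cspace "graded_part s" by (rule graded_cspace)
  note d = dual_basisD[OF graded_dual_basis[OF s]]
  have z': "\<theta> s (cell_point s i) (x s) = 0" if "i \<in> {0..num_roots s}" for i
    using fun_cong[OF z, of i] s that by (simp add: alg_coords_def \<Theta>_def)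
  have "x s = (\<Oplus>\<^bsub>graded_part s\<^esub>i\<in>{0..num_roots s}. \<theta> s (cell_point s i) (x s) \<odot>\<^bsub>graded_part s\<^esub> mclass s (simple_rep s i))"
    by (rule d(5)[OF alg_component[OF x s]])
  also have "\<dots> = (\<Oplus>\<^bsub>graded_part s\<^esub>i\<in>{0..num_roots s}. \<zero>\<^bsub>graded_part s\<^esub>)"
  proof (rule V.M.finsum_cong')
    fix i assume i: "i \<in> {0..num_roots s}"
    show "\<theta> s (cell_point s i) (x s) \<odot>\<^bsub>graded_part s\<^esub> mclass s (simple_rep s i) = \<zero>\<^bsub>graded_part s\<^esub>"
      unfolding z'[OF i] using V.smult_l_null[OF d(2)[OF i]] by (simp del: cplx.V_simps)
  qed (use graded_zero_closed in auto)
  also have "\<dots> = \<zero>\<^bsub>graded_part s\<^esub>" by (rule V.M.finsum_zero)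
  finally show "x s = \<zero>\<^bsub>graded_part s\<^esub>" .
qed

lemma alg_coords_closed:
  assumes x: "x \<in> carrier alg_space"
  shows "alg_coords x \<in> carrier (dsum Omega simple_lines)"
proof -
  have "{s \<in> Omega. alg_coords x s \<noteq> (\<lambda>i\<in>{0..num_roots s}. 0)} = {s \<in> Omega. x s \<noteq> \<zero>\<^bsub>graded_part s\<^esub>}"
    using component_zero_iff[OF x] by blast
  moreover have "alg_coords x \<in> (\<Pi>\<^sub>E s\<in>Omega. extensional {0..num_roots s})"
    by (auto simp: alg_coords_def)
  ultimately show ?thesis unfolding lines_carrier using alg_support_finite[OF x] by simp
qed

lemma alg_coords_bij: "bij_betw alg_coords (carrier alg_space) (carrier (dsum Omega simple_lines))"
  unfolding bij_betw_def
proof (intro conjI inj_onI subset_antisym subsetI)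
  fix x y assume xy: "x \<in> carrier alg_space" "y \<in> carrier alg_space" "alg_coords x = alg_coords y"
  show "x = y"
  proof (rule \<Theta>_inj[OF xy(1,2)])
    fix t i assume "t \<in> Omega" "i \<le> num_roots t"
    then show "\<Theta> x t (cell_point t i) = \<Theta> y t (cell_point t i)"
      using fun_cong[OF fun_cong[OF xy(3), of t], of i] by (simp add: alg_coords_def)
  qed
next
  fix w assume "w \<in> alg_coords ` carrier alg_space"
  then show "w \<in> carrier (dsum Omega simple_lines)" using alg_coords_closed by blast
next
  fix w assume w: "w \<in> carrier (dsum Omega simple_lines)"
  let ?A = "{s \<in> Omega. w s \<noteq> (\<lambda>i\<in>{0..num_roots s}. 0)}"
  \<comment> \<open>The case distinction makes the components outside the finite set
    \<open>?A\<close> equal to zero by definition, which is what membership in the direct sum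
    requires.\<close>
  define f where "f s = (if s \<in> ?A
    then \<Oplus>\<^bsub>graded_part s\<^esub>i\<in>{0..num_roots s}. w s i \<odot>\<^bsub>graded_part s\<^esub> mclass s (simple_rep s i)
    else \<zero>\<^bsub>graded_part s\<^esub>)" for s
  define x where "x = (\<lambda>s\<in>Omega. f s)"
  have fin: "finite ?A" using w by (simp add: lines_carrier)
  have wx: "w s \<in> extensional {0..num_roots s}" if "s \<in> Omega" for s
    using w that by (auto simp: lines_carrier)
  have fc: "f s \<in> carrier (graded_part s)" if s: "s \<in> Omega" for s
  proof (cases "s \<in> ?A")
    case True
    show ?thesis
      unfolding f_def if_P[OF True]
      by (rule cspace.comb_closed[OF graded_cspace dual_basisD(2)[OF graded_dual_basis[OF s]]])
  next
    case False
    show ?thesis unfolding f_def if_not_P[OF False] by (rule graded_zero_closed)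
  qed
  have x: "x \<in> carrier alg_space"
    unfolding x_def by (rule finite_support_closed[OF fin fc]) (simp_all add: f_def del: cplx.V_simps)
  have \<theta>f: "\<theta> s (cell_point s i) (f s) = w s i" if s: "s \<in> Omega" and i: "i \<in> {0..num_roots s}" for s i
  proof (cases "s \<in> ?A")
    case True
    note d = dual_basisD[OF graded_dual_basis[OF s]]
    have "\<theta> s (cell_point s i) (f s) = (\<Sum>j\<in>{0..num_roots s}. w s j * \<theta> s (cell_point s i) (mclass s (simple_rep s j)))"
      unfolding f_def if_P[OF True] by (rule cspace.lin_form_comb[OF graded_cspace \<theta>(1) d(1,2)])
    also have "\<dots> = (\<Sum>j\<in>{0..num_roots s}. if i = j then w s j else 0)"
      by (rule sum.cong) (simp_all add: d(4)[OF i])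
    finally show ?thesis using i by simp
  next
    case False
    then have "w s = (\<lambda>i\<in>{0..num_roots s}. 0)" using s by blast
    then show ?thesis unfolding f_def if_not_P[OF False] \<theta>_zero using i by simp
  qed
  have "alg_coords x = w"
  proof (rule PiE_ext[of _ Omega "\<lambda>s. extensional {0..num_roots s}"])
    show "alg_coords x \<in> (\<Pi>\<^sub>E s\<in>Omega. extensional {0..num_roots s})" "w \<in> (\<Pi>\<^sub>E s\<in>Omega. extensional {0..num_roots s})"
      using alg_coords_closed[OF x] w by (simp_all add: lines_carrier)
    fix s assume s: "s \<in> Omega"
    show "alg_coords x s = w s"
      by (rule extensionalityI[OF _ wx[OF s]])
        (use s \<theta>f[OF s] in \<open>auto simp: alg_coords_def x_def \<Theta>_def\<close>)
  qed
  then show "w \<in> alg_coords ` carrier alg_space" using x by blast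
qed

lemma alg_coords_graded_iso: "graded_linear_iso Omega graded_part simple_lines alg_coords"
  unfolding graded_linear_iso_def alg_space_def[symmetric]
proof (intro conjI ballI)
  show "alg_coords \<in> lmod_hom CC alg_space (dsum Omega simple_lines)"
    using alg_coords_closed
    by (auto simp: lmod_hom_def hom_def alg_coords_def \<Theta>_add \<Theta>_smult complex_line_def intro!: restrict_ext)
  show "bij_betw alg_coords (carrier alg_space) (carrier (dsum Omega simple_lines))" by (rule alg_coords_bij)
  fix t assume "t \<in> Omega"
  have "alg_coords x \<in> homogeneous Omega simple_lines t \<longleftrightarrow> x \<in> homogeneous Omega graded_part t"
    if x: "x \<in> carrier alg_space" for x
  proof -
    have "(alg_coords x s = \<zero>\<^bsub>simple_lines s\<^esub>) = (x s = \<zero>\<^bsub>graded_part s\<^esub>)" if "s \<in> Omega" for s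
      using component_zero_iff[OF x that] by (simp add: complex_line_def del: cplx.V_simps)
    then show ?thesis
      using x alg_coords_closed[OF x] unfolding homogeneous_def alg_space_def[symmetric] by blast
  qed
  moreover have "homogeneous Omega graded_part t \<subseteq> carrier alg_space"
    "homogeneous Omega simple_lines t \<subseteq> alg_coords ` carrier alg_space"
    using alg_coords_bij by (auto simp: homogeneous_def alg_space_def bij_betw_def)
  ultimately show "alg_coords ` homogeneous Omega graded_part t = homogeneous Omega simple_lines t"
    by blast
qed

lemma alg_coords_cls:
  assumes t: "t \<in> Omega" and i: "i \<le> num_roots t"
  shows "alg_coords (cls t (simple_rep t i)) = line_gen t i"
proof -
  have "cell_point t j \<in> cell t i \<longleftrightarrow> j = i" if "j \<le> num_roots t" for j
    using cell_point[OF t that] cell_disjoint[OF t that i] by blast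
  then show ?thesis
    unfolding alg_coords_def line_gen_def
    by (intro restrict_ext) (auto simp: \<Theta>_cls[OF simple_rep(1)[OF t i]] simple_rep(2)[OF t i])
qed

section \<open>The algebra and the product formula\<close>

lemma Alg_simps [simp]:
  "carrier Alg = carrier alg_space" "x \<otimes>\<^bsub>Alg\<^esub> y = alg_mult x y" "\<zero>\<^bsub>Alg\<^esub> = \<zero>\<^bsub>alg_space\<^esub>"
  "x \<oplus>\<^bsub>Alg\<^esub> y = x \<oplus>\<^bsub>alg_space\<^esub> y" "c \<odot>\<^bsub>Alg\<^esub> x = c \<odot>\<^bsub>alg_space\<^esub> x"
  by (simp_all add: Alg_def)

lemma Alg_one: "\<one>\<^bsub>Alg\<^esub> = cls 1 M1"
proof -
  have "\<one>\<^bsub>Alg\<^esub> = (THE e. e \<in> carrier alg_space \<and> (\<forall>x\<in>carrier alg_space. alg_mult e x = x \<and> alg_mult x e = x))"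
    by (simp add: Alg_def)
  also have "\<dots> = cls 1 M1"
  proof (rule the_equality)
    show "cls 1 M1 \<in> carrier alg_space \<and>
        (\<forall>x\<in>carrier alg_space. alg_mult (cls 1 M1) x = x \<and> alg_mult x (cls 1 M1) = x)"
      using cls_M1_closed alg_mult_one alg_mult_commute[OF cls_M1_closed] by auto
    fix e assume e: "e \<in> carrier alg_space \<and> (\<forall>x\<in>carrier alg_space. alg_mult e x = x \<and> alg_mult x e = x)"
    then have "alg_mult (cls 1 M1) e = cls 1 M1" using cls_M1_closed by blast
    then show "e = cls 1 M1" using e alg_mult_one by simp
  qed
  finally show ?thesis .
qed

lemma Alg_algebra: "algebra CC Alg"
proof (rule algebraI[OF class_ring_cring])
  show "cring Alg"
  proof (rule cringI)
    show "abelian_group Alg"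
      by (rule abelian_groupI) (auto simp: AS.M.a_assoc intro: AS.M.a_comm AS.M.l_neg)
    show "comm_monoid Alg"
      by (rule comm_monoidI)
        (auto simp: Alg_one cls_M1_closed alg_mult_linear(1) alg_mult_assoc alg_mult_one intro: alg_mult_commute)
  qed (simp add: alg_mult_linear(2))
qed (simp_all add: AS.smult_l_distr[simplified] AS.smult_r_distr[simplified]
  AS.smult_assoc1[simplified] AS.smult_one[simplified] alg_mult_linear(4))

lemma interval_class:
  assumes t: "t \<in> Omega" "t \<noteq> 1" and i: "i \<le> num_roots t"
  shows "cls t (M_interval t (ext_root t i) (ext_root t (Suc i))) = cls t (simple_rep t i)"
  using t by (simp add: simple_rep_def)

text \<open>Dimension functions multiply pointwise, and the product of the indicators of two open
  intervals is the indicator of the interval from the larger lower end to the smaller upper end.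
  Degree 1 is included, with both ends infinite.\<close>

lemma alg_mult_simple:
  assumes t: "t \<in> Omega" and u: "u \<in> Omega" and i: "i \<le> num_roots t" and j: "j \<le> num_roots u"
  defines "lo \<equiv> max (ext_root t i) (ext_root u j)" and "hi \<equiv> min (ext_root t (Suc i)) (ext_root u (Suc j))"
  shows "alg_mult (cls t (simple_rep t i)) (cls u (simple_rep u j)) =
    (if lo < hi then cls (t * u) (M_interval (t * u) lo hi) else \<zero>\<^bsub>alg_space\<^esub>)"
proof -
  note M = simple_rep(1)[OF t i] and N = simple_rep(1)[OF u j]
  note T = tensor_mod(1)[OF M N]
  have I: "{k::int. lo < ereal (of_int k) \<and> ereal (of_int k) < hi} = cell t i \<inter> cell u j"
    unfolding lo_def hi_def cell_def by auto
  have dim: "wdim (t * u) (tensor_mod t (simple_rep t i) u (simple_rep u j)) k = (if k \<in> cell t i \<inter> cell u j then 1 else 0)" for k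
    by (simp add: tensor_mod(2)[OF M N] simple_rep(2)[OF t i] simple_rep(2)[OF u j])
  have "cls (t * u) (tensor_mod t (simple_rep t i) u (simple_rep u j)) =
    (if lo < hi then cls (t * u) (M_interval (t * u) lo hi) else \<zero>\<^bsub>alg_space\<^esub>)"
  proof (cases "lo < hi")
    case True
    have lo: "lo = -\<infinity> \<or> (\<exists>m::int. lo = ereal (of_int m + 1/2))"
      unfolding lo_def max_def using ext_root_values(1)[OF t i] ext_root_values(1)[OF u j] by (simp split: if_split)
    have hi: "hi = \<infinity> \<or> (\<exists>m::int. hi = ereal (of_int m + 1/2))"
      unfolding hi_def min_def using ext_root_values(2)[OF t i] ext_root_values(2)[OF u j] by (simp split: if_split)
    obtain k where k: "k \<in> cell t i" "k \<in> cell u j" using half_integer_gap[OF lo hi True] I by blast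
    \<comment> \<open>By \<open>sim_mult\<close>, an overlap of an interval of t with one of u is a
      full interval of t u, so it supports a simple module there.\<close>
    have c: "{k::int. lo < ereal (of_int k) \<and> ereal (of_int k) < hi} = {j. sim (t * u) j k}"
      unfolding I using cell_sim[OF t i k(1)] cell_sim[OF u j k(2)] by (auto simp: sim_mult)
    have "cls (t * u) (tensor_mod t (simple_rep t i) u (simple_rep u j)) = cls (t * u) (M_interval (t * u) lo hi)"
    proof (rule cls_cong[OF T simple_by_support(1)[OF Omega_mult[OF t u] c]])
      show "wdim (t * u) (tensor_mod t (simple_rep t i) u (simple_rep u j)) l = wdim (t * u) (M_interval (t * u) lo hi) l" for l
        unfolding simple_by_support(2)[OF Omega_mult[OF t u] c] dim using c I by auto
    qed
    then show ?thesis using True by simp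
  next
    case False
    then have "cell t i \<inter> cell u j = {}" unfolding I[symmetric] using less_trans by blast
    then have d0: "wdim (t * u) (tensor_mod t (simple_rep t i) u (simple_rep u j)) k = 0" for k unfolding dim by simp
    have "cls (t * u) (tensor_mod t (simple_rep t i) u (simple_rep u j)) = \<zero>\<^bsub>alg_space\<^esub>"
    proof (rule \<Theta>_inj[OF cls_closed[OF T] AS.M.zero_closed])
      fix s l assume s: "s \<in> Omega"
      have "\<Theta> \<zero>\<^bsub>alg_space\<^esub> s (cell_point s l) = 0" using s by (simp add: \<Theta>_def alg_ops \<theta>_zero del: cplx.V_simps)
      then show "\<Theta> (cls (t * u) (tensor_mod t (simple_rep t i) u (simple_rep u j))) s (cell_point s l) = \<Theta> \<zero>\<^bsub>alg_space\<^esub> s (cell_point s l)"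
        by (simp add: \<Theta>_cls[OF T s] d0)
    qed
    then show ?thesis using False by simp
  qed
  then show ?thesis unfolding alg_mult_cls[OF t u M N] .
qed

lemma bilinear_on_Alg: "bilinear_on Alg \<nu> \<longleftrightarrow> bilinear_on alg_space \<nu>"
  by (simp add: bilinear_on_def lmod_hom_def hom_def)

text \<open>The classes of the simple modules span, so a bilinear map is determined by its values on
  pairs of them.\<close>

lemma alg_mult_unique:
  assumes \<nu>: "bilinear_on alg_space \<nu>"
    and gen: "\<And>t u i j. t \<in> Omega \<Longrightarrow> u \<in> Omega \<Longrightarrow> i \<le> num_roots t \<Longrightarrow> j \<le> num_roots u \<Longrightarrow>
      \<nu> (cls t (simple_rep t i)) (cls u (simple_rep u j)) = alg_mult (cls t (simple_rep t i)) (cls u (simple_rep u j))"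
    and x: "x \<in> carrier alg_space" and y: "y \<in> carrier alg_space"
  shows "\<nu> x y = alg_mult x y"
  using x
proof (induction rule: alg_induct)
  note lin = bilinear_onD[OF \<nu>]
  case (cls c t i)
  note M = cls_closed[OF simple_rep(1)[OF cls]]
  have "\<nu> (cls t (simple_rep t i)) y = alg_mult (cls t (simple_rep t i)) y"
    using y
  proof (induction rule: alg_induct)
    case (cls d u j)
    then show ?case
      using gen[OF \<open>t \<in> Omega\<close> cls(1) \<open>i \<le> num_roots t\<close> cls(2)] M cls_closed[OF simple_rep(1)[OF cls]]
      by (simp add: lin(5) alg_mult_linear(5))
  qed (use M in \<open>simp add: lin(3) alg_mult_linear(3)\<close>)
  then show ?case using y M by (simp add: lin(4) alg_mult_linear(4))
next
  note lin = bilinear_onD[OF \<nu>]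
  case (add x x')
  then show ?case using y by (simp add: lin(2) alg_mult_linear(2))
qed

theorem theorem4p5:
  shows
    "algebra CC Alg \<and> is_tensor_mult (\<lambda>x y. x \<otimes>\<^bsub>Alg\<^esub> y) \<and>
     (\<exists>\<Phi>. graded_linear_iso Omega graded_part simple_lines \<Phi> \<and>
        (\<forall>t\<in>Omega. \<forall>i\<le>num_roots t. \<Phi> (cls t (simple_rep t i)) = line_gen t i)) \<and>
     \<one>\<^bsub>Alg\<^esub> = cls 1 M1 \<and>
     (\<forall>t\<in>Omega - {1}. \<forall>u\<in>Omega - {1}. \<forall>i\<le>num_roots t. \<forall>j\<le>num_roots u.
        cls t (M_interval t (ext_root t i) (ext_root t (Suc i))) \<otimes>\<^bsub>Alg\<^esub>
        cls u (M_interval u (ext_root u j) (ext_root u (Suc j))) =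
        (let lo = max (ext_root t i) (ext_root u j);
             hi = min (ext_root t (Suc i)) (ext_root u (Suc j))
         in if lo < hi then cls (t * u) (M_interval (t * u) lo hi) else \<zero>\<^bsub>Alg\<^esub>)) \<and>
     (\<forall>\<nu>. bilinear_on Alg \<nu> \<and>
        (\<forall>x\<in>carrier Alg. \<nu> (cls 1 M1) x = x \<and> \<nu> x (cls 1 M1) = x) \<and>
        (\<forall>t\<in>Omega - {1}. \<forall>u\<in>Omega - {1}. \<forall>i\<le>num_roots t. \<forall>j\<le>num_roots u.
           \<nu> (cls t (M_interval t (ext_root t i) (ext_root t (Suc i))))
             (cls u (M_interval u (ext_root u j) (ext_root u (Suc j)))) =
           (let lo = max (ext_root t i) (ext_root u j);
                hi = min (ext_root t (Suc i)) (ext_root u (Suc j))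
            in if lo < hi then cls (t * u) (M_interval (t * u) lo hi) else \<zero>\<^bsub>Alg\<^esub>)) \<longrightarrow>
        (\<forall>x\<in>carrier Alg. \<forall>y\<in>carrier Alg. \<nu> x y = x \<otimes>\<^bsub>Alg\<^esub> y))"
proof (intro conjI)
  let ?lo = "\<lambda>t u i j. max (ext_root t i) (ext_root u j)"
  let ?hi = "\<lambda>t u i j. min (ext_root t (Suc i)) (ext_root u (Suc j))"
  show "algebra CC Alg" by (rule Alg_algebra)
  show "is_tensor_mult (\<lambda>x y. x \<otimes>\<^bsub>Alg\<^esub> y)" using alg_mult by simp
  show "\<exists>\<Phi>. graded_linear_iso Omega graded_part simple_lines \<Phi> \<and>
      (\<forall>t\<in>Omega. \<forall>i\<le>num_roots t. \<Phi> (cls t (simple_rep t i)) = line_gen t i)"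
    using alg_coords_graded_iso alg_coords_cls by blast
  show "\<one>\<^bsub>Alg\<^esub> = cls 1 M1" by (rule Alg_one)
  show "\<forall>t\<in>Omega - {1}. \<forall>u\<in>Omega - {1}. \<forall>i\<le>num_roots t. \<forall>j\<le>num_roots u.
        cls t (M_interval t (ext_root t i) (ext_root t (Suc i))) \<otimes>\<^bsub>Alg\<^esub>
        cls u (M_interval u (ext_root u j) (ext_root u (Suc j))) =
        (let lo = max (ext_root t i) (ext_root u j);
             hi = min (ext_root t (Suc i)) (ext_root u (Suc j))
         in if lo < hi then cls (t * u) (M_interval (t * u) lo hi) else \<zero>\<^bsub>Alg\<^esub>)"
    using alg_mult_simple interval_class by (simp add: Let_def)
  show "\<forall>\<nu>. bilinear_on Alg \<nu> \<and>
        (\<forall>x\<in>carrier Alg. \<nu> (cls 1 M1) x = x \<and> \<nu> x (cls 1 M1) = x) \<and>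
        (\<forall>t\<in>Omega - {1}. \<forall>u\<in>Omega - {1}. \<forall>i\<le>num_roots t. \<forall>j\<le>num_roots u.
           \<nu> (cls t (M_interval t (ext_root t i) (ext_root t (Suc i))))
             (cls u (M_interval u (ext_root u j) (ext_root u (Suc j)))) =
           (let lo = max (ext_root t i) (ext_root u j);
                hi = min (ext_root t (Suc i)) (ext_root u (Suc j))
            in if lo < hi then cls (t * u) (M_interval (t * u) lo hi) else \<zero>\<^bsub>Alg\<^esub>)) \<longrightarrow>
        (\<forall>x\<in>carrier Alg. \<forall>y\<in>carrier Alg. \<nu> x y = x \<otimes>\<^bsub>Alg\<^esub> y)"
  proof (intro allI impI ballI, elim conjE)
    fix \<nu> x y
    assume \<nu>: "bilinear_on Alg \<nu>" and one: "\<forall>x\<in>carrier Alg. \<nu> (cls 1 M1) x = x \<and> \<nu> x (cls 1 M1) = x"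
      and gen: "\<forall>t\<in>Omega - {1}. \<forall>u\<in>Omega - {1}. \<forall>i\<le>num_roots t. \<forall>j\<le>num_roots u.
           \<nu> (cls t (M_interval t (ext_root t i) (ext_root t (Suc i))))
             (cls u (M_interval u (ext_root u j) (ext_root u (Suc j)))) =
           (let lo = max (ext_root t i) (ext_root u j);
                hi = min (ext_root t (Suc i)) (ext_root u (Suc j))
            in if lo < hi then cls (t * u) (M_interval (t * u) lo hi) else \<zero>\<^bsub>Alg\<^esub>)"
      and x: "x \<in> carrier Alg" and y: "y \<in> carrier Alg"
    show "\<nu> x y = x \<otimes>\<^bsub>Alg\<^esub> y"
      unfolding Alg_simps
    proof (rule alg_mult_unique[OF \<nu>[unfolded bilinear_on_Alg] _ x[unfolded Alg_simps] y[unfolded Alg_simps]])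
      fix t u i j assume t: "t \<in> Omega" and u: "u \<in> Omega" and i: "i \<le> num_roots t" and j: "j \<le> num_roots u"
      note M = cls_closed[OF simple_rep(1)[OF t i]] and N = cls_closed[OF simple_rep(1)[OF u j]]
      \<comment> \<open>The interval rule is assumed only for degrees different from 1; pairs
        involving degree 1 are settled by the unit hypothesis.\<close>
      consider "t = 1" | "u = 1" | "t \<noteq> 1" "u \<noteq> 1" by blast
      then show "\<nu> (cls t (simple_rep t i)) (cls u (simple_rep u j)) =
          alg_mult (cls t (simple_rep t i)) (cls u (simple_rep u j))"
      proof cases
        case 1
        then have "cls t (simple_rep t i) = cls 1 M1" by (simp add: simple_rep_def)
        then show ?thesis using one N alg_mult_one[OF N] by simp
      next
        case 2
        then have "cls u (simple_rep u j) = cls 1 M1" by (simp add: simple_rep_def)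
        then show ?thesis using one M alg_mult_one[OF M] alg_mult_commute[OF M cls_M1_closed] by simp
      next
        case 3
        have tt: "t \<in> Omega - {1}" "u \<in> Omega - {1}" using t u 3 by auto
        show ?thesis
          using gen[rule_format, OF tt i j]
          unfolding alg_mult_simple[OF t u i j] interval_class[OF t 3(1) i] interval_class[OF u 3(2) j] Let_def Alg_simps .
      qed
    qed
  qed
qed

end
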